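(* Let $L>0$ and let $E\subset\mathbb R^d$ be a $[0,L)^d$-periodic set of locally finite perimeter. Then $$\mathcal F_{\tau,p,d}(E,[0,L)^d)=\frac1{2L^d}\int_{\mathbb S^{d-1}}\int_{\theta^\perp}\sum_{s\in\partial^*E_{x_\theta^\perp}\cap([0,L)^d)_{x_\theta^\perp}}r_\tau(E_{x_\theta^\perp},s)\,dx_\theta^\perp\,d\theta,$$ where $$r_\tau(E_{x_\theta^\perp},s)=\int_{-1}^1|\rho|\overline K_\tau(\rho)\,d\rho-\int_{s^-}^s\int_0^{+\infty}\bigl|\chi_{E_{x_\theta^\perp}}(u)-\chi_{E_{x_\theta^\perp}}(u+\rho)\bigr|\overline K_\tau(\rho)\,d\rho\,du-\int_s^{s^+}\int_{-\infty}^0\bigl|\chi_{E_{x_\theta^\perp}}(u)-\chi_{E_{x_\theta^\perp}}(u+\rho)\bigr|\overline K_\tau(\rho)\,d\rho\,du.$$ Moreover, for any open and bounded set $\Omega$ (and $E$ of locally finite perimeter), $$\mathrm{Per}(E;\Omega)=\frac1{C_{1,d}}\int_{\mathbb S^{d-1}}\int_{\theta^\perp}\mathrm{Per}^{1D}(E_{x_\theta^\perp},\Omega_{x_\theta^\perp})\,dx_\theta^\perp\,d\theta,\qquad C_{1,d}=\int_{\mathbb S^{d-1}}|\langle\theta,e_1\rangle|\,d\theta.$$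
   Context: Here $d\ge1$, $p\ge d+3$, $\tau>0$. For $\theta\in\mathbb S^{d-1}$, $\theta^\perp=\{x:\langle x,\theta\rangle=0\}$; for $A\subset\mathbb R^d$ and $x_\theta^\perp\in\theta^\perp$, $A_{x_\theta^\perp}=\{s\in\mathbb R:x_\theta^\perp+s\theta\in A\}$. $\partial^*$ is the reduced boundary; for a.e. $\theta$ and a.e. $x_\theta^\perp$ the slice $E_{x_\theta^\perp}$ has locally finite perimeter in $\mathbb R$; for $s\in\partial^*E_{x_\theta^\perp}$, $s^+>s$ and $s^-<s$ are the points of $\partial^*E_{x_\theta^\perp}$ closest to $s$ on the right and on the left. $\mathrm{Per}^{1D}(A,I)$ is the one-dimensional perimeter of $A$ in $I$. The kernel $K_\tau$ is rotation invariant and satisfies $\frac{1}{C(\|\zeta\|+\tau^{1/(p-d-1)})^p}\le K_\tau(\zeta)\le \frac{C}{(\|\zeta\|+\tau^{1/(p-d-1)})^p}$ for a constant $C$ independent of $\tau$, and $K_\tau(\zeta)\uparrow\|\zeta\|^{-p}$ as $\tau\downarrow0$; e.g. $K_\tau(\zeta)=\max(\tau^{1/(p-d-1)},\|\zeta\|)^{-p}$. Write $K_\tau(t)=K_\tau(z)$ for $\|z\|=|t|$ and $\overline K_\tau(t)=|t|^{d-1}K_\tau(t)$, $t\in\mathbb R$. The functional is $$\mathcal F_{\tau,p,d}(E,[0,L)^d)=\frac1{L^d}\Bigl(J_\tau\mathrm{Per}(E,[0,L)^d)-\int_{[0,L)^d}\int_{\mathbb R^d}|\chi_E(x+\zeta)-\chi_E(x)|K_\tau(\zeta)\,d\zeta\,dx\Bigr),$$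 with $J_\tau=\int_{\{\|\zeta\|\le1\}}|\langle\zeta,\theta\rangle|K_\tau(\zeta)\,d\zeta$ (independent of $\theta\in\mathbb S^{d-1}$). *)

theory Defs
  imports "HOL-Analysis.Analysis"
begin

section \<open>Sets of locally finite perimeter\<close>

definition divergence :: "('a::euclidean_space \<Rightarrow> 'a) \<Rightarrow> 'a \<Rightarrow> real" where
  "divergence \<phi> x = (\<Sum>b\<in>Basis. frechet_derivative \<phi> (at x) b \<bullet> b)"

text \<open>Vector fields of class \<open>C\<^sup>1\<close> on the whole space with compact support contained in \<open>A\<close>.\<close>

definition C1_compact_fields :: "'a::euclidean_space set \<Rightarrow> ('a \<Rightarrow> 'a) set" where
  "C1_compact_fields A =
    {\<phi>. (\<exists>\<phi>' :: 'a \<Rightarrow> 'a \<Rightarrow>\<^sub>L 'a.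
            (\<forall>x. (\<phi> has_derivative blinfun_apply (\<phi>' x)) (at x)) \<and> continuous_on UNIV \<phi>') \<and>
         compact (closure {x. \<phi> x \<noteq> 0}) \<and> closure {x. \<phi> x \<noteq> 0} \<subseteq> A}"

text \<open>
  The variation of \<open>\<chi>\<^sub>E\<close> in an open set. The zero field is admissible, so the truncation
  of negative values by \<^const>\<open>ennreal\<close> does not affect the supremum.
\<close>

definition variation_in_open :: "'a::euclidean_space set \<Rightarrow> 'a set \<Rightarrow> ennreal" where
  "variation_in_open E A =
    (SUP \<phi>\<in>{\<phi> \<in> C1_compact_fields A. \<forall>x. norm (\<phi> x) \<le> 1}.
       ennreal (LINT x:E|lebesgue. divergence \<phi> x))"

text \<open>
  \<open>Per(E; B) = |D\<chi>\<^sub>E|(B)\<close> for Borel sets \<open>B\<close> that need not be open (such as \<open>[0,L)\<^sup>d\<close>) is the usual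
  outer regular extension; for open \<open>B\<close> the infimum is attained at \<open>B\<close> itself.
  On the type \<^typ>\<open>real\<close> this is the one-dimensional perimeter.
\<close>

definition perimeter :: "'a::euclidean_space set \<Rightarrow> 'a set \<Rightarrow> ennreal" where
  "perimeter E B = (INF A\<in>{A. open A \<and> B \<subseteq> A}. variation_in_open E A)"

definition locally_finite_perimeter :: "'a::euclidean_space set \<Rightarrow> bool" where
  "locally_finite_perimeter E \<longleftrightarrow>
     E \<in> sets lebesgue \<and> (\<forall>A. open A \<and> bounded A \<longrightarrow> perimeter E A < \<infinity>)"

text \<open>
  The polar decomposition \<open>D\<chi>\<^sub>E = \<sigma> \<mu>\<close> of the distributional derivative of \<open>\<chi>\<^sub>E\<close>, with
  \<open>\<mu> = |D\<chi>\<^sub>E|\<close> a Radon measure and \<open>|\<sigma>| = 1\<close>. By Riesz' theorem it exists if \<open>E\<close> has locally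
  finite perimeter; \<open>\<mu>\<close> is unique and \<open>\<sigma>\<close> is unique \<open>\<mu>\<close>-almost everywhere.
\<close>

definition polar_derivative ::
    "'a::euclidean_space set \<Rightarrow> 'a measure \<Rightarrow> ('a \<Rightarrow> 'a) \<Rightarrow> bool" where
  "polar_derivative E \<mu> \<sigma> \<longleftrightarrow>
     sets \<mu> = sets borel \<and> (\<forall>C. compact C \<longrightarrow> emeasure \<mu> C < \<infinity>) \<and>
     \<sigma> \<in> borel_measurable borel \<and> (AE x in \<mu>. norm (\<sigma> x) = 1) \<and>
     (\<forall>\<phi>\<in>C1_compact_fields UNIV.
        (LINT x:E|lebesgue. divergence \<phi> x) = - (LINT x|\<mu>. \<phi> x \<bullet> \<sigma> x))"

text \<open>
  De Giorgi's reduced boundary: the points of the support of \<open>|D\<chi>\<^sub>E|\<close> at which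
  \<open>D\<chi>\<^sub>E(B\<^sub>r(x)) / |D\<chi>\<^sub>E|(B\<^sub>r(x))\<close> converges to a unit vector as \<open>r \<down> 0\<close>.
\<close>

definition reduced_boundary :: "'a::euclidean_space set \<Rightarrow> 'a set" where
  "reduced_boundary E =
    {x. locally_finite_perimeter E \<and>
        (\<exists>\<mu> \<sigma>. polar_derivative E \<mu> \<sigma> \<and>
          (\<forall>r>0. emeasure \<mu> (ball x r) > 0) \<and>
          (\<exists>n. norm n = 1 \<and>
             ((\<lambda>r. (LINT y:ball x r|\<mu>. \<sigma> y) /\<^sub>R measure \<mu> (ball x r)) \<longlongrightarrow> n) (at_right 0)))}"


section \<open>Surface measure on the sphere and Lebesgue measure on subspaces\<close>

text \<open>
  The surface measure of the unit sphere, \<open>\<sigma>(A) = d |{t\<theta> : \<theta> \<in> A, 0 < t < 1}|\<close>, i.e. the measure for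
  which \<open>dx = r\<^sup>d\<^sup>-\<^sup>1 dr d\<theta>\<close>; for \<open>d = 1\<close> it is the counting measure on \<open>{-1, 1}\<close>.
\<close>

definition sphere_measure :: "'a::euclidean_space measure" where
  "sphere_measure =
     completion (scale_measure (of_nat DIM('a))
       (distr (restrict_space lborel (ball 0 1 - {0})) (restrict_space borel (sphere 0 1))
         (\<lambda>x. x /\<^sub>R norm x)))"

text \<open>
  Lebesgue measure on a linear subspace, transported by the coordinates of an orthonormal basis
  (in the same way as \<^const>\<open>lborel\<close> itself is defined); it does not depend on the basis.
  For \<open>V = {0}\<close> it is the Dirac measure.
\<close>

definition subspace_lebesgue :: "'a::euclidean_space set \<Rightarrow> 'a measure" where
  "subspace_lebesgue V =
    (let B = (SOME B. pairwise orthogonal B \<and> (\<forall>b\<in>B. norm b = 1) \<and> independent B \<and> span B = V)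
     in completion (distr (\<Pi>\<^sub>M b\<in>B. lborel) (restrict_space borel V) (\<lambda>f. \<Sum>b\<in>B. f b *\<^sub>R b)))"

abbreviation perp :: "'a::euclidean_space \<Rightarrow> 'a set" where
  "perp \<theta> \<equiv> {x. x \<bullet> \<theta> = 0}"

definition slice :: "'a::euclidean_space set \<Rightarrow> 'a \<Rightarrow> 'a \<Rightarrow> real set" where
  "slice A \<theta> x = {s. x + s *\<^sub>R \<theta> \<in> A}"

definition C1d :: "'n::finite \<Rightarrow> real" where
  "C1d k = (LINT \<theta>|(sphere_measure :: (real ^ 'n) measure). \<bar>\<theta> \<bullet> axis k 1\<bar>)"


section \<open>The kernel and the functional\<close>

text \<open>
  The family \<open>K \<tau>\<close>, \<open>\<tau> > 0\<close>, of kernels on \<open>\<real>\<^sup>d\<close>. Orthogonal maps are used for rotation invariance so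
  that \<open>K \<tau>\<close> is radial also for \<open>d = 1\<close>. At \<open>\<zeta> = 0\<close> divergence of \<open>K \<tau> 0\<close> as \<open>\<tau> \<down> 0\<close> already
  follows from the lower bound.
\<close>

definition admissible_kernel :: "real \<Rightarrow> (real \<Rightarrow> real ^ 'n \<Rightarrow> real) \<Rightarrow> bool" where
  "admissible_kernel p K \<longleftrightarrow>
     (\<forall>\<tau>>0. K \<tau> \<in> borel_measurable lebesgue) \<and>
     (\<forall>\<tau>>0. \<forall>R \<zeta>. orthogonal_transformation R \<longrightarrow> K \<tau> (R \<zeta>) = K \<tau> \<zeta>) \<and>
     (\<exists>C>0. \<forall>\<tau>>0. \<forall>\<zeta>.
        1 / (C * (norm \<zeta> + \<tau> powr (1 / (p - real CARD('n) - 1))) powr p) \<le> K \<tau> \<zeta> \<and>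
        K \<tau> \<zeta> \<le> C / (norm \<zeta> + \<tau> powr (1 / (p - real CARD('n) - 1))) powr p) \<and>
     (\<forall>\<zeta> \<tau> \<tau>'. 0 < \<tau> \<and> \<tau> \<le> \<tau>' \<longrightarrow> K \<tau>' \<zeta> \<le> K \<tau> \<zeta>) \<and>
     (\<forall>\<zeta>. \<zeta> \<noteq> 0 \<longrightarrow> ((\<lambda>\<tau>. K \<tau> \<zeta>) \<longlongrightarrow> norm \<zeta> powr (- p)) (at_right 0))"

definition kernel_bar :: "(real ^ 'n \<Rightarrow> real) \<Rightarrow> real \<Rightarrow> real" where
  "kernel_bar \<kappa> t = \<bar>t\<bar> ^ (CARD('n) - 1) * \<kappa> (SOME z. norm z = \<bar>t\<bar>)"

text \<open>For radial \<open>\<kappa>\<close> the choice of the unit vector is immaterial.\<close>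

definition J_const :: "(real ^ 'n \<Rightarrow> real) \<Rightarrow> real" where
  "J_const \<kappa> = (LINT \<zeta>:cball 0 1|lebesgue. \<bar>\<zeta> \<bullet> (SOME \<theta>. norm \<theta> = 1)\<bar> * \<kappa> \<zeta>)"

definition cube :: "real \<Rightarrow> (real ^ 'n) set" where
  "cube L = {x. \<forall>i. 0 \<le> x $ i \<and> x $ i < L}"

definition cube_periodic :: "real \<Rightarrow> (real ^ 'n) set \<Rightarrow> bool" where
  "cube_periodic L E \<longleftrightarrow>
     (\<forall>x. \<forall>k :: int ^ 'n. x + L *\<^sub>R (\<chi> i. of_int (k $ i)) \<in> E \<longleftrightarrow> x \<in> E)"

definition functional :: "(real ^ 'n \<Rightarrow> real) \<Rightarrow> (real ^ 'n) set \<Rightarrow> real \<Rightarrow> real" where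
  "functional \<kappa> E L =
     1 / L ^ CARD('n) *
       (J_const \<kappa> * enn2real (perimeter E (cube L)) -
        (LINT x:cube L|lebesgue. (LINT \<zeta>|lebesgue.
           \<bar>indicat_real E (x + \<zeta>) - indicat_real E x\<bar> * \<kappa> \<zeta>)))"


section \<open>The one-dimensional contributions\<close>

text \<open>
  The points of \<open>\<partial>\<^sup>*A\<close> next to \<open>s\<close>; with the convention \<open>\<plusminus>\<infinity>\<close> if there is none.
\<close>

definition next_right :: "real set \<Rightarrow> real \<Rightarrow> ereal" where
  "next_right A s = (INF t\<in>{t \<in> reduced_boundary A. s < t}. ereal t)"

definition next_left :: "real set \<Rightarrow> real \<Rightarrow> ereal" where
  "next_left A s = (SUP t\<in>{t \<in> reduced_boundary A. t < s}. ereal t)"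

definition r_fun :: "(real \<Rightarrow> real) \<Rightarrow> real set \<Rightarrow> real \<Rightarrow> real" where
  "r_fun \<kappa> A s =
     (LINT \<rho>:{-1..1}|lebesgue. \<bar>\<rho>\<bar> * \<kappa> \<rho>)
     - (LINT u:{u. next_left A s < ereal u \<and> u < s}|lebesgue.
          (LINT \<rho>:{0..}|lebesgue. \<bar>indicat_real A u - indicat_real A (u + \<rho>)\<bar> * \<kappa> \<rho>))
     - (LINT u:{u. s < u \<and> ereal u < next_right A s}|lebesgue.
          (LINT \<rho>:{..0}|lebesgue. \<bar>indicat_real A u - indicat_real A (u + \<rho>)\<bar> * \<kappa> \<rho>))"

end

theory Submission
  imports Defs
begin

text \<open>
  Both formulas rest on integral geometry: quantities on \<open>\<real>\<^sup>d\<close> are averages over all directions \<open>\<theta>\<close> and all lines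
  \<open>x + \<real>\<theta>\<close> of quantities on the line.

  \<^bold>\<open>Perimeter.\<close> Let \<open>|D\<^sub>\<theta> \<chi>\<^sub>E|\<close> be the variation in the single direction \<open>\<theta>\<close> (\<open>dir_variation\<close>). Its average over the sphere
  is \<open>C\<^sub>1\<^sub>,\<^sub>d\<close> times the perimeter (\<open>nn_integral_dir_variation\<close>). In one direction, a measurable choice of an almost optimal
  scalar test function for every \<open>\<theta>\<close> is averaged to a vector field of length at most \<open>C\<^sub>1\<^sub>,\<^sub>d\<close>; conversely
  \<open>C\<^sub>1\<^sub>,\<^sub>d v = \<integral> |v| sgn\<langle>v, \<theta>\<rangle> \<theta> d\<theta>\<close> writes every vector field as such an average, up to smoothing.
  Next, \<open>|D\<^sub>\<theta> \<chi>\<^sub>E|\<close> is the integral over the lines of the variation of the slices (\<open>dir_variation_slices\<close>): difference quotients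
  bound that integral from above by Fatou's lemma, test functions restricted to lines from below.

  \<^bold>\<open>The line.\<close> The variation of a subset of \<open>\<real>\<close> counts its essential boundary (\<open>variation_in_open_real\<close>), so almost every slice has
  locally finite essential boundary, and for such sets it equals the reduced boundary (\<open>reduced_boundary_real\<close>).

  \<^bold>\<open>The functional.\<close> In polar coordinates the nonlocal term becomes an average over \<open>\<theta>\<close> of the integral over the cube of the flux
  \<open>F\<^sub>\<theta>(y) = \<integral>\<^sub>0\<^sup>\<infinity> |\<chi>\<^sub>E(y) - \<chi>\<^sub>E(y + \<rho>\<theta>)| \<rho>\<^sup>d\<^sup>-\<^sup>1 K\<^sub>\<tau>(\<rho>) d\<rho>\<close> (\<open>nonlocal_polar\<close>). On a line, the second term of \<open>r\<^sub>\<tau>(s)\<close> is the flux summed over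
  the gap to the left of \<open>s\<close>. Summing over the boundary points in the cube collects the flux of those \<open>y\<close> whose next boundary
  point lies in the cube. Sending every \<open>y\<close> to its next boundary point commutes with the lattice translations, so this is
  the flux of the \<open>y\<close> in the cube themselves (\<open>mass_transport\<close>, \<open>sum_left_gaps\<close>); points without a next boundary point have no
  flux. The third term of \<open>r\<^sub>\<tau>\<close> is the same with \<open>-\<theta>\<close> in place of \<open>\<theta>\<close>, which doubles the nonlocal term. The first term counts
  the boundary points in the cube, and its weight is \<open>2 J\<^sub>\<tau> / C\<^sub>1\<^sub>,\<^sub>d\<close> (\<open>radial_moment\<close>, \<open>J_const_eq\<close>), so it produces
  \<open>2 J\<^sub>\<tau> Per\<close>. This explains the factor \<open>1/2\<close> in the formula.

  Throughout, sets and kernels are first replaced by Borel representatives, and the completed measures by their Borel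
  parts, since nonnegative integrals of Borel functions allow Fubini's theorem without integrability conditions.
\<close>

section \<open>Rotation invariance of Lebesgue measure\<close>

text \<open>For the automatic measurability of functions restricted to \<open>ball 0 1 - {0}\<close>.\<close>

lemma pred_mem_ball [measurable]:
  fixes f :: "'b \<Rightarrow> 'a::euclidean_space"
  assumes [measurable]: "f \<in> borel_measurable M" "g \<in> borel_measurable M"
  shows "Measurable.pred M (\<lambda>x. f x \<in> ball c (g x))"
  unfolding mem_ball by measurable

lemma pred_mem_singleton [measurable]:
  fixes f :: "'b \<Rightarrow> 'a::euclidean_space"
  assumes [measurable]: "f \<in> borel_measurable M"
  shows "Measurable.pred M (\<lambda>x. f x \<in> {c})"
  unfolding singleton_iff by measurable

lemma nn_integral_lborel_translate:
  fixes f :: "'a::euclidean_space \<Rightarrow> ennreal"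
  assumes [measurable]: "f \<in> borel_measurable borel"
  shows "(\<integral>\<^sup>+x. f (x + a) \<partial>lborel) = (\<integral>\<^sup>+x. f x \<partial>lborel)"
proof -
  have "(\<integral>\<^sup>+x. f x \<partial>lborel) = (\<integral>\<^sup>+x. f x \<partial>distr lborel borel ((+) a))"
    by (simp add: lborel_distr_plus)
  also have "\<dots> = (\<integral>\<^sup>+x. f (a + x) \<partial>lborel)"
    by (subst nn_integral_distr) auto
  finally show ?thesis by (simp add: add.commute)
qed

lemma nn_integral_lborel_scale:
  fixes f :: "'a::euclidean_space \<Rightarrow> ennreal"
  assumes [measurable]: "f \<in> borel_measurable borel" and "c \<noteq> 0"
  shows "(\<integral>\<^sup>+x. f x \<partial>lborel) = ennreal (\<bar>c\<bar> ^ DIM('a)) * (\<integral>\<^sup>+x. f (c *\<^sub>R x) \<partial>lborel)"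
proof -
  have "(\<integral>\<^sup>+x. f x \<partial>lborel) = (\<integral>\<^sup>+x. f x \<partial>density (distr lborel borel (\<lambda>x. 0 + c *\<^sub>R x)) (\<lambda>_. \<bar>c\<bar>^DIM('a)))"
    using lborel_affine[OF \<open>c \<noteq> 0\<close>, of "0::'a"] by simp
  also have "\<dots> = (\<integral>\<^sup>+x. ennreal (\<bar>c\<bar> ^ DIM('a)) * f (c *\<^sub>R x) \<partial>lborel)"
    by (subst nn_integral_density) (auto simp: nn_integral_distr)
  also have "\<dots> = ennreal (\<bar>c\<bar> ^ DIM('a)) * (\<integral>\<^sup>+x. f (c *\<^sub>R x) \<partial>lborel)"
    by (rule nn_integral_cmult) auto
  finally show ?thesis .
qed

lemma nn_integral_lborel_reflect:
  fixes f :: "'a::euclidean_space \<Rightarrow> ennreal"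
  assumes "f \<in> borel_measurable borel"
  shows "(\<integral>\<^sup>+x. f (a - x) \<partial>lborel) = (\<integral>\<^sup>+x. f x \<partial>lborel)"
proof -
  have "(\<integral>\<^sup>+x. f x \<partial>lborel) = (\<integral>\<^sup>+x. f (x + a) \<partial>lborel)"
    by (rule nn_integral_lborel_translate[OF assms, symmetric])
  also have "\<dots> = (\<integral>\<^sup>+x. f (a - x) \<partial>lborel)"
    using assms by (subst nn_integral_lborel_scale[where c="-1"]) (auto simp: algebra_simps)
  finally show ?thesis by simp
qed

text \<open>
  A translation invariant measure is a multiple of Lebesgue measure: integrating
  \<open>1\<^sub>A(x) g(x + y)\<close> in both orders gives \<open>\<mu>(A) \<lambda>(g) = \<mu>(g) \<lambda>(A)\<close>. A rotation fixes the unit ball,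
  which determines the factor.
\<close>

proposition lborel_orthogonal_transformation:
  fixes R :: "'a::euclidean_space \<Rightarrow> 'a"
  assumes R: "orthogonal_transformation R"
  shows "distr lborel borel R = lborel"
proof (rule measure_eqI)
  have lin: "linear R" using R by (simp add: orthogonal_transformation_def)
  have [measurable]: "R \<in> borel_measurable borel"
    using lin by (intro borel_measurable_continuous_onI linear_continuous_on) (simp add: linear_linear)
  define \<mu> where "\<mu> = distr lborel borel R"
  have [measurable_cong]: "sets \<mu> = sets borel" by (simp add: \<mu>_def)
  have inv: "(\<integral>\<^sup>+x. f (x + a) \<partial>\<mu>) = (\<integral>\<^sup>+x. f x \<partial>\<mu>)"
    if [measurable]: "f \<in> borel_measurable borel" for f :: "'a \<Rightarrow> ennreal" and a
  proof -
    obtain b where b: "a = R b" using orthogonal_transformation_surj[OF R] by (metis surjD)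
    have "(\<integral>\<^sup>+x. f (x + a) \<partial>\<mu>) = (\<integral>\<^sup>+x. f (R (x + b)) \<partial>lborel)"
      by (simp add: \<mu>_def nn_integral_distr b linear_add[OF lin])
    also have "\<dots> = (\<integral>\<^sup>+x. f (R x) \<partial>lborel)"
      by (rule nn_integral_lborel_translate[where f="\<lambda>x. f (R x)"]) measurable
    finally show ?thesis by (simp add: \<mu>_def nn_integral_distr)
  qed
  have ballR: "emeasure \<mu> (ball 0 1) = emeasure lborel (ball 0 1 :: 'a set)"
  proof -
    have "R -` ball 0 1 = ball 0 1"
      by (auto simp: orthogonal_transformation_norm[OF R])
    then show ?thesis by (simp add: \<mu>_def emeasure_distr)
  qed
  have fin: "emeasure lborel (ball 0 1 :: 'a set) < \<infinity>" by (rule emeasure_lborel_ball_finite)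
  have pos: "emeasure lborel (ball 0 1 :: 'a set) \<noteq> 0"
    using open_not_negligible[of "ball (0::'a) 1"] null_sets_completionI[of "ball (0::'a) 1" lborel]
    by (auto simp: negligible_iff_null_sets null_sets_def)
  have sf: "sigma_finite_measure \<mu>"
  proof
    let ?A = "range (\<lambda>n::nat. ball (0::'a) (real n))"
    have "R -` ball 0 r = ball 0 r" for r
      by (auto simp: orthogonal_transformation_norm[OF R])
    then have "emeasure \<mu> (ball 0 r) \<noteq> \<infinity>" for r
      using emeasure_lborel_ball_finite[of "0::'a" r] by (simp add: \<mu>_def emeasure_distr)
    moreover have "\<Union> ?A = space \<mu>"
      using reals_Archimedean2 by (auto simp: \<mu>_def dist_norm)
    ultimately show "\<exists>A. countable A \<and> A \<subseteq> sets \<mu> \<and> \<Union> A = space \<mu> \<and> (\<forall>a\<in>A. emeasure \<mu> a \<noteq> \<infinity>)"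
      by (intro exI[of _ ?A]) auto
  qed
  interpret pair_sigma_finite lborel \<mu>
    using sf by (simp add: pair_sigma_finite_def sigma_finite_lborel)
  show "sets (distr lborel borel R) = sets lborel" by simp
  fix A assume "A \<in> sets (distr lborel borel R)"
  then have [measurable]: "A \<in> sets borel" by simp
  have key: "emeasure \<mu> A * integral\<^sup>N lborel g = integral\<^sup>N \<mu> g * emeasure lborel A"
    if [measurable]: "g \<in> borel_measurable borel" for g :: "'a \<Rightarrow> ennreal"
  proof -
    have "emeasure \<mu> A * integral\<^sup>N lborel g = (\<integral>\<^sup>+x. indicator A x * integral\<^sup>N lborel g \<partial>\<mu>)"
      by (simp add: nn_integral_multc)
    also have "\<dots> = (\<integral>\<^sup>+x. (\<integral>\<^sup>+y. indicator A x * g (y + x) \<partial>lborel) \<partial>\<mu>)"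
      by (intro nn_integral_cong) (simp add: nn_integral_cmult nn_integral_lborel_translate)
    also have "\<dots> = (\<integral>\<^sup>+y. (\<integral>\<^sup>+x. indicator A x * g (y + x) \<partial>\<mu>) \<partial>lborel)"
      by (rule Fubini'[where f="\<lambda>y x. indicator A x * g (y + x)"]) measurable
    also have "\<dots> = (\<integral>\<^sup>+y. (\<integral>\<^sup>+x. indicator A (x - y) * g x \<partial>\<mu>) \<partial>lborel)"
    proof (rule nn_integral_cong)
      fix y
      show "(\<integral>\<^sup>+x. indicator A x * g (y + x) \<partial>\<mu>) = (\<integral>\<^sup>+x. indicator A (x - y) * g x \<partial>\<mu>)"
        using inv[of "\<lambda>x. indicator A (x - y) * g x" y] by (simp add: add.commute)
    qed
    also have "\<dots> = (\<integral>\<^sup>+x. (\<integral>\<^sup>+y. indicator A (x - y) * g x \<partial>lborel) \<partial>\<mu>)"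
      by (rule Fubini'[where f="\<lambda>y x. indicator A (x - y) * g x", symmetric]) measurable
    also have "\<dots> = (\<integral>\<^sup>+x. emeasure lborel A * g x \<partial>\<mu>)"
      by (intro nn_integral_cong)
        (simp add: nn_integral_multc nn_integral_lborel_reflect[where f="indicator A"])
    also have "\<dots> = integral\<^sup>N \<mu> g * emeasure lborel A"
      by (simp add: nn_integral_multc mult.commute[of "emeasure lborel A"])
    finally show ?thesis .
  qed
  have "emeasure \<mu> A * emeasure lborel (ball 0 1 :: 'a set) = emeasure lborel (ball 0 1 :: 'a set) * emeasure lborel A"
    using key[OF borel_measurable_indicator[of "ball 0 1"]] by (simp add: ballR)
  then show "emeasure (distr lborel borel R) A = emeasure lborel A"
    unfolding \<mu>_def[symmetric] using fin pos
    by (metis ennreal_mult_cancel_left infinity_ennreal_def less_irrefl mult.commute)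
qed

section \<open>Fubini's theorem along parallel lines\<close>

text \<open>The measure \<^const>\<open>subspace_lebesgue\<close> before completion.\<close>

definition subspace_lborel :: "'a::euclidean_space set \<Rightarrow> 'a measure" where
  "subspace_lborel V =
    (let B = (SOME B. pairwise orthogonal B \<and> (\<forall>b\<in>B. norm b = 1) \<and> independent B \<and> span B = V)
     in distr (\<Pi>\<^sub>M b\<in>B. lborel) (restrict_space borel V) (\<lambda>f. \<Sum>b\<in>B. f b *\<^sub>R b))"

lemma subspace_lebesgue_eq: "subspace_lebesgue V = completion (subspace_lborel V)"
  by (simp add: subspace_lebesgue_def subspace_lborel_def Let_def)

lemma sets_subspace_lborel: "sets (subspace_lborel V) = sets (restrict_space borel V)"
  by (simp add: subspace_lborel_def Let_def)

lemma measurable_subspace_lborel: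
  "f \<in> borel \<rightarrow>\<^sub>M N \<Longrightarrow> f \<in> subspace_lborel V \<rightarrow>\<^sub>M N"
  by (simp add: measurable_cong_sets[OF sets_subspace_lborel refl] measurable_restrict_space1)

lemma subspace_perp: "subspace (perp \<theta>)"
  by (simp add: subspace_def inner_add_left)

text \<open>Lets coordinates indexed by the standard basis be indexed by another orthonormal basis instead.\<close>

lemma PiM_lborel_reindex:
  assumes fin: "finite I" and bij: "bij_betw g I J"
  shows "distr (\<Pi>\<^sub>M i\<in>I. (lborel :: real measure)) (\<Pi>\<^sub>M j\<in>J. lborel) (\<lambda>f. \<lambda>j\<in>J. f (inv_into I g j))
    = (\<Pi>\<^sub>M j\<in>J. lborel)"
proof -
  interpret product_sigma_finite "\<lambda>_. (lborel :: real measure)" by standard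
  have finJ: "finite J" using fin bij bij_betw_finite by blast
  have inI: "inv_into I g j \<in> I" if "j \<in> J" for j
    using that bij by (metis bij_betw_imp_surj_on inv_into_into)
  have gI: "g i \<in> J" if "i \<in> I" for i using that bij by (auto simp: bij_betw_def)
  have gi: "inv_into I g (g i) = i" if "i \<in> I" for i using that bij by (simp add: bij_betw_def)
  have ig: "g (inv_into I g j) = j" if "j \<in> J" for j
    using that bij by (simp add: bij_betw_inv_into_right)
  have [measurable]: "(\<lambda>f. \<lambda>j\<in>J. f (inv_into I g j)) \<in> (\<Pi>\<^sub>M i\<in>I. (lborel :: real measure)) \<rightarrow>\<^sub>M (\<Pi>\<^sub>M j\<in>J. lborel)"
    by (intro measurable_restrict measurable_component_singleton inI)
  show ?thesis
  proof (rule PiM_eqI[OF finJ])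
    fix A :: "'b \<Rightarrow> real set" assume A: "\<And>j. j \<in> J \<Longrightarrow> A j \<in> sets lborel"
    have "(\<lambda>f. \<lambda>j\<in>J. f (inv_into I g j)) -` (Pi\<^sub>E J A) \<inter> space (\<Pi>\<^sub>M i\<in>I. (lborel :: real measure))
        = Pi\<^sub>E I (\<lambda>i. A (g i))"
      using gI gi inI ig by (auto simp: space_PiM PiE_iff) (metis)+
    then have "emeasure (distr (\<Pi>\<^sub>M i\<in>I. (lborel :: real measure)) (\<Pi>\<^sub>M j\<in>J. lborel) (\<lambda>f. \<lambda>j\<in>J. f (inv_into I g j))) (Pi\<^sub>E J A)
        = emeasure (\<Pi>\<^sub>M i\<in>I. (lborel :: real measure)) (Pi\<^sub>E I (\<lambda>i. A (g i)))"
      using A finJ by (subst emeasure_distr) (auto intro!: sets_PiM_I_finite)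
    also have "\<dots> = (\<Prod>i\<in>I. emeasure lborel (A (g i)))"
      using A gI fin by (intro emeasure_PiM) auto
    also have "\<dots> = (\<Prod>j\<in>J. emeasure lborel (A j))"
      by (rule prod.reindex_bij_betw[OF bij])
    finally show "emeasure (distr (\<Pi>\<^sub>M i\<in>I. (lborel :: real measure)) (\<Pi>\<^sub>M j\<in>J. lborel) (\<lambda>f. \<lambda>j\<in>J. f (inv_into I g j))) (Pi\<^sub>E J A)
        = (\<Prod>j\<in>J. emeasure lborel (A j))" .
  qed simp
qed

text \<open>
  An orthonormal basis is the image of the standard basis under a rotation, and Lebesgue measure is rotation
  invariant.
\<close>

lemma nn_integral_lborel_orthonormal:
  fixes S :: "'a::euclidean_space set"
  assumes orth: "pairwise orthogonal S" and n1: "\<And>x. x \<in> S \<Longrightarrow> norm x = 1" and card: "card S = DIM('a)"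
    and [measurable]: "f \<in> borel_measurable borel"
  shows "(\<integral>\<^sup>+x. f x \<partial>lborel) = (\<integral>\<^sup>+c. f (\<Sum>b\<in>S. c b *\<^sub>R b) \<partial>(\<Pi>\<^sub>M b\<in>S. lborel))"
proof -
  have fin: "finite S" using card by (metis DIM_positive card.infinite less_irrefl)
  obtain g where g: "bij_betw g (Basis::'a set) S"
    using card fin by (metis bij_betw_iff_card finite_Basis)
  have gS: "g b \<in> S" if "b \<in> Basis" for b using that g by (auto simp: bij_betw_def)
  have gg: "g a \<bullet> g b = (if a = b then 1 else 0)" if "a \<in> Basis" "b \<in> Basis" for a b
  proof (cases "a = b")
    case True
    then show ?thesis using n1[OF gS[OF that(1)]] by (simp add: norm_eq_1)
  next
    case False
    then have "g a \<noteq> g b" using g that by (auto simp: bij_betw_def inj_on_def)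
    then show ?thesis using orth gS that False by (auto simp: pairwise_def orthogonal_def)
  qed
  define R where "R = (\<lambda>y::'a. \<Sum>b\<in>Basis. (y \<bullet> b) *\<^sub>R g b)"
  have "orthogonal_transformation R"
    unfolding orthogonal_transformation_def
  proof safe
    show "linear R" unfolding R_def
      by (intro linear_compose_sum ballI linearI) (auto simp: inner_add_left algebra_simps)
    fix v w :: 'a
    have "R v \<bullet> R w = (\<Sum>b\<in>Basis. \<Sum>a\<in>Basis. (w \<bullet> b) * ((v \<bullet> a) * (g a \<bullet> g b)))"
      by (simp add: R_def inner_sum_left inner_sum_right sum_distrib_left)
    also have "\<dots> = (\<Sum>a\<in>Basis. \<Sum>b\<in>Basis. (v \<bullet> a) * ((w \<bullet> b) * (g a \<bullet> g b)))"
      by (subst sum.swap) (simp add: mult_ac)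
    also have "\<dots> = (\<Sum>a\<in>Basis. \<Sum>b\<in>Basis. if a = b then (v \<bullet> a) * (w \<bullet> b) else 0)"
      by (intro sum.cong refl) (simp add: gg)
    also have "\<dots> = v \<bullet> w" by (simp add: sum.delta euclidean_inner[of v w])
    finally show "R v \<bullet> R w = v \<bullet> w" .
  qed
  then have D: "distr lborel borel R = lborel" by (rule lborel_orthogonal_transformation)
  have Rm [measurable]: "R \<in> borel_measurable borel" unfolding R_def by measurable
  have "(\<integral>\<^sup>+x. f x \<partial>lborel) = (\<integral>\<^sup>+x. f (R x) \<partial>lborel)"
    by (subst D[symmetric]) (simp add: nn_integral_distr)
  also have "\<dots> = (\<integral>\<^sup>+x. f (R x) \<partial>distr (\<Pi>\<^sub>M b\<in>Basis. lborel) borel (\<lambda>f. \<Sum>b\<in>Basis. f b *\<^sub>R b))"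
    by (subst lborel_eq) simp
  also have "\<dots> = (\<integral>\<^sup>+c. f (R (\<Sum>b\<in>Basis. c b *\<^sub>R b)) \<partial>(\<Pi>\<^sub>M b\<in>Basis. lborel))"
    by (subst nn_integral_distr) auto
  also have "\<dots> = (\<integral>\<^sup>+c. f (\<Sum>b\<in>S. (\<lambda>j\<in>S. c (inv_into Basis g j)) b *\<^sub>R b) \<partial>(\<Pi>\<^sub>M b\<in>Basis. lborel))"
  proof (intro nn_integral_cong arg_cong[where f=f])
    fix c :: "'a \<Rightarrow> real"
    have "R (\<Sum>b\<in>Basis. c b *\<^sub>R b) = (\<Sum>b\<in>Basis. c b *\<^sub>R g b)"
      by (simp add: R_def inner_sum_left_Basis)
    also have "\<dots> = (\<Sum>b\<in>Basis. (\<lambda>j\<in>S. c (inv_into Basis g j)) (g b) *\<^sub>R g b)"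
      using gS g by (intro sum.cong) (auto simp: bij_betw_def)
    also have "\<dots> = (\<Sum>b\<in>S. (\<lambda>j\<in>S. c (inv_into Basis g j)) b *\<^sub>R b)"
      by (rule sum.reindex_bij_betw[OF g])
    finally show "R (\<Sum>b\<in>Basis. c b *\<^sub>R b) = (\<Sum>b\<in>S. (\<lambda>j\<in>S. c (inv_into Basis g j)) b *\<^sub>R b)" .
  qed
  also have "\<dots> = (\<integral>\<^sup>+c. f (\<Sum>b\<in>S. c b *\<^sub>R b)
       \<partial>distr (\<Pi>\<^sub>M b\<in>Basis. lborel) (\<Pi>\<^sub>M b\<in>S. lborel) (\<lambda>c. \<lambda>j\<in>S. c (inv_into Basis g j)))"
    using bij_betw_imp_surj_on[OF bij_betw_inv_into[OF g]]
    by (subst nn_integral_distr) (auto intro!: measurable_restrict measurable_component_singleton)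
  also have "\<dots> = (\<integral>\<^sup>+c. f (\<Sum>b\<in>S. c b *\<^sub>R b) \<partial>(\<Pi>\<^sub>M b\<in>S. lborel))"
    by (simp add: PiM_lborel_reindex[OF finite_Basis g])
  finally show ?thesis .
qed

lemma subspace_lborel_basis:
  fixes V :: "'a::euclidean_space set"
  assumes V: "subspace V"
  obtains B where "finite B" "pairwise orthogonal B" "\<And>b. b \<in> B \<Longrightarrow> norm b = 1" "card B = dim V" "span B = V"
    "subspace_lborel V = distr (\<Pi>\<^sub>M b\<in>B. lborel) (restrict_space borel V) (\<lambda>f. \<Sum>b\<in>B. f b *\<^sub>R b)"
proof -
  define B where "B = (SOME B. pairwise orthogonal B \<and> (\<forall>b\<in>B. norm b = 1) \<and> independent B \<and> span B = V)"
  have "\<exists>B. pairwise orthogonal B \<and> (\<forall>b\<in>B. norm b = 1) \<and> independent B \<and> span B = V"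
    using orthonormal_basis_subspace[OF V] by metis
  from someI_ex[OF this, folded B_def]
  have B: "pairwise orthogonal B" "\<And>b. b \<in> B \<Longrightarrow> norm b = 1" "independent B" "span B = V" by auto
  show ?thesis
    by (rule that[of B]) (use B in \<open>auto simp: subspace_lborel_def B_def[symmetric] Let_def
        indep_card_eq_dim_span[OF \<open>independent B\<close>]\<close>)
qed

text \<open>
  Fubini's theorem in the coordinates of an orthonormal basis of \<open>\<theta>\<^sup>\<bottom>\<close> completed
  by \<open>\<theta>\<close>.
\<close>

proposition nn_integral_lborel_lines:
  fixes f :: "'a::euclidean_space \<Rightarrow> ennreal"
  assumes \<theta>: "norm \<theta> = 1" and [measurable]: "f \<in> borel_measurable borel"
  shows "(\<integral>\<^sup>+y. f y \<partial>lborel) = (\<integral>\<^sup>+x. (\<integral>\<^sup>+s. f (x + s *\<^sub>R \<theta>) \<partial>lborel) \<partial>subspace_lborel (perp \<theta>))"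
proof -
  interpret product_sigma_finite "\<lambda>_. (lborel :: real measure)" by standard
  obtain B where B: "finite B" "pairwise orthogonal B" "\<And>b. b \<in> B \<Longrightarrow> norm b = 1" "card B = dim (perp \<theta>)"
      "span B = perp \<theta>"
    and eq: "subspace_lborel (perp \<theta>) = distr (\<Pi>\<^sub>M b\<in>B. lborel) (restrict_space borel (perp \<theta>)) (\<lambda>f. \<Sum>b\<in>B. f b *\<^sub>R b)"
    by (rule subspace_lborel_basis[OF subspace_perp[of \<theta>]]) (rule that)
  have perp: "b \<bullet> \<theta> = 0" if "b \<in> B" for b using B(5) span_base[OF that] by auto
  have nin: "\<theta> \<notin> B" using perp \<theta> by (auto simp: norm_eq_1)
  have [simp]: "\<theta> \<noteq> 0" using \<theta> by auto
  have "perp \<theta> = {x. \<theta> \<bullet> x = 0}" by (simp add: inner_commute)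
  then have "dim (perp \<theta>) = DIM('a) - 1" by (simp add: dim_hyperplane)
  then have card: "card (insert \<theta> B) = DIM('a)"
    using B nin by simp
  have orth: "pairwise orthogonal (insert \<theta> B)"
    using B(2) perp by (auto simp: pairwise_insert orthogonal_def inner_commute)
  have meas: "(\<lambda>f. \<Sum>b\<in>B. f b *\<^sub>R b) \<in> (\<Pi>\<^sub>M b\<in>B. lborel) \<rightarrow>\<^sub>M restrict_space borel (perp \<theta>)"
    by (intro measurable_restrict_space2) (auto simp: inner_sum_left perp)
  have "(\<integral>\<^sup>+y. f y \<partial>lborel) = (\<integral>\<^sup>+c. f (\<Sum>b\<in>insert \<theta> B. c b *\<^sub>R b) \<partial>(\<Pi>\<^sub>M b\<in>insert \<theta> B. lborel))"
    by (rule nn_integral_lborel_orthonormal[OF orth]) (use B \<theta> card in auto)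
  also have "\<dots> = (\<integral>\<^sup>+c. (\<integral>\<^sup>+s. f (\<Sum>b\<in>insert \<theta> B. (c(\<theta> := s)) b *\<^sub>R b) \<partial>lborel) \<partial>(\<Pi>\<^sub>M b\<in>B. lborel))"
    using B nin by (intro product_nn_integral_insert) measurable
  also have "\<dots> = (\<integral>\<^sup>+c. (\<integral>\<^sup>+s. f ((\<Sum>b\<in>B. c b *\<^sub>R b) + s *\<^sub>R \<theta>) \<partial>lborel) \<partial>(\<Pi>\<^sub>M b\<in>B. lborel))"
  proof (intro nn_integral_cong arg_cong[where f=f])
    fix c :: "'a \<Rightarrow> real" and s
    have "(\<Sum>b\<in>B. (c(\<theta> := s)) b *\<^sub>R b) = (\<Sum>b\<in>B. c b *\<^sub>R b)"
      using nin by (intro sum.cong) auto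
    then show "(\<Sum>b\<in>insert \<theta> B. (c(\<theta> := s)) b *\<^sub>R b) = (\<Sum>b\<in>B. c b *\<^sub>R b) + s *\<^sub>R \<theta>"
      using B nin by (simp add: add.commute)
  qed
  also have "\<dots> = (\<integral>\<^sup>+x. (\<integral>\<^sup>+s. f (x + s *\<^sub>R \<theta>) \<partial>lborel) \<partial>subspace_lborel (perp \<theta>))"
    unfolding eq using meas by (subst nn_integral_distr) (auto intro!: measurable_restrict_space1)
  finally show ?thesis .
qed

lemma AE_lborel_lines:
  fixes P :: "'a::euclidean_space \<Rightarrow> bool"
  assumes \<theta>: "norm \<theta> = 1" and AE: "AE y in lborel. P y"
  shows "AE x in subspace_lborel (perp \<theta>). AE s in lborel. P (x + s *\<^sub>R \<theta>)"
proof -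
  obtain N where N: "N \<in> null_sets lborel" "{y. \<not> P y} \<subseteq> N"
    using AE by (auto elim!: AE_E simp: null_sets_def)
  then have [measurable]: "N \<in> sets borel" by auto
  have "(\<integral>\<^sup>+x. (\<integral>\<^sup>+s. indicator N (x + s *\<^sub>R \<theta>) \<partial>lborel) \<partial>subspace_lborel (perp \<theta>)) = emeasure lborel N"
    by (subst nn_integral_lborel_lines[OF \<theta>, symmetric]) auto
  also have "\<dots> = 0" using N by auto
  finally have "AE x in subspace_lborel (perp \<theta>). (\<integral>\<^sup>+s. indicator N (x + s *\<^sub>R \<theta>) \<partial>lborel) = 0"
    by (subst (asm) nn_integral_0_iff_AE) (auto intro!: measurable_subspace_lborel)
  then show ?thesis
  proof (rule eventually_mono)
    fix x assume "(\<integral>\<^sup>+s. indicator N (x + s *\<^sub>R \<theta>) \<partial>lborel) = (0::ennreal)"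
    then have "AE s in lborel. indicator N (x + s *\<^sub>R \<theta>) = (0::ennreal)"
      by (subst (asm) nn_integral_0_iff_AE) auto
    then show "AE s in lborel. P (x + s *\<^sub>R \<theta>)"
      by (rule AE_mp) (use N(2) in \<open>auto simp: indicator_def split: if_splits\<close>)
  qed
qed

section \<open>Polar coordinates\<close>

text \<open>The measure \<^const>\<open>sphere_measure\<close> before completion.\<close>

definition sphere_lborel :: "'a::euclidean_space measure" where
  "sphere_lborel = scale_measure (of_nat DIM('a))
       (distr (restrict_space lborel (ball 0 1 - {0})) (restrict_space borel (sphere 0 1))
         (\<lambda>x. x /\<^sub>R norm x))"

lemma sphere_measure_eq: "sphere_measure = completion sphere_lborel"
  by (simp add: sphere_measure_def sphere_lborel_def)

lemma sets_sphere_lborel: "sets sphere_lborel = sets (restrict_space borel (sphere 0 1))"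
  by (simp add: sphere_lborel_def)

lemma space_sphere_lborel: "space sphere_lborel = sphere 0 1"
  by (simp add: sphere_lborel_def space_scale_measure space_restrict_space)

lemma measurable_sphere_lborel:
  "f \<in> borel \<rightarrow>\<^sub>M N \<Longrightarrow> f \<in> sphere_lborel \<rightarrow>\<^sub>M N"
  by (simp add: measurable_cong_sets[OF sets_sphere_lborel refl] measurable_restrict_space1)

lemma nn_integral_sphere_lborel:
  fixes f :: "'a::euclidean_space \<Rightarrow> ennreal"
  assumes [measurable]: "f \<in> borel_measurable borel"
  shows "(\<integral>\<^sup>+\<theta>. f \<theta> \<partial>sphere_lborel)
    = of_nat DIM('a) * (\<integral>\<^sup>+x. f (x /\<^sub>R norm x) * indicator (ball 0 1 - {0}) x \<partial>lborel)"
proof -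
  have 1: "(\<lambda>x. x /\<^sub>R norm x) \<in> restrict_space lborel (ball 0 1 - {0::'a}) \<rightarrow>\<^sub>M restrict_space borel (sphere 0 1)"
    by (intro measurable_restrict_space2 measurable_restrict_space1)
      (auto simp: space_restrict_space)
  have "f \<in> borel_measurable (restrict_space borel (sphere 0 1))"
    by (rule measurable_restrict_space1) auto
  then show ?thesis
    unfolding sphere_lborel_def using 1
    by (subst nn_integral_scale_measure) (auto simp: nn_integral_distr nn_integral_restrict_space)
qed

lemma finite_sphere_lborel: "finite_measure (sphere_lborel :: 'a::euclidean_space measure)"
proof
  have "emeasure sphere_lborel (space (sphere_lborel :: 'a measure)) = (\<integral>\<^sup>+\<theta>. 1 \<partial>(sphere_lborel :: 'a measure))"
    by simp
  also have "\<dots> = of_nat DIM('a) * (\<integral>\<^sup>+x. indicator (ball 0 1 - {0::'a}) x \<partial>lborel)"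
    by (subst nn_integral_sphere_lborel) auto
  also have "\<dots> = of_nat DIM('a) * emeasure lborel (ball 0 1 - {0::'a})" by simp
  also have "\<dots> \<le> of_nat DIM('a) * emeasure lborel (ball (0::'a) 1)"
    by (intro mult_left_mono emeasure_mono) auto
  also have "\<dots> < \<infinity>"
    using emeasure_lborel_ball_finite[of "0::'a" 1] by (auto simp: ennreal_mult_less_top of_nat_less_top)
  finally show "emeasure sphere_lborel (space (sphere_lborel :: 'a measure)) \<noteq> \<infinity>" by simp
qed

lemma nn_integral_sphere_orthogonal:
  fixes f :: "'a::euclidean_space \<Rightarrow> ennreal" and R :: "'a \<Rightarrow> 'a"
  assumes R: "orthogonal_transformation R" and [measurable]: "f \<in> borel_measurable borel"
  shows "(\<integral>\<^sup>+\<theta>. f (R \<theta>) \<partial>sphere_lborel) = (\<integral>\<^sup>+\<theta>. f \<theta> \<partial>sphere_lborel)"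
proof -
  have lin: "linear R" using R by (simp add: orthogonal_transformation_def)
  have Rm [measurable]: "R \<in> borel_measurable borel"
    using lin by (intro borel_measurable_continuous_onI linear_continuous_on) (simp add: linear_linear)
  have R0: "R x = 0 \<longleftrightarrow> x = 0" for x
    using orthogonal_transformation_norm[OF R, of x] by (metis norm_eq_zero)
  have "(\<integral>\<^sup>+x. f (x /\<^sub>R norm x) * indicator (ball 0 1 - {0}) x \<partial>lborel)
      = (\<integral>\<^sup>+x. f (x /\<^sub>R norm x) * indicator (ball 0 1 - {0}) x \<partial>distr lborel borel R)"
    by (simp only: lborel_orthogonal_transformation[OF R])
  also have "\<dots> = (\<integral>\<^sup>+x. f (R x /\<^sub>R norm (R x)) * indicator (ball 0 1 - {0}) (R x) \<partial>lborel)"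
    by (rule nn_integral_distr) measurable
  also have "\<dots> = (\<integral>\<^sup>+x. f (R (x /\<^sub>R norm x)) * indicator (ball 0 1 - {0}) x \<partial>lborel)"
    by (intro nn_integral_cong)
      (auto simp: orthogonal_transformation_norm[OF R] linear_cmul[OF lin] indicator_def R0)
  finally show ?thesis
    by (simp add: nn_integral_sphere_lborel)
qed

lemma nn_integral_power_tail:
  assumes "a > 0" "D > 0"
  shows "(\<integral>\<^sup>+u. ennreal (real D / u ^ (D + 1)) * indicator {a<..} u \<partial>lborel) = ennreal (1 / a ^ D)"
proof -
  have "(\<integral>\<^sup>+u. ennreal (real D / u ^ (D + 1)) * indicator {a<..} u \<partial>lborel)
      = (\<integral>\<^sup>+u. ennreal (indicator {0<..} u * (real D / u ^ (D + 1))) * indicator {a..} u \<partial>lborel)"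
    by (rule nn_integral_cong_AE, rule AE_mp[OF AE_lborel_singleton[of a]])
      (use assms in \<open>auto simp: indicator_def\<close>)
  also have "\<dots> = ennreal (0 - (- (1 / a ^ D)))"
  proof (rule nn_integral_FTC_atLeast)
    fix x assume x: "a \<le> x"
    then have xp: "x > 0" using assms by linarith
    then have [simp]: "x \<noteq> 0" by auto
    show "((\<lambda>x. - (1 / x ^ D)) has_real_derivative indicator {0<..} x * (real D / x ^ (D + 1))) (at x)"
      using assms xp by (auto intro!: derivative_eq_intros simp: indicator_def field_simps power_eq_if[of x D] power2_eq_square)
    show "0 \<le> indicator {0<..} x * (real D / x ^ (D + 1))"
      using xp by (auto simp: indicator_def)
  next
    have "filterlim (\<lambda>x::real. x ^ D) at_top at_top"
      using assms by (intro filterlim_pow_at_top filterlim_ident) auto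
    then have "((\<lambda>x. 1 / x ^ D) \<longlongrightarrow> (0::real)) at_top"
      using tendsto_divide_0[OF tendsto_const filterlim_at_top_imp_at_infinity, of _ at_top] by blast
    then show "((\<lambda>x. - (1 / x ^ D)) \<longlongrightarrow> (0::real)) at_top"
      using tendsto_minus by fastforce
  qed measurable
  finally show ?thesis by simp
qed

text \<open>
  Substituting \<open>r = u |x|\<close> in the right-hand side, then \<open>y = u x\<close>, leaves the factor
  \<open>\<integral>\<^bsub>u > |y|\<^esub> D |y|\<^sup>D u\<^sup>-\<^sup>D\<^sup>-\<^sup>1 du = 1\<close>.
\<close>

proposition nn_integral_polar:
  fixes f :: "'a::euclidean_space \<Rightarrow> ennreal"
  assumes [measurable]: "f \<in> borel_measurable borel"
  shows "(\<integral>\<^sup>+y. f y \<partial>lborel)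
    = (\<integral>\<^sup>+\<theta>. (\<integral>\<^sup>+r. f (r *\<^sub>R \<theta>) * ennreal (r ^ (DIM('a) - 1)) * indicator {0<..} r \<partial>lborel) \<partial>sphere_lborel)"
    (is "_ = ?R")
proof -
  define D where "D = DIM('a)"
  have D: "D > 0" by (simp add: D_def)
  let ?G = "\<lambda>x::'a. indicator (ball 0 1 - {0}) x :: ennreal"
  have inner: "(\<integral>\<^sup>+r. f (r *\<^sub>R (x /\<^sub>R norm x)) * ennreal (r ^ (D - 1)) * indicator {0<..} r \<partial>lborel)
      = (\<integral>\<^sup>+u. f (u *\<^sub>R x) * ennreal (norm x ^ D * u ^ (D - 1)) * indicator {0<..} u \<partial>lborel)"
    if x: "x \<noteq> 0" for x :: 'a
  proof -
    have "(\<integral>\<^sup>+r. f (r *\<^sub>R (x /\<^sub>R norm x)) * ennreal (r ^ (D - 1)) * indicator {0<..} r \<partial>lborel)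
      = ennreal (norm x) * (\<integral>\<^sup>+u. f ((norm x *\<^sub>R u) *\<^sub>R (x /\<^sub>R norm x)) * ennreal ((norm x *\<^sub>R u) ^ (D - 1))
          * indicator {0<..} (norm x *\<^sub>R u) \<partial>lborel)"
      using x by (subst nn_integral_lborel_scale[where c="norm x"]) auto
    also have "\<dots> = (\<integral>\<^sup>+u. ennreal (norm x) * (f ((norm x *\<^sub>R u) *\<^sub>R (x /\<^sub>R norm x)) * ennreal ((norm x *\<^sub>R u) ^ (D - 1))
          * indicator {0<..} (norm x *\<^sub>R u)) \<partial>lborel)"
      by (rule nn_integral_cmult[symmetric]) measurable
    also have "\<dots> = (\<integral>\<^sup>+u. f (u *\<^sub>R x) * ennreal (norm x ^ D * u ^ (D - 1)) * indicator {0<..} u \<partial>lborel)"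
    proof (rule nn_integral_cong)
      fix u :: real
      have e: "norm x ^ D = norm x * norm x ^ (D - 1)" using D by (metis power_eq_if less_irrefl)
      have "ennreal (norm x) * ennreal ((norm x * u) ^ (D - 1)) = ennreal (norm x ^ D * u ^ (D - 1))"
        by (subst ennreal_mult'[symmetric]) (auto simp: e power_mult_distrib mult_ac)
      note e2 = this
      show "ennreal (norm x) * (f ((norm x *\<^sub>R u) *\<^sub>R (x /\<^sub>R norm x)) * ennreal ((norm x *\<^sub>R u) ^ (D - 1))
          * indicator {0<..} (norm x *\<^sub>R u)) = f (u *\<^sub>R x) * ennreal (norm x ^ D * u ^ (D - 1)) * indicator {0<..} u"
        using x e2[symmetric] by (auto simp: indicator_def zero_less_mult_iff mult_ac)
    qed
    finally show ?thesis .
  qed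
  have "?R = of_nat D * (\<integral>\<^sup>+x. (\<integral>\<^sup>+r. f (r *\<^sub>R (x /\<^sub>R norm x)) * ennreal (r ^ (D - 1)) * indicator {0<..} r \<partial>lborel) * ?G x \<partial>lborel)"
    by (subst nn_integral_sphere_lborel) (auto simp: D_def)
  also have "\<dots> = of_nat D * (\<integral>\<^sup>+x. (\<integral>\<^sup>+u. f (u *\<^sub>R x) * ennreal (norm x ^ D * u ^ (D - 1)) * indicator {0<..} u * ?G x \<partial>lborel) \<partial>lborel)"
  proof (rule arg_cong[where f="\<lambda>t. of_nat D * t"], rule nn_integral_cong)
    fix x :: 'a
    show "(\<integral>\<^sup>+r. f (r *\<^sub>R (x /\<^sub>R norm x)) * ennreal (r ^ (D - 1)) * indicator {0<..} r \<partial>lborel) * ?G x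
      = (\<integral>\<^sup>+u. f (u *\<^sub>R x) * ennreal (norm x ^ D * u ^ (D - 1)) * indicator {0<..} u * ?G x \<partial>lborel)"
    proof (cases "x = 0")
      case False
      show ?thesis by (subst nn_integral_multc, measurable) (simp only: inner[OF False])
    qed simp
  qed
  also have "\<dots> = of_nat D * (\<integral>\<^sup>+u. (\<integral>\<^sup>+x. f (u *\<^sub>R x) * ennreal (norm x ^ D * u ^ (D - 1)) * indicator {0<..} u * ?G x \<partial>lborel) \<partial>lborel)"
    by (rule arg_cong[where f="\<lambda>t. of_nat D * t"], rule lborel_pair.Fubini') measurable
  also have "\<dots> = of_nat D * (\<integral>\<^sup>+u. (\<integral>\<^sup>+y. f y * ennreal (norm y ^ D / u ^ (D + 1)) * indicator {0<..} u
        * indicator (ball 0 u - {0}) y \<partial>lborel) \<partial>lborel)"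
  proof (rule arg_cong[where f="\<lambda>t. of_nat D * t"], rule nn_integral_cong)
    fix u :: real
    show "(\<integral>\<^sup>+x. f (u *\<^sub>R x) * ennreal (norm x ^ D * u ^ (D - 1)) * indicator {0<..} u * ?G x \<partial>lborel)
      = (\<integral>\<^sup>+y. f y * ennreal (norm y ^ D / u ^ (D + 1)) * indicator {0<..} u * indicator (ball 0 u - {0}) y \<partial>lborel)"
    proof (cases "u > 0")
      case u: True
      define h where "h y = f y * ennreal (norm y ^ D / u ^ (D + 1)) * indicator {0<..} u * indicator (ball 0 u - {0}) y" for y
      have [measurable]: "h \<in> borel_measurable borel" unfolding h_def[abs_def] by measurable
      have "(\<integral>\<^sup>+y. h y \<partial>lborel) = ennreal (\<bar>u\<bar> ^ DIM('a)) * (\<integral>\<^sup>+x. h (u *\<^sub>R x) \<partial>lborel)"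
        using u by (intro nn_integral_lborel_scale) auto
      also have "\<dots> = (\<integral>\<^sup>+x. ennreal (\<bar>u\<bar> ^ DIM('a)) * h (u *\<^sub>R x) \<partial>lborel)"
        by (rule nn_integral_cmult[symmetric]) measurable
      also have "\<dots> = (\<integral>\<^sup>+x. f (u *\<^sub>R x) * ennreal (norm x ^ D * u ^ (D - 1)) * indicator {0<..} u * ?G x \<partial>lborel)"
      proof (rule nn_integral_cong)
        fix x :: 'a
        have e: "u ^ (D + 1) = u * u * u ^ (D - 1)" "u ^ D = u * u ^ (D - 1)" 
          using D by (auto simp: power_eq_if)
        have h1: "ennreal (\<bar>u\<bar> ^ DIM('a)) * ennreal (norm (u *\<^sub>R x) ^ D / u ^ (D + 1)) = ennreal (norm x ^ D * u ^ (D - 1))"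
          using u by (subst ennreal_mult'[symmetric]) (auto simp: e D_def[symmetric] power_mult_distrib field_simps)
        have h2: "indicator (ball 0 u - {0}) (u *\<^sub>R x) = ?G x"
          using u by (auto simp: indicator_def)
        show "ennreal (\<bar>u\<bar> ^ DIM('a)) * h (u *\<^sub>R x)
          = f (u *\<^sub>R x) * ennreal (norm x ^ D * u ^ (D - 1)) * indicator {0<..} u * ?G x"
          by (simp only: h1[symmetric] h2 h_def mult_ac)
      qed
      finally show ?thesis by (simp only: h_def)
    qed simp
  qed
  also have "\<dots> = of_nat D * (\<integral>\<^sup>+y. (\<integral>\<^sup>+u. f y * ennreal (norm y ^ D / u ^ (D + 1)) * indicator {0<..} u
        * indicator (ball 0 u - {0}) y \<partial>lborel) \<partial>lborel)"
  proof -
    have [measurable]: "Measurable.pred (borel \<Otimes>\<^sub>M borel) (\<lambda>x::real\<times>'a. snd x \<in> ball 0 (fst x))"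
       "Measurable.pred (borel \<Otimes>\<^sub>M borel) (\<lambda>x::'a\<times>real. fst x \<in> ball 0 (snd x))"
      by (auto simp: mem_ball_0)
    show ?thesis by (subst lborel_pair.Fubini') auto
  qed
  also have "\<dots> = (\<integral>\<^sup>+y. of_nat D * (\<integral>\<^sup>+u. f y * ennreal (norm y ^ D / u ^ (D + 1)) * indicator {0<..} u
        * indicator (ball 0 u - {0}) y \<partial>lborel) \<partial>lborel)"
  proof -
    have [measurable]: "Measurable.pred (borel \<Otimes>\<^sub>M borel) (\<lambda>x::'a\<times>real. fst x \<in> ball 0 (snd x))"
      by (auto simp: mem_ball_0)
    show ?thesis by (rule nn_integral_cmult[symmetric]) measurable
  qed
  also have "\<dots> = (\<integral>\<^sup>+y. f y \<partial>lborel)"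
  proof (rule nn_integral_cong_AE, rule AE_mp[OF AE_lborel_singleton[of 0]], intro AE_I2 impI)
    fix y :: 'a assume y: "y \<noteq> 0"
    have "of_nat D * (\<integral>\<^sup>+u. f y * ennreal (norm y ^ D / u ^ (D + 1)) * indicator {0<..} u
        * indicator (ball 0 u - {0}) y \<partial>lborel) 
      = of_nat D * (\<integral>\<^sup>+u. (f y * ennreal (norm y ^ D / D)) * (ennreal (real D / u ^ (D + 1)) * indicator {norm y<..} u) \<partial>lborel)"
    proof (rule arg_cong[where f="\<lambda>t. of_nat D * t"], rule nn_integral_cong)
      fix u :: real
      have h1: "ennreal (norm y ^ D / u ^ (D + 1)) = ennreal (norm y ^ D / D) * ennreal (real D / u ^ (D + 1))"
        using D by (subst ennreal_mult'[symmetric]) auto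
      have h2: "indicator {0<..} u * indicator (ball 0 u - {0}) y = (indicator {norm y<..} u :: ennreal)"
        using y by (auto simp: indicator_def intro: le_less_trans[OF norm_ge_zero])
      show "f y * ennreal (norm y ^ D / u ^ (D + 1)) * indicator {0<..} u * indicator (ball 0 u - {0}) y
        = (f y * ennreal (norm y ^ D / D)) * (ennreal (real D / u ^ (D + 1)) * indicator {norm y<..} u)"
        by (simp only: h1 h2[symmetric] mult_ac)
    qed
    also have "\<dots> = of_nat D * ((f y * ennreal (norm y ^ D / D)) * ennreal (1 / norm y ^ D))"
      using y by (subst nn_integral_cmult, measurable) (simp only: nn_integral_power_tail[OF _ D] zero_less_norm_iff not_False_eq_True)
    also have "\<dots> = f y * (ennreal (real D) * ennreal (norm y ^ D / D) * ennreal (1 / norm y ^ D))"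
      by (simp add: ennreal_of_nat_eq_real_of_nat mult_ac)
    also have "ennreal (real D) * ennreal (norm y ^ D / D) * ennreal (1 / norm y ^ D) = 1"
      using y D by (simp add: ennreal_mult'[symmetric])
    finally show "of_nat D * (\<integral>\<^sup>+u. f y * ennreal (norm y ^ D / u ^ (D + 1)) * indicator {0<..} u
        * indicator (ball 0 u - {0}) y \<partial>lborel) = f y" by simp
  qed
  finally show ?thesis ..
qed

section \<open>Test functions of class C1\<close>

definition C1_fun :: "('a::euclidean_space \<Rightarrow> 'b::real_normed_vector) \<Rightarrow> bool" where
  "C1_fun f \<longleftrightarrow> (\<exists>f' :: 'a \<Rightarrow> 'a \<Rightarrow>\<^sub>L 'b.
     (\<forall>x. (f has_derivative blinfun_apply (f' x)) (at x)) \<and> continuous_on UNIV f')"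

abbreviation dir_deriv :: "('a::euclidean_space \<Rightarrow> 'b::real_normed_vector) \<Rightarrow> 'a \<Rightarrow> 'a \<Rightarrow> 'b" where
  "dir_deriv f v x \<equiv> frechet_derivative f (at x) v"

lemma C1_funI:
  fixes f :: "'a::euclidean_space \<Rightarrow> 'b::real_normed_vector"
  assumes "\<And>x. (f has_derivative D x) (at x)" and "\<And>v. continuous_on UNIV (\<lambda>x. D x v)"
  shows "C1_fun f"
proof -
  have bl: "bounded_linear (D x)" for x using assms(1) has_derivative_bounded_linear by blast
  show ?thesis
    unfolding C1_fun_def
  proof (intro exI[of _ "\<lambda>x. Blinfun (D x)"] conjI allI)
    show "(f has_derivative blinfun_apply (Blinfun (D x))) (at x)" for x
      using assms(1)[of x] by (simp add: bounded_linear_Blinfun_apply bl)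
    show "continuous_on UNIV (\<lambda>x. Blinfun (D x))"
      by (rule continuous_on_blinfun_componentwise) (simp add: bounded_linear_Blinfun_apply bl assms(2))
  qed
qed

lemma C1_fun_has_derivative:
  "C1_fun f \<Longrightarrow> (f has_derivative frechet_derivative f (at x)) (at x)"
  unfolding C1_fun_def by (metis differentiableI frechet_derivative_works)

lemma C1_fun_blinfun:
  assumes "C1_fun f"
  obtains f' where "\<And>x. frechet_derivative f (at x) = blinfun_apply (f' x)" "continuous_on UNIV f'"
    "\<And>x. (f has_derivative blinfun_apply (f' x)) (at x)"
  using assms unfolding C1_fun_def by (metis frechet_derivative_at)

lemma continuous_on_dir_deriv:
  assumes "C1_fun f" shows "continuous_on UNIV (\<lambda>x. dir_deriv f v x)"
proof -
  obtain f' where "\<And>x. frechet_derivative f (at x) = blinfun_apply (f' x)" "continuous_on UNIV f'"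
    using C1_fun_blinfun[OF assms] by metis
  then show ?thesis by (auto intro!: continuous_intros)
qed

lemma linear_dir_deriv: "C1_fun f \<Longrightarrow> linear (frechet_derivative f (at x))"
  using C1_fun_has_derivative has_derivative_bounded_linear bounded_linear.linear by blast

lemma continuous_on_C1_fun: "C1_fun f \<Longrightarrow> continuous_on A f"
  using C1_fun_has_derivative has_derivative_continuous
  by (metis continuous_at_imp_continuous_on)

lemma C1_fun_const: "C1_fun (\<lambda>_. c)"
  by (rule C1_funI[where D="\<lambda>_ _. 0"]) auto

lemma C1_fun_bounded_linear:
  assumes "bounded_linear f" shows "C1_fun f"
  by (rule C1_funI[where D="\<lambda>_. f"]) (auto intro: bounded_linear_imp_has_derivative assms)

lemma C1_fun_add: 
  assumes "C1_fun f" "C1_fun g" shows "C1_fun (\<lambda>x. f x + g x)"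
  by (rule C1_funI[where D="\<lambda>x v. dir_deriv f v x + dir_deriv g v x"])
    (auto intro!: has_derivative_add C1_fun_has_derivative continuous_on_add continuous_on_dir_deriv assms)

lemma C1_fun_bilinear:
  assumes b: "bounded_bilinear b" and fg: "C1_fun f" "C1_fun g" shows "C1_fun (\<lambda>x. b (f x) (g x))"
proof (rule C1_funI[where D="\<lambda>x v. b (f x) (dir_deriv g v x) + b (dir_deriv f v x) (g x)"])
  show "((\<lambda>x. b (f x) (g x)) has_derivative (\<lambda>v. b (f x) (dir_deriv g v x) + b (dir_deriv f v x) (g x))) (at x)" for x
    by (rule bounded_bilinear.FDERIV[OF b C1_fun_has_derivative[OF fg(1)] C1_fun_has_derivative[OF fg(2)]])
  note c = continuous_on_C1_fun[OF fg(1)] continuous_on_C1_fun[OF fg(2)]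
  show "continuous_on UNIV (\<lambda>x. b (f x) (dir_deriv g v x) + b (dir_deriv f v x) (g x))" for v
    by (intro continuous_on_add bounded_bilinear.continuous_on[OF b] c continuous_on_dir_deriv fg)
qed

lemmas C1_fun_scaleR = C1_fun_bilinear[OF bounded_bilinear_scaleR]
lemmas C1_fun_mult = C1_fun_bilinear[OF bounded_bilinear_mult]
lemmas C1_fun_inner = C1_fun_bilinear[OF bounded_bilinear_inner]

lemma C1_fun_diff: 
  assumes "C1_fun f" "C1_fun g" shows "C1_fun (\<lambda>x. f x - g x)"
  by (rule C1_funI[where D="\<lambda>x v. dir_deriv f v x - dir_deriv g v x"])
    (auto intro!: has_derivative_diff C1_fun_has_derivative continuous_on_diff continuous_on_dir_deriv assms)

lemma C1_fun_sum:
  assumes "finite I" "\<And>i. i \<in> I \<Longrightarrow> C1_fun (f i)" shows "C1_fun (\<lambda>x. \<Sum>i\<in>I. f i x)"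
  using assms by (induction I rule: finite_induct) (auto intro: C1_fun_add C1_fun_const)

lemma C1_fun_compose:
  assumes f: "C1_fun f" and g: "C1_fun g" shows "C1_fun (\<lambda>x. g (f x))"
proof -
  obtain g' where g': "\<And>x. frechet_derivative g (at x) = blinfun_apply (g' x)" "continuous_on UNIV g'"
    using C1_fun_blinfun[OF g] by metis
  have c: "continuous_on UNIV (\<lambda>x. g' (f x))"
    using continuous_on_compose2[OF g'(2) continuous_on_C1_fun[OF f]] by auto
  show ?thesis
  proof (rule C1_funI[where D="\<lambda>x v. dir_deriv g (dir_deriv f v x) (f x)"])
    show "((\<lambda>x. g (f x)) has_derivative (\<lambda>v. dir_deriv g (dir_deriv f v x) (f x))) (at x)" for x
      by (rule has_derivative_compose[OF C1_fun_has_derivative[OF f] C1_fun_has_derivative[OF g]])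
    show "continuous_on UNIV (\<lambda>x. dir_deriv g (dir_deriv f v x) (f x))" for v
      unfolding g'(1) by (intro continuous_intros c continuous_on_dir_deriv f)
  qed
qed

lemma C1_fun_real_compose:
  fixes h :: "real \<Rightarrow> real"
  assumes f: "C1_fun f" and h: "\<And>x. (h has_real_derivative h' (f x)) (at (f x))"
    and c: "continuous_on UNIV (\<lambda>x. h' (f x))"
  shows "C1_fun (\<lambda>x. h (f x))"
proof (rule C1_funI[where D="\<lambda>x v. h' (f x) * dir_deriv f v x"])
  show "((\<lambda>x. h (f x)) has_derivative (\<lambda>v. h' (f x) * dir_deriv f v x)) (at x)" for x
    using has_derivative_compose[OF C1_fun_has_derivative[OF f, of x] h[of x, unfolded has_field_derivative_def]] by simp
  show "continuous_on UNIV (\<lambda>x. h' (f x) * dir_deriv f v x)" for v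
    by (intro continuous_intros c continuous_on_dir_deriv f)
qed

lemma C1_fun_translate: "C1_fun (\<lambda>x. x + a)"
  by (rule C1_funI[where D="\<lambda>_ v. v"]) (auto intro!: derivative_eq_intros)

lemma C1_fun_line: "C1_fun (\<lambda>s::real. x + s *\<^sub>R \<theta>)"
  by (rule C1_funI[where D="\<lambda>_ s. s *\<^sub>R \<theta>"]) (auto intro!: derivative_eq_intros)

lemma has_real_derivative_line:
  fixes \<psi> :: "'a::euclidean_space \<Rightarrow> real"
  assumes "C1_fun \<psi>"
  shows "((\<lambda>s. \<psi> (x + s *\<^sub>R \<theta>)) has_real_derivative dir_deriv \<psi> \<theta> (x + s *\<^sub>R \<theta>)) (at s)"
proof -
  have 1: "((\<lambda>s. x + s *\<^sub>R \<theta>) has_derivative (\<lambda>h. h *\<^sub>R \<theta>)) (at s)"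
    by (auto intro!: derivative_eq_intros)
  have "((\<lambda>s. \<psi> (x + s *\<^sub>R \<theta>)) has_derivative (\<lambda>h. dir_deriv \<psi> (h *\<^sub>R \<theta>) (x + s *\<^sub>R \<theta>))) (at s)"
    using has_derivative_compose[OF 1 C1_fun_has_derivative[OF assms]] by simp
  moreover have "dir_deriv \<psi> (h *\<^sub>R \<theta>) (x + s *\<^sub>R \<theta>) = dir_deriv \<psi> \<theta> (x + s *\<^sub>R \<theta>) * h" for h
    using linear_cmul[OF linear_dir_deriv[OF assms]] by simp
  ultimately show ?thesis by (simp add: has_field_derivative_def)
qed

lemma dir_deriv_real:
  fixes \<phi> :: "real \<Rightarrow> real"
  assumes "(\<phi> has_real_derivative d) (at s)"
  shows "dir_deriv \<phi> 1 s = d"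
  using assms by (simp add: has_field_derivative_def frechet_derivative_at[symmetric])

lemma divergence_real: "divergence (\<phi> :: real \<Rightarrow> real) x = dir_deriv \<phi> 1 x"
  by (simp add: divergence_def)

subsection \<open>Compact support\<close>

definition C1c :: "'a::euclidean_space set \<Rightarrow> ('a \<Rightarrow> 'b::real_normed_vector) set" where
  "C1c A = {f. C1_fun f \<and> compact (closure {x. f x \<noteq> 0}) \<and> closure {x. f x \<noteq> 0} \<subseteq> A}"

lemma C1_compact_fields_eq: "C1_compact_fields A = C1c A"
  by (simp add: C1_compact_fields_def C1c_def C1_fun_def)

lemma C1cI:
  assumes "C1_fun f" "compact S" "S \<subseteq> A" "\<And>x. x \<notin> S \<Longrightarrow> f x = 0"
  shows "f \<in> C1c A"
proof -
  have "closure {x. f x \<noteq> 0} \<subseteq> S"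
    by (rule closure_minimal) (use assms compact_imp_closed in auto)
  moreover from this have "compact (closure {x. f x \<noteq> 0})"
    using assms(2) by (metis closed_closure compact_Int_closed inf.absorb_iff2)
  ultimately show ?thesis using assms by (auto simp: C1c_def)
qed

lemma C1cD: "f \<in> C1c A \<Longrightarrow> C1_fun f"
  by (simp add: C1c_def)

lemma C1cE:
  assumes "f \<in> C1c A"
  obtains S where "compact S" "S \<subseteq> A" "\<And>x. x \<notin> S \<Longrightarrow> f x = 0"
  by (rule that[of "closure {x. f x \<noteq> 0}"])
    (use assms closure_subset[of "{x. f x \<noteq> 0}"] in \<open>auto simp: C1c_def\<close>)

lemma C1c_mono: "A \<subseteq> B \<Longrightarrow> C1c A \<subseteq> C1c B"
  by (auto simp: C1c_def)

lemma C1c_sum_scaleR: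
  assumes "finite I" "\<And>i. i \<in> I \<Longrightarrow> f i \<in> C1c A"
  shows "(\<lambda>x. \<Sum>i\<in>I. f i x *\<^sub>R (w i :: 'b::real_normed_vector)) \<in> C1c A"
proof -
  have "\<exists>S. compact S \<and> S \<subseteq> A \<and> (\<forall>i\<in>I. \<forall>x. x \<notin> S \<longrightarrow> f i x = 0)"
    using assms
  proof (induction I rule: finite_induct)
    case empty
    show ?case by (intro exI[of _ "{}"]) auto
  next
    case (insert i I)
    then obtain S where S: "compact S" "S \<subseteq> A" "\<forall>i\<in>I. \<forall>x. x \<notin> S \<longrightarrow> f i x = 0" by auto
    obtain T where T: "compact T" "T \<subseteq> A" "\<And>x. x \<notin> T \<Longrightarrow> f i x = 0"
      using C1cE[of "f i" A] insert by auto
    show ?case by (intro exI[of _ "S \<union> T"]) (use S T in auto)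
  qed
  then obtain S where S: "compact S" "S \<subseteq> A" "\<And>i x. i \<in> I \<Longrightarrow> x \<notin> S \<Longrightarrow> f i x = 0" by blast
  have "C1_fun (f i)" if "i \<in> I" for i using C1cD assms(2) that by blast
  then show ?thesis
    by (intro C1cI[OF _ S(1,2)] C1_fun_sum C1_fun_scaleR C1_fun_const assms(1)) (auto simp: S(3))
qed

lemma C1c_diff:
  assumes f: "f \<in> C1c A" and g: "g \<in> C1c A" shows "(\<lambda>x. f x - g x) \<in> C1c A"
proof -
  obtain S where S: "compact S" "S \<subseteq> A" "\<And>x. x \<notin> S \<Longrightarrow> f x = 0" using C1cE[OF f] by metis
  obtain T where T: "compact T" "T \<subseteq> A" "\<And>x. x \<notin> T \<Longrightarrow> g x = 0" using C1cE[OF g] by metis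
  show ?thesis
    by (rule C1cI[OF C1_fun_diff[OF C1cD[OF f] C1cD[OF g]], of "S \<union> T"]) (use S T in auto)
qed

lemma C1c_translate:
  assumes f: "f \<in> C1c A"
  shows "(\<lambda>x. f (x + a)) \<in> C1c ((\<lambda>x. x - a) ` A)"
proof -
  obtain S where S: "compact S" "S \<subseteq> A" "\<And>x. x \<notin> S \<Longrightarrow> f x = 0" using C1cE[OF f] by metis
  show ?thesis
  proof (rule C1cI)
    show "C1_fun (\<lambda>x. f (x + a))" using C1_fun_compose[OF C1_fun_translate C1cD[OF f]] .
    show "compact ((\<lambda>x. x - a) ` S)"
      using compact_translation_subtract[OF S(1), of a] by simp
    show "(\<lambda>x. x - a) ` S \<subseteq> (\<lambda>x. x - a) ` A" using S by auto
    fix x assume "x \<notin> (\<lambda>x. x - a) ` S"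
    then have "x + a \<notin> S" by (metis add_diff_cancel_right' image_eqI)
    then show "f (x + a) = 0" by (rule S)
  qed
qed

lemma dir_deriv_outside_support:
  assumes "closed S" "\<And>x. x \<notin> S \<Longrightarrow> f x = 0" "x \<notin> S"
  shows "dir_deriv f v x = 0"
proof -
  have "(f has_derivative (\<lambda>_. 0)) (at x)"
    by (rule has_derivative_transform_within_open[where f="\<lambda>_. 0" and s="-S" and t=UNIV])
      (use assms in auto)
  then show ?thesis by (simp add: frechet_derivative_at[symmetric])
qed

lemma integrable_continuous_compact_support:
  fixes f :: "'a::euclidean_space \<Rightarrow> real"
  assumes c: "continuous_on UNIV f" and S: "compact S" "\<And>x. x \<notin> S \<Longrightarrow> f x = 0"
  shows "integrable lborel f"
proof -
  have "integrable lborel (\<lambda>x. indicator S x *\<^sub>R f x)"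
    using borel_integrable_compact[OF S(1) continuous_on_subset[OF c]] by simp
  moreover have "(\<lambda>x. indicator S x *\<^sub>R f x) = f" using S by (auto simp: fun_eq_iff indicator_def)
  ultimately show ?thesis by simp
qed

lemma integrable_indicator_mult:
  fixes f :: "'a \<Rightarrow> real"
  assumes "integrable M f" "E \<in> sets M"
  shows "integrable M (\<lambda>x. indicat_real E x * f x)"
  using integrable_mult_indicator[OF assms(2,1)] by simp

lemma C1c_integrable:
  fixes f :: "'a::euclidean_space \<Rightarrow> real"
  assumes "f \<in> C1c A" shows "integrable lborel f"
  using C1cE[OF assms] integrable_continuous_compact_support continuous_on_C1_fun C1cD[OF assms]
  by metis

lemma dir_deriv_integrable:
  fixes f :: "'a::euclidean_space \<Rightarrow> real"
  assumes f: "f \<in> C1c A" shows "integrable lborel (\<lambda>x. dir_deriv f v x)"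
proof -
  obtain S where S: "compact S" "\<And>x. x \<notin> S \<Longrightarrow> f x = 0" using C1cE[OF f] by metis
  show ?thesis
    by (rule integrable_continuous_compact_support[OF continuous_on_dir_deriv[OF C1cD[OF f]] S(1)])
      (use dir_deriv_outside_support[OF compact_imp_closed[OF S(1)] S(2)] in auto)
qed

lemma divergence_sum_scaleR:
  assumes fin: "finite I" and C1: "\<And>i. i \<in> I \<Longrightarrow> C1_fun (f i)"
  shows "divergence (\<lambda>x. \<Sum>i\<in>I. f i x *\<^sub>R w i) x = (\<Sum>i\<in>I. dir_deriv (f i) (w i) x)"
proof -
  have "((\<lambda>x. \<Sum>i\<in>I. f i x *\<^sub>R w i) has_derivative (\<lambda>v. \<Sum>i\<in>I. dir_deriv (f i) v x *\<^sub>R w i)) (at x)"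
    by (intro has_derivative_sum has_derivative_scaleR_left C1_fun_has_derivative C1)
  then have "divergence (\<lambda>x. \<Sum>i\<in>I. f i x *\<^sub>R w i) x = (\<Sum>b\<in>Basis. (\<Sum>i\<in>I. dir_deriv (f i) b x *\<^sub>R w i) \<bullet> b)"
    by (simp add: divergence_def frechet_derivative_at[symmetric])
  also have "\<dots> = (\<Sum>i\<in>I. \<Sum>b\<in>Basis. dir_deriv (f i) ((w i \<bullet> b) *\<^sub>R b) x)"
    using linear_cmul[OF linear_dir_deriv[OF C1]]
    by (subst sum.swap) (simp add: inner_sum_left mult.commute)
  also have "\<dots> = (\<Sum>i\<in>I. dir_deriv (f i) (\<Sum>b\<in>Basis. (w i \<bullet> b) *\<^sub>R b) x)"
    by (intro sum.cong refl) (simp add: linear_sum[OF linear_dir_deriv[OF C1]])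
  finally show ?thesis by (simp add: euclidean_representation)
qed

lemma divergence_integrable:
  fixes f :: "'a::euclidean_space \<Rightarrow> 'a"
  assumes f: "f \<in> C1c A" shows "integrable lborel (divergence f)"
proof -
  obtain S where S: "compact S" "\<And>x. x \<notin> S \<Longrightarrow> f x = 0" using C1cE[OF f] by metis
  have "continuous_on UNIV (divergence f)"
    unfolding divergence_def
    by (intro continuous_intros continuous_on_dir_deriv C1cD[OF f])
  moreover have "divergence f x = 0" if "x \<notin> S" for x
    using dir_deriv_outside_support[OF compact_imp_closed[OF S(1)] S(2) that] by (simp add: divergence_def)
  ultimately show ?thesis using integrable_continuous_compact_support[OF _ S(1)] by blast
qed

lemma divergence_diff:
  assumes "C1_fun f" "C1_fun g"
  shows "divergence (\<lambda>x. f x - g x) x = divergence f x - divergence g x"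
proof -
  have "((\<lambda>x. f x - g x) has_derivative (\<lambda>v. dir_deriv f v x - dir_deriv g v x)) (at x)"
    by (intro has_derivative_diff C1_fun_has_derivative assms)
  then show ?thesis
    by (simp add: divergence_def frechet_derivative_at[symmetric] inner_diff_left sum_subtractf)
qed

subsection \<open>Smooth cut-offs and duality\<close>

lemma pos_part_square_deriv:
  "((\<lambda>t::real. (max 0 t)\<^sup>2) has_real_derivative 2 * max 0 t) (at t)"
proof (cases t "0::real" rule: linorder_cases)
  case less
  have "((\<lambda>t::real. (max 0 t)\<^sup>2) has_real_derivative 0) (at t)"
    by (rule has_field_derivative_transform_within_open[where f="\<lambda>_. 0" and S="{..<0}"])
      (use less in auto)
  then show ?thesis using less by simp
next
  case greater
  have "((\<lambda>t::real. t\<^sup>2) has_real_derivative 2 * t) (at t)"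
    by (auto intro!: derivative_eq_intros)
  then have "((\<lambda>t::real. (max 0 t)\<^sup>2) has_real_derivative 2 * t) (at t)"
    by (rule has_field_derivative_transform_within_open[where S="{0<..}"])
      (use greater in auto)
  then show ?thesis using greater by simp
next
  case equal
  have "((\<lambda>h. (max 0 h)\<^sup>2 / h) \<longlongrightarrow> (0::real)) (at 0)"
  proof (rule Lim_null_comparison)
    show "\<forall>\<^sub>F h in at (0::real). norm ((max 0 h)\<^sup>2 / h) \<le> \<bar>h\<bar>"
      by (rule always_eventually) (auto simp: max_def power2_eq_square)
    show "((\<lambda>h::real. \<bar>h\<bar>) \<longlongrightarrow> 0) (at 0)" by (auto intro!: tendsto_eq_intros)
  qed
  then show ?thesis using equal by (simp add: DERIV_def)
qed

lemma C1_fun_pos_part_square: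
  fixes f :: "'a::euclidean_space \<Rightarrow> real"
  assumes "C1_fun f" shows "C1_fun (\<lambda>x. (max 0 (f x))\<^sup>2)"
proof (rule C1_fun_real_compose[where h="\<lambda>t. (max 0 t)\<^sup>2" and h'="\<lambda>t. 2 * max 0 t"])
  note c = continuous_on_C1_fun[OF assms]
  show "continuous_on UNIV (\<lambda>x. 2 * max 0 (f x))" by (intro continuous_intros c)
qed (use assms pos_part_square_deriv in auto)

text \<open>
  A finite sum of the functions \<open>max(0, r\<^sup>2 - |x - a|\<^sup>2)\<^sup>2\<close> is positive on the compact set, and \<open>1 - max(0, 1 - t)\<^sup>2\<close>
  levels it at height one.
\<close>

lemma C1c_bump:
  fixes K :: "'a::euclidean_space set"
  assumes K: "compact K" and A: "open A" "K \<subseteq> A"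
  obtains \<psi> where "\<psi> \<in> C1c A" "\<And>x. 0 \<le> \<psi> x" "\<And>x. \<psi> x \<le> (1::real)" "\<And>x. x \<in> K \<Longrightarrow> \<psi> x = 1"
proof -
  have "\<forall>a\<in>K. \<exists>r>0. cball a r \<subseteq> A" using A open_contains_cball by (metis subsetD)
  then obtain r where r: "\<And>a. a \<in> K \<Longrightarrow> r a > 0 \<and> cball a (r a) \<subseteq> A" by metis
  have "K \<subseteq> (\<Union>a\<in>K. ball a (r a))" using r by force
  then obtain F where F: "F \<subseteq> K" "finite F" "K \<subseteq> (\<Union>a\<in>F. ball a (r a))"
    using compactE_image[OF K, of K "\<lambda>a. ball a (r a)"] by (metis open_ball)
  define b where "b a x = (max 0 ((r a)\<^sup>2 - (x - a) \<bullet> (x - a)))\<^sup>2" for a x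
  define S where "S x = (\<Sum>a\<in>F. b a x)" for x
  have bz: "b a x = 0" if "x \<notin> cball a (r a)" "a \<in> F" for a x
  proof -
    have "r a > 0" using r F that by auto
    then have "(r a)\<^sup>2 \<le> (norm (x - a))\<^sup>2" using that by (intro power_mono) (auto simp: dist_norm norm_minus_commute)
    then show ?thesis by (simp add: b_def dot_square_norm max_def)
  qed
  have bp: "b a x > 0" if "x \<in> ball a (r a)" for a x
  proof -
    have "(norm (x - a))\<^sup>2 < (r a)\<^sup>2" using that by (intro power_strict_mono) (auto simp: dist_norm norm_minus_commute)
    then show ?thesis by (simp add: b_def dot_square_norm max_def)
  qed
  have b0: "b a x \<ge> 0" for a x by (simp add: b_def)
  have S0: "S x \<ge> 0" for x by (auto simp: S_def intro: sum_nonneg b0)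
  have Sp: "S x > 0" if xK: "x \<in> K" for x
  proof -
    obtain a where "a \<in> F" "x \<in> ball a (r a)" using subsetD[OF F(3) xK] by blast
    then show ?thesis using F(2) bp b0 unfolding S_def by (meson sum_pos2)
  qed
  have bC: "C1_fun (b a)" for a
  proof -
    have "C1_fun (\<lambda>x. x - a)" using C1_fun_translate[of "-a"] by simp
    then have "C1_fun (\<lambda>x. (r a)\<^sup>2 - (x - a) \<bullet> (x - a))" by (intro C1_fun_diff[OF C1_fun_const C1_fun_inner])
    then show ?thesis using C1_fun_pos_part_square unfolding b_def by blast
  qed
  have SC: "C1_fun S" unfolding S_def[abs_def] by (intro C1_fun_sum F bC)
  have Sz: "S x = 0" if "x \<notin> (\<Union>a\<in>F. cball a (r a))" for x
    using bz that by (auto simp: S_def intro!: sum.neutral)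
  obtain c where c: "c > 0" "\<And>x. x \<in> K \<Longrightarrow> c \<le> S x"
  proof (cases "K = {}")
    case False
    then obtain x where "x \<in> K" "\<forall>y\<in>K. S x \<le> S y"
      using continuous_attains_inf[OF K _ continuous_on_C1_fun[OF SC]] by blast
    then show ?thesis using that[of "S x"] Sp by auto
  qed (use that[of 1] in auto)
  define \<psi> where "\<psi> x = 1 - (max 0 (1 - (1 / c) * S x))\<^sup>2" for x
  have "C1_fun (\<lambda>x. 1 - (1 / c) * S x)" by (intro C1_fun_diff[OF C1_fun_const C1_fun_mult[OF C1_fun_const SC]])
  then have \<psi>C: "C1_fun \<psi>" unfolding \<psi>_def[abs_def] by (intro C1_fun_diff[OF C1_fun_const C1_fun_pos_part_square])
  have le1: "(max 0 (1 - (1 / c) * S x))\<^sup>2 \<le> 1" for x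
    using S0[of x] c(1) by (intro power_le_one) (auto simp: max_def)
  show ?thesis
  proof
    show "\<psi> \<in> C1c A"
      by (rule C1cI[OF \<psi>C, of "\<Union>a\<in>F. cball a (r a)"]) (use F r in \<open>auto intro!: compact_UN simp: \<psi>_def Sz\<close>)
    show "0 \<le> \<psi> x" for x using le1 by (simp add: \<psi>_def)
    show "\<psi> x \<le> 1" for x by (simp add: \<psi>_def)
    show "\<psi> x = 1" if "x \<in> K" for x
    proof -
      have "1 \<le> (1 / c) * S x" using c(1) c(2)[OF that] by (simp add: field_simps)
      then show ?thesis by (simp add: \<psi>_def max_def)
    qed
  qed
qed

lemma C1c_approx_indicator:
  fixes P :: "'a::euclidean_space set"
  assumes [measurable]: "P \<in> sets borel" and P: "bounded P" and A: "open A" "P \<subseteq> A" and e: "e > 0"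
  obtains \<psi> where "\<psi> \<in> C1c A" "\<And>x. 0 \<le> \<psi> x" "\<And>x. \<psi> x \<le> (1::real)"
    "(\<integral>x. \<bar>\<psi> x - indicat_real P x\<bar> \<partial>lborel) < e"
proof -
  obtain K where K: "closed K" "K \<subseteq> P" "P - K \<in> lmeasurable" "emeasure lebesgue (P - K) < ennreal (e/2)"
    using sets_lebesgue_inner_closed[of P "e/2"] e by auto
  have Kc: "compact K" using K P bounded_subset compact_eq_bounded_closed by blast
  then have [measurable]: "K \<in> sets borel" by (simp add: borel_compact)
  obtain T where T: "open T" "K \<subseteq> T" "T - K \<in> lmeasurable" "emeasure lebesgue (T - K) < ennreal (e/2)"
    using sets_lebesgue_outer_open[of K "e/2"] e by auto
  have [measurable]: "T \<in> sets borel" using T by simp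
  obtain \<psi> where \<psi>: "\<psi> \<in> C1c (A \<inter> T)" "\<And>x. 0 \<le> \<psi> x" "\<And>x. \<psi> x \<le> (1::real)" "\<And>x. x \<in> K \<Longrightarrow> \<psi> x = 1"
    using C1c_bump[OF Kc, of "A \<inter> T"] A T K by blast
  have sz: "\<psi> x = 0" if "x \<notin> T" for x using \<psi>(1) that by (meson C1cE Int_iff subsetD)
  have m1: "emeasure lborel (P - K) < ennreal (e/2)" "emeasure lborel (T - K) < ennreal (e/2)"
    using K(4) T(4) by auto
  have i1: "integrable lborel (indicat_real (P - K))" "integrable lborel (indicat_real (T - K))"
    using order.strict_trans[OF m1(1) ennreal_less_top] order.strict_trans[OF m1(2) ennreal_less_top]
    by (auto intro!: integrable_real_indicator)
  have lt: "measure lborel X < e/2" if "emeasure lborel X < ennreal (e/2)" for X :: "'a set"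
  proof -
    have "emeasure lborel X \<noteq> \<infinity>" using order.strict_trans[OF that ennreal_less_top] by auto
    then have "ennreal (measure lborel X) < ennreal (e/2)" using that emeasure_eq_ennreal_measure by (metis infinity_ennreal_def)
    then show ?thesis by (simp add: ennreal_less_iff)
  qed
  have "(\<integral>x. \<bar>\<psi> x - indicat_real P x\<bar> \<partial>lborel) \<le> (\<integral>x. indicat_real (P - K) x + indicat_real (T - K) x \<partial>lborel)"
  proof (rule integral_mono_AE')
    show "integrable lborel (\<lambda>x. indicat_real (P - K) x + indicat_real (T - K) x)" using i1 by auto
    show "AE x in lborel. \<bar>\<psi> x - indicat_real P x\<bar> \<le> indicat_real (P - K) x + indicat_real (T - K) x"
    proof (rule AE_I2)
      fix x show "\<bar>\<psi> x - indicat_real P x\<bar> \<le> indicat_real (P - K) x + indicat_real (T - K) x"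
        using \<psi>(2,3)[of x] \<psi>(4)[of x] sz[of x] K(2) by (auto simp: indicator_def abs_if)
    qed
  qed auto
  also have "\<dots> = measure lborel (P - K) + measure lborel (T - K)"
    using i1 by (subst Bochner_Integration.integral_add) auto
  also have "\<dots> < e/2 + e/2"
    by (intro add_strict_mono lt m1)
  finally have "(\<integral>x. \<bar>\<psi> x - indicat_real P x\<bar> \<partial>lborel) < e" by simp
  moreover have "\<psi> \<in> C1c A" using \<psi>(1) C1c_mono[of "A \<inter> T" A] by auto
  ultimately show ?thesis using that \<psi> by blast
qed

text \<open>
  \<open>1\<^sub>P - 1\<^sub>N\<close> has absolute value \<open>1\<^sub>P + 1\<^sub>N\<close>, and is
  approximated by test functions bounded by one.
\<close>

lemma measure_le_by_test_functions:
  fixes P N :: "'a::euclidean_space set"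
  assumes [measurable]: "P \<in> sets borel" "N \<in> sets borel" and disj: "P \<inter> N = {}"
    and A: "open A" "bounded A" "P \<subseteq> A" "N \<subseteq> A"
    and le: "\<And>g. g \<in> C1c A \<Longrightarrow> (\<And>x. \<bar>g x\<bar> \<le> 1) \<Longrightarrow>
      (\<integral>x. (indicat_real P x - indicat_real N x) * g x \<partial>lborel) \<le> c"
  shows "measure lborel P + measure lborel N \<le> c"
proof (rule field_le_epsilon)
  fix e :: real assume e: "e > 0"
  have bd: "bounded P" "bounded N" using A bounded_subset by auto
  obtain g where g: "g \<in> C1c A" "\<And>x. 0 \<le> g x" "\<And>x. g x \<le> 1" "(\<integral>x. \<bar>g x - indicat_real P x\<bar> \<partial>lborel) < e/2"
    using C1c_approx_indicator[of P A "e/2"] bd A e by auto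
  obtain h where h: "h \<in> C1c A" "\<And>x. 0 \<le> h x" "\<And>x. h x \<le> 1" "(\<integral>x. \<bar>h x - indicat_real N x\<bar> \<partial>lborel) < e/2"
    using C1c_approx_indicator[of N A "e/2"] bd A e by auto
  have fm: "emeasure lborel P < \<infinity>" "emeasure lborel N < \<infinity>" by (rule emeasure_bounded_finite[OF bd(1)], rule emeasure_bounded_finite[OF bd(2)])
  then have i: "integrable lborel (indicat_real P)" "integrable lborel (indicat_real N)"
    by (auto intro!: integrable_real_indicator)
  note ig = C1c_integrable[OF g(1)] C1c_integrable[OF h(1)]
  have "\<bar>g x - h x\<bar> \<le> 1" for x
    using g(2,3)[of x] h(2,3)[of x] by (simp add: abs_le_iff)
  then have 1: "(\<integral>x. (indicat_real P x - indicat_real N x) * (g x - h x) \<partial>lborel) \<le> c"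
    by (intro le C1c_diff g h)
  have eq: "(indicat_real P x - indicat_real N x) * (g x - h x) =
     indicat_real P x * (g x - h x) - indicat_real N x * (g x - h x)" for x by (simp add: algebra_simps)
  have ii: "integrable lborel (\<lambda>x. (indicat_real P x - indicat_real N x) * (g x - h x))"
    unfolding eq using ig by (intro Bochner_Integration.integrable_diff integrable_indicator_mult) auto
  have "measure lborel P + measure lborel N = (\<integral>x. indicat_real P x + indicat_real N x \<partial>lborel)"
    using i by (subst Bochner_Integration.integral_add) auto
  also have "\<dots> \<le> (\<integral>x. (indicat_real P x - indicat_real N x) * (g x - h x) + (\<bar>g x - indicat_real P x\<bar> + \<bar>h x - indicat_real N x\<bar>) \<partial>lborel)"
  proof (rule integral_mono)
    fix x show "indicat_real P x + indicat_real N x \<le> (indicat_real P x - indicat_real N x) * (g x - h x) + (\<bar>g x - indicat_real P x\<bar> + \<bar>h x - indicat_real N x\<bar>)"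
      using disj g(2,3)[of x] h(2,3)[of x] by (auto simp: indicator_def)
  qed (use i ii ig in auto)
  also have "\<dots> = (\<integral>x. (indicat_real P x - indicat_real N x) * (g x - h x) \<partial>lborel)
      + ((\<integral>x. \<bar>g x - indicat_real P x\<bar> \<partial>lborel) + (\<integral>x. \<bar>h x - indicat_real N x\<bar> \<partial>lborel))"
    using i ii ig by (simp add: Bochner_Integration.integral_add)
  also have "\<dots> \<le> c + (e/2 + e/2)" using 1 g(4) h(4) by (intro add_mono) auto
  finally show "measure lborel P + measure lborel N \<le> c + e" by simp
qed

section \<open>Sets of locally finite perimeter on the line\<close>

text \<open>
  Defined by measures only, so that the set does not change when \<open>A\<close> is altered on a null set.
\<close>

definition essential_boundary :: "real set \<Rightarrow> real set" where
  "essential_boundary A = {s. \<forall>r>0. emeasure lborel (A \<inter> ball s r) > 0 \<and> emeasure lborel (ball s r - A) > 0}"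

definition discrete_essential_boundary :: "real set \<Rightarrow> bool" where
  "discrete_essential_boundary A \<longleftrightarrow> (\<forall>a b. finite (essential_boundary A \<inter> {a<..<b}))"

text \<open>
  The height of the jump of the indicator function at an isolated point of the essential boundary, where
  \<open>A\<close> fills or misses a right neighbourhood up to a null set. Where it does neither,
  the value \<open>-1\<close> is a default.
\<close>

definition jump :: "real set \<Rightarrow> real \<Rightarrow> real" where
  "jump A s = (if \<exists>r>0. AE u in lborel. s < u \<and> u < s + r \<longrightarrow> u \<in> A then 1 else -1)"

lemma not_essential_boundary_iff:
  assumes [measurable]: "A \<in> sets borel"
  shows "s \<notin> essential_boundary A \<longleftrightarrow>
    (\<exists>r>0. (AE u in lborel. u \<in> ball s r \<longrightarrow> u \<in> A) \<or> (AE u in lborel. u \<in> ball s r \<longrightarrow> u \<notin> A))"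
proof -
  have 1: "(AE u in lborel. u \<in> ball s r \<longrightarrow> u \<in> A) \<longleftrightarrow> emeasure lborel (ball s r - A) = 0" for r
    by (subst AE_iff_measurable[of "ball s r - A"]) auto
  have 2: "(AE u in lborel. u \<in> ball s r \<longrightarrow> u \<notin> A) \<longleftrightarrow> emeasure lborel (A \<inter> ball s r) = 0" for r
    by (subst AE_iff_measurable[of "A \<inter> ball s r"]) auto
  show ?thesis unfolding 1 2 essential_boundary_def
    by (auto simp: not_gr_zero)
qed

lemma AE_disj_mono:
  assumes "(AE u in M. P u \<longrightarrow> Q u) \<or> (AE u in M. P u \<longrightarrow> \<not> Q u)" and "\<And>u. P' u \<Longrightarrow> P u"
  shows "(AE u in M. P' u \<longrightarrow> Q u) \<or> (AE u in M. P' u \<longrightarrow> \<not> Q u)"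
  using assms(1)
proof
  assume "AE u in M. P u \<longrightarrow> Q u"
  then have "AE u in M. P' u \<longrightarrow> Q u" by (rule eventually_mono) (use assms(2) in blast)
  then show ?thesis ..
next
  assume "AE u in M. P u \<longrightarrow> \<not> Q u"
  then have "AE u in M. P' u \<longrightarrow> \<not> Q u" by (rule eventually_mono) (use assms(2) in blast)
  then show ?thesis ..
qed

lemma closed_essential_boundary:
  assumes "A \<in> sets borel" shows "closed (essential_boundary A)"
proof -
  have "open (- essential_boundary A)"
  proof (rule openI)
    fix s assume "s \<in> - essential_boundary A"
    then obtain r where r: "r > 0"
      "(AE u in lborel. u \<in> ball s r \<longrightarrow> u \<in> A) \<or> (AE u in lborel. u \<in> ball s r \<longrightarrow> u \<notin> A)"
      using not_essential_boundary_iff[OF assms] by auto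
    show "\<exists>e>0. ball s e \<subseteq> - essential_boundary A"
    proof (intro exI conjI subsetI)
      show "r > 0" by (rule r)
      fix t assume t: "t \<in> ball s r"
      then obtain e where e: "e > 0" "ball t e \<subseteq> ball s r" using open_ball openE by metis
      have "(AE u in lborel. u \<in> ball t e \<longrightarrow> u \<in> A) \<or> (AE u in lborel. u \<in> ball t e \<longrightarrow> u \<notin> A)"
        by (rule AE_disj_mono[OF r(2)]) (use e(2) in blast)
      then show "t \<in> - essential_boundary A"
        using not_essential_boundary_iff[OF assms] e(1) by auto
    qed
  qed
  then show ?thesis by (simp add: closed_def)
qed

lemma AE_lborel_locally:
  fixes I :: "'a::euclidean_space set"
  assumes "\<And>s. s \<in> I \<Longrightarrow> \<exists>r>0. AE u in lborel. u \<in> ball s r \<longrightarrow> P u"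
  shows "AE u in lborel. u \<in> I \<longrightarrow> P u"
proof -
  have neg: "negligible {u \<in> S. \<not> P u}" if "AE u in lborel. u \<in> S \<longrightarrow> P u" for S
  proof -
    have "AE u in lebesgue. u \<in> S \<longrightarrow> P u" using that by (rule AE_completion)
    then have "{u. \<not> (u \<in> S \<longrightarrow> P u)} \<in> null_sets lebesgue"
      by (simp add: completion.AE_iff_null_sets AE_iff_null_sets[symmetric] completion.AE_iff_null_sets)
    then show ?thesis by (simp add: negligible_iff_null_sets)
  qed
  have "negligible {u \<in> I. \<not> P u}"
    unfolding locally_negligible_alt[of "{u \<in> I. \<not> P u}"]
  proof safe
    fix s assume s: "s \<in> I" "\<not> P s"
    obtain r where r: "r > 0" "AE u in lborel. u \<in> ball s r \<longrightarrow> P u" using assms s by metis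
    have "negligible ({u \<in> I. \<not> P u} \<inter> ball s r)"
      by (rule negligible_subset[OF neg[OF r(2)]]) auto
    then show "\<exists>U. openin (top_of_set {u \<in> I. \<not> P u}) U \<and> s \<in> U \<and> negligible U"
      using s r(1) by (intro exI[of _ "{u \<in> I. \<not> P u} \<inter> ball s r"]) (auto simp: openin_open_Int)
  qed
  then have "AE u in lebesgue. u \<notin> {u \<in> I. \<not> P u}"
    by (intro AE_not_in) (simp add: negligible_iff_null_sets)
  then show ?thesis by (simp add: AE_completion_iff)
qed

text \<open>
  The points near which \<open>A\<close> has full measure and those near which it is null form two disjoint open
  sets covering the interval, which is connected.
\<close>

lemma AE_const_between_essential_boundary:
  assumes A: "A \<in> sets borel" and disj: "essential_boundary A \<inter> {a<..<b} = {}"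
  shows "(AE u in lborel. a < u \<and> u < b \<longrightarrow> u \<in> A) \<or> (AE u in lborel. a < u \<and> u < b \<longrightarrow> u \<notin> A)"
proof -
  define U1 where "U1 = {s \<in> {a<..<b}. \<exists>r>0. AE u in lborel. u \<in> ball s r \<longrightarrow> u \<in> A}"
  define U0 where "U0 = {s \<in> {a<..<b}. \<exists>r>0. AE u in lborel. u \<in> ball s r \<longrightarrow> u \<notin> A}"
  have op: "open {s \<in> {a<..<b}. \<exists>r>0. AE u in lborel. u \<in> ball s r \<longrightarrow> P u}" for P :: "real \<Rightarrow> bool"
  proof (rule openI)
    fix s assume "s \<in> {s \<in> {a<..<b}. \<exists>r>0. AE u in lborel. u \<in> ball s r \<longrightarrow> P u}"
    then obtain r where s: "s \<in> {a<..<b}" and r: "r > 0" "AE u in lborel. u \<in> ball s r \<longrightarrow> P u" by auto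
    have "open ({a<..<b} \<inter> ball s r)" "s \<in> {a<..<b} \<inter> ball s r" using s r by auto
    then obtain d where d: "d > 0" "ball s d \<subseteq> {a<..<b} \<inter> ball s r" using openE by blast
    show "\<exists>e>0. ball s e \<subseteq> {s \<in> {a<..<b}. \<exists>r>0. AE u in lborel. u \<in> ball s r \<longrightarrow> P u}"
    proof (intro exI conjI subsetI)
      show "d > 0" by (rule d)
      fix t assume t: "t \<in> ball s d"
      then obtain e where e: "e > 0" "ball t e \<subseteq> ball s d" using open_ball openE by metis
      have "AE u in lborel. u \<in> ball t e \<longrightarrow> P u"
        using r(2) by (rule eventually_mono) (use e d in blast)
      then show "t \<in> {s \<in> {a<..<b}. \<exists>r>0. AE u in lborel. u \<in> ball s r \<longrightarrow> P u}" using t d e by auto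
    qed
  qed
  have "open U1" "open U0" unfolding U1_def U0_def by (rule op)+
  moreover have cover: "{a<..<b} \<subseteq> U1 \<union> U0"
  proof
    fix s assume s: "s \<in> {a<..<b}"
    then have "s \<notin> essential_boundary A" using disj by blast
    then obtain r where "r > 0" "(AE u in lborel. u \<in> ball s r \<longrightarrow> u \<in> A) \<or> (AE u in lborel. u \<in> ball s r \<longrightarrow> u \<notin> A)"
      using not_essential_boundary_iff[OF A] by blast
    then show "s \<in> U1 \<union> U0" using s by (auto simp: U1_def U0_def simp del: mem_ball)
  qed
  moreover have "U1 \<inter> U0 = {}"
  proof (rule ccontr)
    assume "U1 \<inter> U0 \<noteq> {}"
    then obtain s r r' where s: "r > 0" "r' > 0" "AE u in lborel. u \<in> ball s r \<longrightarrow> u \<in> A"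
      "AE u in lborel. u \<in> ball s r' \<longrightarrow> u \<notin> A" by (auto simp: U1_def U0_def)
    have "AE u in lborel. u \<notin> ball s (min r r')" using s(3,4) by eventually_elim auto
    then have "emeasure lborel (ball s (min r r')) = 0"
      by (subst (asm) AE_iff_measurable[of "ball s (min r r')"]) auto
    moreover have "ball s (min r r') = {s - min r r'<..<s + min r r'}" by (auto simp: dist_real_def)
    ultimately show False using s(1,2) by (simp add: min_def split: if_splits)
  qed
  ultimately have "U1 \<inter> {a<..<b} = {} \<or> U0 \<inter> {a<..<b} = {}"
    by (intro connectedD[OF connected_Ioo]) auto
  then show ?thesis
  proof
    assume "U1 \<inter> {a<..<b} = {}"
    then have "AE u in lborel. u \<in> {a<..<b} \<longrightarrow> u \<notin> A"
      using cover by (intro AE_lborel_locally) (unfold U0_def, blast)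
    then show ?thesis by simp
  next
    assume "U0 \<inter> {a<..<b} = {}"
    then have "AE u in lborel. u \<in> {a<..<b} \<longrightarrow> u \<in> A"
      using cover by (intro AE_lborel_locally) (unfold U1_def, blast)
    then show ?thesis by simp
  qed
qed

lemma AE_interval_nonempty:
  assumes "AE u in lborel. a < u \<and> u < b \<longrightarrow> P u" "a < (b::real)"
  shows "\<exists>u. a < u \<and> u < b \<and> P u"
proof (rule ccontr)
  assume "\<not> ?thesis"
  then have "AE u in lborel. u \<notin> {a<..<b}" using assms(1) by (auto elim!: eventually_mono)
  then have "emeasure lborel {a<..<b} = 0"
    by (subst (asm) AE_iff_measurable[of "{a<..<b}"]) auto
  then show False using assms(2) by simp
qed

text \<open>
  Between consecutive points of the essential boundary the indicator function is constant, and it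
  jumps by one at each of them; the induction adds the last point.
\<close>

lemma indicator_eq_sum_jumps:
  assumes A: "A \<in> sets borel" and fin: "finite (essential_boundary A \<inter> {a<..<b})"
  shows "\<exists>c. AE u in lborel. a < u \<and> u < b \<longrightarrow>
    indicat_real A u = c + (\<Sum>s\<in>essential_boundary A \<inter> {a<..<b}. jump A s * indicat_real {s<..} u)"
  using fin
proof (induction "card (essential_boundary A \<inter> {a<..<b})" arbitrary: b)
  case 0
  then have e: "essential_boundary A \<inter> {a<..<b} = {}" by auto
  from AE_const_between_essential_boundary[OF A e] show ?case
  proof
    assume "AE u in lborel. a < u \<and> u < b \<longrightarrow> u \<in> A"
    then show ?case unfolding e by (intro exI[of _ 1]) (auto elim!: eventually_mono)
  next
    assume "AE u in lborel. a < u \<and> u < b \<longrightarrow> u \<notin> A"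
    then show ?case unfolding e by (intro exI[of _ 0]) (auto elim!: eventually_mono)
  qed
next
  case (Suc n)
  define F where "F = essential_boundary A \<inter> {a<..<b}"
  have F: "finite F" "F \<noteq> {}" using Suc by (auto simp: F_def)
  define s where "s = Max F"
  have sF: "s \<in> F" "\<And>t. t \<in> F \<Longrightarrow> t \<le> s" using F by (auto simp: s_def)
  have sab: "a < s" "s < b" "s \<in> essential_boundary A" using sF by (auto simp: F_def)
  have F': "essential_boundary A \<inter> {a<..<s} = F - {s}" using sF by (force simp: F_def)
  then have "card (essential_boundary A \<inter> {a<..<s}) = n" using Suc(2) F sF by (simp add: F_def[symmetric])
  then obtain c where c: "AE u in lborel. a < u \<and> u < s \<longrightarrow>
      indicat_real A u = c + (\<Sum>s\<in>F - {s}. jump A s * indicat_real {s<..} u)"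
    using Suc(1)[of s] F F' by auto
  (* on (m, s) all earlier points have been passed, so the sum has its final value v *)
  define m where "m = Max (insert a (F - {s}))"
  have "t < s" if "t \<in> insert a (F - {s})" for t
    using that sF(2)[of t] sab by (auto simp: order.strict_iff_order)
  then have m: "m < s" "\<And>t. t \<in> F - {s} \<Longrightarrow> t \<le> m" "a \<le> m"
    using F unfolding m_def by (auto simp: Max_less_iff)
  define v where "v = c + (\<Sum>s\<in>F - {s}. jump A s)"
  have sumv: "c + (\<Sum>s\<in>F - {s}. jump A s * indicat_real {s<..} u) = v" if "m < u" for u
    unfolding v_def using m(2) that by (intro arg_cong[where f="\<lambda>x. c + x"] sum.cong) force+
  have left: "AE u in lborel. m < u \<and> u < s \<longrightarrow> indicat_real A u = v"
    using c by (rule eventually_mono) (use m sumv in auto)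
  have "essential_boundary A \<inter> {s<..<b} = {}" using sF sab by (force simp: F_def)
  note right = AE_const_between_essential_boundary[OF A this]
  have v01: "v = 0 \<or> v = 1" using AE_interval_nonempty[OF left m(1)] by (auto simp: indicator_def split: if_splits)
  define w where "w = v + jump A s"
  (* equal values on both sides would exclude s from the essential boundary *)
  have mix: False if P: "AE u in lborel. m < u \<and> u < s \<longrightarrow> P u" "AE u in lborel. s < u \<and> u < b \<longrightarrow> P u"
    and PA: "(\<forall>u. P u \<longrightarrow> u \<in> A) \<or> (\<forall>u. P u \<longrightarrow> u \<notin> A)" for P
  proof -
    define r where "r = min (s - m) (b - s)"
    have r: "r > 0" using m sab by (simp add: r_def)
    have "AE u in lborel. u \<in> ball s r \<longrightarrow> P u"
      using P AE_lborel_singleton[of s]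
      by eventually_elim (auto simp: r_def dist_real_def abs_if split: if_splits)
    note Pr = this
    have "(AE u in lborel. u \<in> ball s r \<longrightarrow> u \<in> A) \<or> (AE u in lborel. u \<in> ball s r \<longrightarrow> u \<notin> A)"
      using PA
    proof
      assume "\<forall>u. P u \<longrightarrow> u \<in> A"
      with Pr have "AE u in lborel. u \<in> ball s r \<longrightarrow> u \<in> A"
        by (auto elim: eventually_mono)
      then show ?thesis ..
    next
      assume "\<forall>u. P u \<longrightarrow> u \<notin> A"
      with Pr have "AE u in lborel. u \<in> ball s r \<longrightarrow> u \<notin> A"
        by (auto elim: eventually_mono)
      then show ?thesis ..
    qed
    then show False using not_essential_boundary_iff[OF A] r sab(3) by blast
  qed
  have right': "AE u in lborel. s < u \<and> u < b \<longrightarrow> indicat_real A u = w"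
    using right
  proof
    assume R: "AE u in lborel. s < u \<and> u < b \<longrightarrow> u \<in> A"
    then have "AE u in lborel. s < u \<and> u < s + (b - s) \<longrightarrow> u \<in> A" by simp
    then have j: "jump A s = 1" unfolding jump_def using sab by (metis diff_gt_0_iff_gt)
    have "v = 0"
    proof (rule ccontr)
      assume "v \<noteq> 0"
      then have "AE u in lborel. m < u \<and> u < s \<longrightarrow> u \<in> A"
        using left v01 by (auto elim!: eventually_mono simp: indicator_def split: if_splits)
      then show False using mix[of "\<lambda>u. u \<in> A"] R by auto
    qed
    then show ?thesis using R j by (auto elim!: eventually_mono simp: w_def)
  next
    assume R: "AE u in lborel. s < u \<and> u < b \<longrightarrow> u \<notin> A"
    have j: "jump A s = -1"
    proof -
      have False if r: "r > 0" "AE u in lborel. s < u \<and> u < s + r \<longrightarrow> u \<in> A" for r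
      proof -
        have "AE u in lborel. s < u \<and> u < min b (s + r) \<longrightarrow> False"
          using R r(2) by eventually_elim auto
        then show False using AE_interval_nonempty[of s "min b (s + r)" "\<lambda>_. False"] r sab by auto
      qed
      then show ?thesis by (auto simp: jump_def)
    qed
    have "v = 1"
    proof (rule ccontr)
      assume "v \<noteq> 1"
      then have "AE u in lborel. m < u \<and> u < s \<longrightarrow> u \<notin> A"
        using left v01 by (auto elim!: eventually_mono simp: indicator_def split: if_splits)
      then show False using mix[of "\<lambda>u. u \<notin> A"] R by auto
    qed
    then show ?thesis using R j by (auto elim!: eventually_mono simp: w_def)
  qed
  have split: "(\<Sum>s\<in>F. jump A s * indicat_real {s<..} u)
      = jump A s * indicat_real {s<..} u + (\<Sum>s\<in>F - {s}. jump A s * indicat_real {s<..} u)" for u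
    by (rule sum.remove[OF F(1) sF(1)])
  have "AE u in lborel. a < u \<and> u < b \<longrightarrow> indicat_real A u = c + (\<Sum>s\<in>F. jump A s * indicat_real {s<..} u)"
    using c right' AE_lborel_singleton[of s]
  proof eventually_elim
    case (elim u)
    show ?case
    proof (intro impI)
      assume u: "a < u \<and> u < b"
      show "indicat_real A u = c + (\<Sum>s\<in>F. jump A s * indicat_real {s<..} u)"
      proof (cases "u < s")
        case True
        then show ?thesis using elim(1) u by (simp add: split)
      next
        case False
        then have "s < u" using elim(3) by auto
        then show ?thesis using elim(2) u sumv[of u] m(1) by (simp add: split w_def)
      qed
    qed
  qed
  then show ?case unfolding F_def by blast
qed

lemma C1c_real_bounds:
  fixes \<phi> :: "real \<Rightarrow> real"
  assumes "\<phi> \<in> C1c I"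
  obtains a b where "a < b" "\<And>u. u \<le> a \<or> b \<le> u \<Longrightarrow> \<phi> u = 0" "\<And>u. u \<le> a \<or> b \<le> u \<Longrightarrow> dir_deriv \<phi> 1 u = 0"
proof -
  obtain S where S: "compact S" "\<And>x. x \<notin> S \<Longrightarrow> \<phi> x = 0" using C1cE[OF assms] by metis
  obtain R where R: "R > 0" "\<And>x. x \<in> S \<Longrightarrow> norm x \<le> R"
    using compact_imp_bounded[OF S(1)] by (meson bounded_pos)
  have o: "x \<notin> S" if "x \<le> -R-1 \<or> R+1 \<le> x" for x using that R(2)[of x] by (auto simp: abs_le_iff)
  show ?thesis
    by (rule that[of "-R-1" "R+1"])
      (use R(1) S o dir_deriv_outside_support[OF compact_imp_closed[OF S(1)] S(2)] in auto)
qed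

lemma C1_fun_DERIV:
  fixes \<phi> :: "real \<Rightarrow> real"
  assumes "C1_fun \<phi>" shows "(\<phi> has_real_derivative dir_deriv \<phi> 1 u) (at u)"
  using has_real_derivative_line[OF assms, of 0 1 u] by simp

lemma integral_deriv_right:
  fixes \<phi> :: "real \<Rightarrow> real"
  assumes "\<phi> \<in> C1c I"
  shows "(\<integral>u. indicat_real {s<..} u * dir_deriv \<phi> 1 u \<partial>lborel) = - \<phi> s"
proof -
  note C1 = C1cD[OF assms]
  obtain a b where ab: "a < b" "\<And>u. u \<le> a \<or> b \<le> u \<Longrightarrow> \<phi> u = 0" "\<And>u. u \<le> a \<or> b \<le> u \<Longrightarrow> dir_deriv \<phi> 1 u = 0"
    using C1c_real_bounds[OF assms] by metis
  have "(\<integral>u. indicat_real {s<..} u * dir_deriv \<phi> 1 u \<partial>lborel)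
      = (\<integral>u. dir_deriv \<phi> 1 u * indicat_real {s..max s b} u \<partial>lborel)"
  proof (rule integral_cong_AE)
    show "AE u in lborel. indicat_real {s<..} u * dir_deriv \<phi> 1 u = dir_deriv \<phi> 1 u * indicat_real {s..max s b} u"
      using AE_lborel_singleton[of s]
    proof eventually_elim
      case (elim u)
      then show ?case using ab(3)[of u] by (auto simp: indicator_def max_def not_le split: if_splits)
    qed
  qed (use borel_measurable_continuous_onI[OF continuous_on_dir_deriv[OF C1]] in measurable)
  also have "\<dots> = \<phi> (max s b) - \<phi> s"
    by (rule integral_FTC_Icc_real)
      (use C1_fun_DERIV[OF C1] continuous_on_dir_deriv[OF C1] in \<open>auto simp: continuous_on_eq_continuous_at\<close>)
  also have "\<dots> = - \<phi> s" using ab(2)[of "max s b"] by auto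
  finally show ?thesis .
qed

lemma integral_deriv_zero:
  fixes \<phi> :: "real \<Rightarrow> real"
  assumes "\<phi> \<in> C1c I" shows "(\<integral>u. dir_deriv \<phi> 1 u \<partial>lborel) = 0"
proof -
  obtain a b where ab: "a < b" "\<And>u. u \<le> a \<or> b \<le> u \<Longrightarrow> \<phi> u = 0" "\<And>u. u \<le> a \<or> b \<le> u \<Longrightarrow> dir_deriv \<phi> 1 u = 0"
    using C1c_real_bounds[OF assms] by metis
  have "(\<integral>u. dir_deriv \<phi> 1 u \<partial>lborel) = (\<integral>u. indicat_real {a<..} u * dir_deriv \<phi> 1 u \<partial>lborel)"
    by (rule Bochner_Integration.integral_cong) (auto simp: indicator_def ab(3))
  then show ?thesis using integral_deriv_right[OF assms, of a] ab(2)[of a] by simp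
qed

text \<open>
  Pair the representation by jumps with \<open>\<phi>'\<close>: a unit step at \<open>s\<close> contributes
  \<open>-\<phi>(s)\<close>, a constant contributes nothing.
\<close>

lemma integral_deriv_eq_sum_jumps:
  fixes \<phi> :: "real \<Rightarrow> real"
  assumes A [measurable]: "A \<in> sets borel" and disc: "discrete_essential_boundary A" and \<phi>: "\<phi> \<in> C1c I"
  shows "finite {s \<in> essential_boundary A. \<phi> s \<noteq> 0}"
    and "(\<integral>u. indicat_real A u * dir_deriv \<phi> 1 u \<partial>lborel)
      = - (\<Sum>s | s \<in> essential_boundary A \<and> \<phi> s \<noteq> 0. jump A s * \<phi> s)"
proof -
  obtain a b where ab: "a < b" "\<And>u. u \<le> a \<or> b \<le> u \<Longrightarrow> \<phi> u = 0" "\<And>u. u \<le> a \<or> b \<le> u \<Longrightarrow> dir_deriv \<phi> 1 u = 0"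
    using C1c_real_bounds[OF \<phi>] by metis
  define F where "F = essential_boundary A \<inter> {a<..<b}"
  have F: "finite F" using disc by (simp add: F_def discrete_essential_boundary_def)
  have sub: "{s \<in> essential_boundary A. \<phi> s \<noteq> 0} \<subseteq> F" using ab(2) by (force simp: F_def not_le[symmetric])
  then show "finite {s \<in> essential_boundary A. \<phi> s \<noteq> 0}" using F finite_subset by blast
  obtain c where c: "AE u in lborel. a < u \<and> u < b \<longrightarrow>
      indicat_real A u = c + (\<Sum>s\<in>F. jump A s * indicat_real {s<..} u)"
    using indicator_eq_sum_jumps[OF A F[unfolded F_def]] by (auto simp: F_def)
  have [measurable]: "dir_deriv \<phi> 1 \<in> borel_measurable borel"
    by (rule borel_measurable_continuous_onI[OF continuous_on_dir_deriv[OF C1cD[OF \<phi>]]])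
  note i = dir_deriv_integrable[OF \<phi>, of 1]
  have i': "integrable lborel (\<lambda>u. indicat_real {s<..} u * dir_deriv \<phi> 1 u)" for s
    by (rule integrable_indicator_mult[OF i]) auto
  have "(\<integral>u. indicat_real A u * dir_deriv \<phi> 1 u \<partial>lborel)
      = (\<integral>u. c * dir_deriv \<phi> 1 u + (\<Sum>s\<in>F. jump A s * (indicat_real {s<..} u * dir_deriv \<phi> 1 u)) \<partial>lborel)"
  proof (rule integral_cong_AE)
    show "AE u in lborel. indicat_real A u * dir_deriv \<phi> 1 u
        = c * dir_deriv \<phi> 1 u + (\<Sum>s\<in>F. jump A s * (indicat_real {s<..} u * dir_deriv \<phi> 1 u))"
      using c
    proof eventually_elim
      case (elim u)
      show ?case
      proof (cases "a < u \<and> u < b")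
        case True
        then have "indicat_real A u = c + (\<Sum>s\<in>F. jump A s * indicat_real {s<..} u)" using elim by auto
        then show ?thesis by (simp add: distrib_right sum_distrib_right mult.assoc)
      next
        case False
        then show ?thesis using ab(3)[of u] by auto
      qed
    qed
  qed measurable
  also have "\<dots> = c * (\<integral>u. dir_deriv \<phi> 1 u \<partial>lborel) + (\<Sum>s\<in>F. jump A s * (\<integral>u. indicat_real {s<..} u * dir_deriv \<phi> 1 u \<partial>lborel))"
    using i i' by simp
  also have "\<dots> = - (\<Sum>s\<in>F. jump A s * \<phi> s)"
    by (simp add: integral_deriv_zero[OF \<phi>] integral_deriv_right[OF \<phi>] sum_negf)
  also have "(\<Sum>s\<in>F. jump A s * \<phi> s) = (\<Sum>s | s \<in> essential_boundary A \<and> \<phi> s \<noteq> 0. jump A s * \<phi> s)"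
    using F sub by (intro sum.mono_neutral_right) (auto simp: F_def)
  finally show "(\<integral>u. indicat_real A u * dir_deriv \<phi> 1 u \<partial>lborel)
      = - (\<Sum>s | s \<in> essential_boundary A \<and> \<phi> s \<noteq> 0. jump A s * \<phi> s)" .
qed

subsection \<open>The variation counts the essential boundary\<close>

text \<open>
  Vanishing mean makes the primitive vanish to the right of the support of \<open>g\<close> as well as to the
  left.
\<close>

lemma C1c_primitive:
  fixes g :: "real \<Rightarrow> real"
  assumes g: "continuous_on UNIV g" and S: "S = {c..d}" "\<And>u. u \<notin> S \<Longrightarrow> g u = 0" and int: "(\<integral>u. g u \<partial>lborel) = 0"
    and sub: "S \<subseteq> J"
  obtains \<phi> where "\<phi> \<in> C1c J" "\<And>u. dir_deriv \<phi> 1 u = g u"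
    "\<And>u. \<phi> u = (\<integral>t. indicat_real {..u} t * g t \<partial>lborel)"
proof -
  define \<phi> where "\<phi> u = integral {c-1..u} g" for u
  have gi: "set_integrable lborel {a..b} g" for a b
    using continuous_on_subset[OF g] by (intro borel_integrable_atLeastAtMost') auto
  have ig: "integrable lborel g"
    by (rule integrable_continuous_compact_support[OF g, of S]) (use S in auto)
  have z: "g u = 0" if "u < c \<or> d < u" for u using that S by auto
  have eq: "\<phi> u = (\<integral>t. indicat_real {..u} t * g t \<partial>lborel)" for u
  proof -
    have "\<phi> u = (\<integral>t. indicat_real {c-1..u} t *\<^sub>R g t \<partial>lborel)"
      unfolding \<phi>_def using set_borel_integral_eq_integral(2)[OF gi, of "c-1" u] by (simp add: set_lebesgue_integral_def)
    also have "(\<lambda>t. indicat_real {c-1..u} t *\<^sub>R g t) = (\<lambda>t. indicat_real {..u} t * g t)"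
      using z by (fastforce simp: indicator_def)
    finally show ?thesis .
  qed
  have zl: "\<phi> u = 0" if "u < c" for u
  proof -
    have "(\<lambda>t. indicat_real {..u} t * g t) = (\<lambda>_. 0)" using that z by (auto simp: indicator_def fun_eq_iff)
    then show ?thesis by (simp add: eq)
  qed
  have zr: "\<phi> u = 0" if "d < u" for u
  proof -
    have "(\<lambda>t. indicat_real {..u} t * g t) = g" using that z by (auto simp: indicator_def fun_eq_iff)
    then show ?thesis by (simp add: eq int)
  qed
  have D: "(\<phi> has_real_derivative g u) (at u)" for u
  proof (cases "u < c")
    case True
    have "(\<phi> has_real_derivative 0) (at u)"
      by (rule has_field_derivative_transform_within_open[where f="\<lambda>_. 0" and S="{..<c}"]) (use True zl in auto)
    then show ?thesis using z True by simp
  next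
    case False
    have "((\<lambda>u. integral {c-1..u} g) has_real_derivative g u) (at u within {c-1..u+1})"
      by (rule integral_has_real_derivative[OF continuous_on_subset[OF g]]) (use False in auto)
    moreover have "at u within {c-1..u+1} = at u"
      by (rule at_within_interior) (use False in auto)
    ultimately show ?thesis by (simp add: \<phi>_def[abs_def])
  qed
  have fd: "dir_deriv \<phi> 1 u = g u" for u using dir_deriv_real[OF D] .
  have "C1_fun \<phi>"
    by (rule C1_funI[where D="\<lambda>u v. g u * v"])
      (use D in \<open>auto simp: has_field_derivative_def intro!: continuous_intros g\<close>)
  then have "\<phi> \<in> C1c J"
    by (rule C1cI[of _ "{c..d}"]) (use S sub zl zr in force)+
  then show ?thesis using that fd eq by blast
qed

text \<open>
  The primitive of the difference of approximate indicator functions of \<open>J \<inter> A\<close> and \<open>J - A\<close>, both normalised to integral one,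
  is bounded by one; its derivative has integral almost one over \<open>A\<close>.
\<close>

lemma variation_near_essential_boundary:
  fixes A :: "real set"
  assumes A [measurable]: "A \<in> sets borel" and pos: "emeasure lborel (A \<inter> {a<..<b}) > 0" "emeasure lborel ({a<..<b} - A) > 0"
    and e: "e > 0"
  obtains \<phi> where "\<phi> \<in> C1c {a<..<b}" "\<And>x. \<bar>\<phi> x\<bar> \<le> (1::real)" "(\<integral>u. indicat_real A u * dir_deriv \<phi> 1 u \<partial>lborel) \<ge> 1 - e"
proof -
  define J where "J = {a<..<b}"
  define P where "P = A \<inter> J"
  define N where "N = J - A"
  have [measurable]: "P \<in> sets borel" "N \<in> sets borel" "J \<in> sets borel" unfolding P_def N_def J_def by measurable
  have J: "open J" "bounded J" by (auto simp: J_def)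
  have bd: "bounded P" "bounded N" using J bounded_subset by (auto simp: P_def N_def)
  have fm: "emeasure lborel P < \<infinity>" "emeasure lborel N < \<infinity>"
    by (rule emeasure_bounded_finite[OF bd(1)], rule emeasure_bounded_finite[OF bd(2)])
  define m where "m = min (measure lborel P) (measure lborel N)"
  have m: "m > 0"
    using pos fm by (auto simp: m_def P_def N_def J_def measure_def enn2real_positive_iff less_top)
  (* \<delta> \<le> m/2 keeps the integrals of g and h above m/2; \<delta> \<le> e m/4 then makes the relative errors at most e/2 *)
  define \<delta> where "\<delta> = min (m / 2) (e * m / 4)"
  have \<delta>: "\<delta> > 0" "\<delta> \<le> m / 2" "\<delta> \<le> e * m / 4" using m e by (auto simp: \<delta>_def)
  obtain g where g: "g \<in> C1c J" "\<And>x. 0 \<le> g x" "\<And>x. g x \<le> 1" "(\<integral>x. \<bar>g x - indicat_real P x\<bar> \<partial>lborel) < \<delta>"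
    using C1c_approx_indicator[of P J \<delta>] bd J \<delta> by (auto simp: P_def)
  obtain h where h: "h \<in> C1c J" "\<And>x. 0 \<le> h x" "\<And>x. h x \<le> 1" "(\<integral>x. \<bar>h x - indicat_real N x\<bar> \<partial>lborel) < \<delta>"
    using C1c_approx_indicator[of N J \<delta>] bd J \<delta> by (auto simp: N_def)
  note ig = C1c_integrable[OF g(1)] C1c_integrable[OF h(1)]
  have ii: "integrable lborel (indicat_real P)" "integrable lborel (indicat_real N)"
    using fm by (auto intro!: integrable_real_indicator)
  have big: "(\<integral>x. f x \<partial>lborel) \<ge> m / 2" if f: "integrable lborel f" "(\<integral>x. \<bar>f x - indicat_real Q x\<bar> \<partial>lborel) < \<delta>"
     and Q: "integrable lborel (indicat_real Q)" "m \<le> measure lborel Q" "Q \<in> sets borel" for f Q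
  proof -
    have "measure lborel Q = (\<integral>x. indicat_real Q x \<partial>lborel)" using Q(3) by simp
    also have "\<dots> \<le> (\<integral>x. f x + \<bar>f x - indicat_real Q x\<bar> \<partial>lborel)"
      by (intro integral_mono Q f Bochner_Integration.integrable_add integrable_abs Bochner_Integration.integrable_diff) auto
    also have "\<dots> = (\<integral>x. f x \<partial>lborel) + (\<integral>x. \<bar>f x - indicat_real Q x\<bar> \<partial>lborel)"
      using f Q by (intro Bochner_Integration.integral_add) auto
    finally show ?thesis using f(2) Q(2) \<delta>(2) by linarith
  qed
  define \<alpha> where "\<alpha> = (\<integral>x. g x \<partial>lborel)"
  define \<beta> where "\<beta> = (\<integral>x. h x \<partial>lborel)"
  have ab: "\<alpha> \<ge> m / 2" "\<beta> \<ge> m / 2"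
    unfolding \<alpha>_def \<beta>_def using big[OF ig(1) g(4) ii(1)] big[OF ig(2) h(4) ii(2)] by (auto simp: m_def)
  have ab0: "\<alpha> > 0" "\<beta> > 0" using ab m by linarith+
  define k where "k = (\<lambda>x. g x / \<alpha> - h x / \<beta>)"
  have kc: "continuous_on UNIV k" unfolding k_def using ab0
    by (intro continuous_intros continuous_on_C1_fun C1cD[OF g(1)] C1cD[OF h(1)]) auto
  have kint: "(\<integral>x. k x \<partial>lborel) = 0"
    unfolding k_def using ig ab0 by (simp add: \<alpha>_def[symmetric] \<beta>_def[symmetric])
  obtain S T where S: "compact S" "S \<subseteq> J" "\<And>x. x \<notin> S \<Longrightarrow> g x = 0" and T: "compact T" "T \<subseteq> J" "\<And>x. x \<notin> T \<Longrightarrow> h x = 0"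
    using C1cE[OF g(1)] C1cE[OF h(1)] by metis
  have ST: "S \<union> T \<noteq> {}"
  proof
    assume "S \<union> T = {}"
    then have "g = (\<lambda>_. 0)" using S by auto
    then show False using ab0 by (simp add: \<alpha>_def)
  qed
  have cST: "compact (S \<union> T)" using S T by auto
  obtain c where c: "c \<in> S \<union> T" "\<And>x. x \<in> S \<union> T \<Longrightarrow> c \<le> x" using compact_attains_inf[OF cST ST] by blast
  obtain d where d: "d \<in> S \<union> T" "\<And>x. x \<in> S \<union> T \<Longrightarrow> x \<le> d" using compact_attains_sup[OF cST ST] by blast
  have "a < c" "d < b" using c(1) d(1) S(2) T(2) by (auto simp: J_def)
  then have cd: "{c..d} \<subseteq> {a<..<b}" by auto
  have kz: "k u = 0" if "u \<notin> {c..d}" for u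
  proof -
    have "u \<notin> S \<union> T" using that c(2)[of u] d(2)[of u] by auto
    then show ?thesis using S(3)[of u] T(3)[of u] by (auto simp: k_def)
  qed
  obtain \<phi> where \<phi>: "\<phi> \<in> C1c {a<..<b}" "\<And>u. dir_deriv \<phi> 1 u = k u" "\<And>u. \<phi> u = (\<integral>t. indicat_real {..u} t * k t \<partial>lborel)"
    using C1c_primitive[OF kc refl kz kint cd] by metis
  have frac: "0 \<le> (\<integral>t. indicat_real X t * f t \<partial>lborel) / (\<integral>t. f t \<partial>lborel) \<and> (\<integral>t. indicat_real X t * f t \<partial>lborel) / (\<integral>t. f t \<partial>lborel) \<le> 1"
    if f: "integrable lborel f" "\<And>x. 0 \<le> f x" "(\<integral>t. f t \<partial>lborel) > 0" and X: "X \<in> sets lborel" for X and f :: "real \<Rightarrow> real"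
  proof -
    have "0 \<le> (\<integral>t. indicat_real X t * f t \<partial>lborel)" using f by (intro integral_nonneg_AE) auto
    moreover have "(\<integral>t. indicat_real X t * f t \<partial>lborel) \<le> (\<integral>t. f t \<partial>lborel)"
      using f by (intro integral_mono integrable_indicator_mult X) (auto simp: indicator_def)
    ultimately show ?thesis using f(3) by (simp add: divide_le_eq_1)
  qed
  have spl: "(\<integral>t. indicat_real X t * k t \<partial>lborel) = (\<integral>t. indicat_real X t * g t \<partial>lborel) / \<alpha> - (\<integral>t. indicat_real X t * h t \<partial>lborel) / \<beta>"
    if X: "X \<in> sets lborel" for X
  proof -
    have "(\<lambda>t. indicat_real X t * k t) = (\<lambda>t. (indicat_real X t * g t) / \<alpha> - (indicat_real X t * h t) / \<beta>)"
      by (auto simp: k_def algebra_simps)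
    then show ?thesis
      using integrable_indicator_mult[OF ig(1) X] integrable_indicator_mult[OF ig(2) X] by simp
  qed
  have le1: "\<bar>\<phi> x\<bar> \<le> 1" for x
  proof -
    have "0 \<le> (\<integral>t. indicat_real {..x} t * g t \<partial>lborel) / \<alpha> \<and> (\<integral>t. indicat_real {..x} t * g t \<partial>lborel) / \<alpha> \<le> 1"
      unfolding \<alpha>_def by (rule frac[OF ig(1) g(2)]) (use ab0 in \<open>auto simp: \<alpha>_def\<close>)
    moreover have "0 \<le> (\<integral>t. indicat_real {..x} t * h t \<partial>lborel) / \<beta> \<and> (\<integral>t. indicat_real {..x} t * h t \<partial>lborel) / \<beta> \<le> 1"
      unfolding \<beta>_def by (rule frac[OF ig(2) h(2)]) (use ab0 in \<open>auto simp: \<beta>_def\<close>)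
    moreover have "\<phi> x = (\<integral>t. indicat_real {..x} t * g t \<partial>lborel) / \<alpha> - (\<integral>t. indicat_real {..x} t * h t \<partial>lborel) / \<beta>"
      unfolding \<phi>(3) by (rule spl) simp
    ultimately show ?thesis by linarith
  qed
  have d1: "integrable lborel (\<lambda>t. \<bar>g t - indicat_real P t\<bar>)" "integrable lborel (\<lambda>t. \<bar>h t - indicat_real N t\<bar>)"
    using ig ii by auto
  have i2: "integrable lborel (\<lambda>t. indicat_real A t * g t)" "integrable lborel (\<lambda>t. indicat_real A t * h t)"
    using ig by (auto intro: integrable_indicator_mult)
  have gA: "(\<integral>t. indicat_real A t * g t \<partial>lborel) \<ge> \<alpha> - \<delta>"
  proof -
    have "\<alpha> \<le> (\<integral>t. indicat_real A t * g t + \<bar>g t - indicat_real P t\<bar> \<partial>lborel)"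
      unfolding \<alpha>_def
    proof (rule integral_mono)
      fix t show "g t \<le> indicat_real A t * g t + \<bar>g t - indicat_real P t\<bar>"
        using g(2)[of t] by (auto simp: indicator_def P_def)
    qed (use ig d1 i2 in auto)
    also have "\<dots> = (\<integral>t. indicat_real A t * g t \<partial>lborel) + (\<integral>t. \<bar>g t - indicat_real P t\<bar> \<partial>lborel)"
      by (intro Bochner_Integration.integral_add d1 i2)
    finally show ?thesis using g(4) by linarith
  qed
  have hA: "(\<integral>t. indicat_real A t * h t \<partial>lborel) \<le> \<delta>"
  proof -
    have "(\<integral>t. indicat_real A t * h t \<partial>lborel) \<le> (\<integral>t. \<bar>h t - indicat_real N t\<bar> \<partial>lborel)"
    proof (rule integral_mono)
      fix t show "indicat_real A t * h t \<le> \<bar>h t - indicat_real N t\<bar>"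
        using h(2)[of t] by (auto simp: indicator_def N_def)
    qed (use d1 i2 in auto)
    then show ?thesis using h(4) by linarith
  qed
  have "\<delta> / \<alpha> \<le> e / 2" "\<delta> / \<beta> \<le> e / 2"
  proof -
    have "\<delta> \<le> (e / 2) * (m / 2)" using \<delta>(3) by simp
    also have "\<dots> \<le> (e / 2) * \<alpha>" using ab e by (intro mult_left_mono) auto
    finally show "\<delta> / \<alpha> \<le> e / 2" using ab0 by (simp add: pos_divide_le_eq)
    have "\<delta> \<le> (e / 2) * (m / 2)" using \<delta>(3) by simp
    also have "\<dots> \<le> (e / 2) * \<beta>" using ab e by (intro mult_left_mono) auto
    finally show "\<delta> / \<beta> \<le> e / 2" using ab0 by (simp add: pos_divide_le_eq)
  qed
  moreover have "(\<integral>t. indicat_real A t * g t \<partial>lborel) / \<alpha> \<ge> 1 - \<delta> / \<alpha>"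
    using divide_right_mono[OF gA, of \<alpha>] ab0 by (simp add: diff_divide_distrib)
  moreover have "(\<integral>t. indicat_real A t * h t \<partial>lborel) / \<beta> \<le> \<delta> / \<beta>"
    using hA ab0 by (simp add: divide_right_mono)
  ultimately have "(\<integral>t. indicat_real A t * k t \<partial>lborel) \<ge> 1 - e"
    unfolding spl[OF A[folded sets_lborel]] by linarith
  then show ?thesis using that[OF \<phi>(1) le1] by (simp add: \<phi>(2))
qed

section \<open>Variation, perimeter and null sets\<close>

lemma set_lebesgue_integral_AE_cong:
  fixes f :: "'a::euclidean_space \<Rightarrow> real"
  assumes E: "E \<in> sets lebesgue" and E' [measurable]: "E' \<in> sets borel" and eq: "AE x in lborel. x \<in> E \<longleftrightarrow> x \<in> E'"
    and f [measurable]: "f \<in> borel_measurable borel"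
  shows "(LINT x:E|lebesgue. f x) = (\<integral>x. indicat_real E' x * f x \<partial>lborel)"
proof -
  have fl: "f \<in> borel_measurable lebesgue" by (intro measurable_completion) simp
  have fE: "(\<lambda>x. indicator E' x * f x) \<in> borel_measurable lborel" by simp
  have "(LINT x:E|lebesgue. f x) = (\<integral>x. indicat_real E' x * f x \<partial>lebesgue)"
    unfolding set_lebesgue_integral_def
  proof (rule integral_cong_AE)
    show "(\<lambda>x. indicat_real E x *\<^sub>R f x) \<in> borel_measurable lebesgue"
      by (intro borel_measurable_scaleR borel_measurable_indicator E fl)
    show "(\<lambda>x. indicator E' x * f x) \<in> borel_measurable lebesgue"
      by (rule measurable_completion[OF fE])
    show "AE x in lebesgue. indicat_real E x *\<^sub>R f x = indicat_real E' x * f x"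
      using AE_completion[OF eq] by eventually_elim (auto simp: indicator_def)
  qed
  also have "\<dots> = (\<integral>x. indicat_real E' x * f x \<partial>lborel)"
    by (rule integral_completion[OF fE])
  finally show ?thesis .
qed

lemma borel_measurable_divergence:
  "C1_fun \<phi> \<Longrightarrow> divergence \<phi> \<in> borel_measurable borel"
  unfolding divergence_def[abs_def]
  by (intro borel_measurable_sum borel_measurable_inner borel_measurable_continuous_onI[OF continuous_on_dir_deriv])
     auto

lemma variation_in_open_eq:
  assumes E: "E \<in> sets lebesgue" and E': "E' \<in> sets borel" and eq: "AE x in lborel. x \<in> E \<longleftrightarrow> x \<in> E'"
  shows "variation_in_open E A =
    (SUP \<phi>\<in>{\<phi> \<in> C1c A. \<forall>x. norm (\<phi> x) \<le> 1}. ennreal (\<integral>x. indicat_real E' x * divergence \<phi> x \<partial>lborel))"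
  unfolding variation_in_open_def C1_compact_fields_eq
  by (intro SUP_cong refl arg_cong[where f=ennreal] set_lebesgue_integral_AE_cong[OF E E' eq]
      borel_measurable_divergence C1cD) auto

lemma variation_in_open_cong:
  assumes E: "E \<in> sets lebesgue" and E': "E' \<in> sets borel" and eq: "AE x in lborel. x \<in> E \<longleftrightarrow> x \<in> E'"
  shows "variation_in_open E = variation_in_open E'"
  by (rule ext, subst variation_in_open_eq[OF E E' eq], subst variation_in_open_eq[of E' E']) (use E' in auto)

lemma perimeter_cong:
  assumes E: "E \<in> sets lebesgue" and E': "E' \<in> sets borel" and eq: "AE x in lborel. x \<in> E \<longleftrightarrow> x \<in> E'"
  shows "perimeter E = perimeter E'"
  by (simp add: perimeter_def[abs_def] variation_in_open_cong[OF assms])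

lemma locally_finite_perimeter_cong:
  assumes E: "E \<in> sets lebesgue" and E': "E' \<in> sets borel" and eq: "AE x in lborel. x \<in> E \<longleftrightarrow> x \<in> E'"
  shows "locally_finite_perimeter E \<longleftrightarrow> locally_finite_perimeter E'"
  using E E' by (simp add: locally_finite_perimeter_def perimeter_cong[OF assms])

lemma polar_derivative_cong:
  assumes E: "E \<in> sets lebesgue" and E': "E' \<in> sets borel" and eq: "AE x in lborel. x \<in> E \<longleftrightarrow> x \<in> E'"
  shows "polar_derivative E = polar_derivative E'"
proof -
  have "(LINT x:E|lebesgue. divergence \<phi> x) = (LINT x:E'|lebesgue. divergence \<phi> x)" if "\<phi> \<in> C1c UNIV" for \<phi> :: "'a \<Rightarrow> 'a"
    using set_lebesgue_integral_AE_cong[OF E E' eq borel_measurable_divergence[OF C1cD[OF that]]]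
      set_lebesgue_integral_AE_cong[OF _ E' _ borel_measurable_divergence[OF C1cD[OF that]], of E'] E' by simp
  then show ?thesis
    unfolding polar_derivative_def[abs_def] C1_compact_fields_eq
    by (intro ext conj_cong refl ball_cong) simp
qed

lemma reduced_boundary_cong:
  assumes E: "E \<in> sets lebesgue" and E': "E' \<in> sets borel" and eq: "AE x in lborel. x \<in> E \<longleftrightarrow> x \<in> E'"
  shows "reduced_boundary E = reduced_boundary E'"
  unfolding reduced_boundary_def
  by (simp add: locally_finite_perimeter_cong[OF assms] polar_derivative_cong[OF assms])

lemma variation_in_open_mono: "A \<subseteq> B \<Longrightarrow> variation_in_open E A \<le> variation_in_open E B"
  unfolding variation_in_open_def C1_compact_fields_eq
  using C1c_mono[of A B] by (intro SUP_subset_mono) auto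

lemma perimeter_open: "open A \<Longrightarrow> perimeter E A = variation_in_open E A"
  unfolding perimeter_def
  by (intro antisym INF_lower2[of A] INF_greatest) (auto intro: variation_in_open_mono)

subsection \<open>Counting on the line\<close>

text \<open>
  Almost optimal test functions concentrated near the different points have disjoint supports, so their sum is
  still bounded by one.
\<close>

lemma card_le_variation_in_open:
  fixes A I :: "real set"
  assumes A [measurable]: "A \<in> sets borel" and I: "open I" and F: "finite F" "F \<subseteq> essential_boundary A \<inter> I"
  shows "ennreal (card F) \<le> variation_in_open A I"
proof -
  have "\<forall>s\<in>F. \<exists>e>0. {s - e<..<s + e} \<subseteq> I"
  proof
    fix s assume "s \<in> F"
    then obtain e where "e > 0" "ball s e \<subseteq> I" using F I openE by blast
    then show "\<exists>e>0. {s - e<..<s + e} \<subseteq> I" by (auto simp: ball_eq_greaterThanLessThan)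
  qed
  then obtain e where e: "\<And>s. s \<in> F \<Longrightarrow> e s > 0" "\<And>s. s \<in> F \<Longrightarrow> {s - e s<..<s + e s} \<subseteq> I" by metis
  define r where "r = Min (insert 1 (e ` F \<union> (\<lambda>(s,t). \<bar>s - t\<bar> / 2) ` (F \<times> F - Id)))"
  have fin: "finite (insert 1 (e ` F \<union> (\<lambda>(s,t). \<bar>s - t\<bar> / 2) ` (F \<times> F - Id)))"
    using F by auto
  have r0: "r > 0" unfolding r_def using fin e by (subst Min_gr_iff) auto
  have re: "r \<le> e s" if "s \<in> F" for s unfolding r_def using fin that by (intro Min_le) auto
  have rd: "r \<le> \<bar>s - t\<bar> / 2" if "s \<in> F" "t \<in> F" "s \<noteq> t" for s t
    unfolding r_def using fin that by (intro Min_le) (auto intro!: rev_image_eqI[of "(s,t)"])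
  have key: "ennreal (z * card F) \<le> variation_in_open A I" if z: "0 < z" "z < 1" for z :: real
  proof -
    have ex: "\<exists>\<phi>. \<phi> \<in> C1c {s-r<..<s+r} \<and> (\<forall>x. \<bar>\<phi> x\<bar> \<le> (1::real)) \<and> (\<integral>u. indicat_real A u * dir_deriv \<phi> 1 u \<partial>lborel) \<ge> z"
      if s: "s \<in> F" for s
    proof -
      have "emeasure lborel (A \<inter> ball s r) > 0 \<and> emeasure lborel (ball s r - A) > 0"
        using s F(2) r0 by (auto simp: essential_boundary_def)
      then show ?thesis
        using variation_near_essential_boundary[OF A, of "s-r" "s+r" "1 - z"] z
        by (auto simp: ball_eq_greaterThanLessThan)
    qed
    from bchoice[OF ballI[OF ex]] obtain \<phi> where \<phi>0: "\<forall>s\<in>F. \<phi> s \<in> C1c {s-r<..<s+r} \<and> (\<forall>x. \<bar>\<phi> s x\<bar> \<le> (1::real))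
        \<and> (\<integral>u. indicat_real A u * dir_deriv (\<phi> s) 1 u \<partial>lborel) \<ge> z" ..
    have \<phi>: "\<And>s. s \<in> F \<Longrightarrow> \<phi> s \<in> C1c {s-r<..<s+r}" "\<And>s x. s \<in> F \<Longrightarrow> \<bar>\<phi> s x\<bar> \<le> (1::real)"
      "\<And>s. s \<in> F \<Longrightarrow> (\<integral>u. indicat_real A u * dir_deriv (\<phi> s) 1 u \<partial>lborel) \<ge> z"
      using \<phi>0 by auto
    have \<phi>I: "\<phi> s \<in> C1c I" if "s \<in> F" for s
      using \<phi>(1)[OF that] C1c_mono[of "{s-r<..<s+r}" I] e(2)[OF that] re[OF that] by (force simp: subset_iff)
    define \<Phi> where "\<Phi> = (\<lambda>x. \<Sum>s\<in>F. \<phi> s x *\<^sub>R (1::real))"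
    have \<Phi>C: "\<Phi> \<in> C1c I" unfolding \<Phi>_def by (intro C1c_sum_scaleR F \<phi>I)
    have \<Phi>1: "norm (\<Phi> x) \<le> 1" for x
    proof (cases "\<exists>s\<in>F. \<phi> s x \<noteq> 0")
      case True
      then obtain s where s: "s \<in> F" "\<phi> s x \<noteq> 0" by auto
      have mem: "x \<in> {t-r<..<t+r}" if "t \<in> F" "\<phi> t x \<noteq> 0" for t
        using \<phi>(1)[OF that(1)] that(2) by (meson C1cE subsetD)
      have z0: "\<phi> t x = 0" if "t \<in> F - {s}" for t
        using mem[OF s] mem[of t] rd[of s t] that s by (cases "\<phi> t x = 0") auto
      have "\<Phi> x = \<phi> s x" using F(1) s z0 by (simp add: \<Phi>_def sum.remove)
      then show ?thesis using \<phi>(2)[OF s(1)] by simp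
    qed (simp add: \<Phi>_def)
    have "z * card F \<le> (\<Sum>s\<in>F. \<integral>u. indicat_real A u * dir_deriv (\<phi> s) 1 u \<partial>lborel)"
      using sum_mono[of F "\<lambda>_. z", OF \<phi>(3)] by (simp add: mult.commute)
    also have "\<dots> = (\<integral>u. (\<Sum>s\<in>F. indicat_real A u * dir_deriv (\<phi> s) 1 u) \<partial>lborel)"
      by (rule Bochner_Integration.integral_sum[symmetric])
        (auto intro!: integrable_indicator_mult dir_deriv_integrable \<phi>I)
    also have "\<dots> = (\<integral>u. indicat_real A u * divergence \<Phi> u \<partial>lborel)"
      using F C1cD[OF \<phi>I] by (simp add: \<Phi>_def divergence_sum_scaleR sum_distrib_left del: scaleR_one real_scaleR_def)
    finally show ?thesis
      unfolding variation_in_open_eq[of A A, OF _ A] using \<Phi>C \<Phi>1 A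
      by (subst variation_in_open_eq[of A A]) (auto intro!: SUP_upper2[of \<Phi>] ennreal_leI)
  qed
  show ?thesis
  proof (cases "variation_in_open A I")
    case (real v)
    have "real (card F) \<le> v"
    proof (rule field_le_mult_one_interval)
      fix z :: real assume "0 < z" "z < 1"
      then show "z * real (card F) \<le> v" using key[of z] real by simp
    qed
    then show ?thesis using real by (simp add: ennreal_leI)
  qed simp
qed

text \<open>A test function is bounded by one, so each of the jumps in its support contributes at most one.\<close>

lemma variation_in_open_le_count:
  fixes A I :: "real set"
  assumes A [measurable]: "A \<in> sets borel" and disc: "discrete_essential_boundary A"
  shows "variation_in_open A I \<le> emeasure (count_space UNIV) (essential_boundary A \<inter> I)"
proof (subst variation_in_open_eq[of A A])
  show "(SUP \<phi>\<in>{\<phi> \<in> C1c I. \<forall>x. norm (\<phi> x) \<le> 1}. ennreal (\<integral>x. indicat_real A x * divergence \<phi> x \<partial>lborel))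
      \<le> emeasure (count_space UNIV) (essential_boundary A \<inter> I)"
  proof (rule SUP_least)
    fix \<phi> :: "real \<Rightarrow> real" assume "\<phi> \<in> {\<phi> \<in> C1c I. \<forall>x. norm (\<phi> x) \<le> 1}"
    then have \<phi>: "\<phi> \<in> C1c I" "\<And>x. \<bar>\<phi> x\<bar> \<le> 1" by auto
    define F where "F = {s \<in> essential_boundary A. \<phi> s \<noteq> 0}"
    have F: "finite F" using integral_deriv_eq_sum_jumps(1)[OF A disc \<phi>(1)] by (simp add: F_def)
    obtain S where "S \<subseteq> I" "\<And>x. x \<notin> S \<Longrightarrow> \<phi> x = 0" using C1cE[OF \<phi>(1)] by metis
    then have FI: "F \<subseteq> essential_boundary A \<inter> I" by (auto simp: F_def)
    have "(\<integral>x. indicat_real A x * divergence \<phi> x \<partial>lborel) = - (\<Sum>s\<in>F. jump A s * \<phi> s)"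
      unfolding divergence_real F_def using integral_deriv_eq_sum_jumps(2)[OF A disc \<phi>(1)] .
    also have "\<dots> \<le> (\<Sum>s\<in>F. \<bar>jump A s * \<phi> s\<bar>)"
      using sum_abs[of "\<lambda>s. jump A s * \<phi> s" F] by linarith
    also have "\<dots> \<le> (\<Sum>s\<in>F. 1)"
      using \<phi>(2) by (intro sum_mono) (auto simp: jump_def abs_mult)
    finally have "ennreal (\<integral>x. indicat_real A x * divergence \<phi> x \<partial>lborel) \<le> ennreal (card F)"
      by (intro ennreal_leI) simp
    also have "\<dots> = emeasure (count_space UNIV) F"
      using F by (simp add: emeasure_count_space_finite ennreal_of_nat_eq_real_of_nat)
    also have "\<dots> \<le> emeasure (count_space UNIV) (essential_boundary A \<inter> I)"
      using FI by (intro emeasure_mono) auto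
    finally show "ennreal (\<integral>x. indicat_real A x * divergence \<phi> x \<partial>lborel) \<le> emeasure (count_space UNIV) (essential_boundary A \<inter> I)" .
  qed
qed (use A in auto)

lemma count_le_variation_in_open:
  fixes A I :: "real set"
  assumes A: "A \<in> sets borel" and I: "open I"
  shows "emeasure (count_space UNIV) (essential_boundary A \<inter> I) \<le> variation_in_open A I"
proof (cases "finite (essential_boundary A \<inter> I)")
  case True
  then show ?thesis
    using card_le_variation_in_open[OF A I True] by (simp add: emeasure_count_space_finite ennreal_of_nat_eq_real_of_nat)
next
  case False
  have "ennreal (real n) \<le> variation_in_open A I" for n
  proof -
    obtain F where "finite F" "card F = n" "F \<subseteq> essential_boundary A \<inter> I"
      using infinite_arbitrarily_large[OF False] by blast
    then show ?thesis using card_le_variation_in_open[OF A I] by blast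
  qed
  then have "variation_in_open A I = \<infinity>"
    using ennreal_Ex_less_of_nat[of "variation_in_open A I"]
    by (metis ennreal_of_nat_eq_real_of_nat infinity_ennreal_def less_top not_less)
  then show ?thesis by simp
qed

lemma locally_finite_perimeter_real_iff:
  fixes A :: "real set"
  assumes A: "A \<in> sets borel"
  shows "locally_finite_perimeter A \<longleftrightarrow> discrete_essential_boundary A"
proof
  assume L: "locally_finite_perimeter A"
  show "discrete_essential_boundary A"
    unfolding discrete_essential_boundary_def
  proof (intro allI)
    fix a b :: real
    have "perimeter A {a<..<b} < \<infinity>" using L unfolding locally_finite_perimeter_def by auto
    then have "variation_in_open A {a<..<b} < \<infinity>" by (simp add: perimeter_open)
    then show "finite (essential_boundary A \<inter> {a<..<b})"
      using count_le_variation_in_open[OF A, of "{a<..<b}"] by (auto simp: emeasure_count_space top_unique split: if_splits)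
  qed
next
  assume disc: "discrete_essential_boundary A"
  show "locally_finite_perimeter A"
    unfolding locally_finite_perimeter_def
  proof (intro conjI allI impI)
    fix I :: "real set" assume I: "open I \<and> bounded I"
    then obtain R where R: "\<And>x. x \<in> I \<Longrightarrow> \<bar>x\<bar> < R" using bounded_pos_less by (metis real_norm_def)
    have "essential_boundary A \<inter> I \<subseteq> essential_boundary A \<inter> {-R<..<R}" using R by force
    then have "finite (essential_boundary A \<inter> I)"
      by (rule finite_subset) (use disc in \<open>auto simp: discrete_essential_boundary_def\<close>)
    then have "emeasure (count_space UNIV) (essential_boundary A \<inter> I) < \<infinity>"
      by (simp add: emeasure_count_space_finite of_nat_less_top)
    then show "perimeter A I < \<infinity>"
      using variation_in_open_le_count[OF A disc, of I] I by (simp add: perimeter_open)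
  qed (use A in auto)
qed

lemma variation_in_open_real:
  fixes A I :: "real set"
  assumes A: "A \<in> sets borel" and "discrete_essential_boundary A" "open I"
  shows "variation_in_open A I = emeasure (count_space UNIV) (essential_boundary A \<inter> I)"
  using assms by (intro antisym variation_in_open_le_count count_le_variation_in_open)

subsection \<open>The reduced boundary on the line\<close>

lemma discrete_essential_boundary_isolated:
  assumes disc: "discrete_essential_boundary A"
  obtains d where "d > 0" "\<And>t. t \<in> essential_boundary A \<Longrightarrow> t \<noteq> s \<Longrightarrow> d \<le> \<bar>t - s\<bar>"
proof -
  have "finite (essential_boundary A \<inter> {s-1<..<s+1})" using disc by (simp add: discrete_essential_boundary_def)
  then obtain d where d: "d > 0" "\<And>t. t \<in> essential_boundary A \<inter> {s-1<..<s+1} \<Longrightarrow> t \<noteq> s \<Longrightarrow> d \<le> dist s t"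
    using finite_set_avoid[of "essential_boundary A \<inter> {s-1<..<s+1}" s] by blast
  show ?thesis
  proof (rule that[of "min d 1"])
    fix t assume "t \<in> essential_boundary A" "t \<noteq> s"
    then show "min d 1 \<le> \<bar>t - s\<bar>"
      using d(2)[of t] by (cases "t \<in> {s-1<..<s+1}") (auto simp: dist_real_def abs_if split: if_splits)
  qed (use d in auto)
qed

lemma countable_discrete_essential_boundary:
  assumes disc: "discrete_essential_boundary A" shows "countable (essential_boundary A)"
proof -
  have "essential_boundary A = (\<Union>n::nat. essential_boundary A \<inter> {-real n<..<real n})"
  proof safe
    fix s assume s: "s \<in> essential_boundary A"
    obtain n where "\<bar>s\<bar> < real n" using reals_Archimedean2 by blast
    then show "s \<in> (\<Union>n::nat. essential_boundary A \<inter> {-real n<..<real n})" using s by (auto intro!: exI[of _ n])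
  qed
  moreover have "countable (\<Union>n::nat. essential_boundary A \<inter> {-real n<..<real n})"
    using disc by (intro countable_UN) (auto simp: discrete_essential_boundary_def intro: countable_finite)
  ultimately show ?thesis by metis
qed

text \<open>
  The counting measure on the essential boundary with density given by the sign of the jump is the polar
  decomposition of the derivative; near a boundary point the quotients in the definition of the reduced boundary
  are constant.
\<close>

lemma essential_boundary_subset_reduced_boundary:
  assumes A: "A \<in> sets borel" and disc: "discrete_essential_boundary A"
  shows "essential_boundary A \<subseteq> reduced_boundary A"
proof
  define D where "D = essential_boundary A"
  (* the jump on D, and 1 elsewhere, to have modulus one everywhere *)
  define \<sigma> where "\<sigma> s = 1 - 2 * indicat_real {s \<in> D. jump A s = -1} s" for s
  define \<mu> where "\<mu> = distr (count_space D) borel (\<lambda>x::real. x)"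
  have cD: "countable D" using countable_discrete_essential_boundary[OF disc] by (simp add: D_def)
  have "countable {s \<in> D. jump A s = -1}" using cD by (rule countable_subset[rotated]) auto
  then have [measurable]: "{s \<in> D. jump A s = -1} \<in> sets borel" by (rule sets.countable[rotated]) auto
  have \<sigma>m [measurable]: "\<sigma> \<in> borel_measurable borel" unfolding \<sigma>_def[abs_def] by measurable
  have \<sigma>D: "\<sigma> s = jump A s" if "s \<in> D" for s using that by (auto simp: \<sigma>_def jump_def)
  have \<sigma>1: "\<bar>\<sigma> s\<bar> = 1" for s by (auto simp: \<sigma>_def indicator_def)
  have em: "emeasure \<mu> X = emeasure (count_space D) (X \<inter> D)" if "X \<in> sets borel" for X
    using that by (simp add: \<mu>_def emeasure_distr)
  have polar: "polar_derivative A \<mu> \<sigma>"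
    unfolding polar_derivative_def
  proof (intro conjI allI impI ballI)
    show "sets \<mu> = sets borel" by (simp add: \<mu>_def)
    fix C :: "real set" assume C: "compact C"
    then obtain R where R: "\<And>x. x \<in> C \<Longrightarrow> \<bar>x\<bar> < R" using bounded_pos_less compact_imp_bounded by (metis real_norm_def)
    have "C \<inter> D \<subseteq> D \<inter> {-R<..<R}" using R by force
    then have "finite (C \<inter> D)"
      by (rule finite_subset) (use disc in \<open>auto simp: discrete_essential_boundary_def D_def\<close>)
    then show "emeasure \<mu> C < \<infinity>"
      using C by (simp add: em borel_compact emeasure_count_space_finite of_nat_less_top)
  next
    fix \<phi> :: "real \<Rightarrow> real" assume "\<phi> \<in> C1_compact_fields UNIV"
    then have \<phi>: "\<phi> \<in> C1c UNIV" by (simp add: C1_compact_fields_eq)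
    have [measurable]: "\<phi> \<in> borel_measurable borel"
      by (rule borel_measurable_continuous_onI[OF continuous_on_C1_fun[OF C1cD[OF \<phi>]]])
    have "(LINT x:A|lebesgue. divergence \<phi> x) = (\<integral>x. indicat_real A x * divergence \<phi> x \<partial>lborel)"
      using A by (intro set_lebesgue_integral_AE_cong borel_measurable_divergence C1cD[OF \<phi>]) auto
    also have "\<dots> = - (\<Sum>s | s \<in> D \<and> \<phi> s \<noteq> 0. jump A s * \<phi> s)"
      unfolding divergence_real D_def by (rule integral_deriv_eq_sum_jumps(2)[OF A disc \<phi>])
    also have "(\<Sum>s | s \<in> D \<and> \<phi> s \<noteq> 0. jump A s * \<phi> s) = (\<Sum>s | s \<in> D \<and> \<phi> s * \<sigma> s \<noteq> 0. \<phi> s * \<sigma> s)"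
    proof (rule sum.cong)
      show "{s \<in> D. \<phi> s \<noteq> 0} = {s \<in> D. \<phi> s * \<sigma> s \<noteq> 0}" using \<sigma>1 by (auto) (metis abs_zero zero_neq_one)
    qed (auto simp: \<sigma>D)
    also have "\<dots> = (\<integral>x. \<phi> x * \<sigma> x \<partial>count_space D)"
    proof (rule lebesgue_integral_count_space_finite_support[symmetric])
      have "finite {s \<in> D. \<phi> s \<noteq> 0}" unfolding D_def by (rule integral_deriv_eq_sum_jumps(1)[OF A disc \<phi>])
      then show "finite {s \<in> D. \<phi> s * \<sigma> s \<noteq> 0}" by (rule finite_subset[rotated]) auto
    qed
    also have "\<dots> = (\<integral>x. \<phi> x \<bullet> \<sigma> x \<partial>\<mu>)" unfolding \<mu>_def by (subst integral_distr) auto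
    finally show "(LINT x:A|lebesgue. divergence \<phi> x) = - (\<integral>x. \<phi> x \<bullet> \<sigma> x \<partial>\<mu>)" .
  qed (use \<sigma>1 \<sigma>m in auto)
  fix s assume "s \<in> essential_boundary A"
  then have s: "s \<in> D" by (simp add: D_def)
  obtain d where d: "d > 0" "\<And>t. t \<in> essential_boundary A \<Longrightarrow> t \<noteq> s \<Longrightarrow> d \<le> \<bar>t - s\<bar>"
    using discrete_essential_boundary_isolated[OF disc, of s] by metis
  have near: "ball s r \<inter> D = {s}" if "0 < r" "r < d" for r
    using d(2) s that by (force simp: D_def dist_real_def)
  have lim: "((\<lambda>r. (LINT y:ball s r|\<mu>. \<sigma> y) /\<^sub>R measure \<mu> (ball s r)) \<longlongrightarrow> \<sigma> s) (at_right 0)"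
  proof (rule tendsto_eventually)
    show "\<forall>\<^sub>F r in at_right 0. (LINT y:ball s r|\<mu>. \<sigma> y) /\<^sub>R measure \<mu> (ball s r) = \<sigma> s"
    proof (subst eventually_at_right_field, intro exI conjI allI impI)
      fix r :: real assume r: "0 < r" "r < d"
      have "(LINT y:ball s r|\<mu>. \<sigma> y) = (\<integral>y. indicat_real (ball s r) y *\<^sub>R \<sigma> y \<partial>count_space D)"
        unfolding set_lebesgue_integral_def \<mu>_def by (rule integral_distr) auto
      also have "\<dots> = (\<Sum>y | y \<in> D \<and> indicat_real (ball s r) y *\<^sub>R \<sigma> y \<noteq> 0. indicat_real (ball s r) y *\<^sub>R \<sigma> y)"
      proof (rule lebesgue_integral_count_space_finite_support, rule finite_subset)
        show "{y \<in> D. indicat_real (ball s r) y *\<^sub>R \<sigma> y \<noteq> 0} \<subseteq> ball s r \<inter> D" by (auto simp: indicator_def)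
      qed (simp add: near[OF r])
      also have "{y. y \<in> D \<and> indicat_real (ball s r) y *\<^sub>R \<sigma> y \<noteq> 0} = ball s r \<inter> D"
        using \<sigma>1 by (auto simp: indicator_def) (metis abs_zero zero_neq_one)
      finally have 1: "(LINT y:ball s r|\<mu>. \<sigma> y) = \<sigma> s" using r by (simp add: near[OF r])
      have "measure \<mu> (ball s r) = 1"
        using s by (simp add: measure_def em near[OF r] emeasure_count_space_finite)
      then show "(LINT y:ball s r|\<mu>. \<sigma> y) /\<^sub>R measure \<mu> (ball s r) = \<sigma> s" using 1 by simp
    qed (rule d(1))
  qed
  have "emeasure \<mu> (ball s r) > 0" if "r > 0" for r
  proof -
    have "s \<in> ball s r \<inter> D" using s that by simp
    then have "ball s r \<inter> D \<noteq> {}" by blast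
    then show ?thesis by (simp add: em emeasure_count_space_eq_0 zero_less_iff_neq_zero)
  qed
  then show "s \<in> reduced_boundary A"
    unfolding reduced_boundary_def mem_Collect_eq
    using polar lim \<sigma>1[of s] locally_finite_perimeter_real_iff[OF A] disc
    by (intro conjI exI[of _ \<mu>] exI[of _ \<sigma>] exI[of _ "\<sigma> s"]) auto
qed

text \<open>
  Away from the essential boundary the measure \<open>\<sigma> \<mu>\<close> annihilates all test functions, hence all small intervals;
  so it vanishes, and \<open>\<mu>\<close> with it since \<open>|\<sigma>| = 1\<close>.
\<close>

lemma reduced_boundary_subset_essential_boundary:
  assumes A: "A \<in> sets borel" and disc: "discrete_essential_boundary A"
  shows "reduced_boundary A \<subseteq> essential_boundary A"
proof
  fix x assume "x \<in> reduced_boundary A"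
  then obtain \<mu> \<sigma> where pol: "polar_derivative A \<mu> \<sigma>" and pos: "\<And>r. r > 0 \<Longrightarrow> emeasure \<mu> (ball x r) > 0"
    by (auto simp: reduced_boundary_def)
  have sets [measurable_cong]: "sets \<mu> = sets borel" and fin: "\<And>C. compact C \<Longrightarrow> emeasure \<mu> C < \<infinity>"
    and \<sigma>m [measurable]: "\<sigma> \<in> borel_measurable borel" and \<sigma>1: "AE x in \<mu>. \<bar>\<sigma> x\<bar> = 1"
    and div: "\<And>\<phi>. \<phi> \<in> C1c UNIV \<Longrightarrow> (LINT x:A|lebesgue. divergence \<phi> x) = - (\<integral>x. \<phi> x * \<sigma> x \<partial>\<mu>)"
    using pol by (auto simp: polar_derivative_def C1_compact_fields_eq)
  show "x \<in> essential_boundary A"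
  proof (rule ccontr)
    assume "x \<notin> essential_boundary A"
    then have "x \<in> - essential_boundary A" "open (- essential_boundary A)"
      using closed_essential_boundary[OF A] by auto
    then obtain r where r: "r > 0" "ball x r \<subseteq> - essential_boundary A" using openE by metis
    have z: "(\<integral>x. \<psi> x * \<sigma> x \<partial>\<mu>) = 0" if \<psi>: "\<psi> \<in> C1c (ball x r)" for \<psi>
    proof -
      have "\<psi> s = 0" if "s \<in> essential_boundary A" for s
        using C1cE[OF \<psi>] r(2) that by (metis ComplD subsetD)
      then have e: "{s \<in> essential_boundary A. \<psi> s \<noteq> 0} = {}" by auto
      have U: "\<psi> \<in> C1c UNIV" using \<psi> C1c_mono[of "ball x r" UNIV] by auto
      have "(LINT x:A|lebesgue. divergence \<psi> x) = (\<integral>x. indicat_real A x * divergence \<psi> x \<partial>lborel)"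
        using A by (intro set_lebesgue_integral_AE_cong borel_measurable_divergence C1cD[OF \<psi>]) auto
      also have "\<dots> = 0"
        unfolding divergence_real using integral_deriv_eq_sum_jumps(2)[OF A disc \<psi>] e by simp
      finally show ?thesis using div[OF U] by simp
    qed
    (* intervals inside [c, d] are approximated by test functions supported in B2, which lies in the ball *)
    define c d where "c = x - r / 2" and "d = x + r / 2"
    define B2 where "B2 = {x - 3 * r / 4..x + 3 * r / 4}"
    have B2fin: "emeasure \<mu> B2 < \<infinity>" unfolding B2_def by (rule fin) auto
    have B2i: "integrable \<mu> (indicat_real B2)" using B2fin by (intro integrable_real_indicator) (auto simp: B2_def sets)
    have int0: "(\<integral>t. indicat_real {a..b} t * \<sigma> t \<partial>\<mu>) = 0" if ab: "c \<le> a" "b \<le> d" for a b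
    proof -
      define q where "q n = r / 4 / (real n + 1)" for n
      define J where "J n = {a - q n<..<b + q n}" for n
      have small: "0 < q n" "q n \<le> r / 4" for n
        using r(1) by (auto simp: q_def divide_le_eq mult_le_cancel_left1)
      have "\<exists>\<psi>. \<psi> \<in> C1c (J n) \<and> (\<forall>t. 0 \<le> \<psi> t \<and> \<psi> t \<le> (1::real)) \<and> (\<forall>t\<in>{a..b}. \<psi> t = 1)" for n
      proof -
        have "{a..b} \<subseteq> J n" using small(1)[of n] by (auto simp: J_def)
        then show ?thesis using C1c_bump[of "{a..b}" "J n"] by (metis J_def compact_Icc open_greaterThanLessThan)
      qed
      then obtain \<psi> where \<psi>: "\<And>n. \<psi> n \<in> C1c (J n)" "\<And>n t. 0 \<le> \<psi> n t" "\<And>n t. \<psi> n t \<le> (1::real)"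
        "\<And>n t. t \<in> {a..b} \<Longrightarrow> \<psi> n t = 1" by metis
      have out: "\<psi> n t = 0" if "t \<notin> J n" for n t using C1cE[OF \<psi>(1)] that by (metis subsetD)
      have JB: "J n \<subseteq> B2" for n
        using ab small[of n] by (auto simp: J_def B2_def c_def d_def)
      have JB': "J n \<subseteq> ball x r" for n
        using ab small[of n] r(1) by (auto simp: J_def c_def d_def dist_real_def abs_if)
      have [measurable]: "\<psi> n \<in> borel_measurable borel" for n
        by (rule borel_measurable_continuous_onI[OF continuous_on_C1_fun[OF C1cD[OF \<psi>(1)]]])
      have "(\<lambda>n. \<integral>t. \<psi> n t * \<sigma> t \<partial>\<mu>) \<longlonglongrightarrow> (\<integral>t. indicat_real {a..b} t * \<sigma> t \<partial>\<mu>)"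
      proof (rule integral_dominated_convergence[where w="indicat_real B2"])
        show "AE t in \<mu>. norm (\<psi> n t * \<sigma> t) \<le> indicat_real B2 t" for n
          using \<sigma>1
        proof eventually_elim
          case (elim t)
          then show ?case using out[of t n] JB[of n] \<psi>(2,3)[of n t] by (auto simp: indicator_def abs_mult)
        qed
        show "AE t in \<mu>. (\<lambda>n. \<psi> n t * \<sigma> t) \<longlonglongrightarrow> indicat_real {a..b} t * \<sigma> t"
        proof (rule AE_I2)
          fix t
          have "(\<lambda>n. \<psi> n t) \<longlonglongrightarrow> indicat_real {a..b} t"
          proof (cases "t \<in> {a..b}")
            case False
            then obtain g where g: "g > 0" "t \<le> a - g \<or> b + g \<le> t"
              by (metis add_diff_cancel_left' atLeastAtMost_iff diff_gt_0_iff_gt le_diff_eq linorder_not_le order_refl add.commute)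
            have "q \<longlonglongrightarrow> 0" unfolding q_def
              using LIMSEQ_Suc[OF lim_const_over_n[of "r / 4"]] by (simp add: add.commute)
            then have "\<forall>\<^sub>F n in sequentially. q n < g" using g(1) by (rule order_tendstoD)
            then have "\<forall>\<^sub>F n in sequentially. \<psi> n t = indicat_real {a..b} t"
            proof eventually_elim
              case (elim n)
              then have "t \<notin> J n" using g(2) by (auto simp: J_def)
              then show ?case using out False by simp
            qed
            then show ?thesis by (rule tendsto_eventually)
          qed (simp add: \<psi>(4))
          then show "(\<lambda>n. \<psi> n t * \<sigma> t) \<longlonglongrightarrow> indicat_real {a..b} t * \<sigma> t" by (intro tendsto_mult) auto
        qed
      qed (use B2i in \<open>auto\<close>)
      moreover have "(\<integral>t. \<psi> n t * \<sigma> t \<partial>\<mu>) = 0" for n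
        using z[of "\<psi> n"] \<psi>(1)[of n] C1c_mono[OF JB'] by blast
      ultimately show ?thesis by (simp add: LIMSEQ_const_iff)
    qed
    define B where "B = {c..d}"
    have Bm [measurable]: "B \<in> sets borel" by (simp add: B_def)
    have Bfin: "emeasure \<mu> B < \<infinity>" unfolding B_def by (rule fin) auto
    have Bi: "integrable \<mu> (indicat_real B)" using Bfin by (intro integrable_real_indicator) (auto simp: sets)
    have i\<sigma>: "integrable \<mu> (\<lambda>t. indicat_real X t * \<sigma> t)" if X [measurable]: "X \<in> sets borel" "X \<subseteq> B" for X
    proof (rule Bochner_Integration.integrable_bound[OF Bi])
      show "AE t in \<mu>. norm (indicat_real X t * \<sigma> t) \<le> norm (indicat_real B t)"
        using \<sigma>1 by eventually_elim (use that in \<open>auto simp: indicator_def abs_mult\<close>)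
    qed measurable
    have ray: "(\<integral>t. indicat_real (B \<inter> {y<..}) t * \<sigma> t \<partial>\<mu>) = 0" for y
    proof -
      have "(\<lambda>t. indicat_real (B \<inter> {y<..}) t * \<sigma> t) = (\<lambda>t. indicat_real {c..d} t * \<sigma> t - indicat_real {c..min y d} t * \<sigma> t)"
        by (auto simp: B_def indicator_def fun_eq_iff)
      then show ?thesis
        using int0[of c d] int0[of c "min y d"] i\<sigma>[of "{c..d}"] i\<sigma>[of "{c..min y d}"] by (simp add: B_def)
    qed
    (* \<nu> 1 and \<nu> (-1) are the positive and the negative part of \<sigma> \<mu> on B; they agree on rays, hence coincide, hence vanish *)
    define \<nu> where "\<nu> e = density \<mu> (\<lambda>t. ennreal (indicat_real B t * (e * \<sigma> t)))" for e :: real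
    have \<nu>: "emeasure (\<nu> e) X = (\<integral>\<^sup>+t. ennreal (indicat_real (B \<inter> X) t * (e * \<sigma> t)) \<partial>\<mu>)" if [measurable]: "X \<in> sets borel" for e X
      unfolding \<nu>_def by (subst emeasure_density) (auto simp: sets indicator_def intro!: nn_integral_cong)
    have "\<nu> 1 = \<nu> (-1)"
    proof (rule measure_eqI_lessThan)
      fix y :: real
      have i: "integrable \<mu> (\<lambda>t. indicat_real (B \<inter> {y<..}) t * \<sigma> t)" by (rule i\<sigma>) auto
      have f1: "(\<integral>\<^sup>+t. ennreal (indicat_real (B \<inter> {y<..}) t * \<sigma> t) \<partial>\<mu>) < \<infinity>"
        and f2: "(\<integral>\<^sup>+t. ennreal (- (indicat_real (B \<inter> {y<..}) t * \<sigma> t)) \<partial>\<mu>) < \<infinity>"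
        using real_integrable_def[of \<mu> "\<lambda>t. indicat_real (B \<inter> {y<..}) t * \<sigma> t"] i by (auto simp: less_top)
      show "emeasure (\<nu> 1) {y<..} < \<infinity>" using f1 by (simp add: \<nu>)
      have "enn2real (\<integral>\<^sup>+t. ennreal (indicat_real (B \<inter> {y<..}) t * \<sigma> t) \<partial>\<mu>)
          = enn2real (\<integral>\<^sup>+t. ennreal (- (indicat_real (B \<inter> {y<..}) t * \<sigma> t)) \<partial>\<mu>)"
        using ray[of y] real_lebesgue_integral_def[OF i] by simp
      then show "emeasure (\<nu> 1) {y<..} = emeasure (\<nu> (-1)) {y<..}"
        using f1 f2 by (simp add: \<nu>) (metis ennreal_enn2real infinity_ennreal_def)
    qed (auto simp: \<nu>_def sets)
    then have eqX: "(\<integral>\<^sup>+t. ennreal (indicat_real (B \<inter> X) t * \<sigma> t) \<partial>\<mu>) = (\<integral>\<^sup>+t. ennreal (- (indicat_real (B \<inter> X) t * \<sigma> t)) \<partial>\<mu>)"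
      if "X \<in> sets borel" for X using \<nu>[OF that, of 1] \<nu>[OF that, of "-1"] by simp
    have p [measurable]: "{t. \<sigma> t > 0} \<in> sets borel" "{t. \<sigma> t < 0} \<in> sets borel" by measurable
    have "(\<integral>\<^sup>+t. ennreal (- (indicat_real (B \<inter> {t. \<sigma> t > 0}) t * \<sigma> t)) \<partial>\<mu>) = 0"
      by (subst nn_integral_0_iff_AE) (auto simp: indicator_def ennreal_neg)
    then have "(\<integral>\<^sup>+t. ennreal (indicat_real (B \<inter> {t. \<sigma> t > 0}) t * \<sigma> t) \<partial>\<mu>) = 0" by (simp add: eqX[OF p(1)])
    then have a1: "AE t in \<mu>. ennreal (indicat_real (B \<inter> {t. \<sigma> t > 0}) t * \<sigma> t) = 0"
      by (subst (asm) nn_integral_0_iff_AE) measurable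
    have "(\<integral>\<^sup>+t. ennreal (indicat_real (B \<inter> {t. \<sigma> t < 0}) t * \<sigma> t) \<partial>\<mu>) = 0"
      by (subst nn_integral_0_iff_AE) (auto simp: indicator_def ennreal_neg)
    then have "(\<integral>\<^sup>+t. ennreal (- (indicat_real (B \<inter> {t. \<sigma> t < 0}) t * \<sigma> t)) \<partial>\<mu>) = 0" by (simp add: eqX[OF p(2)])
    then have a2: "AE t in \<mu>. ennreal (- (indicat_real (B \<inter> {t. \<sigma> t < 0}) t * \<sigma> t)) = 0"
      by (subst (asm) nn_integral_0_iff_AE) measurable
    have "AE t in \<mu>. t \<notin> B"
      using a1 a2 \<sigma>1
    proof eventually_elim
      case (elim t)
      show ?case
      proof
        assume "t \<in> B"
        then show False using elim by (cases "\<sigma> t" "0::real" rule: linorder_cases) (auto simp: ennreal_eq_0_iff)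
      qed
    qed
    then have "emeasure \<mu> B = 0"
      by (subst (asm) AE_iff_measurable[of B]) (auto simp: sets sets_eq_imp_space_eq[OF sets])
    moreover have "emeasure \<mu> (ball x (r / 2)) \<le> emeasure \<mu> B"
      by (intro emeasure_mono) (auto simp: B_def c_def d_def dist_real_def sets abs_real_def split: if_splits)
    ultimately show False using pos[of "r / 2"] r(1) by simp
  qed
qed

lemma reduced_boundary_real:
  assumes "A \<in> sets borel" "discrete_essential_boundary A"
  shows "reduced_boundary A = essential_boundary A"
  using assms by (intro antisym reduced_boundary_subset_essential_boundary essential_boundary_subset_reduced_boundary)

section \<open>Integration over the sphere\<close>

lemma AE_sphere_I: "(\<And>\<theta>. norm \<theta> = 1 \<Longrightarrow> P \<theta>) \<Longrightarrow> AE \<theta> in sphere_lborel. P \<theta>"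
  by (rule AE_I2) (simp add: space_sphere_lborel)

lemma integrable_sphere_bounded:
  fixes f :: "'a::euclidean_space \<Rightarrow> 'b::{banach, second_countable_topology}"
  assumes "f \<in> borel_measurable borel" "\<And>\<theta>. norm \<theta> = 1 \<Longrightarrow> norm (f \<theta>) \<le> B"
  shows "integrable sphere_lborel f"
  using finite_measure.integrable_const_bound[OF finite_sphere_lborel AE_sphere_I[OF assms(2)]
      measurable_sphere_lborel[OF assms(1)]] by simp

lemma integral_sphere_orthogonal:
  fixes f :: "'a::euclidean_space \<Rightarrow> real" and R :: "'a \<Rightarrow> 'a"
  assumes R: "orthogonal_transformation R" and f [measurable]: "f \<in> borel_measurable borel"
    and B: "\<And>\<theta>. norm \<theta> = 1 \<Longrightarrow> \<bar>f \<theta>\<bar> \<le> B"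
  shows "(\<integral>\<theta>. f (R \<theta>) \<partial>sphere_lborel) = (\<integral>\<theta>. f \<theta> \<partial>sphere_lborel)"
proof -
  have lin: "linear R" using R by (simp add: orthogonal_transformation_def)
  have Rm [measurable]: "R \<in> borel_measurable borel"
    using lin by (intro borel_measurable_continuous_onI linear_continuous_on) (simp add: linear_linear)
  have i: "integrable sphere_lborel f" "integrable sphere_lborel (\<lambda>\<theta>. f (R \<theta>))"
    using B by (auto intro!: integrable_sphere_bounded[of _ B] simp: orthogonal_transformation_norm[OF R])
  have "(\<integral>\<^sup>+\<theta>. ennreal (f (R \<theta>)) \<partial>sphere_lborel) = (\<integral>\<^sup>+\<theta>. ennreal (f \<theta>) \<partial>sphere_lborel)"
    "(\<integral>\<^sup>+\<theta>. ennreal (- f (R \<theta>)) \<partial>sphere_lborel) = (\<integral>\<^sup>+\<theta>. ennreal (- f \<theta>) \<partial>sphere_lborel)"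
    by (rule nn_integral_sphere_orthogonal[OF R], measurable)+
  then show ?thesis using i by (simp add: real_lebesgue_integral_def)
qed

definition mean_width :: "'a::euclidean_space itself \<Rightarrow> 'a \<Rightarrow> real" where
  "mean_width _ e = (\<integral>\<theta>. \<bar>\<theta> \<bullet> e\<bar> \<partial>sphere_lborel)"

text \<open>
  The constant \<open>C\<^sub>1\<^sub>,\<^sub>d\<close>; by rotation invariance every unit vector in place of this
  axis gives the same value.
\<close>

abbreviation sphere_const :: "(real ^ 'n) itself \<Rightarrow> real" where
  "sphere_const t \<equiv> mean_width t (axis undefined 1)"

lemma integral_sphere_inner:
  fixes e e' :: "real ^ 'n"
  assumes g: "g \<in> borel_measurable borel" "\<And>c. \<bar>c\<bar> \<le> 1 \<Longrightarrow> \<bar>g c\<bar> \<le> (B::real)" and e: "norm e = 1" "norm e' = 1"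
  shows "(\<integral>\<theta>. g (\<theta> \<bullet> e) \<partial>sphere_lborel) = (\<integral>\<theta>. g (\<theta> \<bullet> e') \<partial>sphere_lborel)"
proof -
  note [measurable] = g(1)
  obtain R where R: "orthogonal_transformation R" "R e = e'"
    using orthogonal_transformation_exists[of e e'] e by metis
  have in1: "\<bar>\<theta> \<bullet> e'\<bar> \<le> 1" if "norm \<theta> = 1" for \<theta> using Cauchy_Schwarz_ineq2[of \<theta> e'] e that by simp
  have "(\<integral>\<theta>. g (\<theta> \<bullet> e) \<partial>sphere_lborel) = (\<integral>\<theta>. g (R \<theta> \<bullet> e') \<partial>sphere_lborel)"
    using R by (simp add: orthogonal_transformation_def flip: R(2))
  also have "\<dots> = (\<integral>\<theta>. g (\<theta> \<bullet> e') \<partial>sphere_lborel)"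
    by (rule integral_sphere_orthogonal[OF R(1), of "\<lambda>\<theta>. g (\<theta> \<bullet> e')" B]) (auto intro!: g(2) in1)
  finally show ?thesis .
qed

lemma mean_width_unit:
  fixes e :: "real ^ 'n"
  assumes "norm e = 1" shows "mean_width t e = sphere_const TYPE(real ^ 'n)"
  unfolding mean_width_def by (rule integral_sphere_inner[of abs 1]) (use assms in \<open>auto simp: norm_axis_1\<close>)

lemma mean_width_scale: "mean_width t v = norm v * mean_width t (sgn v)"
proof -
  have "mean_width t v = (\<integral>\<theta>. norm v * \<bar>\<theta> \<bullet> sgn v\<bar> \<partial>sphere_lborel)"
    unfolding mean_width_def
  proof (rule Bochner_Integration.integral_cong)
    fix \<theta>
    have "v = norm v *\<^sub>R sgn v" by (cases "v = 0") (auto simp: sgn_div_norm)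
    then have "\<bar>\<theta> \<bullet> v\<bar> = \<bar>norm v * (\<theta> \<bullet> sgn v)\<bar>" by (metis inner_scaleR_right)
    then show "\<bar>\<theta> \<bullet> v\<bar> = norm v * \<bar>\<theta> \<bullet> sgn v\<bar>" by (simp add: abs_mult)
  qed simp
  then show ?thesis by (simp add: mean_width_def)
qed

lemma mean_width_eq:
  fixes v :: "real ^ 'n"
  shows "mean_width t v = norm v * sphere_const TYPE(real ^ 'n)"
proof (cases "v = 0")
  case False
  then show ?thesis
    using mean_width_scale[of t v] mean_width_unit[of "sgn v" t] by (simp add: norm_sgn)
qed (simp add: mean_width_def)

lemma inner_sphere_bound: "norm \<theta> = 1 \<Longrightarrow> \<bar>\<theta> \<bullet> v\<bar> \<le> norm v"
  using Cauchy_Schwarz_ineq2[of \<theta> v] by simp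

text \<open>
  Otherwise almost every direction, and thus almost every point of the ball, would be orthogonal to a fixed
  vector.
\<close>

lemma sphere_const_pos: "sphere_const TYPE(real ^ 'n) > 0"
proof -
  define e where "e = (axis undefined 1 :: real ^ 'n)"
  have e: "norm e = 1" by (simp add: e_def norm_axis_1)
  have nn: "sphere_const TYPE(real ^ 'n) \<ge> 0" unfolding mean_width_def by (intro integral_nonneg_AE) auto
  have i: "integrable sphere_lborel (\<lambda>\<theta>. \<bar>\<theta> \<bullet> e\<bar>)"
    by (rule integrable_sphere_bounded[of _ 1]) (use inner_sphere_bound[of _ e] e in auto)
  have "sphere_const TYPE(real ^ 'n) \<noteq> 0"
  proof
    assume "sphere_const TYPE(real ^ 'n) = 0"
    then have "AE \<theta> in sphere_lborel. \<theta> \<bullet> e = 0"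
      using integral_nonneg_eq_0_iff_AE[OF i] by (simp add: mean_width_def e_def)
    then have "(\<integral>\<^sup>+\<theta>. indicator {\<theta>. \<theta> \<bullet> e \<noteq> 0} \<theta> \<partial>sphere_lborel) = (0::ennreal)"
      by (subst nn_integral_0_iff_AE) (auto intro!: measurable_sphere_lborel elim!: eventually_mono)
    then have "(\<integral>\<^sup>+x. indicator {\<theta>. \<theta> \<bullet> e \<noteq> 0} (x /\<^sub>R norm x) * indicator (ball 0 1 - {0}) x \<partial>lborel) = (0::ennreal)"
      by (subst (asm) nn_integral_sphere_lborel) auto
    then have "AE x in lborel. indicator {\<theta>. \<theta> \<bullet> e \<noteq> 0} (x /\<^sub>R norm x) * indicator (ball 0 1 - {0}) x = (0::ennreal)"
      by (subst (asm) nn_integral_0_iff_AE) (auto intro!: borel_measurable_times borel_measurable_indicator)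
    moreover have "AE x in lborel. e \<bullet> x \<noteq> 0"
    proof -
      have "negligible {x. e \<bullet> x = 0}" using e by (intro negligible_hyperplane) auto
      then have "AE x in lebesgue. x \<notin> {x. e \<bullet> x = 0}"
        by (intro AE_not_in) (simp add: negligible_iff_null_sets)
      then show ?thesis by (simp add: AE_completion_iff)
    qed
    ultimately have "AE x in lborel. x \<notin> ball (0::real^'n) 1"
      by eventually_elim (auto simp: indicator_def inner_commute split: if_splits)
    then have "emeasure lborel (ball (0::real^'n) 1) = 0"
      by (subst (asm) AE_iff_measurable[of "ball 0 1"]) auto
    then have "ball (0::real^'n) 1 \<in> null_sets lebesgue" by (intro null_sets_completionI) (auto simp: null_sets_def)
    then show False
      using open_not_negligible[of "ball (0::real^'n) 1"] by (auto simp: negligible_iff_null_sets)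
  qed
  then show ?thesis using nn by simp
qed

text \<open>
  By reflection in the line through \<open>v\<close> only the component of \<open>u\<close> along \<open>v\<close>
  contributes.
\<close>

lemma integral_sphere_sgn:
  fixes v u :: "real ^ 'n"
  shows "(\<integral>\<theta>. norm v * sgn (v \<bullet> \<theta>) * (\<theta> \<bullet> u) \<partial>sphere_lborel) = sphere_const TYPE(real ^ 'n) * (v \<bullet> u)"
proof (cases "v = 0")
  case False
  define e where "e = sgn v"
  have e: "norm e = 1" "e \<bullet> e = 1" using False by (auto simp: e_def norm_sgn norm_eq_1[symmetric])
  have v: "v = norm v *\<^sub>R e" using False by (simp add: e_def sgn_div_norm)
  have sv: "sgn (v \<bullet> \<theta>) = sgn (e \<bullet> \<theta>)" for \<theta>
    by (subst v) (use False in \<open>simp add: sgn_mult\<close>)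
  define u' where "u' = u - (u \<bullet> e) *\<^sub>R e"
  have ue: "u' \<bullet> e = 0" by (simp add: u'_def inner_diff_left e)
  define R where "R x = (2 * (x \<bullet> e)) *\<^sub>R e - x" for x
  have R: "orthogonal_transformation R"
    unfolding orthogonal_transformation_def
  proof
    show "linear R" by (rule linearI) (auto simp: R_def inner_add_left algebra_simps scaleR_add_left)
    show "\<forall>v w. R v \<bullet> R w = v \<bullet> w"
      by (auto simp: R_def inner_diff_left inner_diff_right e inner_commute algebra_simps)
  qed
  have m: "(\<lambda>\<theta>. sgn (e \<bullet> \<theta>) * (\<theta> \<bullet> w)) \<in> borel_measurable borel" for w :: "real ^ 'n" by measurable
  have b: "\<bar>sgn (e \<bullet> \<theta>) * (\<theta> \<bullet> w)\<bar> \<le> norm w" if "norm \<theta> = 1" for \<theta> w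
    using inner_sphere_bound[OF that, of w] by (auto simp: abs_mult sgn_if)
  have i: "integrable sphere_lborel (\<lambda>\<theta>. sgn (e \<bullet> \<theta>) * (\<theta> \<bullet> w))" for w
    by (rule integrable_sphere_bounded[OF m, of _ "norm w"]) (use b in auto)
  have "(\<integral>\<theta>. sgn (e \<bullet> \<theta>) * (\<theta> \<bullet> u') \<partial>sphere_lborel) = (\<integral>\<theta>. sgn (e \<bullet> R \<theta>) * (R \<theta> \<bullet> u') \<partial>sphere_lborel)"
    by (rule integral_sphere_orthogonal[OF R m b, symmetric])
  also have "\<dots> = (\<integral>\<theta>. - (sgn (e \<bullet> \<theta>) * (\<theta> \<bullet> u')) \<partial>sphere_lborel)"
  proof (rule Bochner_Integration.integral_cong)
    fix \<theta>
    have "e \<bullet> R \<theta> = e \<bullet> \<theta>" by (simp add: R_def inner_diff_right e inner_commute)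
    moreover have "R \<theta> \<bullet> u' = - (\<theta> \<bullet> u')" unfolding R_def inner_diff_left inner_scaleR_left using ue by (simp add: inner_commute)
    ultimately show "sgn (e \<bullet> R \<theta>) * (R \<theta> \<bullet> u') = - (sgn (e \<bullet> \<theta>) * (\<theta> \<bullet> u'))" by simp
  qed simp
  finally have z: "(\<integral>\<theta>. sgn (e \<bullet> \<theta>) * (\<theta> \<bullet> u') \<partial>sphere_lborel) = 0" by simp
  have ee: "(\<integral>\<theta>. sgn (e \<bullet> \<theta>) * (\<theta> \<bullet> e) \<partial>sphere_lborel) = sphere_const TYPE(real ^ 'n)"
  proof -
    have "(\<integral>\<theta>. sgn (e \<bullet> \<theta>) * (\<theta> \<bullet> e) \<partial>sphere_lborel) = mean_width TYPE(real ^ 'n) e"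
      unfolding mean_width_def by (rule Bochner_Integration.integral_cong) (auto simp: inner_commute abs_sgn mult.commute)
    then show ?thesis using mean_width_unit[OF e(1)] by simp
  qed
  have "(\<integral>\<theta>. norm v * sgn (v \<bullet> \<theta>) * (\<theta> \<bullet> u) \<partial>sphere_lborel)
      = (\<integral>\<theta>. norm v * ((u \<bullet> e) * (sgn (e \<bullet> \<theta>) * (\<theta> \<bullet> e)) + sgn (e \<bullet> \<theta>) * (\<theta> \<bullet> u')) \<partial>sphere_lborel)"
    by (rule Bochner_Integration.integral_cong) (auto simp: sv u'_def inner_diff_right algebra_simps)
  also have "\<dots> = norm v * ((u \<bullet> e) * sphere_const TYPE(real ^ 'n))"
    using i by (simp add: z ee)
  also have "\<dots> = sphere_const TYPE(real ^ 'n) * (v \<bullet> u)"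
    by (subst (2) v) (simp add: inner_commute)
  finally show ?thesis .
qed simp

section \<open>Directional variation\<close>

text \<open>Linear in \<open>v\<close>, which is what permits averaging over directions.\<close>

definition dir_pairing :: "'a::euclidean_space set \<Rightarrow> ('a \<Rightarrow> real) \<Rightarrow> 'a \<Rightarrow> real" where
  "dir_pairing E \<psi> v = (\<integral>x. indicat_real E x * dir_deriv \<psi> v x \<partial>lborel)"

definition tests :: "'a::euclidean_space set \<Rightarrow> ('a \<Rightarrow> real) set" where
  "tests A = {\<psi> \<in> C1c A. \<forall>x. \<bar>\<psi> x\<bar> \<le> 1}"

text \<open>
  The total variation in \<open>A\<close> of the derivative of \<open>\<chi>\<^sub>E\<close> in the direction
  \<open>v\<close>.
\<close>

definition dir_variation :: "'a::euclidean_space set \<Rightarrow> 'a \<Rightarrow> 'a set \<Rightarrow> ennreal" where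
  "dir_variation E v A = (SUP \<psi>\<in>tests A. ennreal (dir_pairing E \<psi> v))"

lemma zero_tests: "(\<lambda>_. 0) \<in> tests A"
proof -
  have "(\<lambda>_. 0::real) \<in> C1c A" by (rule C1cI[OF C1_fun_const, of "{}"]) auto
  then show ?thesis by (simp add: tests_def)
qed

lemma linear_dir_pairing:
  fixes \<psi> :: "'a::euclidean_space \<Rightarrow> real"
  assumes E: "E \<in> sets borel" and \<psi>: "\<psi> \<in> C1c A"
  shows "linear (dir_pairing E \<psi>)"
proof -
  have i: "integrable lborel (\<lambda>x. indicat_real E x * dir_deriv \<psi> v x)" for v
    by (intro integrable_indicator_mult dir_deriv_integrable[OF \<psi>]) (use E in auto)
  note l = linear_dir_deriv[OF C1cD[OF \<psi>]]
  show ?thesis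
    unfolding dir_pairing_def
    by (rule linearI) (simp_all add: linear_add[OF l] linear_cmul[OF l] distrib_left i mult.left_commute[of _ r for r])
qed

lemma continuous_dir_pairing:
  fixes \<psi> :: "'a::euclidean_space \<Rightarrow> real"
  assumes "E \<in> sets borel" "\<psi> \<in> C1c A"
  shows "continuous_on UNIV (dir_pairing E \<psi>)"
  using linear_dir_pairing[OF assms] by (intro linear_continuous_on) (simp add: linear_linear)

lemma measurable_dir_pairing:
  fixes \<psi> :: "'a::euclidean_space \<Rightarrow> real"
  assumes "E \<in> sets borel" "\<psi> \<in> C1c A"
  shows "dir_pairing E \<psi> \<in> borel_measurable borel"
  by (rule borel_measurable_continuous_onI[OF continuous_dir_pairing[OF assms]])

text \<open>
  A supremum of continuous functions is the supremum of countably many of them, by Lindelof's theorem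
  for the superlevel sets.
\<close>

lemma dir_variation_countable:
  fixes E A :: "'a::euclidean_space set"
  assumes E: "E \<in> sets borel"
  obtains \<psi> :: "nat \<Rightarrow> 'a \<Rightarrow> real" where "\<psi> 0 = (\<lambda>_. 0)" "\<And>i. \<psi> i \<in> tests A"
    "\<And>v. dir_variation E v A = (SUP i. ennreal (dir_pairing E (\<psi> i) v))"
proof -
  define U where "U q \<psi> = {v. dir_pairing E \<psi> v > q}" for q :: real and \<psi>
  have op: "open (U q \<psi>)" if "\<psi> \<in> tests A" for q \<psi>
    unfolding U_def using that
    by (intro open_Collect_less continuous_on_const continuous_dir_pairing[OF E, of _ A]) (auto simp: tests_def)
  have "\<exists>T. countable T \<and> T \<subseteq> tests A \<and> (\<Union>\<psi>\<in>T. U q \<psi>) = (\<Union>\<psi>\<in>tests A. U q \<psi>)" for q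
  proof -
    obtain F where F: "F \<subseteq> U q ` tests A" "countable F" "\<Union>F = \<Union>(U q ` tests A)"
      using Lindelof[of "U q ` tests A"] op by blast
    then obtain T where "countable T" "T \<subseteq> tests A" "F = U q ` T"
      using countable_subset_image[of F "U q" "tests A"] by auto
    then show ?thesis using F(3) by auto
  qed
  then obtain T where T: "\<And>q. countable (T q)" "\<And>q. T q \<subseteq> tests A" "\<And>q. (\<Union>\<psi>\<in>T q. U q \<psi>) = (\<Union>\<psi>\<in>tests A. U q \<psi>)"
    by metis
  define S where "S = (\<Union>q\<in>\<rat>. T q)"
  have S: "countable S" "S \<subseteq> tests A" using T countable_rat by (auto simp: S_def)
  define \<psi> where "\<psi> = case_nat (\<lambda>_. 0) (from_nat_into (insert (\<lambda>_. 0) S))"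
  have rng: "range (from_nat_into (insert (\<lambda>_. 0) S)) = insert (\<lambda>_. 0) S"
    by (rule range_from_nat_into) (use S in auto)
  have \<psi>t: "\<psi> i \<in> tests A" for i
  proof (cases i)
    case (Suc n)
    have "from_nat_into (insert (\<lambda>_. 0) S) n \<in> insert (\<lambda>_. 0) S" using rng by blast
    then show ?thesis using Suc S(2) zero_tests by (auto simp: \<psi>_def)
  qed (simp add: \<psi>_def zero_tests)
  have "dir_variation E v A = (SUP i. ennreal (dir_pairing E (\<psi> i) v))" for v
  proof (rule antisym)
    show "(SUP i. ennreal (dir_pairing E (\<psi> i) v)) \<le> dir_variation E v A"
      unfolding dir_variation_def using \<psi>t by (intro SUP_least SUP_upper)
    show "dir_variation E v A \<le> (SUP i. ennreal (dir_pairing E (\<psi> i) v))"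
      unfolding dir_variation_def
    proof (rule SUP_least)
      fix \<phi> assume \<phi>: "\<phi> \<in> tests A"
      show "ennreal (dir_pairing E \<phi> v) \<le> (SUP i. ennreal (dir_pairing E (\<psi> i) v))"
      proof (rule ccontr)
        assume "\<not> ?thesis"
        then have lt: "(SUP i. ennreal (dir_pairing E (\<psi> i) v)) < ennreal (dir_pairing E \<phi> v)" by simp
        then obtain s where s: "(SUP i. ennreal (dir_pairing E (\<psi> i) v)) = ennreal s" "s \<ge> 0"
          by (metis ennreal_cases infinity_ennreal_def not_less top_greatest)
        then have "s < dir_pairing E \<phi> v" using lt by (simp add: ennreal_less_iff)
        then obtain q where q: "q \<in> \<rat>" "s < q" "q < dir_pairing E \<phi> v" using Rats_dense_in_real by blast
        then have "v \<in> (\<Union>\<psi>\<in>T q. U q \<psi>)" using T(3) \<phi> by (auto simp: U_def)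
        then obtain \<xi> where \<xi>: "\<xi> \<in> S" "dir_pairing E \<xi> v > q" using q by (auto simp: S_def U_def)
        then obtain n where "from_nat_into (insert (\<lambda>_. 0) S) n = \<xi>" using rng by (metis (no_types, lifting) imageE insertCI)
        then have "\<psi> (Suc n) = \<xi>" by (simp add: \<psi>_def)
        then have "ennreal (dir_pairing E \<xi> v) \<le> ennreal s"
          unfolding s(1)[symmetric] by (intro SUP_upper2[of "Suc n"]) auto
        then show False using \<xi>(2) q(2) s(2) by (simp add: ennreal_le_iff)
      qed
    qed
  qed
  then show ?thesis using that[of \<psi>] \<psi>t by (simp add: \<psi>_def)
qed

lemma measurable_dir_variation:
  fixes E A :: "'a::euclidean_space set"
  assumes E: "E \<in> sets borel"
  shows "(\<lambda>v. dir_variation E v A) \<in> borel_measurable borel"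
proof -
  obtain \<psi> :: "nat \<Rightarrow> 'a \<Rightarrow> real" where \<psi>: "\<psi> 0 = (\<lambda>_. 0)" "\<And>i. \<psi> i \<in> tests A"
    "\<And>v. dir_variation E v A = (SUP i. ennreal (dir_pairing E (\<psi> i) v))"
    using dir_variation_countable[OF E] by blast
  have [measurable]: "dir_pairing E (\<psi> i) \<in> borel_measurable borel" for i
    using \<psi>(2)[of i] by (intro measurable_dir_pairing[OF E, of _ A]) (auto simp: tests_def)
  show ?thesis unfolding \<psi>(3) by measurable
qed

lemma variation_in_open_eq':
  assumes "E \<in> sets borel"
  shows "variation_in_open E A =
    (SUP \<phi>\<in>{\<phi> \<in> C1c A. \<forall>x. norm (\<phi> x) \<le> 1}. ennreal (\<integral>x. indicat_real E x * divergence \<phi> x \<partial>lborel))"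
  by (rule variation_in_open_eq) (use assms in auto)

lemma pairing_le_variation:
  fixes \<phi> :: "'a::euclidean_space \<Rightarrow> 'a"
  assumes E: "E \<in> sets borel" and V: "variation_in_open E A = ennreal V" "V \<ge> 0"
    and \<phi>: "\<phi> \<in> C1c A" "\<And>x. norm (\<phi> x) \<le> B" and B: "B > 0"
  shows "(\<integral>x. indicat_real E x * divergence \<phi> x \<partial>lborel) \<le> B * V"
proof -
  define \<phi>' where "\<phi>' = (\<lambda>x. (1 / B) *\<^sub>R \<phi> x)"
  have bl: "bounded_linear (\<lambda>y::'a. (1 / B) *\<^sub>R y)" by (rule bounded_linear_scaleR_right)
  have D: "(\<phi>' has_derivative (\<lambda>v. (1 / B) *\<^sub>R dir_deriv \<phi> v x)) (at x)" for x
    unfolding \<phi>'_def by (rule bounded_linear.has_derivative[OF bl C1_fun_has_derivative[OF C1cD[OF \<phi>(1)]]])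
  have div: "divergence \<phi>' x = (1 / B) * divergence \<phi> x" for x
    unfolding divergence_def frechet_derivative_at[OF D, symmetric] by (simp add: sum_distrib_left)
  obtain S where S: "compact S" "S \<subseteq> A" "\<And>x. x \<notin> S \<Longrightarrow> \<phi> x = 0" using C1cE[OF \<phi>(1)] by metis
  have "\<phi>' \<in> C1c A"
    unfolding \<phi>'_def
    by (rule C1cI[OF C1_fun_compose[OF C1cD[OF \<phi>(1)] C1_fun_bounded_linear[OF bl]] S(1,2)]) (simp add: S(3))
  moreover have "norm (\<phi>' x) \<le> 1" for x using \<phi>(2)[of x] B by (simp add: \<phi>'_def divide_le_eq)
  ultimately have "ennreal (\<integral>x. indicat_real E x * divergence \<phi>' x \<partial>lborel) \<le> ennreal V"
    unfolding V(1)[symmetric] variation_in_open_eq'[OF E] by (intro SUP_upper) auto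
  then have "(\<integral>x. indicat_real E x * divergence \<phi>' x \<partial>lborel) \<le> V" using V(2) by (auto simp: ennreal_le_iff2)
  moreover have "(\<integral>x. indicat_real E x * divergence \<phi>' x \<partial>lborel) = (1 / B) * (\<integral>x. indicat_real E x * divergence \<phi> x \<partial>lborel)"
    unfolding div by (subst integral_mult_right_zero[symmetric]) (simp add: mult_ac)
  ultimately have "(\<integral>x. indicat_real E x * divergence \<phi> x \<partial>lborel) / B \<le> V" by simp
  then show ?thesis using B by (simp add: pos_divide_le_eq mult.commute)
qed

lemma dir_variation_le_variation:
  fixes E A :: "'a::euclidean_space set"
  assumes E: "E \<in> sets borel" and \<theta>: "norm \<theta> = 1"
  shows "dir_variation E \<theta> A \<le> variation_in_open E A"
  unfolding dir_variation_def variation_in_open_eq'[OF E]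
proof (rule SUP_least)
  fix \<psi> assume \<psi>: "\<psi> \<in> tests A"
  define \<phi> where "\<phi> = (\<lambda>x. \<Sum>i\<in>{()}. \<psi> x *\<^sub>R \<theta>)"
  have "\<phi> \<in> C1c A" unfolding \<phi>_def using \<psi> by (intro C1c_sum_scaleR) (auto simp: tests_def)
  moreover have "norm (\<phi> x) \<le> 1" for x using \<psi> \<theta> by (auto simp: \<phi>_def tests_def)
  moreover have "divergence \<phi> x = dir_deriv \<psi> \<theta> x" for x
    unfolding \<phi>_def using \<psi> by (subst divergence_sum_scaleR) (auto simp: tests_def C1cD)
  ultimately show "ennreal (dir_pairing E \<psi> \<theta>) \<le> (SUP \<phi>\<in>{\<phi> \<in> C1c A. \<forall>x. norm (\<phi> x) \<le> 1}. ennreal (\<integral>x. indicat_real E x * divergence \<phi> x \<partial>lborel))"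
    by (intro SUP_upper2[of \<phi>]) (auto simp: dir_pairing_def)
qed

text \<open>
  The field is \<open>\<Phi>(x) = \<integral> \<psi>\<^sub>j\<^sub>(\<^sub>\<theta>\<^sub>)(x) \<theta>
  d\<theta>\<close>. Since \<open>j\<close> takes finitely many values, it is a finite sum of test functions times
  vectors, so its regularity and its divergence need no differentiation under the integral.
\<close>

lemma selection_field:
  fixes E A :: "'a::euclidean_space set" and j :: "'a \<Rightarrow> nat"
  assumes E: "E \<in> sets borel" and j [measurable]: "j \<in> borel \<rightarrow>\<^sub>M count_space UNIV" and jN: "\<And>\<theta>. j \<theta> \<le> N"
    and \<psi>: "\<And>i. i \<le> N \<Longrightarrow> \<psi> i \<in> tests A"
  obtains \<Phi> where "\<Phi> \<in> C1c A" "\<And>x v. \<Phi> x \<bullet> v = (\<integral>\<theta>. \<psi> (j \<theta>) x * (\<theta> \<bullet> v) \<partial>sphere_lborel)"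
    "(\<integral>x. indicat_real E x * divergence \<Phi> x \<partial>lborel) = (\<integral>\<theta>. dir_pairing E (\<psi> (j \<theta>)) \<theta> \<partial>sphere_lborel)"
    "integrable sphere_lborel (\<lambda>\<theta>. dir_pairing E (\<psi> (j \<theta>)) \<theta>)"
proof -
  have [measurable]: "{\<theta>. j \<theta> = i} \<in> sets borel" for i by measurable
  have \<psi>C: "\<psi> i \<in> C1c A" if "i \<le> N" for i using \<psi>[OF that] by (simp add: tests_def)
  define w where "w i = (\<integral>\<theta>. indicat_real {\<theta>. j \<theta> = i} \<theta> *\<^sub>R \<theta> \<partial>sphere_lborel)" for i
  have iw: "integrable sphere_lborel (\<lambda>\<theta>. indicat_real {\<theta>. j \<theta> = i} \<theta> *\<^sub>R \<theta>)" for i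
    by (rule integrable_sphere_bounded[of _ 1]) (auto simp: indicator_def)
  have pick: "(\<Sum>i\<in>{..N}. indicat_real {\<theta>. j \<theta> = i} \<theta> * f i) = f (j \<theta>)" for f \<theta>
    using jN[of \<theta>] by (simp add: indicator_def of_bool_def if_distrib[where f="\<lambda>x. x * _"] sum.delta' cong: if_cong)
  have lw: "f (w i) = (\<integral>\<theta>. indicat_real {\<theta>. j \<theta> = i} \<theta> * f \<theta> \<partial>sphere_lborel)"
    and li: "integrable sphere_lborel (\<lambda>\<theta>. indicat_real {\<theta>. j \<theta> = i} \<theta> * f \<theta>)" if f: "linear f" for f :: "'a \<Rightarrow> real" and i
  proof -
    have bl: "bounded_linear f" using f by (simp add: linear_conv_bounded_linear)
    have e: "f (indicat_real {\<theta>. j \<theta> = i} \<theta> *\<^sub>R \<theta>) = indicat_real {\<theta>. j \<theta> = i} \<theta> * f \<theta>" for \<theta>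
      by (simp add: linear_cmul[OF f])
    show "f (w i) = (\<integral>\<theta>. indicat_real {\<theta>. j \<theta> = i} \<theta> * f \<theta> \<partial>sphere_lborel)"
      unfolding w_def using integral_bounded_linear[OF bl iw[of i]] by (simp add: e)
    show "integrable sphere_lborel (\<lambda>\<theta>. indicat_real {\<theta>. j \<theta> = i} \<theta> * f \<theta>)"
      using integrable_bounded_linear[OF bl iw[of i]] by (simp add: e)
  qed
  define \<Phi> where "\<Phi> = (\<lambda>x. \<Sum>i\<in>{..N}. \<psi> i x *\<^sub>R w i)"
  have \<Phi>C: "\<Phi> \<in> C1c A" unfolding \<Phi>_def by (intro C1c_sum_scaleR) (auto intro: \<psi>C)
  moreover have "\<Phi> x \<bullet> v = (\<integral>\<theta>. \<psi> (j \<theta>) x * (\<theta> \<bullet> v) \<partial>sphere_lborel)" for x v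
  proof -
    have lin: "linear (\<lambda>\<theta>. \<psi> i x * (\<theta> \<bullet> v))" for i by (rule linearI) (auto simp: inner_add_left algebra_simps)
    have "\<Phi> x \<bullet> v = (\<Sum>i\<in>{..N}. \<integral>\<theta>. indicat_real {\<theta>. j \<theta> = i} \<theta> * (\<psi> i x * (\<theta> \<bullet> v)) \<partial>sphere_lborel)"
      by (simp add: \<Phi>_def inner_sum_left lw[OF lin, symmetric])
    also have "\<dots> = (\<integral>\<theta>. (\<Sum>i\<in>{..N}. indicat_real {\<theta>. j \<theta> = i} \<theta> * (\<psi> i x * (\<theta> \<bullet> v))) \<partial>sphere_lborel)"
      by (rule Bochner_Integration.integral_sum[symmetric]) (rule li[OF lin])
    finally show ?thesis by (simp only: pick)
  qed
  moreover have I: "integrable sphere_lborel (\<lambda>\<theta>. \<Sum>i\<in>{..N}. indicat_real {\<theta>. j \<theta> = i} \<theta> * dir_pairing E (\<psi> i) \<theta>)"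
    by (intro Bochner_Integration.integrable_sum li linear_dir_pairing[OF E, of _ A] \<psi>C) auto
  moreover have "(\<integral>x. indicat_real E x * divergence \<Phi> x \<partial>lborel) = (\<integral>\<theta>. dir_pairing E (\<psi> (j \<theta>)) \<theta> \<partial>sphere_lborel)"
  proof -
    have "(\<integral>x. indicat_real E x * divergence \<Phi> x \<partial>lborel)
        = (\<integral>x. (\<Sum>i\<in>{..N}. indicat_real E x * dir_deriv (\<psi> i) (w i) x) \<partial>lborel)"
      unfolding \<Phi>_def by (subst divergence_sum_scaleR) (auto intro: C1cD[OF \<psi>C] simp: sum_distrib_left)
    also have "\<dots> = (\<Sum>i\<in>{..N}. dir_pairing E (\<psi> i) (w i))"
      unfolding dir_pairing_def
      by (rule Bochner_Integration.integral_sum) (use E in \<open>auto intro!: integrable_indicator_mult dir_deriv_integrable \<psi>C\<close>)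
    also have "\<dots> = (\<Sum>i\<in>{..N}. \<integral>\<theta>. indicat_real {\<theta>. j \<theta> = i} \<theta> * dir_pairing E (\<psi> i) \<theta> \<partial>sphere_lborel)"
      by (intro sum.cong refl lw linear_dir_pairing[OF E, of _ A] \<psi>C) auto
    also have "\<dots> = (\<integral>\<theta>. (\<Sum>i\<in>{..N}. indicat_real {\<theta>. j \<theta> = i} \<theta> * dir_pairing E (\<psi> i) \<theta>) \<partial>sphere_lborel)"
      by (rule Bochner_Integration.integral_sum[symmetric]) (intro li linear_dir_pairing[OF E, of _ A] \<psi>C, auto)
    finally show ?thesis by (simp only: pick[where f="\<lambda>i. dir_pairing E (\<psi> i) _"])
  qed
  ultimately show ?thesis
    using that by (simp only: pick[where f="\<lambda>i. dir_pairing E (\<psi> i) _"])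
qed

text \<open>
  Choosing in every direction the best among the first \<open>N\<close> test functions of a countable supremum
  gives a field \<open>\<Phi>\<close> with \<open>|\<Phi>|\<^sup>2 = \<integral>
  \<psi>\<^sub>j\<^sub>(\<^sub>\<theta>\<^sub>) \<langle>\<theta>, \<Phi>\<rangle> d\<theta> \<le> \<integral>
  |\<langle>\<theta>, \<Phi>\<rangle>| d\<theta> = C\<^sub>1\<^sub>,\<^sub>d |\<Phi>|\<close>.
\<close>

lemma nn_integral_dir_variation_le:
  fixes E A :: "(real ^ 'n) set"
  assumes E: "E \<in> sets borel" and V: "variation_in_open E A = ennreal V" "V \<ge> 0"
  shows "(\<integral>\<^sup>+\<theta>. dir_variation E \<theta> A \<partial>sphere_lborel) \<le> ennreal (sphere_const TYPE(real ^ 'n) * V)"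
proof -
  obtain \<psi> :: "nat \<Rightarrow> real ^ 'n \<Rightarrow> real" where \<psi>: "\<psi> 0 = (\<lambda>_. 0)" "\<And>i. \<psi> i \<in> tests A"
    "\<And>v. dir_variation E v A = (SUP i. ennreal (dir_pairing E (\<psi> i) v))"
    using dir_variation_countable[OF E] by blast
  have pm [measurable]: "dir_pairing E (\<psi> i) \<in> borel_measurable borel" for i
    using \<psi>(2)[of i] by (intro measurable_dir_pairing[OF E, of _ A]) (auto simp: tests_def)
  define G where "G N \<theta> = (MAX i\<in>{..N}. dir_pairing E (\<psi> i) \<theta>)" for N :: nat and \<theta>
  have G: "dir_pairing E (\<psi> i) \<theta> \<le> G N \<theta>" if "i \<le> N" for i N \<theta>
    unfolding G_def using that by (intro Max_ge) auto
  have Gex: "\<exists>i\<le>N. dir_pairing E (\<psi> i) \<theta> = G N \<theta>" for N \<theta>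
  proof -
    have "G N \<theta> \<in> (\<lambda>i. dir_pairing E (\<psi> i) \<theta>) ` {..N}" unfolding G_def by (intro Max_in) auto
    then show ?thesis by auto
  qed
  have sup: "dir_variation E \<theta> A = (SUP N. ennreal (G N \<theta>))" for \<theta>
    unfolding \<psi>(3)
  proof (rule antisym)
    show "(SUP i. ennreal (dir_pairing E (\<psi> i) \<theta>)) \<le> (SUP N. ennreal (G N \<theta>))"
      by (intro SUP_mono) (auto intro!: ennreal_leI G)
    show "(SUP N. ennreal (G N \<theta>)) \<le> (SUP i. ennreal (dir_pairing E (\<psi> i) \<theta>))"
      using Gex by (intro SUP_mono) (metis UNIV_I order_refl)
  qed
  have inc: "incseq (\<lambda>N \<theta>. ennreal (G N \<theta>))"
  proof (intro monoI le_funI ennreal_leI)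
    fix N M :: nat and \<theta> assume "N \<le> M"
    then show "G N \<theta> \<le> G M \<theta>" using Gex[of N \<theta>] G[of _ M \<theta>] by (metis order_trans)
  qed
  have Gm [measurable]: "G N \<in> borel_measurable borel" for N
    unfolding G_def[abs_def] by (rule borel_measurable_Max) (auto intro: pm)
  have each: "(\<integral>\<^sup>+\<theta>. ennreal (G N \<theta>) \<partial>sphere_lborel) \<le> ennreal (sphere_const TYPE(real ^ 'n) * V)" for N
  proof -
    define j where "j \<theta> = (LEAST i. dir_pairing E (\<psi> i) \<theta> = G N \<theta>)" for \<theta>
    have jm: "j \<in> borel \<rightarrow>\<^sub>M count_space UNIV" unfolding j_def by (rule measurable_Least) measurable
    have jN: "j \<theta> \<le> N" for \<theta>
    proof -
      obtain i where i: "i \<le> N" "dir_pairing E (\<psi> i) \<theta> = G N \<theta>" using Gex by blast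
      have "j \<theta> \<le> i" unfolding j_def by (rule Least_le) (rule i)
      then show ?thesis using i by simp
    qed
    have jG: "dir_pairing E (\<psi> (j \<theta>)) \<theta> = G N \<theta>" for \<theta> using Gex[of N \<theta>] unfolding j_def by (metis (mono_tags, lifting) LeastI)
    obtain \<Phi> where \<Phi>: "\<Phi> \<in> C1c A" "\<And>x v. \<Phi> x \<bullet> v = (\<integral>\<theta>. \<psi> (j \<theta>) x * (\<theta> \<bullet> v) \<partial>sphere_lborel)"
      "(\<integral>x. indicat_real E x * divergence \<Phi> x \<partial>lborel) = (\<integral>\<theta>. dir_pairing E (\<psi> (j \<theta>)) \<theta> \<partial>sphere_lborel)"
      "integrable sphere_lborel (\<lambda>\<theta>. dir_pairing E (\<psi> (j \<theta>)) \<theta>)"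
      by (rule selection_field[OF E jm jN \<psi>(2)]) (rule that)
    have nb: "norm (\<Phi> x) \<le> sphere_const TYPE(real ^ 'n)" for x
    proof -
      have "norm (\<Phi> x) * norm (\<Phi> x) = \<Phi> x \<bullet> \<Phi> x" by (simp add: dot_square_norm power2_eq_square)
      also have "\<dots> = (\<integral>\<theta>. \<psi> (j \<theta>) x * (\<theta> \<bullet> \<Phi> x) \<partial>sphere_lborel)" by (rule \<Phi>(2))
      also have "\<dots> \<le> (\<integral>\<theta>. \<bar>\<theta> \<bullet> \<Phi> x\<bar> \<partial>sphere_lborel)"
      proof (rule integral_mono')
        show "integrable sphere_lborel (\<lambda>\<theta>. \<bar>\<theta> \<bullet> \<Phi> x\<bar>)"
          by (rule integrable_sphere_bounded[of _ "norm (\<Phi> x)"]) (auto intro: inner_sphere_bound)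
        fix \<theta>
        have "\<bar>\<psi> (j \<theta>) x\<bar> \<le> 1" using \<psi>(2) by (auto simp: tests_def)
        then have "\<bar>\<psi> (j \<theta>) x * (\<theta> \<bullet> \<Phi> x)\<bar> \<le> 1 * \<bar>\<theta> \<bullet> \<Phi> x\<bar>" unfolding abs_mult by (intro mult_right_mono) auto
        then show "\<psi> (j \<theta>) x * (\<theta> \<bullet> \<Phi> x) \<le> \<bar>\<theta> \<bullet> \<Phi> x\<bar>" by linarith
      qed simp
      also have "\<dots> = norm (\<Phi> x) * sphere_const TYPE(real ^ 'n)"
        using mean_width_eq[of "TYPE(real ^ 'n)" "\<Phi> x"] by (simp add: mean_width_def)
      finally show ?thesis using sphere_const_pos[where 'n='n] by (cases "\<Phi> x = 0") auto
    qed
    have G0: "0 \<le> G N \<theta>" for \<theta>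
    proof -
      have "dir_pairing E (\<psi> 0) \<theta> = 0" by (simp add: dir_pairing_def \<psi>(1))
      then show ?thesis using G[of 0 N \<theta>] by simp
    qed
    have "(\<integral>\<^sup>+\<theta>. ennreal (G N \<theta>) \<partial>sphere_lborel) = ennreal (\<integral>\<theta>. G N \<theta> \<partial>sphere_lborel)"
      using \<Phi>(4) G0 by (intro nn_integral_eq_integral) (auto simp: jG)
    also have "(\<integral>\<theta>. G N \<theta> \<partial>sphere_lborel) = (\<integral>x. indicat_real E x * divergence \<Phi> x \<partial>lborel)"
      by (simp add: \<Phi>(3) jG)
    also have "\<dots> \<le> sphere_const TYPE(real ^ 'n) * V"
      by (rule pairing_le_variation[OF E V \<Phi>(1) nb sphere_const_pos])
    finally show ?thesis by (simp add: ennreal_leI)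
  qed
  have "(\<integral>\<^sup>+\<theta>. dir_variation E \<theta> A \<partial>sphere_lborel) = (SUP N. \<integral>\<^sup>+\<theta>. ennreal (G N \<theta>) \<partial>sphere_lborel)"
    unfolding sup by (rule nn_integral_monotone_convergence_SUP[OF inc]) (auto intro!: measurable_sphere_lborel)
  also have "\<dots> \<le> ennreal (sphere_const TYPE(real ^ 'n) * V)" by (intro SUP_least each)
  finally show ?thesis .
qed

subsection \<open>The lower bound\<close>

text \<open>
  A smooth approximation of \<open>|v| sgn \<langle>v, \<theta>\<rangle>\<close>. The first factor replaces
  \<open>|v|\<close>; subtracting \<open>\<delta>\<close> makes it at most \<open>|v|\<close> and zero at \<open>v
  = 0\<close>, so that composition with a test field keeps the bound and the support. The error is small only
  where \<open>\<langle>v, \<theta>\<rangle>\<close> is not, but its average over the sphere is uniformly small.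
\<close>

definition smooth_sgn :: "real \<Rightarrow> 'a::real_inner \<Rightarrow> 'a \<Rightarrow> real" where
  "smooth_sgn \<delta> v \<theta> = (sqrt (v \<bullet> v + \<delta>\<^sup>2) - \<delta>) * ((v \<bullet> \<theta>) * inverse (sqrt ((v \<bullet> \<theta>)\<^sup>2 + \<delta>\<^sup>2)))"

lemma sqrt_add_square_bounds:
  assumes "\<delta> > 0" shows "\<bar>t\<bar> \<le> sqrt (t\<^sup>2 + \<delta>\<^sup>2)" "sqrt (t\<^sup>2 + \<delta>\<^sup>2) \<le> \<bar>t\<bar> + \<delta>" "\<delta> \<le> sqrt (t\<^sup>2 + \<delta>\<^sup>2)" "0 < sqrt (t\<^sup>2 + \<delta>\<^sup>2)"
proof -
  show "\<bar>t\<bar> \<le> sqrt (t\<^sup>2 + \<delta>\<^sup>2)" by (rule real_le_rsqrt) simp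
  show "\<delta> \<le> sqrt (t\<^sup>2 + \<delta>\<^sup>2)" by (rule real_le_rsqrt) simp
  have "t\<^sup>2 + \<delta>\<^sup>2 \<le> (\<bar>t\<bar> + \<delta>)\<^sup>2" using assms by (simp add: power2_sum)
  then show "sqrt (t\<^sup>2 + \<delta>\<^sup>2) \<le> \<bar>t\<bar> + \<delta>" using assms by (intro real_le_lsqrt) auto
  show "0 < sqrt (t\<^sup>2 + \<delta>\<^sup>2)" using assms by (simp add: add_nonneg_pos)
qed

lemma smooth_sgn_bounds:
  assumes \<delta>: "\<delta> > 0" and v: "norm v \<le> 1"
  shows "\<bar>smooth_sgn \<delta> v \<theta>\<bar> \<le> 1"
    and "\<bar>norm v * sgn (v \<bullet> \<theta>) - smooth_sgn \<delta> v \<theta>\<bar> \<le> \<delta> + min 1 (\<delta> / \<bar>\<theta> \<bullet> sgn v\<bar>)"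
proof -
  define n where "n = sqrt (v \<bullet> v + \<delta>\<^sup>2) - \<delta>"
  have vv: "v \<bullet> v = (norm v)\<^sup>2" by (simp add: dot_square_norm)
  have n: "0 \<le> n" "n \<le> norm v" "norm v \<le> n + \<delta>"
    using sqrt_add_square_bounds[OF \<delta>, of "norm v"] by (auto simp: n_def vv)
  define t where "t = v \<bullet> \<theta>"
  define q where "q = sqrt (t\<^sup>2 + \<delta>\<^sup>2)"
  have q: "q > 0" "\<bar>t\<bar> \<le> q" "q \<le> \<bar>t\<bar> + \<delta>" using sqrt_add_square_bounds[OF \<delta>, of t] by (auto simp: q_def)
  have S: "smooth_sgn \<delta> v \<theta> = n * (t / q)" by (simp add: smooth_sgn_def n_def t_def q_def divide_inverse)
  have tq: "\<bar>t / q\<bar> \<le> 1" using q by (simp add: abs_divide)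
  have "\<bar>n * (t / q)\<bar> \<le> 1 * 1" unfolding abs_mult using n v tq by (intro mult_mono) auto
  then show "\<bar>smooth_sgn \<delta> v \<theta>\<bar> \<le> 1" by (simp add: S)
  have "\<bar>norm v * sgn t - n * (t / q)\<bar> \<le> \<bar>(norm v - n) * (t / q)\<bar> + norm v * \<bar>sgn t - t / q\<bar>"
  proof -
    have "norm v * sgn t - n * (t / q) = (norm v - n) * (t / q) + norm v * (sgn t - t / q)" by (simp add: algebra_simps)
    then show ?thesis using abs_triangle_ineq[of "(norm v - n) * (t / q)" "norm v * (sgn t - t / q)"] by (simp add: abs_mult)
  qed
  moreover have "\<bar>(norm v - n) * (t / q)\<bar> \<le> \<delta> * 1" unfolding abs_mult using n tq by (intro mult_mono) auto
  moreover have "norm v * \<bar>sgn t - t / q\<bar> \<le> min 1 (\<delta> / \<bar>\<theta> \<bullet> sgn v\<bar>)"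
  proof (cases "t = 0")
    case False
    then have v0: "norm v > 0" by (auto simp: t_def)
    have ts: "\<bar>t\<bar> = norm v * \<bar>\<theta> \<bullet> sgn v\<bar>"
      using v0 by (simp add: t_def sgn_div_norm inner_commute abs_mult)
    have e: "\<bar>sgn t - t / q\<bar> = 1 - \<bar>t\<bar> / q"
      using False q tq by (cases "t > 0") (auto simp: abs_if)
    have "1 - \<bar>t\<bar> / q = (q - \<bar>t\<bar>) / q" using q by (simp add: diff_divide_distrib)
    also have "\<dots> \<le> \<delta> / q" using q by (intro divide_right_mono) auto
    also have "\<dots> \<le> \<delta> / \<bar>t\<bar>" using q False \<delta> by (intro divide_left_mono) auto
    finally have "norm v * \<bar>sgn t - t / q\<bar> \<le> norm v * (\<delta> / \<bar>t\<bar>)" unfolding e using v0 by (intro mult_left_mono) auto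
    also have "\<dots> = \<delta> / \<bar>\<theta> \<bullet> sgn v\<bar>" using v0 by (simp add: ts)
    finally have 1: "norm v * \<bar>sgn t - t / q\<bar> \<le> \<delta> / \<bar>\<theta> \<bullet> sgn v\<bar>" .
    have "norm v * \<bar>sgn t - t / q\<bar> \<le> 1 * 1" unfolding e using v q by (intro mult_mono) auto
    then show ?thesis using 1 by simp
  qed (use \<delta> in simp)
  ultimately show "\<bar>norm v * sgn (v \<bullet> \<theta>) - smooth_sgn \<delta> v \<theta>\<bar> \<le> \<delta> + min 1 (\<delta> / \<bar>\<theta> \<bullet> sgn v\<bar>)"
    unfolding S t_def[symmetric] by linarith
qed

lemma continuous_on_smooth_sgn:
  assumes "\<delta> > 0" shows "continuous_on S (\<lambda>(v,\<theta>). smooth_sgn \<delta> v \<theta>)"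
  unfolding smooth_sgn_def case_prod_beta
  using sqrt_add_square_bounds(4)[OF assms] by (intro continuous_intros) (metis less_irrefl)

lemma smooth_sgn_tests:
  fixes \<phi> :: "'a::euclidean_space \<Rightarrow> 'a"
  assumes \<delta>: "\<delta> > 0" and \<phi>: "\<phi> \<in> C1c A" "\<And>x. norm (\<phi> x) \<le> 1"
  shows "(\<lambda>x. smooth_sgn \<delta> (\<phi> x) \<theta>) \<in> tests A"
proof -
  note C = C1cD[OF \<phi>(1)]
  have pos: "\<phi> x \<bullet> \<phi> x + \<delta>\<^sup>2 > 0" "(\<phi> x \<bullet> \<theta>)\<^sup>2 + \<delta>\<^sup>2 > 0" for x using \<delta> by (auto intro!: add_nonneg_pos)
  have sq: "C1_fun (\<lambda>x. sqrt (f x))" if f: "C1_fun f" "\<And>x. f x > 0" for f :: "'a \<Rightarrow> real"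
  proof (rule C1_fun_real_compose[where h=sqrt and h'="\<lambda>z. inverse (sqrt z) / 2"])
    note c = continuous_on_C1_fun[OF f(1)]
    show "continuous_on UNIV (\<lambda>x. inverse (sqrt (f x)) / 2)"
      using f(2) by (intro continuous_intros c) (auto simp: less_imp_neq[symmetric])
  qed (use f DERIV_real_sqrt in auto)
  have inv: "C1_fun (\<lambda>x. inverse (f x))" if f: "C1_fun f" "\<And>x. f x > 0" for f :: "'a \<Rightarrow> real"
  proof (rule C1_fun_real_compose[where h=inverse and h'="\<lambda>z. - (inverse z * inverse z)"])
    note c = continuous_on_C1_fun[OF f(1)]
    show "continuous_on UNIV (\<lambda>x. - (inverse (f x) * inverse (f x)))"
      using f(2) by (intro continuous_intros c) (auto simp: less_imp_neq[symmetric])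
    fix x
    have "f x \<noteq> 0" using f(2)[of x] by simp
    then show "(inverse has_real_derivative - (inverse (f x) * inverse (f x))) (at (f x))"
      using DERIV_inverse_fun[OF DERIV_ident, of "f x" UNIV] by (simp add: power2_eq_square)
  qed (use f in auto)
  have c\<theta>: "C1_fun (\<lambda>x. \<phi> x \<bullet> \<theta>)" by (rule C1_fun_inner[OF C C1_fun_const])
  have c1: "C1_fun (\<lambda>x. \<phi> x \<bullet> \<phi> x + \<delta>\<^sup>2)" by (rule C1_fun_add[OF C1_fun_inner[OF C C] C1_fun_const])
  have c2: "C1_fun (\<lambda>x. (\<phi> x \<bullet> \<theta>)\<^sup>2 + \<delta>\<^sup>2)"
    unfolding power2_eq_square[of "_ \<bullet> \<theta>"] by (rule C1_fun_add[OF C1_fun_mult[OF c\<theta> c\<theta>] C1_fun_const])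
  have c3: "C1_fun (\<lambda>x. inverse (sqrt ((\<phi> x \<bullet> \<theta>)\<^sup>2 + \<delta>\<^sup>2)))"
    by (rule inv[OF sq[OF c2 pos(2)]]) (use pos(2) in simp)
  have "C1_fun (\<lambda>x. smooth_sgn \<delta> (\<phi> x) \<theta>)"
    unfolding smooth_sgn_def
    by (rule C1_fun_mult[OF C1_fun_diff[OF sq[OF c1 pos(1)] C1_fun_const] C1_fun_mult[OF c\<theta> c3]])
  moreover obtain S where S: "compact S" "S \<subseteq> A" "\<And>x. x \<notin> S \<Longrightarrow> \<phi> x = 0" using C1cE[OF \<phi>(1)] by metis
  ultimately have "(\<lambda>x. smooth_sgn \<delta> (\<phi> x) \<theta>) \<in> C1c A"
    by (intro C1cI[OF _ S(1,2)]) (auto simp: S(3) smooth_sgn_def)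
  then show ?thesis using smooth_sgn_bounds(1)[OF \<delta> \<phi>(2)] by (simp add: tests_def)
qed

lemma mean_min_tendsto_0:
  fixes e :: "'a::euclidean_space"
  shows "(\<lambda>n. \<integral>\<theta>. min 1 (1 / (real n + 1) / \<bar>\<theta> \<bullet> e\<bar>) \<partial>sphere_lborel) \<longlonglongrightarrow> 0"
proof -
  have "(\<lambda>n. \<integral>\<theta>. min 1 (1 / (real n + 1) / \<bar>\<theta> \<bullet> e\<bar>) \<partial>sphere_lborel) \<longlonglongrightarrow> (\<integral>\<theta>. 0 \<partial>(sphere_lborel :: 'a measure))"
  proof (rule integral_dominated_convergence[where w="\<lambda>_. 1"])
    show "AE \<theta> in sphere_lborel. (\<lambda>n. min 1 (1 / (real n + 1) / \<bar>\<theta> \<bullet> e\<bar>)) \<longlonglongrightarrow> 0"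
    proof (rule AE_I2)
      fix \<theta> :: 'a
      have "(\<lambda>n. 1 / (real n + 1)) \<longlonglongrightarrow> 0"
        using LIMSEQ_Suc[OF lim_const_over_n[of "1::real"]] by (simp add: add.commute)
      then have "(\<lambda>n. min 1 (1 / (real n + 1) / \<bar>\<theta> \<bullet> e\<bar>)) \<longlonglongrightarrow> min 1 (0 / \<bar>\<theta> \<bullet> e\<bar>)"
      proof (cases "\<theta> \<bullet> e = 0")
        case False
        assume "(\<lambda>n. 1 / (real n + 1)) \<longlonglongrightarrow> 0"
        then show ?thesis using False by (intro tendsto_min tendsto_const tendsto_divide) auto
      qed simp
      then show "(\<lambda>n. min 1 (1 / (real n + 1) / \<bar>\<theta> \<bullet> e\<bar>)) \<longlonglongrightarrow> 0" by simp
    qed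
    show "integrable (sphere_lborel :: 'a measure) (\<lambda>_. 1::real)" by (rule integrable_sphere_bounded[of _ 1]) auto
  qed (auto intro!: measurable_sphere_lborel)
  then show ?thesis by simp
qed

text \<open>Compactness of the sphere; taking the first close point of the net makes the choice measurable.\<close>

lemma sphere_finite_net:
  assumes d: "d > 0"
  obtains p :: "nat \<Rightarrow> real ^ 'n" and N j where "j \<in> borel \<rightarrow>\<^sub>M count_space UNIV" "\<And>\<theta>. j \<theta> \<le> N"
    "\<And>i. i \<le> N \<Longrightarrow> norm (p i) = 1" "\<And>\<theta>. norm \<theta> = 1 \<Longrightarrow> dist (p (j \<theta>)) \<theta> < d"
proof -
  have "sphere 0 1 \<subseteq> (\<Union>\<theta>\<in>sphere (0::real^'n) 1. ball \<theta> d)" using d by auto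
  then obtain K where K: "K \<subseteq> sphere (0::real^'n) 1" "finite K" "sphere 0 1 \<subseteq> (\<Union>\<theta>\<in>K. ball \<theta> d)"
    using compactE_image[OF compact_sphere, of "sphere (0::real^'n) 1" "\<lambda>\<theta>. ball \<theta> d" 0 1] by (metis open_ball)
  have "axis undefined 1 \<in> sphere (0::real^'n) 1" by (simp add: norm_axis_1)
  then have "K \<noteq> {}" using K(3) by blast
  obtain xs where xs: "set xs = K" using finite_list[OF K(2)] by blast
  define N where "N = length xs - 1"
  have len: "i \<le> N \<longleftrightarrow> i < length xs" for i using \<open>K \<noteq> {}\<close> xs by (cases xs) (auto simp: N_def)
  define j where "j \<theta> = (LEAST i. dist (xs ! i) \<theta> < d \<or> i = N)" for \<theta>
  have jm: "j \<in> borel \<rightarrow>\<^sub>M count_space UNIV" unfolding j_def by (rule measurable_Least) measurable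
  have jN: "j \<theta> \<le> N" for \<theta> unfolding j_def by (rule Least_le) simp
  have jd: "dist (xs ! j \<theta>) \<theta> < d" if "norm \<theta> = 1" for \<theta>
  proof -
    have "\<theta> \<in> sphere 0 1" using that by simp
    then have "\<theta> \<in> (\<Union>\<theta>\<in>K. ball \<theta> d)" using K(3) by blast
    then obtain i where i: "i \<le> N" "dist (xs ! i) \<theta> < d" using xs by (auto simp: in_set_conv_nth len)
    have le: "j \<theta> \<le> i" unfolding j_def by (rule Least_le) (use i in simp)
    have "dist (xs ! j \<theta>) \<theta> < d \<or> j \<theta> = N" unfolding j_def by (rule LeastI[of _ N]) simp
    then show ?thesis using le i by auto
  qed
  have "norm (xs ! i) = 1" if "i \<le> N" for i
  proof -
    have "xs ! i \<in> K" using that xs len by (metis nth_mem)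
    then show ?thesis using K(1) by auto
  qed
  then show ?thesis using that[of j N "\<lambda>i. xs ! i"] jm jN jd by blast
qed

text \<open>
  A test field \<open>\<phi>\<close> satisfies \<open>C\<^sub>1\<^sub>,\<^sub>d \<phi> = \<integral> |\<phi>|
  sgn\<langle>\<phi>, \<theta>\<rangle> \<theta> d\<theta>\<close>. Smoothing the sign, and replacing
  \<open>\<theta>\<close> by a close point of a finite net, turns the integrand into finitely many scalar test
  functions, whose average \<open>\<Phi>\<close> is uniformly close to \<open>C\<^sub>1\<^sub>,\<^sub>d
  \<phi>\<close>. A uniform error \<open>e\<close> costs at most \<open>e V\<close> in the pairing.
\<close>

lemma nn_integral_dir_variation_ge:
  fixes E A :: "(real ^ 'n) set"
  assumes E: "E \<in> sets borel" and V: "variation_in_open E A = ennreal V" "V \<ge> 0"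
  shows "ennreal (sphere_const TYPE(real ^ 'n) * V) \<le> (\<integral>\<^sup>+\<theta>. dir_variation E \<theta> A \<partial>sphere_lborel)"
proof -
  define c where "c = sphere_const TYPE(real ^ 'n)"
  have c: "c > 0" using sphere_const_pos by (simp add: c_def)
  define M where "M = measure (sphere_lborel :: (real^'n) measure) (space sphere_lborel)"
  have M: "M \<ge> 0" by (simp add: M_def)
  interpret fm: finite_measure "sphere_lborel :: (real^'n) measure" by (rule finite_sphere_lborel)
  obtain w where w: "(\<integral>\<^sup>+\<theta>. dir_variation E \<theta> A \<partial>sphere_lborel) = ennreal w" "w \<ge> 0"
    using nn_integral_dir_variation_le[OF E V] by (metis ennreal_cases ennreal_less_top infinity_ennreal_def leD)
  have key: "c * (\<integral>x. indicat_real E x * divergence \<phi> x \<partial>lborel) \<le> w"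
    if \<phi>: "\<phi> \<in> C1c A" "\<And>x. norm (\<phi> x) \<le> 1" for \<phi>
  proof (rule field_le_epsilon)
    fix e0 :: real assume e0: "e0 > 0"
    define e where "e = e0 / (V + 1)"
    have e: "e > 0" using e0 V(2) by (simp add: e_def)
    have eV: "e * V \<le> e0"
    proof -
      have "e * V \<le> e * (V + 1)" using e by (intro mult_left_mono) auto
      then show ?thesis using V(2) by (simp add: e_def)
    qed
    define a where "a = (axis undefined 1 :: real^'n)"
    have na: "norm a = 1" by (simp add: a_def norm_axis_1)
    (* the mean error of the smoothed sign for a unit vector; by rotation invariance it is the same for all of them *)
    define \<eta> where "\<eta> n = (\<integral>\<theta>. min 1 (1 / (real n + 1) / \<bar>\<theta> \<bullet> a\<bar>) \<partial>sphere_lborel)" for n :: nat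
    have "(\<lambda>n. 1 / (real n + 1) * M + \<eta> n) \<longlonglongrightarrow> 0 * M + 0"
      unfolding \<eta>_def using LIMSEQ_Suc[OF lim_const_over_n[of "1::real"]]
      by (intro tendsto_add tendsto_mult tendsto_const mean_min_tendsto_0) (simp add: add.commute)
    then have "\<forall>\<^sub>F n in sequentially. 1 / (real n + 1) * M + \<eta> n < e / 2"
      using e by (intro order_tendstoD(2)) auto
    then obtain n where n: "1 / (real n + 1) * M + \<eta> n < e / 2" by (auto simp: eventually_sequentially)
    define \<delta> where "\<delta> = 1 / (real n + 1)"
    have \<delta>: "\<delta> > 0" by (simp add: \<delta>_def)
    (* the error allowed for moving \<theta> to the net; integrated over the sphere it is at most e/2 *)
    define e1 where "e1 = e / (2 * (M + 1))"
    have e1: "e1 > 0" "e1 * M \<le> e / 2"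
      using e M by (auto simp: e1_def field_simps)
    define g where "g = (\<lambda>(v::real^'n,\<theta>). smooth_sgn \<delta> v \<theta>)"
    define X where "X = cball (0::real^'n) 1 \<times> sphere (0::real^'n) 1"
    have "uniformly_continuous_on X g" unfolding g_def X_def
      by (intro compact_uniformly_continuous continuous_on_smooth_sgn[OF \<delta>] compact_Times) auto
    from this[unfolded uniformly_continuous_on_def, THEN spec, THEN mp, OF e1(1)]
    obtain d where d0: "d > 0" "\<forall>z\<in>X. \<forall>z'\<in>X. dist z' z < d \<longrightarrow> dist (g z') (g z) < e1" by (elim exE conjE)
    have d: "d > 0" "\<And>v \<theta> \<theta>'. norm v \<le> 1 \<Longrightarrow> norm \<theta> = 1 \<Longrightarrow> norm (\<theta>'::real^'n) = 1 \<Longrightarrow> dist \<theta> \<theta>' < d \<Longrightarrow>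
        dist (smooth_sgn \<delta> v \<theta>) (smooth_sgn \<delta> v \<theta>') < e1"
    proof -
      fix v \<theta> \<theta>' :: "real^'n" assume "norm v \<le> 1" "norm \<theta> = 1" "norm \<theta>' = 1" "dist \<theta> \<theta>' < d"
      then show "dist (smooth_sgn \<delta> v \<theta>) (smooth_sgn \<delta> v \<theta>') < e1"
        using d0(2)[THEN bspec, of "(v, \<theta>')", THEN bspec, of "(v, \<theta>)"] by (simp add: dist_Pair_Pair g_def X_def)
    qed (rule d0(1))
    obtain p :: "nat \<Rightarrow> real ^ 'n" and N j where j: "j \<in> borel \<rightarrow>\<^sub>M count_space UNIV" "\<And>\<theta>. j \<theta> \<le> N"
      and p: "\<And>i. i \<le> N \<Longrightarrow> norm (p i) = 1" "\<And>\<theta>. norm \<theta> = 1 \<Longrightarrow> dist (p (j \<theta>)) \<theta> < d"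
      by (rule sphere_finite_net[OF d(1)]) (rule that)
    note [measurable] = j(1)
    define \<psi> where "\<psi> i x = smooth_sgn \<delta> (\<phi> x) (p i)" for i x
    have \<psi>t: "\<psi> i \<in> tests A" for i unfolding \<psi>_def[abs_def] by (rule smooth_sgn_tests[OF \<delta> \<phi>])
    obtain \<Phi> where \<Phi>: "\<Phi> \<in> C1c A" "\<And>x v. \<Phi> x \<bullet> v = (\<integral>\<theta>. \<psi> (j \<theta>) x * (\<theta> \<bullet> v) \<partial>sphere_lborel)"
      "(\<integral>x. indicat_real E x * divergence \<Phi> x \<partial>lborel) = (\<integral>\<theta>. dir_pairing E (\<psi> (j \<theta>)) \<theta> \<partial>sphere_lborel)"
      "integrable sphere_lborel (\<lambda>\<theta>. dir_pairing E (\<psi> (j \<theta>)) \<theta>)"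
      by (rule selection_field[OF E j \<psi>t]) (rule that)
    have near: "norm (c *\<^sub>R \<phi> x - \<Phi> x) \<le> e" for x
    proof -
      define v where "v = \<phi> x"
      define u where "u = sgn (c *\<^sub>R v - \<Phi> x)"
      have u: "norm u \<le> 1" by (simp add: u_def norm_sgn)
      have v: "norm v \<le> 1" using \<phi>(2) by (simp add: v_def)
      have m1: "(\<lambda>\<theta>. norm v * sgn (v \<bullet> \<theta>) * (\<theta> \<bullet> u)) \<in> borel_measurable borel" by measurable
      have m2: "(\<lambda>\<theta>. \<psi> (j \<theta>) x * (\<theta> \<bullet> u)) \<in> borel_measurable borel" by measurable
      have tu: "\<bar>\<theta> \<bullet> u\<bar> \<le> 1" if "norm \<theta> = 1" for \<theta> using inner_sphere_bound[OF that, of u] u by linarith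
      have b1: "\<bar>norm v * sgn (v \<bullet> \<theta>)\<bar> \<le> 1" for \<theta> using v by (auto simp: abs_mult sgn_if)
      have b2: "\<bar>\<psi> i x\<bar> \<le> 1" for i using \<psi>t[of i] by (simp add: tests_def)
      have i1: "integrable sphere_lborel (\<lambda>\<theta>. norm v * sgn (v \<bullet> \<theta>) * (\<theta> \<bullet> u))"
      proof (rule integrable_sphere_bounded[OF m1, of 1])
        fix \<theta> :: "real^'n" assume \<theta>: "norm \<theta> = 1"
        show "norm (norm v * sgn (v \<bullet> \<theta>) * (\<theta> \<bullet> u)) \<le> 1"
          using mult_mono[OF b1[of \<theta>] tu[OF \<theta>]] by (simp add: abs_mult)
      qed
      have i2: "integrable sphere_lborel (\<lambda>\<theta>. \<psi> (j \<theta>) x * (\<theta> \<bullet> u))"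
      proof (rule integrable_sphere_bounded[OF m2, of 1])
        fix \<theta> :: "real^'n" assume \<theta>: "norm \<theta> = 1"
        show "norm (\<psi> (j \<theta>) x * (\<theta> \<bullet> u)) \<le> 1"
          using mult_mono[OF b2[of "j \<theta>"] tu[OF \<theta>]] by (simp add: abs_mult)
      qed
      define B where "B \<theta> = e1 + (\<delta> + min 1 (\<delta> / \<bar>\<theta> \<bullet> sgn v\<bar>))" for \<theta>
      have im: "integrable sphere_lborel (\<lambda>\<theta>. min 1 (\<delta> / \<bar>\<theta> \<bullet> sgn v\<bar>))"
        by (rule integrable_sphere_bounded[of _ 1]) (use \<delta> in auto)
      have "norm (c *\<^sub>R v - \<Phi> x) = (c *\<^sub>R v - \<Phi> x) \<bullet> u"
        by (cases "c *\<^sub>R v - \<Phi> x = 0") (auto simp: u_def sgn_div_norm dot_square_norm power2_eq_square)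
      also have "\<dots> = (\<integral>\<theta>. norm v * sgn (v \<bullet> \<theta>) * (\<theta> \<bullet> u) \<partial>sphere_lborel) - (\<integral>\<theta>. \<psi> (j \<theta>) x * (\<theta> \<bullet> u) \<partial>sphere_lborel)"
        by (simp add: inner_diff_left \<Phi>(2) integral_sphere_sgn c_def)
      also have "\<dots> = (\<integral>\<theta>. (norm v * sgn (v \<bullet> \<theta>) - \<psi> (j \<theta>) x) * (\<theta> \<bullet> u) \<partial>sphere_lborel)"
        using i1 i2 by (simp add: left_diff_distrib)
      also have "\<dots> \<le> (\<integral>\<theta>. B \<theta> \<partial>sphere_lborel)"
      proof (rule integral_mono_AE)
        show "integrable sphere_lborel (\<lambda>\<theta>. (norm v * sgn (v \<bullet> \<theta>) - \<psi> (j \<theta>) x) * (\<theta> \<bullet> u))"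
          using i1 i2 by (simp add: left_diff_distrib)
        show "integrable sphere_lborel B" unfolding B_def using im by simp
        show "AE \<theta> in sphere_lborel. (norm v * sgn (v \<bullet> \<theta>) - \<psi> (j \<theta>) x) * (\<theta> \<bullet> u) \<le> B \<theta>"
        proof (rule AE_sphere_I)
          fix \<theta> :: "real^'n" assume \<theta>: "norm \<theta> = 1"
          have "\<bar>smooth_sgn \<delta> v \<theta> - \<psi> (j \<theta>) x\<bar> < e1"
            using d(2)[OF v p(1)[OF j(2)] \<theta> p(2)[OF \<theta>]] by (simp add: \<psi>_def v_def dist_real_def abs_minus_commute)
          moreover have "\<bar>norm v * sgn (v \<bullet> \<theta>) - smooth_sgn \<delta> v \<theta>\<bar> \<le> \<delta> + min 1 (\<delta> / \<bar>\<theta> \<bullet> sgn v\<bar>)"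
            by (rule smooth_sgn_bounds(2)[OF \<delta> v])
          ultimately have 1: "\<bar>norm v * sgn (v \<bullet> \<theta>) - \<psi> (j \<theta>) x\<bar> \<le> B \<theta>" unfolding B_def by linarith
          have "\<bar>(norm v * sgn (v \<bullet> \<theta>) - \<psi> (j \<theta>) x) * (\<theta> \<bullet> u)\<bar> \<le> B \<theta> * 1"
            unfolding abs_mult using 1 tu[OF \<theta>] by (intro mult_mono) auto
          then show "(norm v * sgn (v \<bullet> \<theta>) - \<psi> (j \<theta>) x) * (\<theta> \<bullet> u) \<le> B \<theta>" by linarith
        qed
      qed
      also have "\<dots> = e1 * M + (\<delta> * M + (\<integral>\<theta>. min 1 (\<delta> / \<bar>\<theta> \<bullet> sgn v\<bar>) \<partial>sphere_lborel))"
        unfolding B_def M_def using im by (simp add: mult.commute)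
      also have "(\<integral>\<theta>. min 1 (\<delta> / \<bar>\<theta> \<bullet> sgn v\<bar>) \<partial>sphere_lborel) \<le> \<eta> n"
      proof (cases "v = 0")
        case True
        then show ?thesis unfolding \<eta>_def using \<delta> by (simp add: integral_nonneg_AE)
      next
        case False
        have "(\<integral>\<theta>. min 1 (\<delta> / \<bar>\<theta> \<bullet> sgn v\<bar>) \<partial>sphere_lborel) = (\<integral>\<theta>. min 1 (\<delta> / \<bar>\<theta> \<bullet> a\<bar>) \<partial>sphere_lborel)"
          by (rule integral_sphere_inner[of "\<lambda>t. min 1 (\<delta> / \<bar>t\<bar>)" 1]) (use \<delta> False na in \<open>auto simp: norm_sgn\<close>)
        then show ?thesis by (simp add: \<eta>_def \<delta>_def)
      qed
      finally show ?thesis using n[folded \<delta>_def] e1(2) unfolding v_def by linarith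
    qed
    have c\<phi>: "(\<lambda>x. c *\<^sub>R \<phi> x) \<in> C1c A"
    proof -
      obtain S where S: "compact S" "S \<subseteq> A" "\<And>x. x \<notin> S \<Longrightarrow> \<phi> x = 0" using C1cE[OF \<phi>(1)] by metis
      show ?thesis
        by (rule C1cI[OF C1_fun_compose[OF C1cD[OF \<phi>(1)] C1_fun_bounded_linear[OF bounded_linear_scaleR_right]] S(1,2)])
          (simp add: S(3))
    qed
    have divc: "divergence (\<lambda>x. c *\<^sub>R \<phi> x) x = c * divergence \<phi> x" for x
    proof -
      have D: "((\<lambda>x. c *\<^sub>R \<phi> x) has_derivative (\<lambda>v. c *\<^sub>R dir_deriv \<phi> v x)) (at x)"
        by (rule bounded_linear.has_derivative[OF bounded_linear_scaleR_right C1_fun_has_derivative[OF C1cD[OF \<phi>(1)]]])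
      show ?thesis
        unfolding divergence_def frechet_derivative_at[OF D, symmetric] by (simp add: sum_distrib_left)
    qed
    have Em: "E \<in> sets lborel" using E by simp
    note id = integrable_indicator_mult[OF divergence_integrable[OF \<phi>(1)] Em] integrable_indicator_mult[OF divergence_integrable[OF \<Phi>(1)] Em]
    have "(\<integral>x. indicat_real E x * divergence (\<lambda>x. c *\<^sub>R \<phi> x - \<Phi> x) x \<partial>lborel) \<le> e * V"
      by (rule pairing_le_variation[OF E V C1c_diff[OF c\<phi> \<Phi>(1)] near e])
    moreover have "(\<integral>x. indicat_real E x * divergence (\<lambda>x. c *\<^sub>R \<phi> x - \<Phi> x) x \<partial>lborel)
        = c * (\<integral>x. indicat_real E x * divergence \<phi> x \<partial>lborel) - (\<integral>x. indicat_real E x * divergence \<Phi> x \<partial>lborel)"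
      unfolding divergence_diff[OF C1cD[OF c\<phi>] C1cD[OF \<Phi>(1)]] divc
      using id by (simp add: right_diff_distrib mult.left_commute[of _ c])
    moreover have "(\<integral>x. indicat_real E x * divergence \<Phi> x \<partial>lborel) \<le> w"
    proof -
      have "ennreal (\<integral>\<theta>. dir_pairing E (\<psi> (j \<theta>)) \<theta> \<partial>sphere_lborel) \<le> (\<integral>\<^sup>+\<theta>. ennreal (dir_pairing E (\<psi> (j \<theta>)) \<theta>) \<partial>sphere_lborel)"
      proof -
        have "(\<integral>\<theta>. dir_pairing E (\<psi> (j \<theta>)) \<theta> \<partial>sphere_lborel) \<le> (\<integral>\<theta>. max 0 (dir_pairing E (\<psi> (j \<theta>)) \<theta>) \<partial>sphere_lborel)"
          using \<Phi>(4) by (intro integral_mono) auto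
        then have "ennreal (\<integral>\<theta>. dir_pairing E (\<psi> (j \<theta>)) \<theta> \<partial>sphere_lborel) \<le> (\<integral>\<^sup>+\<theta>. ennreal (max 0 (dir_pairing E (\<psi> (j \<theta>)) \<theta>)) \<partial>sphere_lborel)"
          using \<Phi>(4) by (subst nn_integral_eq_integral) (auto intro: ennreal_leI)
        moreover have "ennreal (max 0 t) = ennreal t" for t by (simp add: max_def ennreal_neg)
        ultimately show ?thesis by (simp only:)
      qed
      also have "\<dots> \<le> (\<integral>\<^sup>+\<theta>. dir_variation E \<theta> A \<partial>sphere_lborel)"
        unfolding dir_variation_def using \<psi>t by (intro nn_integral_mono SUP_upper)
      finally show ?thesis unfolding \<Phi>(3) w(1) using w(2) by (auto simp: ennreal_le_iff2)
    qed
    ultimately show "c * (\<integral>x. indicat_real E x * divergence \<phi> x \<partial>lborel) \<le> w + e0" using eV by linarith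
  qed
  have "ennreal V \<le> ennreal (w / c)"
    unfolding V(1)[symmetric] variation_in_open_eq'[OF E]
  proof (rule SUP_least, rule ennreal_leI)
    fix \<phi> :: "real^'n \<Rightarrow> real^'n" assume "\<phi> \<in> {\<phi> \<in> C1c A. \<forall>x. norm (\<phi> x) \<le> 1}"
    then have "c * (\<integral>x. indicat_real E x * divergence \<phi> x \<partial>lborel) \<le> w" using key by blast
    then show "(\<integral>x. indicat_real E x * divergence \<phi> x \<partial>lborel) \<le> w / c" using c by (simp add: field_simps)
  qed
  then have "V \<le> w / c" using w(2) c by (simp add: ennreal_le_iff)
  then have "c * V \<le> w" using c by (simp add: field_simps)
  then show ?thesis by (simp add: w(1) c_def ennreal_leI)
qed

theorem nn_integral_dir_variation:
  fixes E A :: "(real ^ 'n) set"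
  assumes E: "E \<in> sets borel" and V: "variation_in_open E A < \<infinity>"
  shows "(\<integral>\<^sup>+\<theta>. dir_variation E \<theta> A \<partial>sphere_lborel) = ennreal (sphere_const TYPE(real ^ 'n)) * variation_in_open E A"
proof -
  obtain V' where V': "variation_in_open E A = ennreal V'" "V' \<ge> 0"
    using V by (metis ennreal_cases infinity_ennreal_def less_irrefl)
  show ?thesis
    using nn_integral_dir_variation_le[OF E V'] nn_integral_dir_variation_ge[OF E V'] V'(2) sphere_const_pos[where 'n='n]
    by (simp add: V'(1) ennreal_mult antisym)
qed

section \<open>Slicing\<close>

lemma borel_slice:
  fixes E :: "'a::euclidean_space set"
  assumes [measurable]: "E \<in> sets borel" shows "slice E \<theta> x \<in> sets borel"
proof -
  have "{s \<in> space borel. x + s *\<^sub>R \<theta> \<in> E} \<in> sets borel" by measurable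
  then show ?thesis by (simp add: slice_def)
qed

lemma open_slice:
  fixes A :: "'a::euclidean_space set"
  assumes "open A" shows "open (slice A \<theta> x)"
proof -
  have "slice A \<theta> x = (\<lambda>s. x + s *\<^sub>R \<theta>) -` A" by (auto simp: slice_def)
  then show ?thesis using assms by (simp add: open_vimage continuous_intros)
qed

lemma bounded_slice:
  fixes A :: "'a::euclidean_space set"
  assumes "bounded A" and \<theta>: "norm \<theta> = 1" shows "bounded (slice A \<theta> x)"
proof -
  obtain B where B: "\<And>y. y \<in> A \<Longrightarrow> norm y \<le> B" using assms(1) by (auto simp: bounded_iff)
  have "\<bar>s\<bar> \<le> B + norm x" if "s \<in> slice A \<theta> x" for s
  proof -
    have "\<bar>s\<bar> = norm ((x + s *\<^sub>R \<theta>) - x)" using \<theta> by simp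
    also have "\<dots> \<le> norm (x + s *\<^sub>R \<theta>) + norm x" by (rule norm_triangle_ineq4)
    finally show ?thesis using B[of "x + s *\<^sub>R \<theta>"] that by (auto simp: slice_def)
  qed
  then show ?thesis by (auto simp: bounded_iff)
qed

lemma indicator_slice: "indicator (slice E \<theta> x) s = indicator E (x + s *\<^sub>R \<theta>)"
  by (simp add: indicator_def slice_def)

lemma C1c_slice:
  fixes \<psi> :: "'a::euclidean_space \<Rightarrow> real"
  assumes \<psi>: "\<psi> \<in> C1c A" and \<theta>: "norm \<theta> = 1"
  shows "(\<lambda>s. \<psi> (x + s *\<^sub>R \<theta>)) \<in> C1c (slice A \<theta> x)"
proof -
  obtain S where S: "compact S" "S \<subseteq> A" "\<And>x. x \<notin> S \<Longrightarrow> \<psi> x = 0" using C1cE[OF \<psi>] by metis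
  show ?thesis
  proof (rule C1cI)
    show "C1_fun (\<lambda>s. \<psi> (x + s *\<^sub>R \<theta>))" by (rule C1_fun_compose[OF C1_fun_line C1cD[OF \<psi>]])
    have "slice S \<theta> x = (\<lambda>s. x + s *\<^sub>R \<theta>) -` S" by (auto simp: slice_def)
    then have "closed (slice S \<theta> x)" using compact_imp_closed[OF S(1)] by (simp add: closed_vimage continuous_intros)
    then show "compact (slice S \<theta> x)"
      using bounded_slice[OF compact_imp_bounded[OF S(1)] \<theta>] by (simp add: compact_eq_bounded_closed)
    show "slice S \<theta> x \<subseteq> slice A \<theta> x" using S(2) by (auto simp: slice_def)
    show "\<psi> (x + s *\<^sub>R \<theta>) = 0" if "s \<notin> slice S \<theta> x" for s using S(3) that by (simp add: slice_def)
  qed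
qed

lemma dir_deriv_slice:
  fixes \<psi> :: "'a::euclidean_space \<Rightarrow> real"
  assumes "C1_fun \<psi>"
  shows "dir_deriv (\<lambda>s. \<psi> (x + s *\<^sub>R \<theta>)) 1 s = dir_deriv \<psi> \<theta> (x + s *\<^sub>R \<theta>)"
  by (rule dir_deriv_real[OF has_real_derivative_line[OF assms]])

subsection \<open>Difference quotients\<close>

definition diff_quot :: "'a::euclidean_space set \<Rightarrow> 'a \<Rightarrow> nat \<Rightarrow> 'a \<Rightarrow> ennreal" where
  "diff_quot E \<theta> k y = ennreal (real k + 1) * ennreal \<bar>indicat_real E (y + (1 / (real k + 1)) *\<^sub>R \<theta>) - indicat_real E y\<bar>"

lemma borel_measurable_diff_quot [measurable]:
  assumes [measurable]: "E \<in> sets borel" shows "diff_quot E \<theta> k \<in> borel_measurable borel"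
  unfolding diff_quot_def[abs_def] by measurable

lemma diff_quot_slice: "diff_quot E \<theta> k (x + s *\<^sub>R \<theta>) = diff_quot (slice E \<theta> x) 1 k s"
  by (simp add: diff_quot_def indicator_slice algebra_simps)

text \<open>
  Against a test function the difference quotients converge to the distributional derivative, so their
  lower limit dominates the variation.
\<close>

lemma pairing_le_liminf_diff_quot:
  fixes A :: "real set" and \<phi> :: "real \<Rightarrow> real"
  assumes A [measurable]: "A \<in> sets borel" and \<phi>: "\<phi> \<in> C1c J" "\<And>s. \<bar>\<phi> s\<bar> \<le> 1" and J: "open J" "bounded J"
  shows "ennreal (\<integral>s. indicat_real A s * dir_deriv \<phi> 1 s \<partial>lborel)
    \<le> liminf (\<lambda>k. \<integral>\<^sup>+s. diff_quot A 1 k s * indicator J s \<partial>lborel)"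
proof -
  define h where "h k = 1 / (real k + 1)" for k :: nat
  have h: "h k > 0" "h k \<le> 1" "1 / h k = real k + 1" for k by (auto simp: h_def)
  have [measurable]: "J \<in> sets borel" using J by simp
  note C = C1cD[OF \<phi>(1)]
  have [measurable]: "\<phi> \<in> borel_measurable borel" by (rule borel_measurable_continuous_onI[OF continuous_on_C1_fun[OF C]])
  have [measurable]: "dir_deriv \<phi> 1 \<in> borel_measurable borel" by (rule borel_measurable_continuous_onI[OF continuous_on_dir_deriv[OF C]])
  obtain S where S: "S \<subseteq> J" "\<And>x. x \<notin> S \<Longrightarrow> \<phi> x = 0" using C1cE[OF \<phi>(1)] by metis
  obtain a b where ab: "a < b" "\<And>u. u \<le> a \<or> b \<le> u \<Longrightarrow> \<phi> u = 0" "\<And>u. u \<le> a \<or> b \<le> u \<Longrightarrow> dir_deriv \<phi> 1 u = 0"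
    using C1c_real_bounds[OF \<phi>(1)] by metis
  have "bounded (dir_deriv \<phi> 1 ` {a..b})"
    by (intro compact_imp_bounded compact_continuous_image continuous_on_subset[OF continuous_on_dir_deriv[OF C]]) auto
  then obtain B where B: "B > 0" "\<And>u. u \<in> {a..b} \<Longrightarrow> \<bar>dir_deriv \<phi> 1 u\<bar> \<le> B"
    by (auto simp: bounded_pos)
  have Ball: "\<bar>dir_deriv \<phi> 1 u\<bar> \<le> B" for u
    using B ab(3)[of u] by (cases "u \<in> {a..b}") auto
  have lip: "\<bar>(\<phi> s - \<phi> (s - h k)) / h k\<bar> \<le> B" for s k
  proof -
    obtain z where "\<phi> s - \<phi> (s - h k) = (s - (s - h k)) * dir_deriv \<phi> 1 z"
      using MVT2[of "s - h k" s \<phi> "dir_deriv \<phi> 1"] C1_fun_DERIV[OF C] h(1)[of k] by auto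
    then show ?thesis using h(1)[of k] Ball[of z] by simp
  qed
  have "(\<lambda>k. \<integral>s. indicat_real A s * ((\<phi> s - \<phi> (s - h k)) / h k) \<partial>lborel) \<longlonglongrightarrow> (\<integral>s. indicat_real A s * dir_deriv \<phi> 1 s \<partial>lborel)"
  proof (rule integral_dominated_convergence[where w="\<lambda>s. B * indicat_real {a..b+1} s"])
    show "AE s in lborel. (\<lambda>k. indicat_real A s * ((\<phi> s - \<phi> (s - h k)) / h k)) \<longlonglongrightarrow> indicat_real A s * dir_deriv \<phi> 1 s"
    proof (rule AE_I2)
      fix s
      have "((\<lambda>t. (\<phi> (s + t) - \<phi> s) / t) \<longlongrightarrow> dir_deriv \<phi> 1 s) (at 0)" using C1_fun_DERIV[OF C, of s] by (simp add: DERIV_def)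
      moreover have "filterlim (\<lambda>k. - h k) (at 0) sequentially"
      proof (rule filterlim_atI)
        have "h \<longlonglongrightarrow> 0" unfolding h_def using LIMSEQ_Suc[OF lim_const_over_n[of "1::real"]] by (simp add: add.commute)
        then show "(\<lambda>k. - h k) \<longlonglongrightarrow> 0" using tendsto_minus[of h 0] by simp
        show "\<forall>\<^sub>F k in sequentially. - h k \<noteq> 0" using h(1) by (auto intro!: always_eventually simp: less_imp_neq[symmetric])
      qed
      ultimately have "(\<lambda>k. (\<phi> (s + - h k) - \<phi> s) / - h k) \<longlonglongrightarrow> dir_deriv \<phi> 1 s" by (rule filterlim_compose)
      moreover have "(\<phi> (s + - h k) - \<phi> s) / - h k = (\<phi> s - \<phi> (s - h k)) / h k" for k by (simp add: minus_divide_left)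
      ultimately have "(\<lambda>k. (\<phi> s - \<phi> (s - h k)) / h k) \<longlonglongrightarrow> dir_deriv \<phi> 1 s" by simp
      then show "(\<lambda>k. indicat_real A s * ((\<phi> s - \<phi> (s - h k)) / h k)) \<longlonglongrightarrow> indicat_real A s * dir_deriv \<phi> 1 s"
        by (intro tendsto_mult tendsto_const)
    qed
    show "AE s in lborel. norm (indicat_real A s * ((\<phi> s - \<phi> (s - h k)) / h k)) \<le> B * indicat_real {a..b+1} s" for k
    proof (rule AE_I2)
      fix s
      have "\<phi> s - \<phi> (s - h k) = 0" if "s \<notin> {a..b+1}"
        using that ab(2)[of s] ab(2)[of "s - h k"] h[of k] by auto
      then show "norm (indicat_real A s * ((\<phi> s - \<phi> (s - h k)) / h k)) \<le> B * indicat_real {a..b+1} s"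
        using lip[of s k] B(1) by (auto simp: indicator_def)
    qed
  qed (auto intro!: integrable_real_indicator simp: emeasure_lborel_Icc_eq)
  then have "(\<lambda>k. ennreal (\<integral>s. indicat_real A s * ((\<phi> s - \<phi> (s - h k)) / h k) \<partial>lborel)) \<longlonglongrightarrow> ennreal (\<integral>s. indicat_real A s * dir_deriv \<phi> 1 s \<partial>lborel)"
    by (rule tendsto_ennrealI)
  then have "ennreal (\<integral>s. indicat_real A s * dir_deriv \<phi> 1 s \<partial>lborel)
      = liminf (\<lambda>k. ennreal (\<integral>s. indicat_real A s * ((\<phi> s - \<phi> (s - h k)) / h k) \<partial>lborel))"
    by (rule lim_imp_Liminf[symmetric, rotated]) simp
  also have "\<dots> \<le> liminf (\<lambda>k. \<integral>\<^sup>+s. diff_quot A 1 k s * indicator J s \<partial>lborel)"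
  proof (rule Liminf_mono, rule always_eventually, rule allI)
    fix k
    have i0: "integrable lborel \<phi>" by (rule C1c_integrable[OF \<phi>(1)])
    have i1: "integrable lborel (\<lambda>s. indicat_real A s * \<phi> s)" by (rule integrable_indicator_mult[OF i0]) simp
    have i2: "integrable lborel (\<lambda>s. indicat_real A (s + h k) * \<phi> s)"
      by (rule Bochner_Integration.integrable_bound[OF i0]) (auto simp: indicator_def)
    have eq: "(\<integral>s. indicat_real A s * \<phi> (s - h k) \<partial>lborel) = (\<integral>s. indicat_real A (s + h k) * \<phi> s \<partial>lborel)"
      using lborel_integral_real_affine[of 1 "\<lambda>s. indicat_real A s * \<phi> (s - h k)" "h k"] by (simp add: add.commute)
    have i3: "integrable lborel (\<lambda>s. indicat_real A s * \<phi> (s - h k))"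
      using lborel_integrable_real_affine_iff[of 1 "\<lambda>s. indicat_real A s * \<phi> (s - h k)" "h k"] i2 by (simp add: add.commute)
    have "(\<integral>s. indicat_real A s * ((\<phi> s - \<phi> (s - h k)) / h k) \<partial>lborel)
        = (1 / h k) * ((\<integral>s. indicat_real A s * \<phi> s \<partial>lborel) - (\<integral>s. indicat_real A s * \<phi> (s - h k) \<partial>lborel))"
    proof -
      have "(\<lambda>s. indicat_real A s * ((\<phi> s - \<phi> (s - h k)) / h k)) = (\<lambda>s. (1 / h k) * (indicat_real A s * \<phi> s - indicat_real A s * \<phi> (s - h k)))"
        by (simp add: right_diff_distrib diff_divide_distrib)
      then show ?thesis by (simp only: integral_mult_right_zero Bochner_Integration.integral_diff[OF i1 i3])
    qed
    also have "\<dots> = (\<integral>s. (1 / h k) * ((indicat_real A s - indicat_real A (s + h k)) * \<phi> s) \<partial>lborel)"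
      unfolding eq by (simp only: integral_mult_right_zero left_diff_distrib Bochner_Integration.integral_diff[OF i1 i2])
    finally have e: "(\<integral>s. indicat_real A s * ((\<phi> s - \<phi> (s - h k)) / h k) \<partial>lborel)
        = (\<integral>s. (1 / h k) * ((indicat_real A s - indicat_real A (s + h k)) * \<phi> s) \<partial>lborel)" .
    have "ennreal (\<integral>s. (1 / h k) * ((indicat_real A s - indicat_real A (s + h k)) * \<phi> s) \<partial>lborel)
        \<le> ennreal (\<integral>s. \<bar>(1 / h k) * ((indicat_real A s - indicat_real A (s + h k)) * \<phi> s)\<bar> \<partial>lborel)"
      by (rule ennreal_leI, rule order_trans[OF abs_ge_self integral_abs_bound])
    also have "\<dots> = (\<integral>\<^sup>+s. ennreal (\<bar>(1 / h k) * ((indicat_real A s - indicat_real A (s + h k)) * \<phi> s)\<bar>) \<partial>lborel)"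
      using i1 i2 by (intro nn_integral_eq_integral[symmetric]) (auto simp: left_diff_distrib)
    also have "\<dots> \<le> (\<integral>\<^sup>+s. diff_quot A 1 k s * indicator J s \<partial>lborel)"
    proof (rule nn_integral_mono)
      fix s
      show "ennreal (\<bar>(1 / h k) * ((indicat_real A s - indicat_real A (s + h k)) * \<phi> s)\<bar>) \<le> diff_quot A 1 k s * indicator J s"
      proof (cases "s \<in> J")
        case True
        have "\<bar>(1 / h k) * ((indicat_real A s - indicat_real A (s + h k)) * \<phi> s)\<bar> = (real k + 1) * (\<bar>indicat_real A (s + h k) - indicat_real A s\<bar> * \<bar>\<phi> s\<bar>)"
          by (simp only: h(3) abs_mult) (simp add: abs_minus_commute)
        also have "\<dots> \<le> (real k + 1) * (\<bar>indicat_real A (s + h k) - indicat_real A s\<bar> * 1)"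
          using \<phi>(2)[of s] by (intro mult_left_mono) auto
        finally have "ennreal \<bar>(1 / h k) * ((indicat_real A s - indicat_real A (s + h k)) * \<phi> s)\<bar>
            \<le> ennreal ((real k + 1) * \<bar>indicat_real A (s + h k) - indicat_real A s\<bar>)" by (intro ennreal_leI) simp
        also have "\<dots> = diff_quot A 1 k s" unfolding diff_quot_def h_def by (subst ennreal_mult) auto
        finally show ?thesis using True by simp
      next
        case False
        then have "\<phi> s = 0" using S by blast
        then show ?thesis by simp
      qed
    qed
    finally show "ennreal (\<integral>s. indicat_real A s * ((\<phi> s - \<phi> (s - h k)) / h k) \<partial>lborel) \<le> (\<integral>\<^sup>+s. diff_quot A 1 k s * indicator J s \<partial>lborel)"
      unfolding e .
  qed
  finally show ?thesis .
qed

text \<open>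
  By duality, and since \<open>g(y) - g(y - h\<theta>) = \<integral>\<^sub>0\<^sup>h \<partial>\<^sub>\<theta> g(y - s\<theta>) ds\<close> is an average of directional derivatives of
  translated test functions, difference quotients are bounded by the directional variation.
\<close>

lemma pairing_difference_le:
  fixes E :: "'a::euclidean_space set"
  assumes E [measurable]: "E \<in> sets borel" and W: "dir_variation E \<theta> \<Omega> = ennreal w" "w \<ge> 0"
    and h: "h > 0" and g: "g \<in> C1c A" "\<And>y. \<bar>g y\<bar> \<le> 1"
    and sub: "\<And>y t. y \<in> A \<Longrightarrow> 0 \<le> t \<Longrightarrow> t \<le> h \<Longrightarrow> y + t *\<^sub>R \<theta> \<in> \<Omega>"
  shows "(\<integral>y. indicat_real E y * (g y - g (y - h *\<^sub>R \<theta>)) \<partial>lborel) \<le> h * w"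
proof -
  note C = C1cD[OF g(1)]
  define D where "D = dir_deriv g \<theta>"
  have Dc: "continuous_on UNIV D" unfolding D_def by (rule continuous_on_dir_deriv[OF C])
  have [measurable]: "D \<in> borel_measurable borel" by (rule borel_measurable_continuous_onI[OF Dc])
  obtain S where S: "compact S" "S \<subseteq> A" "\<And>x. x \<notin> S \<Longrightarrow> g x = 0" using C1cE[OF g(1)] by metis
  have Dz: "D y = 0" if "y \<notin> S" for y
    unfolding D_def using dir_deriv_outside_support[OF compact_imp_closed[OF S(1)] S(3) that] .
  obtain R where R: "R > 0" "\<And>y. y \<in> S \<Longrightarrow> norm y \<le> R" using compact_imp_bounded[OF S(1)] by (auto simp: bounded_pos)
  have "bounded (D ` S)" by (intro compact_imp_bounded compact_continuous_image continuous_on_subset[OF Dc] S) auto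
  then obtain B where B: "B > 0" "\<And>y. y \<in> S \<Longrightarrow> \<bar>D y\<bar> \<le> B" by (auto simp: bounded_pos)
  have DB: "\<bar>D y\<bar> \<le> B" for y using B Dz[of y] by (cases "y \<in> S") auto
  define R' where "R' = R + h * norm \<theta>"
  have pair: "integrable (lborel \<Otimes>\<^sub>M lborel) (\<lambda>(s, y). indicat_real {0..h} s * (indicat_real E y * D (y - s *\<^sub>R \<theta>)))"
  proof (rule Bochner_Integration.integrable_bound)
    have "emeasure (lborel \<Otimes>\<^sub>M lborel) ({0..h} \<times> cball (0::'a) R') = emeasure lborel {0..h} * emeasure lborel (cball (0::'a) R')"
      by (rule lborel.emeasure_pair_measure_Times) auto
    also have "\<dots> < \<infinity>" using emeasure_lborel_cball_finite[of "0::'a" R'] by (auto simp: ennreal_mult_less_top emeasure_lborel_Icc_eq)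
    finally show "integrable (lborel \<Otimes>\<^sub>M lborel) (\<lambda>z. B * indicat_real ({0..h} \<times> cball (0::'a) R') z)"
      by (intro integrable_mult_right integrable_real_indicator) auto
    show "AE z in lborel \<Otimes>\<^sub>M lborel. norm (case z of (s, y) \<Rightarrow> indicat_real {0..h} s * (indicat_real E y * D (y - s *\<^sub>R \<theta>)))
        \<le> norm (B * indicat_real ({0..h} \<times> cball (0::'a) R') z)"
    proof (rule AE_I2, clarify)
      fix s y
      show "norm (indicat_real {0..h} s * (indicat_real E y * D (y - s *\<^sub>R \<theta>))) \<le> norm (B * indicat_real ({0..h} \<times> cball (0::'a) R') (s, y))"
      proof (cases "s \<in> {0..h} \<and> D (y - s *\<^sub>R \<theta>) \<noteq> 0")
        case True
        then have "norm (y - s *\<^sub>R \<theta>) \<le> R" using Dz R(2) by blast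
        moreover have "norm y \<le> norm (y - s *\<^sub>R \<theta>) + norm (s *\<^sub>R \<theta>)" using norm_triangle_ineq[of "y - s *\<^sub>R \<theta>" "s *\<^sub>R \<theta>"] by simp
        moreover have "norm (s *\<^sub>R \<theta>) \<le> h * norm \<theta>" using True by (auto intro: mult_right_mono)
        ultimately have "y \<in> cball 0 R'" by (simp add: R'_def)
        then show ?thesis using True DB[of "y - s *\<^sub>R \<theta>"] B(1) by (auto simp: indicator_def)
      qed (use B(1) in \<open>auto simp: indicator_def\<close>)
    qed
  qed measurable
  have ftc: "g y - g (y - h *\<^sub>R \<theta>) = (\<integral>s. indicat_real {0..h} s * D (y - s *\<^sub>R \<theta>) \<partial>lborel)" for y
  proof -
    have "(\<integral>s. (D (y - s *\<^sub>R \<theta>)) * indicat_real {0..h} s \<partial>lborel) = - g (y - h *\<^sub>R \<theta>) - (- g (y - 0 *\<^sub>R \<theta>))"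
    proof (rule integral_FTC_Icc_real)
      fix s
      have "((\<lambda>s. g (y + s *\<^sub>R (- \<theta>))) has_real_derivative dir_deriv g (- \<theta>) (y + s *\<^sub>R (- \<theta>))) (at s)"
        by (rule has_real_derivative_line[OF C])
      moreover have "dir_deriv g (- \<theta>) z = - D z" for z unfolding D_def by (rule linear_neg[OF linear_dir_deriv[OF C]])
      ultimately show "((\<lambda>s. - g (y - s *\<^sub>R \<theta>)) has_real_derivative D (y - s *\<^sub>R \<theta>)) (at s)"
        using DERIV_minus[of "\<lambda>s. g (y - s *\<^sub>R \<theta>)" "- D (y - s *\<^sub>R \<theta>)" s UNIV] by simp
      have "isCont (\<lambda>s. y - s *\<^sub>R \<theta>) s" by (intro continuous_intros)
      moreover have "isCont D (y - s *\<^sub>R \<theta>)" using Dc by (simp add: continuous_on_eq_continuous_at)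
      ultimately show "isCont (\<lambda>s. D (y - s *\<^sub>R \<theta>)) s" by (rule isCont_o2)
    qed (use h in simp)
    then show ?thesis by (simp add: mult.commute)
  qed
  have gs: "(\<integral>y. indicat_real E y * D (y - s *\<^sub>R \<theta>) \<partial>lborel) \<le> w" if s: "0 \<le> s" "s \<le> h" for s
  proof -
    define gs where "gs = (\<lambda>y. g (y + - (s *\<^sub>R \<theta>)))"
    have "gs \<in> C1c ((\<lambda>x. x - - (s *\<^sub>R \<theta>)) ` A)" unfolding gs_def by (rule C1c_translate[OF g(1)])
    moreover have "(\<lambda>x. x - - (s *\<^sub>R \<theta>)) ` A \<subseteq> \<Omega>" using sub s by auto
    ultimately have "gs \<in> C1c \<Omega>" using C1c_mono by blast
    then have "gs \<in> tests \<Omega>" using g(2) by (simp add: tests_def gs_def)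
    then have "ennreal (dir_pairing E gs \<theta>) \<le> ennreal w" unfolding W(1)[symmetric] dir_variation_def by (rule SUP_upper)
    then have "dir_pairing E gs \<theta> \<le> w" using W(2) by (auto simp: ennreal_le_iff2)
    moreover have "dir_deriv gs \<theta> y = D (y - s *\<^sub>R \<theta>)" for y
    proof -
      have 1: "((\<lambda>y. y + - (s *\<^sub>R \<theta>)) has_derivative (\<lambda>v. v)) (at y)" by (auto intro!: derivative_eq_intros)
      have "(gs has_derivative (\<lambda>v. dir_deriv g v (y + - (s *\<^sub>R \<theta>)))) (at y)"
        unfolding gs_def by (rule has_derivative_compose[OF 1 C1_fun_has_derivative[OF C]])
      then show ?thesis by (simp add: frechet_derivative_at[symmetric] D_def)
    qed
    ultimately show ?thesis by (simp add: dir_pairing_def)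
  qed
  have "(\<integral>y. indicat_real E y * (g y - g (y - h *\<^sub>R \<theta>)) \<partial>lborel)
      = (\<integral>y. (\<integral>s. indicat_real {0..h} s * (indicat_real E y * D (y - s *\<^sub>R \<theta>)) \<partial>lborel) \<partial>lborel)"
  proof (rule Bochner_Integration.integral_cong[OF refl])
    fix y
    have "indicat_real E y * (\<integral>s. indicat_real {0..h} s * D (y - s *\<^sub>R \<theta>) \<partial>lborel)
        = (\<integral>s. indicat_real E y * (indicat_real {0..h} s * D (y - s *\<^sub>R \<theta>)) \<partial>lborel)"
      by (rule integral_mult_right_zero[symmetric])
    also have "\<dots> = (\<integral>s. indicat_real {0..h} s * (indicat_real E y * D (y - s *\<^sub>R \<theta>)) \<partial>lborel)"
      by (simp only: mult.left_commute[of "indicat_real E y"])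
    finally show "indicat_real E y * (g y - g (y - h *\<^sub>R \<theta>)) = (\<integral>s. indicat_real {0..h} s * (indicat_real E y * D (y - s *\<^sub>R \<theta>)) \<partial>lborel)"
      unfolding ftc .
  qed
  also have "\<dots> = (\<integral>s. (\<integral>y. indicat_real {0..h} s * (indicat_real E y * D (y - s *\<^sub>R \<theta>)) \<partial>lborel) \<partial>lborel)"
    by (rule lborel_pair.Fubini_integral[OF pair])
  also have "\<dots> \<le> (\<integral>s. w * indicat_real {0..h} s \<partial>lborel)"
  proof (rule integral_mono)
    show "integrable lborel (\<lambda>s. \<integral>y. indicat_real {0..h} s * (indicat_real E y * D (y - s *\<^sub>R \<theta>)) \<partial>lborel)"
      using lborel_pair.integrable_fst'[OF pair] by simp
    show "(\<integral>y. indicat_real {0..h} s * (indicat_real E y * D (y - s *\<^sub>R \<theta>)) \<partial>lborel) \<le> w * indicat_real {0..h} s" for s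
      using gs[of s] by (auto simp: indicator_def)
  qed (auto intro!: integrable_real_indicator simp: emeasure_lborel_Icc_eq)
  also have "\<dots> = h * w" using h by simp
  finally show ?thesis .
qed

text \<open>
  \<open>|\<chi>\<^sub>E(y + h\<theta>) - \<chi>\<^sub>E(y)|\<close> is the indicator function of the points that
  leave (\<open>P\<close>) or enter (\<open>N\<close>) the set, and their measure is bounded by duality.
\<close>

lemma nn_integral_diff_quot_le:
  fixes E :: "'a::euclidean_space set"
  assumes E [measurable]: "E \<in> sets borel" and A: "open A" "bounded A"
    and sub: "\<And>y t. y \<in> A \<Longrightarrow> 0 \<le> t \<Longrightarrow> t \<le> 1 / (real k + 1) \<Longrightarrow> y + t *\<^sub>R \<theta> \<in> \<Omega>"
  shows "(\<integral>\<^sup>+y. diff_quot E \<theta> k y * indicator A y \<partial>lborel) \<le> dir_variation E \<theta> \<Omega>"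
proof (cases "dir_variation E \<theta> \<Omega>")
  case (real w)
  define h where "h = 1 / (real k + 1)"
  have h: "h > 0" by (simp add: h_def)
  have [measurable]: "A \<in> sets borel" using A by simp
  define P where "P = {y \<in> A. y \<in> E \<and> y + h *\<^sub>R \<theta> \<notin> E}"
  define N where "N = {y \<in> A. y \<notin> E \<and> y + h *\<^sub>R \<theta> \<in> E}"
  have [measurable]: "P \<in> sets borel" "N \<in> sets borel" unfolding P_def N_def by measurable
  have le: "measure lborel P + measure lborel N \<le> h * w"
  proof (rule measure_le_by_test_functions[OF _ _ _ A])
    fix g :: "'a \<Rightarrow> real" assume g: "g \<in> C1c A" "\<And>x. \<bar>g x\<bar> \<le> 1"
    have gz: "g y = 0" if "y \<notin> A" for y using C1cE[OF g(1)] that by (metis subsetD)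
    have ig: "integrable lborel g" by (rule C1c_integrable[OF g(1)])
    have [measurable]: "g \<in> borel_measurable borel" by (rule borel_measurable_continuous_onI[OF continuous_on_C1_fun[OF C1cD[OF g(1)]]])
    have i1: "integrable lborel (\<lambda>y. indicat_real E y * g y)" by (rule integrable_indicator_mult[OF ig]) simp
    have i2: "integrable lborel (\<lambda>y. indicat_real E (y + h *\<^sub>R \<theta>) * g y)"
      by (rule Bochner_Integration.integrable_bound[OF ig]) (auto simp: indicator_def)
    have tr: "(\<integral>y. f (y + h *\<^sub>R \<theta>) \<partial>lborel) = (\<integral>y. f y \<partial>lborel)" "integrable lborel f \<longleftrightarrow> integrable lborel (\<lambda>y. f (y + h *\<^sub>R \<theta>))"
      if [measurable]: "f \<in> borel_measurable borel" for f :: "'a \<Rightarrow> real"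
    proof -
      have "(\<integral>y. f y \<partial>lborel) = (\<integral>y. f y \<partial>distr lborel borel ((+) (h *\<^sub>R \<theta>)))" by (simp add: lborel_distr_plus)
      also have "\<dots> = (\<integral>y. f (h *\<^sub>R \<theta> + y) \<partial>lborel)" by (rule integral_distr) auto
      finally show "(\<integral>y. f (y + h *\<^sub>R \<theta>) \<partial>lborel) = (\<integral>y. f y \<partial>lborel)" by (simp add: add.commute)
      have "integrable lborel f \<longleftrightarrow> integrable (distr lborel borel ((+) (h *\<^sub>R \<theta>))) f" by (simp add: lborel_distr_plus)
      also have "\<dots> \<longleftrightarrow> integrable lborel (\<lambda>y. f (h *\<^sub>R \<theta> + y))" by (rule integrable_distr_eq) auto
      finally show "integrable lborel f \<longleftrightarrow> integrable lborel (\<lambda>y. f (y + h *\<^sub>R \<theta>))" by (simp add: add.commute)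
    qed
    have i3: "integrable lborel (\<lambda>y. indicat_real E y * g (y - h *\<^sub>R \<theta>))"
      using tr(2)[of "\<lambda>y. indicat_real E y * g (y - h *\<^sub>R \<theta>)"] i2 by simp
    have t3: "(\<integral>y. indicat_real E (y + h *\<^sub>R \<theta>) * g y \<partial>lborel) = (\<integral>y. indicat_real E y * g (y - h *\<^sub>R \<theta>) \<partial>lborel)"
      using tr(1)[of "\<lambda>y. indicat_real E y * g (y - h *\<^sub>R \<theta>)"] by simp
    have "(\<integral>x. (indicat_real P x - indicat_real N x) * g x \<partial>lborel) = (\<integral>y. indicat_real E y * g y - indicat_real E (y + h *\<^sub>R \<theta>) * g y \<partial>lborel)"
      by (rule Bochner_Integration.integral_cong) (auto simp: P_def N_def indicator_def gz)
    also have "\<dots> = (\<integral>y. indicat_real E y * (g y - g (y - h *\<^sub>R \<theta>)) \<partial>lborel)"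
      using i1 i2 i3 t3 by (simp add: right_diff_distrib)
    also have "\<dots> \<le> h * w"
      by (rule pairing_difference_le[OF E real(2) real(1) h g sub]) (auto simp: h_def)
    finally show "(\<integral>x. (indicat_real P x - indicat_real N x) * g x \<partial>lborel) \<le> h * w" .
  qed (auto simp: P_def N_def)
  have fin: "emeasure lborel P < \<infinity>" "emeasure lborel N < \<infinity>"
    by (rule emeasure_bounded_finite, rule bounded_subset[OF A(2)], force simp: P_def N_def)+
  have "(\<integral>\<^sup>+y. diff_quot E \<theta> k y * indicator A y \<partial>lborel)
      = (\<integral>\<^sup>+y. ennreal (real k + 1) * (indicator P y + indicator N y) \<partial>lborel)"
    by (rule nn_integral_cong) (auto simp: diff_quot_def P_def N_def h_def indicator_def)
  also have "\<dots> = ennreal (real k + 1) * (emeasure lborel P + emeasure lborel N)"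
    by (simp add: nn_integral_cmult nn_integral_add)
  also have "\<dots> = ennreal ((real k + 1) * (measure lborel P + measure lborel N))"
    using fin by (simp add: emeasure_eq_ennreal_measure ennreal_plus[symmetric] ennreal_mult[symmetric] top.not_eq_extremum del: ennreal_plus)
  also have "\<dots> \<le> ennreal ((real k + 1) * (h * w))"
    using le by (intro ennreal_leI mult_left_mono) auto
  also have "\<dots> = ennreal w" by (simp add: h_def)
  finally show ?thesis using real by simp
qed simp

subsection \<open>Directional variation as an integral over lines\<close>

text \<open>
  Steps of length at most \<open>1/(n+1)\<close> starting here stay in \<open>\<Omega>\<close>, so difference
  quotients can be compared with the variation in \<open>\<Omega>\<close>.
\<close>

definition inner_part :: "'a::metric_space set \<Rightarrow> nat \<Rightarrow> 'a set" where
  "inner_part \<Omega> n = {y. infdist y (- \<Omega>) > 1 / (real n + 1)}"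

lemma open_inner_part: "open (inner_part \<Omega> n)"
  unfolding inner_part_def by (intro open_Collect_less continuous_intros)

lemma inner_part_mono: "n \<le> m \<Longrightarrow> inner_part \<Omega> n \<subseteq> inner_part \<Omega> m"
  unfolding inner_part_def by (auto intro: le_less_trans[rotated] simp: frac_le)

lemma inner_part_dist:
  assumes "y \<in> inner_part \<Omega> n" "dist y z \<le> 1 / (real n + 1)" shows "z \<in> \<Omega>"
proof (rule ccontr)
  assume "z \<notin> \<Omega>"
  then have "infdist y (- \<Omega>) \<le> dist y z" by (intro infdist_le) auto
  then show False using assms by (simp add: inner_part_def)
qed

lemma inner_part_subset: "inner_part \<Omega> n \<subseteq> \<Omega>"
proof
  fix y assume "y \<in> inner_part \<Omega> n"
  then show "y \<in> \<Omega>" by (rule inner_part_dist) simp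
qed

lemma Union_inner_part:
  fixes \<Omega> :: "'a::euclidean_space set"
  assumes "open \<Omega>" "bounded \<Omega>" shows "(\<Union>n. inner_part \<Omega> n) = \<Omega>"
proof
  show "\<Omega> \<subseteq> (\<Union>n. inner_part \<Omega> n)"
  proof
    fix y assume y: "y \<in> \<Omega>"
    have "- \<Omega> \<noteq> {}" using assms(2) not_bounded_UNIV by (metis Compl_empty_eq double_complement)
    then have "infdist y (- \<Omega>) > 0" using y assms(1) by (intro infdist_pos_not_in_closed) auto
    then obtain n where "inverse (real (Suc n)) < infdist y (- \<Omega>)" using reals_Archimedean by blast
    then show "y \<in> (\<Union>n. inner_part \<Omega> n)" by (auto simp: inner_part_def inverse_eq_divide add.commute)
  qed
qed (use inner_part_subset in blast)

text \<open>The compact support of a test function on the slice lies in one of the increasing inner parts.\<close>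

lemma variation_slice_le:
  fixes E \<Omega> :: "'a::euclidean_space set"
  assumes E: "E \<in> sets borel" and \<Omega>: "open \<Omega>" "bounded \<Omega>" and \<theta>: "norm \<theta> = 1"
  shows "variation_in_open (slice E \<theta> x) (slice \<Omega> \<theta> x)
    \<le> (SUP n. liminf (\<lambda>k. \<integral>\<^sup>+s. diff_quot E \<theta> k (x + s *\<^sub>R \<theta>) * indicator (inner_part \<Omega> n) (x + s *\<^sub>R \<theta>) \<partial>lborel))"
  unfolding variation_in_open_eq'[OF borel_slice[OF E]]
proof (rule SUP_least)
  fix \<phi> :: "real \<Rightarrow> real" assume "\<phi> \<in> {\<phi> \<in> C1c (slice \<Omega> \<theta> x). \<forall>x. norm (\<phi> x) \<le> 1}"
  then have \<phi>: "\<phi> \<in> C1c (slice \<Omega> \<theta> x)" "\<And>s. \<bar>\<phi> s\<bar> \<le> 1" by auto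
  obtain S where S: "compact S" "S \<subseteq> slice \<Omega> \<theta> x" "\<And>s. s \<notin> S \<Longrightarrow> \<phi> s = 0" using C1cE[OF \<phi>(1)] by metis
  have "S \<subseteq> (\<Union>n. slice (inner_part \<Omega> n) \<theta> x)"
    using S(2) Union_inner_part[OF \<Omega>] by (auto simp: slice_def)
  then obtain F where F: "finite F" "S \<subseteq> (\<Union>n\<in>F. slice (inner_part \<Omega> n) \<theta> x)"
    using compactE_image[OF S(1), of UNIV "\<lambda>n. slice (inner_part \<Omega> n) \<theta> x"] open_slice[OF open_inner_part] by metis
  define n where "n = Max (insert 0 F)"
  have "inner_part \<Omega> m \<subseteq> inner_part \<Omega> n" if "m \<in> F" for m
    by (rule inner_part_mono) (use F that in \<open>auto simp: n_def\<close>)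
  then have "S \<subseteq> slice (inner_part \<Omega> n) \<theta> x" using F(2) unfolding slice_def by blast
  then have \<phi>n: "\<phi> \<in> C1c (slice (inner_part \<Omega> n) \<theta> x)" by (rule C1cI[OF C1cD[OF \<phi>(1)] S(1) _ S(3)])
  have "ennreal (\<integral>s. indicat_real (slice E \<theta> x) s * dir_deriv \<phi> 1 s \<partial>lborel)
      \<le> liminf (\<lambda>k. \<integral>\<^sup>+s. diff_quot (slice E \<theta> x) 1 k s * indicator (slice (inner_part \<Omega> n) \<theta> x) s \<partial>lborel)"
    by (rule pairing_le_liminf_diff_quot[OF borel_slice[OF E] \<phi>n \<phi>(2) open_slice[OF open_inner_part]])
      (rule bounded_slice[OF bounded_subset[OF \<Omega>(2) inner_part_subset] \<theta>])
  also have "\<dots> = liminf (\<lambda>k. \<integral>\<^sup>+s. diff_quot E \<theta> k (x + s *\<^sub>R \<theta>) * indicator (inner_part \<Omega> n) (x + s *\<^sub>R \<theta>) \<partial>lborel)"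
    by (simp add: diff_quot_slice indicator_slice)
  finally show "ennreal (\<integral>s. indicat_real (slice E \<theta> x) s * divergence \<phi> s \<partial>lborel)
     \<le> (SUP n. liminf (\<lambda>k. \<integral>\<^sup>+s. diff_quot E \<theta> k (x + s *\<^sub>R \<theta>) * indicator (inner_part \<Omega> n) (x + s *\<^sub>R \<theta>) \<partial>lborel))"
    unfolding divergence_real by (rule order_trans) (rule SUP_upper, simp)
qed

text \<open>
  Fubini's theorem applied to the pairing with \<open>\<psi>\<close>; \<open>f\<close> is the positive part of the
  pairing of the slice with the restriction of \<open>\<psi>\<close> to the line, written as a truncated
  difference to be evidently Borel.
\<close>

lemma pairing_le_nn_integral_slices:
  fixes E \<Omega> :: "'a::euclidean_space set"
  assumes E [measurable]: "E \<in> sets borel" and \<theta>: "norm \<theta> = 1" and \<psi>: "\<psi> \<in> tests \<Omega>"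
  obtains f where "f \<in> borel_measurable borel" "\<And>x. f x \<le> variation_in_open (slice E \<theta> x) (slice \<Omega> \<theta> x)"
    "ennreal (dir_pairing E \<psi> \<theta>) \<le> (\<integral>\<^sup>+x. f x \<partial>subspace_lborel (perp \<theta>))"
proof -
  have \<psi>C: "\<psi> \<in> C1c \<Omega>" and \<psi>1: "\<And>x. \<bar>\<psi> x\<bar> \<le> 1" using \<psi> by (auto simp: tests_def)
  note C = C1cD[OF \<psi>C]
  define u where "u = (\<lambda>y. indicat_real E y * dir_deriv \<psi> \<theta> y)"
  have [measurable]: "dir_deriv \<psi> \<theta> \<in> borel_measurable borel" by (rule borel_measurable_continuous_onI[OF continuous_on_dir_deriv[OF C]])
  have um [measurable]: "u \<in> borel_measurable borel" unfolding u_def by measurable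
  have ui: "integrable lborel u" unfolding u_def by (rule integrable_indicator_mult[OF dir_deriv_integrable[OF \<psi>C]]) simp
  define Up Um where "Up x = (\<integral>\<^sup>+s. ennreal (u (x + s *\<^sub>R \<theta>)) \<partial>lborel)" and "Um x = (\<integral>\<^sup>+s. ennreal (- u (x + s *\<^sub>R \<theta>)) \<partial>lborel)" for x
  have [measurable]: "Up \<in> borel_measurable borel" "Um \<in> borel_measurable borel" unfolding Up_def[abs_def] Um_def[abs_def] by measurable
  have us: "u (x + s *\<^sub>R \<theta>) = indicat_real (slice E \<theta> x) s * dir_deriv (\<lambda>s. \<psi> (x + s *\<^sub>R \<theta>)) 1 s" for x s
    by (simp add: u_def indicator_slice dir_deriv_slice[OF C])
  have usi: "integrable lborel (\<lambda>s. u (x + s *\<^sub>R \<theta>))" for x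
    unfolding us by (intro integrable_indicator_mult dir_deriv_integrable[OF C1c_slice[OF \<psi>C \<theta>]]) (simp add: borel_slice)
  have fin: "Up x < \<infinity>" "Um x < \<infinity>" for x
    using usi[of x] unfolding real_integrable_def Up_def Um_def by (auto simp: less_top)
  show ?thesis
  proof
    show "(\<lambda>x. Up x - Um x) \<in> borel_measurable borel" by measurable
    fix x
    have "Up x - Um x = ennreal (enn2real (Up x) - enn2real (Um x))"
      using fin[of x] by (subst ennreal_minus[symmetric]) auto
    also have "enn2real (Up x) - enn2real (Um x) = (\<integral>s. u (x + s *\<^sub>R \<theta>) \<partial>lborel)"
      unfolding Up_def Um_def by (rule real_lebesgue_integral_def[OF usi, symmetric])
    also have "ennreal \<dots> \<le> variation_in_open (slice E \<theta> x) (slice \<Omega> \<theta> x)"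
      unfolding variation_in_open_eq'[OF borel_slice[OF E]] us using C1c_slice[OF \<psi>C \<theta>] \<psi>1
      by (intro SUP_upper2[of "\<lambda>s. \<psi> (x + s *\<^sub>R \<theta>)"]) (auto simp: divergence_real)
    finally show "Up x - Um x \<le> variation_in_open (slice E \<theta> x) (slice \<Omega> \<theta> x)" .
  next
    let ?M = "subspace_lborel (perp \<theta>)"
    have P: "(\<integral>\<^sup>+x. Up x \<partial>?M) = (\<integral>\<^sup>+y. ennreal (u y) \<partial>lborel)" "(\<integral>\<^sup>+x. Um x \<partial>?M) = (\<integral>\<^sup>+y. ennreal (- u y) \<partial>lborel)"
      unfolding Up_def Um_def by (rule nn_integral_lborel_lines[OF \<theta>, symmetric], measurable)+
    have finP: "(\<integral>\<^sup>+y. ennreal (u y) \<partial>lborel) < \<infinity>" "(\<integral>\<^sup>+y. ennreal (- u y) \<partial>lborel) < \<infinity>"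
      using ui unfolding real_integrable_def by (auto simp: less_top)
    have "dir_pairing E \<psi> \<theta> = enn2real (\<integral>\<^sup>+y. ennreal (u y) \<partial>lborel) - enn2real (\<integral>\<^sup>+y. ennreal (- u y) \<partial>lborel)"
      unfolding dir_pairing_def u_def[symmetric] using real_lebesgue_integral_def[OF ui] by (simp add: u_def)
    then have "ennreal (dir_pairing E \<psi> \<theta>) = (\<integral>\<^sup>+x. Up x \<partial>?M) - (\<integral>\<^sup>+x. Um x \<partial>?M)"
      unfolding P using finP by (simp add: ennreal_minus[symmetric] less_top)
    also have "(\<integral>\<^sup>+x. Up x \<partial>?M) \<le> (\<integral>\<^sup>+x. (Up x - Um x) + Um x \<partial>?M)"
      by (intro nn_integral_mono) (metis add.commute diff_add_self_ennreal ennreal_minus_eq_0 le_cases le_iff_add order_refl add_0 order_trans)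
    also have "(\<integral>\<^sup>+x. (Up x - Um x) + Um x \<partial>?M) = (\<integral>\<^sup>+x. Up x - Um x \<partial>?M) + (\<integral>\<^sup>+x. Um x \<partial>?M)"
      by (rule nn_integral_add) (auto intro!: measurable_subspace_lborel)
    finally have "ennreal (dir_pairing E \<psi> \<theta>) \<le> ((\<integral>\<^sup>+x. Up x - Um x \<partial>?M) + (\<integral>\<^sup>+x. Um x \<partial>?M)) - (\<integral>\<^sup>+x. Um x \<partial>?M)"
      by (simp add: ennreal_minus_mono)
    then show "ennreal (dir_pairing E \<psi> \<theta>) \<le> (\<integral>\<^sup>+x. Up x - Um x \<partial>?M)"
      using finP P by (simp add: ennreal_add_diff_cancel_right less_top)
  qed
qed

text \<open>
  The variation of the slices lies between two Borel functions: lower limits of difference quotients from above,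
  and a supremum of countably many pairings from below. By Fatou's lemma the larger one has integral at most the
  directional variation, and the smaller one at least that; so they agree almost everywhere. This is also what
  makes the variation of the slices measurable up to null sets.
\<close>

theorem dir_variation_slices:
  fixes E \<Omega> :: "'a::euclidean_space set"
  assumes E [measurable]: "E \<in> sets borel" and \<Omega>: "open \<Omega>" "bounded \<Omega>" and \<theta>: "norm \<theta> = 1"
    and fin: "dir_variation E \<theta> \<Omega> < \<infinity>"
  obtains g where "g \<in> borel_measurable borel"
    "AE x in subspace_lborel (perp \<theta>). variation_in_open (slice E \<theta> x) (slice \<Omega> \<theta> x) = g x"
    "(\<integral>\<^sup>+x. g x \<partial>subspace_lborel (perp \<theta>)) = dir_variation E \<theta> \<Omega>"
proof -
  let ?M = "subspace_lborel (perp \<theta>)"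
  let ?f = "\<lambda>x. variation_in_open (slice E \<theta> x) (slice \<Omega> \<theta> x)"
  have [measurable]: "inner_part \<Omega> n \<in> sets borel" for n by (rule borel_open[OF open_inner_part])
  define q where "q n k x = (\<integral>\<^sup>+s. diff_quot E \<theta> k (x + s *\<^sub>R \<theta>) * indicator (inner_part \<Omega> n) (x + s *\<^sub>R \<theta>) \<partial>lborel)" for n k x
  have qm [measurable]: "q n k \<in> borel_measurable borel" for n k unfolding q_def[abs_def] by measurable
  define g where "g x = (SUP n. liminf (\<lambda>k. q n k x))" for x
  have gm [measurable]: "g \<in> borel_measurable borel" unfolding g_def[abs_def] by measurable
  have fg: "?f x \<le> g x" for x
    unfolding g_def q_def by (rule variation_slice_le[OF E \<Omega> \<theta>])
  have "(\<integral>\<^sup>+x. g x \<partial>?M) = (SUP n. \<integral>\<^sup>+x. liminf (\<lambda>k. q n k x) \<partial>?M)"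
    unfolding g_def
  proof (rule nn_integral_monotone_convergence_SUP)
    show "incseq (\<lambda>n x. liminf (\<lambda>k. q n k x))"
      unfolding q_def
      by (intro monoI le_funI Liminf_mono always_eventually allI nn_integral_mono mult_left_mono)
         (use inner_part_mono in \<open>auto simp: indicator_def\<close>)
  qed (intro measurable_subspace_lborel, measurable)
  also have "\<dots> \<le> dir_variation E \<theta> \<Omega>"
  proof (rule SUP_least)
    fix n
    have "(\<integral>\<^sup>+x. liminf (\<lambda>k. q n k x) \<partial>?M) \<le> liminf (\<lambda>k. \<integral>\<^sup>+x. q n k x \<partial>?M)"
      by (rule nn_integral_liminf) (intro measurable_subspace_lborel, measurable)
    also have "\<dots> \<le> liminf (\<lambda>k. dir_variation E \<theta> \<Omega>)"
    proof (rule Liminf_mono, rule eventually_sequentiallyI[of n])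
      fix k assume "n \<le> k"
      have "(\<integral>\<^sup>+x. q n k x \<partial>?M) = (\<integral>\<^sup>+y. diff_quot E \<theta> k y * indicator (inner_part \<Omega> n) y \<partial>lborel)"
        unfolding q_def by (rule nn_integral_lborel_lines[OF \<theta>, symmetric]) measurable
      also have "\<dots> \<le> dir_variation E \<theta> \<Omega>"
      proof (rule nn_integral_diff_quot_le[OF E open_inner_part])
        show "bounded (inner_part \<Omega> n)" by (rule bounded_subset[OF \<Omega>(2) inner_part_subset])
        fix y t assume y: "y \<in> inner_part \<Omega> n" and t: "0 \<le> t" "t \<le> 1 / (real k + 1)"
        have "dist y (y + t *\<^sub>R \<theta>) = t" using \<theta> t by (simp add: dist_norm)
        also have "t \<le> 1 / (real n + 1)" using t(2) \<open>n \<le> k\<close> by (elim order_trans) (simp add: frac_le)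
        finally show "y + t *\<^sub>R \<theta> \<in> \<Omega>" by (rule inner_part_dist[OF y])
      qed
      finally show "(\<integral>\<^sup>+x. q n k x \<partial>?M) \<le> dir_variation E \<theta> \<Omega>" .
    qed
    also have "\<dots> = dir_variation E \<theta> \<Omega>" by (simp add: Liminf_const)
    finally show "(\<integral>\<^sup>+x. liminf (\<lambda>k. q n k x) \<partial>?M) \<le> dir_variation E \<theta> \<Omega>" .
  qed
  finally have gle: "(\<integral>\<^sup>+x. g x \<partial>?M) \<le> dir_variation E \<theta> \<Omega>" .
  obtain \<psi> :: "nat \<Rightarrow> 'a \<Rightarrow> real" where \<psi>: "\<And>i. \<psi> i \<in> tests \<Omega>"
    "\<And>v. dir_variation E v \<Omega> = (SUP i. ennreal (dir_pairing E (\<psi> i) v))"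
    using dir_variation_countable[OF E] by blast
  have "\<exists>f. f \<in> borel_measurable borel \<and> (\<forall>x. f x \<le> ?f x) \<and> ennreal (dir_pairing E (\<psi> i) \<theta>) \<le> (\<integral>\<^sup>+x. f x \<partial>?M)" for i
    using pairing_le_nn_integral_slices[OF E \<theta> \<psi>(1)[of i]] by metis
  from choice[OF allI[OF this]] obtain F where F0: "\<forall>i. F i \<in> borel_measurable borel \<and> (\<forall>x. F i x \<le> ?f x)
      \<and> ennreal (dir_pairing E (\<psi> i) \<theta>) \<le> (\<integral>\<^sup>+x. F i x \<partial>?M)" ..
  then have F [measurable]: "\<And>i. F i \<in> borel_measurable borel" and Ff: "\<And>i x. F i x \<le> ?f x"
    and FI: "\<And>i. ennreal (dir_pairing E (\<psi> i) \<theta>) \<le> (\<integral>\<^sup>+x. F i x \<partial>?M)" by auto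
  define f0 where "f0 x = (SUP i. F i x)" for x
  have f0m [measurable]: "f0 \<in> borel_measurable borel" unfolding f0_def[abs_def] by measurable
  have f0f: "f0 x \<le> ?f x" for x unfolding f0_def by (intro SUP_least Ff)
  have f0ge: "dir_variation E \<theta> \<Omega> \<le> (\<integral>\<^sup>+x. f0 x \<partial>?M)"
    unfolding \<psi>(2)
  proof (rule SUP_least)
    fix i
    have "(\<integral>\<^sup>+x. F i x \<partial>?M) \<le> (\<integral>\<^sup>+x. f0 x \<partial>?M)" unfolding f0_def by (intro nn_integral_mono SUP_upper) auto
    then show "ennreal (dir_pairing E (\<psi> i) \<theta>) \<le> (\<integral>\<^sup>+x. f0 x \<partial>?M)" using FI order_trans by blast
  qed
  have f0g: "f0 x \<le> g x" for x using f0f fg order_trans by blast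
  have eq: "(\<integral>\<^sup>+x. g x \<partial>?M) = dir_variation E \<theta> \<Omega>" "(\<integral>\<^sup>+x. f0 x \<partial>?M) = dir_variation E \<theta> \<Omega>"
    using gle f0ge nn_integral_mono[of ?M f0 g] f0g by (auto intro!: antisym intro: order_trans)
  have "(\<integral>\<^sup>+x. g x - f0 x \<partial>?M) = (\<integral>\<^sup>+x. g x \<partial>?M) - (\<integral>\<^sup>+x. f0 x \<partial>?M)"
    by (rule nn_integral_diff) (use eq fin f0g in \<open>auto intro!: measurable_subspace_lborel\<close>)
  also have "\<dots> = 0" using fin by (simp add: eq)
  finally have "AE x in ?M. g x - f0 x = 0"
    by (subst (asm) nn_integral_0_iff_AE) (intro measurable_subspace_lborel, measurable)
  moreover have "AE x in ?M. g x \<noteq> \<infinity>"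
    by (rule nn_integral_noteq_infinite) (use eq fin in \<open>auto intro!: measurable_subspace_lborel\<close>)
  ultimately have "AE x in ?M. ?f x = g x"
  proof eventually_elim
    case (elim x)
    then have "g x \<le> f0 x" by (simp add: ennreal_minus_eq_0)
    then show ?case using f0f[of x] fg[of x] by (metis antisym order_trans)
  qed
  then show ?thesis using that[OF gm] eq by blast
qed

section \<open>Null sets and completions\<close>

lemma completion_sets_AE_cong:
  assumes "A \<in> sets M" "AE x in M. x \<in> A \<longleftrightarrow> x \<in> B" "B \<subseteq> space M"
  shows "B \<in> sets (completion M)"
  by (rule completion.in_sets_AE[OF AE_completion[OF assms(2)]]) (use assms in auto)

lemma completion_measurable_AE_cong:
  fixes f f' :: "'a \<Rightarrow> real"
  assumes f': "f' \<in> borel_measurable M" and eq: "AE x in M. f x = f' x"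
  shows "f \<in> borel_measurable (completion M)"
proof (rule measurableI)
  fix X :: "real set" assume X: "X \<in> sets borel"
  show "f -` X \<inter> space (completion M) \<in> sets (completion M)"
  proof (rule completion_sets_AE_cong)
    show "f' -` X \<inter> space M \<in> sets M" by (rule measurable_sets[OF f' X])
    show "AE x in M. x \<in> f' -` X \<inter> space M \<longleftrightarrow> x \<in> f -` X \<inter> space (completion M)"
      using eq by eventually_elim auto
  qed auto
qed simp

lemma integral_completion_AE_cong:
  fixes f f' :: "'a \<Rightarrow> real"
  assumes f': "f' \<in> borel_measurable M" and eq: "AE x in M. f x = f' x"
  shows "(\<integral>x. f x \<partial>completion M) = (\<integral>x. f' x \<partial>M)"
proof -
  have "(\<integral>x. f x \<partial>completion M) = (\<integral>x. f' x \<partial>completion M)"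
    by (rule integral_cong_AE[OF completion_measurable_AE_cong[OF f' eq] measurable_completion[OF f'] AE_completion[OF eq]])
  then show ?thesis by (simp add: integral_completion[OF f'])
qed

lemma integral_enn2real:
  assumes f [measurable]: "f \<in> borel_measurable M" and fin: "AE x in M. f x \<noteq> \<infinity>"
  shows "(\<integral>x. enn2real (f x) \<partial>M) = enn2real (\<integral>\<^sup>+x. f x \<partial>M)"
proof -
  have "(\<integral>x. enn2real (f x) \<partial>M) = enn2real (\<integral>\<^sup>+x. ennreal (enn2real (f x)) \<partial>M)"
    by (rule integral_eq_nn_integral) auto
  also have "(\<integral>\<^sup>+x. ennreal (enn2real (f x)) \<partial>M) = (\<integral>\<^sup>+x. f x \<partial>M)"
    using fin by (intro nn_integral_cong_AE, eventually_elim) (auto simp: top.not_eq_extremum)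
  finally show ?thesis .
qed

lemma lebesgue_AE_borel:
  assumes "E \<in> sets lebesgue"
  obtains E' where "E' \<in> sets borel" "E' \<subseteq> E" "AE x in lborel. x \<in> E \<longleftrightarrow> x \<in> E'"
proof -
  obtain S N N' where S: "E = S \<union> N" "N \<subseteq> N'" "N' \<in> null_sets lborel" "S \<in> sets lborel"
    using assms by (rule sets_completionE)
  have "AE x in lborel. x \<notin> N'" using S(3) by (rule AE_not_in)
  then have "AE x in lborel. x \<in> E \<longleftrightarrow> x \<in> S" by eventually_elim (use S in auto)
  then show ?thesis using that[of S] S by auto
qed

lemma AE_slice_cong:
  fixes E E' :: "'a::euclidean_space set"
  assumes "norm \<theta> = 1" "AE x in lborel. x \<in> E \<longleftrightarrow> x \<in> E'"
  shows "AE x in subspace_lborel (perp \<theta>). AE s in lborel. s \<in> slice E \<theta> x \<longleftrightarrow> s \<in> slice E' \<theta> x"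
  using AE_lborel_lines[OF assms] by (simp add: slice_def)

lemma lebesgue_sets_AE_cong:
  fixes A :: "'a::euclidean_space set"
  assumes "A' \<in> sets borel" "AE s in lborel. s \<in> A \<longleftrightarrow> s \<in> A'"
  shows "A \<in> sets lebesgue"
proof -
  have "AE s in lborel. s \<in> A' \<longleftrightarrow> s \<in> A" using assms(2) by eventually_elim auto
  then show ?thesis using assms(1) by (intro completion_sets_AE_cong[of A']) auto
qed

section \<open>The integral formula for the perimeter\<close>

text \<open>
  Almost every slice has finite variation in all balls, and the variation counts the essential boundary.
\<close>

lemma AE_discrete_slices:
  fixes E :: "'a::euclidean_space set"
  assumes E: "E \<in> sets borel" and lfp: "locally_finite_perimeter E" and \<theta>: "norm \<theta> = 1"
  shows "AE x in subspace_lborel (perp \<theta>). discrete_essential_boundary (slice E \<theta> x)"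
proof -
  let ?M = "subspace_lborel (perp \<theta>)"
  have "AE x in ?M. variation_in_open (slice E \<theta> x) (slice (ball 0 (real n)) \<theta> x) \<noteq> \<infinity>" for n
  proof -
    have "perimeter E (ball 0 (real n)) < \<infinity>" using lfp unfolding locally_finite_perimeter_def by auto
    then have "dir_variation E \<theta> (ball 0 (real n)) < \<infinity>"
      using dir_variation_le_variation[OF E \<theta>, of "ball 0 (real n)"] by (simp add: perimeter_open)
    note fin = this
    obtain g where g: "g \<in> borel_measurable borel"
      "AE x in ?M. variation_in_open (slice E \<theta> x) (slice (ball 0 (real n)) \<theta> x) = g x"
      "(\<integral>\<^sup>+x. g x \<partial>?M) = dir_variation E \<theta> (ball 0 (real n))"
      by (rule dir_variation_slices[OF E open_ball bounded_ball \<theta> fin])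
    have "AE x in ?M. g x \<noteq> \<infinity>"
      by (rule nn_integral_noteq_infinite) (use g fin in \<open>auto intro!: measurable_subspace_lborel\<close>)
    then show ?thesis using g(2) by eventually_elim simp
  qed
  then have "AE x in ?M. \<forall>n. variation_in_open (slice E \<theta> x) (slice (ball 0 (real n)) \<theta> x) \<noteq> \<infinity>"
    by (simp add: AE_all_countable)
  then show ?thesis
  proof eventually_elim
    case (elim x)
    show ?case
      unfolding discrete_essential_boundary_def
    proof (intro allI)
      fix a b
      obtain n where n: "norm x + \<bar>a\<bar> + \<bar>b\<bar> < real n" using reals_Archimedean2 by blast
      have "{a<..<b} \<subseteq> slice (ball 0 (real n)) \<theta> x"
      proof
        fix s assume s: "s \<in> {a<..<b}"
        have "norm (x + s *\<^sub>R \<theta>) \<le> norm x + \<bar>s\<bar>" using norm_triangle_ineq[of x "s *\<^sub>R \<theta>"] \<theta> by simp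
        then show "s \<in> slice (ball 0 (real n)) \<theta> x" using s n by (auto simp: slice_def)
      qed
      moreover have "emeasure (count_space UNIV) (essential_boundary (slice E \<theta> x) \<inter> slice (ball 0 (real n)) \<theta> x) \<noteq> \<infinity>"
        using count_le_variation_in_open[OF borel_slice[OF E, of \<theta> x] open_slice[OF open_ball, of 0 "real n" \<theta> x]] elim
        by (metis infinity_ennreal_def top_unique)
      then have "finite (essential_boundary (slice E \<theta> x) \<inter> slice (ball 0 (real n)) \<theta> x)"
        by (auto simp: emeasure_count_space split: if_splits)
      ultimately show "finite (essential_boundary (slice E \<theta> x) \<inter> {a<..<b})"
        by (elim finite_subset[rotated]) auto
    qed
  qed
qed

lemma C1d_eq: "C1d (k::'n::finite) = sphere_const TYPE(real ^ 'n)"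
proof -
  have "C1d k = (\<integral>\<theta>. \<bar>\<theta> \<bullet> axis k 1\<bar> \<partial>(sphere_lborel :: (real^'n) measure))"
    unfolding C1d_def sphere_measure_eq by (rule integral_completion) (auto intro!: measurable_sphere_lborel)
  then show ?thesis using mean_width_unit[of "axis k 1" "TYPE(real^'n)"] by (simp add: mean_width_def norm_axis_1)
qed

lemma nn_integral_slice_variation:
  fixes E \<Omega> :: "'a::euclidean_space set"
  assumes E: "E \<in> sets borel" and lfp: "locally_finite_perimeter E" and \<Omega>: "open \<Omega>" "bounded \<Omega>" and \<theta>: "norm \<theta> = 1"
  shows "(\<integral>\<^sup>+x. variation_in_open (slice E \<theta> x) (slice \<Omega> \<theta> x) \<partial>subspace_lborel (perp \<theta>)) = dir_variation E \<theta> \<Omega>"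
proof -
  have "perimeter E \<Omega> < \<infinity>" using lfp \<Omega> unfolding locally_finite_perimeter_def by auto
  then have "dir_variation E \<theta> \<Omega> < \<infinity>"
    using dir_variation_le_variation[OF E \<theta>, of \<Omega>] \<Omega> by (simp add: perimeter_open)
  then obtain g where "AE x in subspace_lborel (perp \<theta>). variation_in_open (slice E \<theta> x) (slice \<Omega> \<theta> x) = g x"
    "(\<integral>\<^sup>+x. g x \<partial>subspace_lborel (perp \<theta>)) = dir_variation E \<theta> \<Omega>"
    by (rule dir_variation_slices[OF E \<Omega> \<theta>])
  then show ?thesis using nn_integral_cong_AE[of "\<lambda>x. variation_in_open (slice E \<theta> x) (slice \<Omega> \<theta> x)" g] by simp
qed

text \<open>
  Averaging over directions and slicing, applied to a Borel representative, which has the same slices up to null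
  sets on almost every line.
\<close>

theorem perimeter_open_eq_integral_slices:
  fixes E \<Omega> :: "(real ^ 'n) set" and k :: 'n
  assumes lfp: "locally_finite_perimeter E" and \<Omega>: "open \<Omega>" "bounded \<Omega>"
  shows "perimeter E \<Omega> =
    (\<integral>\<^sup>+ \<theta>. (\<integral>\<^sup>+ x. perimeter (slice E \<theta> x) (slice \<Omega> \<theta> x) \<partial>subspace_lebesgue (perp \<theta>))
       \<partial>sphere_measure) / ennreal (C1d k)"
proof -
  have EL: "E \<in> sets lebesgue" using lfp by (simp add: locally_finite_perimeter_def)
  obtain E' where E': "E' \<in> sets borel" "AE x in lborel. x \<in> E \<longleftrightarrow> x \<in> E'" using lebesgue_AE_borel[OF EL] by metis
  note cong = EL E'
  have lfp': "locally_finite_perimeter E'" using lfp locally_finite_perimeter_cong[OF cong] by simp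
  have fin: "perimeter E' \<Omega> < \<infinity>" using lfp' \<Omega> unfolding locally_finite_perimeter_def by auto
  have inner: "(\<integral>\<^sup>+ x. perimeter (slice E \<theta> x) (slice \<Omega> \<theta> x) \<partial>subspace_lebesgue (perp \<theta>)) = dir_variation E' \<theta> \<Omega>"
    if \<theta>: "norm \<theta> = 1" for \<theta>
  proof -
    have "AE x in subspace_lborel (perp \<theta>). perimeter (slice E \<theta> x) (slice \<Omega> \<theta> x) = variation_in_open (slice E' \<theta> x) (slice \<Omega> \<theta> x)"
      using AE_slice_cong[OF \<theta> E'(2)]
    proof eventually_elim
      case (elim x)
      show ?case
        using perimeter_cong[OF lebesgue_sets_AE_cong[OF borel_slice[OF E'(1)] elim] borel_slice[OF E'(1)] elim]
          perimeter_open[OF open_slice[OF \<Omega>(1)]] by metis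
    qed
    from nn_integral_cong_AE[OF this] show ?thesis
      unfolding subspace_lebesgue_eq nn_integral_completion nn_integral_slice_variation[OF E'(1) lfp' \<Omega> \<theta>] .
  qed
  have "(\<integral>\<^sup>+ \<theta>. (\<integral>\<^sup>+ x. perimeter (slice E \<theta> x) (slice \<Omega> \<theta> x) \<partial>subspace_lebesgue (perp \<theta>)) \<partial>sphere_measure)
      = (\<integral>\<^sup>+ \<theta>. dir_variation E' \<theta> \<Omega> \<partial>sphere_lborel)"
    unfolding sphere_measure_eq nn_integral_completion
    by (rule nn_integral_cong) (simp add: space_sphere_lborel inner)
  also have "\<dots> = ennreal (C1d k) * perimeter E \<Omega>"
    using nn_integral_dir_variation[OF E'(1), of \<Omega>] fin \<Omega> perimeter_cong[OF cong] by (simp add: perimeter_open C1d_eq)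
  finally show ?thesis
    using sphere_const_pos[where 'n='n]
    by (simp add: C1d_eq mult.commute[of "ennreal _"] ennreal_mult_divide_eq)
qed

section \<open>The one-dimensional contributions\<close>

text \<open>
  The open intervals between a point and its neighbours in the essential boundary, unbounded if there is no
  neighbour.
\<close>

definition left_gap :: "real set \<Rightarrow> real \<Rightarrow> real set" where
  "left_gap A s = {u. u < s \<and> essential_boundary A \<inter> {u..<s} = {}}"

definition right_gap :: "real set \<Rightarrow> real \<Rightarrow> real set" where
  "right_gap A s = {u. s < u \<and> essential_boundary A \<inter> {s<..u} = {}}"

lemma left_gap_eq:
  assumes disc: "discrete_essential_boundary A" and rb: "reduced_boundary B = essential_boundary A"
  shows "{u. next_left B s < ereal u \<and> u < s} = left_gap A s"
proof safe
  fix u assume u: "next_left B s < ereal u" "u < s"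
  have "essential_boundary A \<inter> {u..<s} = {}"
  proof (rule ccontr)
    assume "essential_boundary A \<inter> {u..<s} \<noteq> {}"
    then obtain t where t: "t \<in> essential_boundary A" "u \<le> t" "t < s" by auto
    then have "ereal t \<le> next_left B s" unfolding next_left_def rb by (intro SUP_upper) auto
    then show False using u t by (metis ereal_less_eq(3) less_le_trans not_le order_trans)
  qed
  then show "u \<in> left_gap A s" using u by (simp add: left_gap_def)
next
  fix u assume "u \<in> left_gap A s"
  then have u: "u < s" "essential_boundary A \<inter> {u..<s} = {}" by (auto simp: left_gap_def)
  then show "u < s" by simp
  obtain d where d: "d > 0" "\<And>t. t \<in> essential_boundary A \<Longrightarrow> t \<noteq> u \<Longrightarrow> d \<le> \<bar>t - u\<bar>"
    using discrete_essential_boundary_isolated[OF disc, of u] by metis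
  have "next_left B s \<le> ereal (u - d)"
    unfolding next_left_def rb
  proof (rule SUP_least)
    fix t assume "t \<in> {t \<in> essential_boundary A. t < s}"
    then have t: "t \<in> essential_boundary A" "t < s" by auto
    then have "t < u" using u by (metis IntI atLeastLessThan_iff empty_iff not_le)
    then show "ereal t \<le> ereal (u - d)" using d(2)[OF t(1)] by simp
  qed
  also have "\<dots> < ereal u" using d(1) by simp
  finally show "next_left B s < ereal u" .
qed

lemma right_gap_eq:
  assumes disc: "discrete_essential_boundary A" and rb: "reduced_boundary B = essential_boundary A"
  shows "{u. s < u \<and> ereal u < next_right B s} = right_gap A s"
proof safe
  fix u assume u: "ereal u < next_right B s" "s < u"
  have "essential_boundary A \<inter> {s<..u} = {}"
  proof (rule ccontr)
    assume "essential_boundary A \<inter> {s<..u} \<noteq> {}"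
    then obtain t where t: "t \<in> essential_boundary A" "s < t" "t \<le> u" by auto
    then have "next_right B s \<le> ereal t" unfolding next_right_def rb by (intro INF_lower) auto
    then show False using u t by (metis ereal_less_eq(3) less_le_trans not_le order_trans)
  qed
  then show "u \<in> right_gap A s" using u by (simp add: right_gap_def)
next
  fix u assume "u \<in> right_gap A s"
  then have u: "s < u" "essential_boundary A \<inter> {s<..u} = {}" by (auto simp: right_gap_def)
  then show "s < u" by simp
  obtain d where d: "d > 0" "\<And>t. t \<in> essential_boundary A \<Longrightarrow> t \<noteq> u \<Longrightarrow> d \<le> \<bar>t - u\<bar>"
    using discrete_essential_boundary_isolated[OF disc, of u] by metis
  have "ereal u < ereal (u + d)" using d(1) by simp
  also have "ereal (u + d) \<le> next_right B s"
    unfolding next_right_def rb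
  proof (rule INF_greatest)
    fix t assume "t \<in> {t \<in> essential_boundary A. s < t}"
    then have t: "t \<in> essential_boundary A" "s < t" by auto
    then have "u < t" using u by (metis IntI greaterThanAtMost_iff empty_iff not_le)
    then show "ereal (u + d) \<le> ereal t" using d(2)[OF t(1)] by simp
  qed
  finally show "ereal u < next_right B s" .
qed

lemma borel_left_gap:
  assumes A: "A \<in> sets borel" shows "left_gap A s \<in> sets borel"
proof (rule borel_open, rule openI)
  fix u assume u: "u \<in> left_gap A s"
  then have "u \<in> - essential_boundary A" by (auto simp: left_gap_def disjoint_iff)
  then obtain e where e: "e > 0" "ball u e \<subseteq> - essential_boundary A"
    using closed_essential_boundary[OF A] by (metis open_Compl openE)
  have "ball u (min e (s - u)) \<subseteq> left_gap A s"
  proof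
    fix v assume v: "v \<in> ball u (min e (s - u))"
    have "t \<notin> essential_boundary A" if t: "v \<le> t" "t < s" for t
    proof (cases "t < u")
      case True
      then have "t \<in> ball u e" using v t by (auto simp: dist_real_def)
      then show ?thesis using e(2) by auto
    qed (use u t in \<open>auto simp: left_gap_def disjoint_iff\<close>)
    then show "v \<in> left_gap A s" using v by (auto simp: left_gap_def dist_real_def)
  qed
  moreover have "min e (s - u) > 0" using e u by (auto simp: left_gap_def)
  ultimately show "\<exists>e>0. ball u e \<subseteq> left_gap A s" by blast
qed

lemma borel_right_gap:
  assumes A: "A \<in> sets borel" shows "right_gap A s \<in> sets borel"
proof (rule borel_open, rule openI)
  fix u assume u: "u \<in> right_gap A s"
  then have "u \<in> - essential_boundary A" by (auto simp: right_gap_def disjoint_iff)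
  then obtain e where e: "e > 0" "ball u e \<subseteq> - essential_boundary A"
    using closed_essential_boundary[OF A] by (metis open_Compl openE)
  have "ball u (min e (u - s)) \<subseteq> right_gap A s"
  proof
    fix v assume v: "v \<in> ball u (min e (u - s))"
    have "t \<notin> essential_boundary A" if t: "s < t" "t \<le> v" for t
    proof (cases "u < t")
      case True
      then have "t \<in> ball u e" using v t by (auto simp: dist_real_def)
      then show ?thesis using e(2) by auto
    qed (use u t in \<open>auto simp: right_gap_def disjoint_iff\<close>)
    then show "v \<in> right_gap A s" using v by (auto simp: right_gap_def dist_real_def)
  qed
  moreover have "min e (u - s) > 0" using e u by (auto simp: right_gap_def)
  ultimately show "\<exists>e>0. ball u e \<subseteq> right_gap A s" by blast
qed

text \<open>
  The inner integrals of \<^const>\<open>r_fun\<close>, for a ray in direction \<open>\<theta>\<close> in a space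
  of any dimension.
\<close>

definition flux :: "(real \<Rightarrow> real) \<Rightarrow> 'a::euclidean_space set \<Rightarrow> 'a \<Rightarrow> 'a \<Rightarrow> ennreal" where
  "flux \<kappa> E \<theta> y = (\<integral>\<^sup>+\<rho>. ennreal (\<bar>indicat_real E y - indicat_real E (y + \<rho> *\<^sub>R \<theta>)\<bar> * \<kappa> \<rho>) * indicator {0<..} \<rho> \<partial>lborel)"

lemma flux_slice: "flux \<kappa> E \<theta> (x + u *\<^sub>R \<theta>) = flux \<kappa> (slice E \<theta> x) 1 u"
  by (simp add: flux_def indicator_slice algebra_simps)

lemma borel_measurable_flux [measurable]:
  assumes [measurable]: "E \<in> sets borel" "\<kappa> \<in> borel_measurable borel"
  shows "flux \<kappa> E \<theta> \<in> borel_measurable borel"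
  unfolding flux_def[abs_def] by measurable

lemma flux_le:
  assumes "\<And>\<rho>. 0 \<le> \<kappa> \<rho>"
  shows "flux \<kappa> E \<theta> y \<le> (\<integral>\<^sup>+\<rho>. ennreal (\<kappa> \<rho>) \<partial>lborel)"
  unfolding flux_def by (rule nn_integral_mono) (auto simp: indicator_def assms)

text \<open>
  The integrands change on null sets only, because translates of null sets are null; reflection turns the
  integrals over negative \<open>\<rho>\<close> into the flux in direction \<open>-1\<close>.
\<close>

lemma r_fun_eq:
  fixes A A' :: "real set" and \<kappa> \<kappa>' :: "real \<Rightarrow> real"
  assumes A' [measurable]: "A' \<in> sets borel" and disc: "discrete_essential_boundary A'"
    and AA: "AE u in lborel. u \<in> A \<longleftrightarrow> u \<in> A'"
    and \<kappa>' [measurable]: "\<kappa>' \<in> borel_measurable borel" and nn: "\<And>\<rho>. 0 \<le> \<kappa>' \<rho>" and eq: "AE \<rho> in lborel. \<kappa> \<rho> = \<kappa>' \<rho>"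
    and even: "\<And>\<rho>. \<kappa>' (- \<rho>) = \<kappa>' \<rho>"
    and fin: "(\<integral>\<^sup>+\<rho>. ennreal (\<kappa>' \<rho>) \<partial>lborel) < \<infinity>"
  shows "r_fun \<kappa> A s = enn2real (\<integral>\<^sup>+\<rho>. ennreal (\<bar>\<rho>\<bar> * \<kappa>' \<rho>) * indicator {-1..1} \<rho> \<partial>lborel)
     - enn2real (\<integral>\<^sup>+u. flux \<kappa>' A' 1 u * indicator (left_gap A' s) u \<partial>lborel)
     - enn2real (\<integral>\<^sup>+u. flux \<kappa>' A' (-1) u * indicator (right_gap A' s) u \<partial>lborel)"
proof -
  have rb: "reduced_boundary A = essential_boundary A'"
    using reduced_boundary_cong[OF lebesgue_sets_AE_cong[OF A' AA] A' AA] reduced_boundary_real[OF A' disc] by simp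
  have fluxfin: "flux \<kappa>' A' t u \<noteq> \<infinity>" for t u using flux_le[where \<kappa>=\<kappa>' and E=A' and \<theta>=t and y=u, OF nn] fin by (auto simp: top_unique)
  have shift: "AE \<rho> in lborel. u + \<rho> \<in> A \<longleftrightarrow> u + \<rho> \<in> A'" for u
  proof -
    have "AE \<rho> in distr lborel borel ((+) u). \<rho> \<in> A \<longleftrightarrow> \<rho> \<in> A'" using AA unfolding lborel_distr_plus .
    then show ?thesis by (rule AE_distrD[rotated]) simp
  qed
  have inner1: "(LINT \<rho>:{0..}|lebesgue. \<bar>indicat_real A u - indicat_real A (u + \<rho>)\<bar> * \<kappa> \<rho>) = enn2real (flux \<kappa>' A' 1 u)"
    if u: "u \<in> A \<longleftrightarrow> u \<in> A'" for u
  proof -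
    have "(LINT \<rho>:{0..}|lebesgue. \<bar>indicat_real A u - indicat_real A (u + \<rho>)\<bar> * \<kappa> \<rho>)
        = (\<integral>\<rho>. (\<bar>indicat_real A' u - indicat_real A' (u + \<rho>)\<bar> * \<kappa>' \<rho>) * indicat_real {0<..} \<rho> \<partial>lborel)"
      unfolding set_lebesgue_integral_def
    proof (rule integral_completion_AE_cong)
      show "AE \<rho> in lborel. indicat_real {0..} \<rho> *\<^sub>R (\<bar>indicat_real A u - indicat_real A (u + \<rho>)\<bar> * \<kappa> \<rho>)
          = (\<bar>indicat_real A' u - indicat_real A' (u + \<rho>)\<bar> * \<kappa>' \<rho>) * indicat_real {0<..} \<rho>"
        using shift[of u] eq AE_lborel_singleton[of 0] by eventually_elim (use u in \<open>auto simp: indicator_def\<close>)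
    qed measurable
    also have "\<dots> = enn2real (flux \<kappa>' A' 1 u)"
      unfolding flux_def
      by (subst integral_eq_nn_integral) (auto intro!: arg_cong[where f=enn2real] nn_integral_cong simp: nn indicator_def)
    finally show ?thesis .
  qed
  have flux2: "flux \<kappa>' A' (-1) u = (\<integral>\<^sup>+\<rho>. ennreal (\<bar>indicat_real A' u - indicat_real A' (u + \<rho>)\<bar> * \<kappa>' \<rho>) * indicator {..<0} \<rho> \<partial>lborel)" for u
  proof -
    have "(\<integral>\<^sup>+\<rho>. ennreal (\<bar>indicat_real A' u - indicat_real A' (u + \<rho>)\<bar> * \<kappa>' \<rho>) * indicator {..<0} \<rho> \<partial>lborel)
      = (\<integral>\<^sup>+\<rho>. ennreal (\<bar>indicat_real A' u - indicat_real A' (u + (0 - \<rho>))\<bar> * \<kappa>' (0 - \<rho>)) * indicator {..<0} (0 - \<rho>) \<partial>lborel)"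
      by (rule nn_integral_lborel_reflect[symmetric]) measurable
    also have "\<dots> = flux \<kappa>' A' (-1) u"
      unfolding flux_def by (rule nn_integral_cong) (auto simp: even indicator_def)
    finally show ?thesis ..
  qed
  have inner2: "(LINT \<rho>:{..0}|lebesgue. \<bar>indicat_real A u - indicat_real A (u + \<rho>)\<bar> * \<kappa> \<rho>) = enn2real (flux \<kappa>' A' (-1) u)"
    if u: "u \<in> A \<longleftrightarrow> u \<in> A'" for u
  proof -
    have "(LINT \<rho>:{..0}|lebesgue. \<bar>indicat_real A u - indicat_real A (u + \<rho>)\<bar> * \<kappa> \<rho>)
        = (\<integral>\<rho>. (\<bar>indicat_real A' u - indicat_real A' (u + \<rho>)\<bar> * \<kappa>' \<rho>) * indicat_real {..<0} \<rho> \<partial>lborel)"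
      unfolding set_lebesgue_integral_def
    proof (rule integral_completion_AE_cong)
      show "AE \<rho> in lborel. indicat_real {..0} \<rho> *\<^sub>R (\<bar>indicat_real A u - indicat_real A (u + \<rho>)\<bar> * \<kappa> \<rho>)
          = (\<bar>indicat_real A' u - indicat_real A' (u + \<rho>)\<bar> * \<kappa>' \<rho>) * indicat_real {..<0} \<rho>"
        using shift[of u] eq AE_lborel_singleton[of 0] by eventually_elim (use u in \<open>auto simp: indicator_def\<close>)
    qed measurable
    also have "\<dots> = enn2real (flux \<kappa>' A' (-1) u)"
      unfolding flux2
      by (subst integral_eq_nn_integral) (auto intro!: arg_cong[where f=enn2real] nn_integral_cong simp: nn indicator_def)
    finally show ?thesis .
  qed
  have outer: "(LINT u:S|lebesgue. f u) = enn2real (\<integral>\<^sup>+u. flux \<kappa>' A' t u * indicator S u \<partial>lborel)"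
    if S [measurable]: "S \<in> sets borel" and f: "\<And>u. (u \<in> A \<longleftrightarrow> u \<in> A') \<Longrightarrow> f u = enn2real (flux \<kappa>' A' t u)" for S f t
  proof -
    have "(LINT u:S|lebesgue. f u) = (\<integral>u. enn2real (flux \<kappa>' A' t u * indicator S u) \<partial>lborel)"
      unfolding set_lebesgue_integral_def
    proof (rule integral_completion_AE_cong)
      show "AE u in lborel. indicat_real S u *\<^sub>R f u = enn2real (flux \<kappa>' A' t u * indicator S u)"
        using AA by eventually_elim (auto simp: f indicator_def)
    qed measurable
    also have "\<dots> = enn2real (\<integral>\<^sup>+u. flux \<kappa>' A' t u * indicator S u \<partial>lborel)"
      by (rule integral_enn2real) (use fluxfin in \<open>auto simp: indicator_def\<close>)
    finally show ?thesis .
  qed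
  have "(LINT \<rho>:{-1..1}|lebesgue. \<bar>\<rho>\<bar> * \<kappa> \<rho>) = (\<integral>\<rho>. (\<bar>\<rho>\<bar> * \<kappa>' \<rho>) * indicat_real {-1..1} \<rho> \<partial>lborel)"
    unfolding set_lebesgue_integral_def
    by (rule integral_completion_AE_cong, measurable) (use eq in \<open>eventually_elim, simp\<close>)
  also have "\<dots> = enn2real (\<integral>\<^sup>+\<rho>. ennreal (\<bar>\<rho>\<bar> * \<kappa>' \<rho>) * indicator {-1..1} \<rho> \<partial>lborel)"
    by (subst integral_eq_nn_integral) (auto intro!: arg_cong[where f=enn2real] nn_integral_cong simp: nn indicator_def)
  finally show ?thesis
    unfolding r_fun_def left_gap_eq[OF disc rb] right_gap_eq[OF disc rb]
    using outer[OF borel_left_gap[OF A'] inner1] outer[OF borel_right_gap[OF A'] inner2] by simp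
qed

text \<open>
  The indicator function is constant up to a null set on each interval free of boundary points. Intervals with
  rational end points suffice, because the boundary points are isolated.
\<close>

lemma AE_const_to_right:
  assumes A [measurable]: "A \<in> sets borel" and disc: "discrete_essential_boundary A"
  shows "AE u in lborel. \<forall>q>0. essential_boundary A \<inter> {u<..<u + q} = {} \<longrightarrow>
    (AE \<rho> in lborel. 0 < \<rho> \<and> \<rho> < q \<longrightarrow> (u + \<rho> \<in> A \<longleftrightarrow> u \<in> A))"
proof -
  have shift: "AE \<rho> in lborel. P (u + \<rho>)" if "AE v in lborel. P v" for P and u :: real
  proof -
    have "AE \<rho> in distr lborel borel ((+) u). P \<rho>" using that unfolding lborel_distr_plus .
    then show ?thesis by (rule AE_distrD[rotated]) simp
  qed
  have one: "AE u in lborel. essential_boundary A \<inter> {a<..<b} = {} \<longrightarrow> a < u \<and> u < b \<longrightarrow>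
      (AE \<rho> in lborel. 0 < \<rho> \<and> \<rho> < b - u \<longrightarrow> (u + \<rho> \<in> A \<longleftrightarrow> u \<in> A))" for a b
  proof (cases "essential_boundary A \<inter> {a<..<b} = {}")
    case True
    from AE_const_between_essential_boundary[OF A True] show ?thesis
    proof
      assume c: "AE u in lborel. a < u \<and> u < b \<longrightarrow> u \<in> A"
      from c show ?thesis
      proof eventually_elim
        case (elim u)
        from shift[OF c, of u] have "AE \<rho> in lborel. a < u \<and> u < b \<longrightarrow> 0 < \<rho> \<and> \<rho> < b - u \<longrightarrow> (u + \<rho> \<in> A \<longleftrightarrow> u \<in> A)"
          by eventually_elim (use elim in auto)
        then show ?case by auto
      qed
    next
      assume c: "AE u in lborel. a < u \<and> u < b \<longrightarrow> u \<notin> A"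
      from c show ?thesis
      proof eventually_elim
        case (elim u)
        from shift[OF c, of u] have "AE \<rho> in lborel. a < u \<and> u < b \<longrightarrow> 0 < \<rho> \<and> \<rho> < b - u \<longrightarrow> (u + \<rho> \<in> A \<longleftrightarrow> u \<in> A)"
          by eventually_elim (use elim in auto)
        then show ?case by auto
      qed
    qed
  qed simp
  have "AE u in lborel. \<forall>a\<in>\<rat>. \<forall>b\<in>\<rat>. essential_boundary A \<inter> {a<..<b} = {} \<longrightarrow> a < u \<and> u < b \<longrightarrow>
      (AE \<rho> in lborel. 0 < \<rho> \<and> \<rho> < b - u \<longrightarrow> (u + \<rho> \<in> A \<longleftrightarrow> u \<in> A))"
    unfolding AE_ball_countable[OF countable_rat] using one by blast
  moreover have "AE u in lborel. u \<notin> essential_boundary A"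
    using countable_discrete_essential_boundary[OF disc] by (intro AE_not_in countable_imp_null_set_lborel)
  ultimately show ?thesis
  proof eventually_elim
    case (elim u)
    show ?case
    proof (intro allI impI)
      fix q :: real assume q: "q > 0" and gap: "essential_boundary A \<inter> {u<..<u + q} = {}"
      obtain d where d: "d > 0" "\<And>t. t \<in> essential_boundary A \<Longrightarrow> t \<noteq> u \<Longrightarrow> d \<le> \<bar>t - u\<bar>"
        using discrete_essential_boundary_isolated[OF disc, of u] by metis
      obtain a where a: "a \<in> \<rat>" "u - d < a" "a < u" using Rats_dense_in_real[of "u - d" u] d(1) by auto
      have c: "AE \<rho> in lborel. 0 < \<rho> \<and> \<rho> < b - u \<longrightarrow> (u + \<rho> \<in> A \<longleftrightarrow> u \<in> A)" if b: "b \<in> \<rat>" "u < b" "b < u + q" for b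
      proof -
        have "essential_boundary A \<inter> {a<..<b} = {}"
        proof (rule ccontr)
          assume "essential_boundary A \<inter> {a<..<b} \<noteq> {}"
          then obtain t where t: "t \<in> essential_boundary A" "a < t" "t < b" by auto
          then have "t \<noteq> u" using elim(2) by auto
          then have "u < t" using d(2)[OF t(1)] a t by auto
          then show False using gap t b by auto
        qed
        then show ?thesis using elim(1) a b by auto
      qed
      have "AE \<rho> in lborel. \<forall>b\<in>{b \<in> \<rat>. u < b \<and> b < u + q}. 0 < \<rho> \<and> \<rho> < b - u \<longrightarrow> (u + \<rho> \<in> A \<longleftrightarrow> u \<in> A)"
        using c by (subst AE_ball_countable) (auto intro: countable_subset[OF _ countable_rat])
      then show "AE \<rho> in lborel. 0 < \<rho> \<and> \<rho> < q \<longrightarrow> (u + \<rho> \<in> A \<longleftrightarrow> u \<in> A)"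
      proof eventually_elim
        case (elim \<rho>)
        show ?case
        proof (intro impI)
          assume \<rho>: "0 < \<rho> \<and> \<rho> < q"
          obtain b where "b \<in> \<rat>" "u + \<rho> < b" "b < u + q" using Rats_dense_in_real[of "u + \<rho>" "u + q"] \<rho> by auto
          then show "u + \<rho> \<in> A \<longleftrightarrow> u \<in> A" using elim \<rho> by auto
        qed
      qed
    qed
  qed
qed

section \<open>The perimeter in the half-open cube\<close>

text \<open>
  Only the faces that belong to the half-open cube are moved outwards, so that these open sets decrease to it.
\<close>

definition outer_cube :: "real \<Rightarrow> nat \<Rightarrow> (real ^ 'n) set" where
  "outer_cube L n = box (vec (- (1 / (real n + 1)))) (vec L)"

lemma mem_outer_cube: "x \<in> outer_cube L n \<longleftrightarrow> (\<forall>i. - (1 / (real n + 1)) < x $ i \<and> x $ i < L)"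
  by (simp add: outer_cube_def mem_box_cart)

lemma open_outer_cube: "open (outer_cube L n)" and bounded_outer_cube: "bounded (outer_cube L n)"
  by (simp_all add: outer_cube_def bounded_box open_box)

lemma outer_cube_Suc: "outer_cube L (Suc n) \<subseteq> outer_cube L n"
proof
  fix x :: "real^'a" assume "x \<in> outer_cube L (Suc n)"
  moreover have "- (1 / (real n + 1)) \<le> - (1 / (real (Suc n) + 1))" by (simp add: frac_le)
  ultimately show "x \<in> outer_cube L n" unfolding mem_outer_cube by (meson le_less_trans)
qed

lemma cube_subset_outer_cube: "cube L \<subseteq> outer_cube L n"
proof
  fix x :: "real^'a" assume x: "x \<in> cube L"
  have "- (1 / (real n + 1)) < 0" by simp
  then show "x \<in> outer_cube L n" using x unfolding mem_outer_cube cube_def by (simp add: less_le_trans[of _ 0])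
qed

lemma Inter_outer_cube: "(\<Inter>n. outer_cube L n) = cube L"
proof
  show "(\<Inter>n. outer_cube L n) \<subseteq> (cube L :: (real^'a) set)"
  proof
    fix x :: "real^'a" assume x: "x \<in> (\<Inter>n. outer_cube L n)"
    have "0 \<le> x $ i" for i
    proof (rule ccontr)
      assume "\<not> 0 \<le> x $ i"
      then obtain n where "inverse (real (Suc n)) < - x $ i" using reals_Archimedean[of "- x $ i"] by auto
      then have "x $ i < - (1 / (real n + 1))" by (simp add: inverse_eq_divide add.commute)
      moreover have "- (1 / (real n + 1)) < x $ i" using x by (auto simp: mem_outer_cube)
      ultimately show False by simp
    qed
    moreover have "x $ i < L" for i using x by (auto simp: mem_outer_cube)
    ultimately show "x \<in> cube L" by (simp add: cube_def)
  qed
qed (use cube_subset_outer_cube in blast)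

lemma borel_cube [measurable]: "cube L \<in> sets borel"
proof -
  have "(\<Inter>n. outer_cube L n) \<in> sets borel" by (intro sets.countable_INT) (auto intro: borel_open open_outer_cube)
  then show ?thesis by (simp add: Inter_outer_cube)
qed

text \<open>
  The directional variation of the half-open cube; the infimum over this sequence of neighbourhoods is the outer
  regular value.
\<close>

definition cube_dir_variation :: "(real ^ 'n) set \<Rightarrow> real \<Rightarrow> real ^ 'n \<Rightarrow> ennreal" where
  "cube_dir_variation E L \<theta> = (INF n. dir_variation E \<theta> (outer_cube L n))"

lemma borel_measurable_cube_dir_variation:
  assumes "E \<in> sets borel" shows "cube_dir_variation E L \<in> borel_measurable borel"
  unfolding cube_dir_variation_def[abs_def] by (intro borel_measurable_INF measurable_dir_variation assms) auto

abbreviation boundary_count :: "'a::euclidean_space set \<Rightarrow> 'a \<Rightarrow> 'a set \<Rightarrow> 'a \<Rightarrow> ennreal" where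
  "boundary_count E \<theta> B x \<equiv> emeasure (count_space UNIV) (essential_boundary (slice E \<theta> x) \<inter> slice B \<theta> x)"

lemma AE_variation_slice_eq_count:
  fixes E \<Omega> :: "'a::euclidean_space set"
  assumes E: "E \<in> sets borel" and lfp: "locally_finite_perimeter E" and \<Omega>: "open \<Omega>" and \<theta>: "norm \<theta> = 1"
  shows "AE x in subspace_lborel (perp \<theta>). variation_in_open (slice E \<theta> x) (slice \<Omega> \<theta> x) = boundary_count E \<theta> \<Omega> x"
  using AE_discrete_slices[OF E lfp \<theta>]
  by eventually_elim (rule variation_in_open_real[OF borel_slice[OF E] _ open_slice[OF \<Omega>]])

lemma dir_variation_finite:
  fixes E \<Omega> :: "'a::euclidean_space set"
  assumes E: "E \<in> sets borel" and lfp: "locally_finite_perimeter E" and \<Omega>: "open \<Omega>" "bounded \<Omega>" and \<theta>: "norm \<theta> = 1"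
  shows "dir_variation E \<theta> \<Omega> < \<infinity>"
proof -
  have "perimeter E \<Omega> < \<infinity>" using lfp \<Omega> unfolding locally_finite_perimeter_def by auto
  then show ?thesis using dir_variation_le_variation[OF E \<theta>, of \<Omega>] \<Omega> by (simp add: perimeter_open)
qed

text \<open>
  Continuity from above of the counting measure and of the integral, starting from the finite count in the first
  neighbourhood.
\<close>

lemma cube_count_slices:
  fixes E :: "(real ^ 'n) set"
  assumes E: "E \<in> sets borel" and lfp: "locally_finite_perimeter E" and \<theta>: "norm \<theta> = 1"
  obtains g where "g \<in> borel_measurable borel" "AE x in subspace_lborel (perp \<theta>). boundary_count E \<theta> (cube L) x = g x"
    "(\<integral>\<^sup>+x. g x \<partial>subspace_lborel (perp \<theta>)) = cube_dir_variation E L \<theta>"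
proof -
  let ?M = "subspace_lborel (perp \<theta>)"
  note fin = dir_variation_finite[OF E lfp open_outer_cube[of L] bounded_outer_cube[of L] \<theta>]
  have "\<exists>g. g \<in> borel_measurable borel \<and> (AE x in ?M. variation_in_open (slice E \<theta> x) (slice (outer_cube L n) \<theta> x) = g x)
      \<and> (\<integral>\<^sup>+x. g x \<partial>?M) = dir_variation E \<theta> (outer_cube L n)" for n
    by (rule dir_variation_slices[OF E open_outer_cube bounded_outer_cube \<theta> fin]) blast
  from choice[OF allI[OF this]] obtain G where G0: "\<forall>n. G n \<in> borel_measurable borel
      \<and> (AE x in ?M. variation_in_open (slice E \<theta> x) (slice (outer_cube L n) \<theta> x) = G n x)
      \<and> (\<integral>\<^sup>+x. G n x \<partial>?M) = dir_variation E \<theta> (outer_cube L n)" ..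
  then have G [measurable]: "\<And>n. G n \<in> borel_measurable borel"
    and Gv: "\<And>n. AE x in ?M. variation_in_open (slice E \<theta> x) (slice (outer_cube L n) \<theta> x) = G n x"
    and GI: "\<And>n. (\<integral>\<^sup>+x. G n x \<partial>?M) = dir_variation E \<theta> (outer_cube L n)" by auto
  have Gc: "AE x in ?M. \<forall>n. boundary_count E \<theta> (outer_cube L n) x = G n x"
  proof (subst AE_all_countable, rule allI)
    fix n
    show "AE x in ?M. boundary_count E \<theta> (outer_cube L n) x = G n x"
      using AE_variation_slice_eq_count[OF E lfp open_outer_cube \<theta>, of L n] Gv[of n] by eventually_elim simp
  qed
  have G0fin: "AE x in ?M. G 0 x \<noteq> \<infinity>"
    by (rule nn_integral_noteq_infinite) (use fin[of 0] in \<open>auto intro!: measurable_subspace_lborel simp: GI\<close>)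
  have sl: "slice (outer_cube L (Suc n)) \<theta> x \<subseteq> slice (outer_cube L n) \<theta> x" for n x
    using outer_cube_Suc[of L n] by (auto simp: slice_def)
  show ?thesis
  proof
    show "(\<lambda>x. INF n. G n x) \<in> borel_measurable borel" by measurable
    show "AE x in ?M. boundary_count E \<theta> (cube L) x = (INF n. G n x)"
      using Gc G0fin
    proof eventually_elim
      case (elim x)
      have "(INF n. boundary_count E \<theta> (outer_cube L n) x)
          = emeasure (count_space UNIV) (\<Inter>n. essential_boundary (slice E \<theta> x) \<inter> slice (outer_cube L n) \<theta> x)"
      proof (rule INF_emeasure_decseq')
        show "decseq (\<lambda>n. essential_boundary (slice E \<theta> x) \<inter> slice (outer_cube L n) \<theta> x)"
          by (rule decseq_SucI) (use sl in auto)
        show "\<exists>n. boundary_count E \<theta> (outer_cube L n) x \<noteq> \<infinity>" using elim by metis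
      qed simp
      also have "(\<Inter>n. essential_boundary (slice E \<theta> x) \<inter> slice (outer_cube L n) \<theta> x) = essential_boundary (slice E \<theta> x) \<inter> slice (cube L) \<theta> x"
        unfolding Inter_outer_cube[symmetric] by (auto simp: slice_def)
      finally show ?case using elim by simp
    qed
    have "(\<integral>\<^sup>+x. (INF n. G n x) \<partial>?M) = (INF n. integral\<^sup>N ?M (G n))"
    proof (rule nn_integral_monotone_convergence_INF_AE')
      show "AE x in ?M. G (Suc n) x \<le> G n x" for n
        using Gc
      proof eventually_elim
        case (elim x)
        have "boundary_count E \<theta> (outer_cube L (Suc n)) x \<le> boundary_count E \<theta> (outer_cube L n) x"
          by (rule emeasure_mono) (use sl in auto)
        then show ?case using elim by simp
      qed
    qed (use fin in \<open>auto intro!: measurable_subspace_lborel simp: GI\<close>)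
    then show "(\<integral>\<^sup>+x. (INF n. G n x) \<partial>?M) = cube_dir_variation E L \<theta>" by (simp add: cube_dir_variation_def GI)
  qed
qed

text \<open>
  The half-open cube is a decreasing intersection of bounded open sets. For \<open>\<le>\<close>, the number of
  boundary points in the cube is at most that in any bounded open neighbourhood, where the formula for open sets
  applies; for \<open>\<ge>\<close>, the formula passes to the limit.
\<close>

lemma perimeter_cube:
  fixes E :: "(real ^ 'n) set"
  assumes E: "E \<in> sets borel" and lfp: "locally_finite_perimeter E"
  shows "(\<integral>\<^sup>+\<theta>. cube_dir_variation E L \<theta> \<partial>sphere_lborel) = ennreal (sphere_const TYPE(real ^ 'n)) * perimeter E (cube L)"
proof (rule antisym)
  define c where "c = ennreal (sphere_const TYPE(real ^ 'n))"
  have c: "c \<noteq> 0" "c \<noteq> \<infinity>" using sphere_const_pos[where 'n='n] by (auto simp: c_def)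
  have avg: "(\<integral>\<^sup>+\<theta>. dir_variation E \<theta> A \<partial>sphere_lborel) = c * variation_in_open E A" if "open A" "bounded A" for A
  proof -
    have "perimeter E A < \<infinity>" using lfp that unfolding locally_finite_perimeter_def by auto
    then show ?thesis unfolding c_def using that by (intro nn_integral_dir_variation[OF E]) (simp add: perimeter_open)
  qed
  have mono: "dir_variation E \<theta> A \<le> dir_variation E \<theta> B" if "A \<subseteq> B" for A B \<theta>
    unfolding dir_variation_def tests_def using C1c_mono[OF that] by (intro SUP_subset_mono) auto
  show "(\<integral>\<^sup>+\<theta>. cube_dir_variation E L \<theta> \<partial>sphere_lborel) \<le> ennreal (sphere_const TYPE(real ^ 'n)) * perimeter E (cube L)"
    unfolding c_def[symmetric]
  proof -
    have "(\<integral>\<^sup>+\<theta>. cube_dir_variation E L \<theta> \<partial>sphere_lborel) / c \<le> perimeter E (cube L)"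
      unfolding perimeter_def
    proof (rule INF_greatest)
      fix A :: "(real ^ 'n) set" assume "A \<in> {A. open A \<and> cube L \<subseteq> A}"
      then have A: "open A" "cube L \<subseteq> A" by auto
      define A' where "A' = A \<inter> outer_cube L 0"
      have A': "open A'" "bounded A'" "cube L \<subseteq> A'" "A' \<subseteq> A"
        using A cube_subset_outer_cube[of L 0] by (auto simp: A'_def open_outer_cube bounded_outer_cube bounded_Int open_Int)
      have "(\<integral>\<^sup>+\<theta>. cube_dir_variation E L \<theta> \<partial>sphere_lborel) \<le> (\<integral>\<^sup>+\<theta>. dir_variation E \<theta> A' \<partial>sphere_lborel)"
      proof (rule nn_integral_mono)
        fix \<theta> :: "real^'n" assume "\<theta> \<in> space sphere_lborel"
        then have \<theta>: "norm \<theta> = 1" by (simp add: space_sphere_lborel)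
        obtain g where g: "AE x in subspace_lborel (perp \<theta>). boundary_count E \<theta> (cube L) x = g x"
            "(\<integral>\<^sup>+x. g x \<partial>subspace_lborel (perp \<theta>)) = cube_dir_variation E L \<theta>"
          by (rule cube_count_slices[OF E lfp \<theta>])
        have "cube_dir_variation E L \<theta> \<le> (\<integral>\<^sup>+x. variation_in_open (slice E \<theta> x) (slice A' \<theta> x) \<partial>subspace_lborel (perp \<theta>))"
          unfolding g(2)[symmetric]
        proof (rule nn_integral_mono_AE)
          show "AE x in subspace_lborel (perp \<theta>). g x \<le> variation_in_open (slice E \<theta> x) (slice A' \<theta> x)"
            using g(1) AE_variation_slice_eq_count[OF E lfp A'(1) \<theta>]
          proof eventually_elim
            case (elim x)
            have "boundary_count E \<theta> (cube L) x \<le> boundary_count E \<theta> A' x"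
              by (rule emeasure_mono) (use A'(3) in \<open>auto simp: slice_def\<close>)
            then show ?case using elim by simp
          qed
        qed
        also have "\<dots> = dir_variation E \<theta> A'" by (rule nn_integral_slice_variation[OF E lfp A'(1,2) \<theta>])
        finally show "cube_dir_variation E L \<theta> \<le> dir_variation E \<theta> A'" .
      qed
      also have "\<dots> = c * variation_in_open E A'" by (rule avg[OF A'(1,2)])
      also have "\<dots> \<le> c * variation_in_open E A" by (intro mult_left_mono variation_in_open_mono A') simp
      finally have "(\<integral>\<^sup>+\<theta>. cube_dir_variation E L \<theta> \<partial>sphere_lborel) / c \<le> c * variation_in_open E A / c"
        by (rule divide_right_mono_ennreal)
      also have "\<dots> = variation_in_open E A" using c by (simp add: mult.commute[of c] ennreal_mult_divide_eq)
      finally show "(\<integral>\<^sup>+\<theta>. cube_dir_variation E L \<theta> \<partial>sphere_lborel) / c \<le> variation_in_open E A" .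
    qed
    then have "c * ((\<integral>\<^sup>+\<theta>. cube_dir_variation E L \<theta> \<partial>sphere_lborel) / c) \<le> c * perimeter E (cube L)" by (intro mult_left_mono) auto
    moreover have "c * (X / c) = X" for X using c by (simp add: ennreal_times_divide mult.commute[of c] ennreal_mult_divide_eq)
    ultimately show "(\<integral>\<^sup>+\<theta>. cube_dir_variation E L \<theta> \<partial>sphere_lborel) \<le> c * perimeter E (cube L)" by simp
  qed
  have "c * perimeter E (cube L) \<le> (INF n. \<integral>\<^sup>+\<theta>. dir_variation E \<theta> (outer_cube L n) \<partial>sphere_lborel)"
  proof (rule INF_greatest)
    fix n
    have "perimeter E (cube L) \<le> variation_in_open E (outer_cube L n)"
      unfolding perimeter_def by (intro INF_lower) (simp add: open_outer_cube cube_subset_outer_cube)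
    then show "c * perimeter E (cube L) \<le> (\<integral>\<^sup>+\<theta>. dir_variation E \<theta> (outer_cube L n) \<partial>sphere_lborel)"
      unfolding avg[OF open_outer_cube bounded_outer_cube] by (rule mult_left_mono) simp
  qed
  also have "\<dots> = (\<integral>\<^sup>+\<theta>. cube_dir_variation E L \<theta> \<partial>sphere_lborel)"
    unfolding cube_dir_variation_def
  proof (rule nn_integral_monotone_convergence_INF_AE'[symmetric])
    show "AE \<theta> in sphere_lborel. dir_variation E \<theta> (outer_cube L (Suc n)) \<le> dir_variation E \<theta> (outer_cube L n)" for n
      by (rule AE_I2) (rule mono[OF outer_cube_Suc])
    have "perimeter E (outer_cube L 0) < \<infinity>"
      using lfp unfolding locally_finite_perimeter_def by (blast intro: open_outer_cube bounded_outer_cube)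
    then show "(\<integral>\<^sup>+\<theta>. dir_variation E \<theta> (outer_cube L 0) \<partial>sphere_lborel) < \<infinity>"
      using c by (simp add: avg[OF open_outer_cube bounded_outer_cube] perimeter_open[OF open_outer_cube] ennreal_mult_less_top less_top)
  qed (auto intro!: measurable_sphere_lborel measurable_dir_variation[OF E])
  finally show "ennreal (sphere_const TYPE(real ^ 'n)) * perimeter E (cube L) \<le> (\<integral>\<^sup>+\<theta>. cube_dir_variation E L \<theta> \<partial>sphere_lborel)"
    by (simp add: c_def)
qed

section \<open>Transport to the next boundary point\<close>

text \<open>
  Up to a null set the segment of length \<open>q\<close> ahead of \<open>y\<close> lies in the complement of
  \<open>E\<close> or in \<open>E\<close>.
\<close>

definition const_ahead :: "'a::euclidean_space set \<Rightarrow> 'a \<Rightarrow> real \<Rightarrow> 'a \<Rightarrow> bool" where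
  "const_ahead E \<theta> q y \<longleftrightarrow>
     (\<integral>\<^sup>+\<rho>. indicator E (y + \<rho> *\<^sub>R \<theta>) * indicator {0<..<q} \<rho> \<partial>lborel) = (0::ennreal) \<or>
     (\<integral>\<^sup>+\<rho>. indicator (- E) (y + \<rho> *\<^sub>R \<theta>) * indicator {0<..<q} \<rho> \<partial>lborel) = (0::ennreal)"

text \<open>
  The distance from \<open>y\<close>, in direction \<open>\<theta>\<close>, to the next point of the essential boundary of the slice, expressed
  through integrals to make its measurability evident.
\<close>

definition reach :: "'a::euclidean_space set \<Rightarrow> 'a \<Rightarrow> 'a \<Rightarrow> ennreal" where
  "reach E \<theta> y = (SUP q\<in>{q \<in> \<rat>. 0 < q}. if const_ahead E \<theta> q y then ennreal q else 0)"

text \<open>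
  The points from which the next boundary point in direction \<open>\<theta>\<close> exists and lies in
  \<open>B\<close>.
\<close>

definition arrives :: "'a::euclidean_space set \<Rightarrow> 'a \<Rightarrow> 'a set \<Rightarrow> 'a set" where
  "arrives E \<theta> B = {y. reach E \<theta> y < \<infinity> \<and> y + enn2real (reach E \<theta> y) *\<^sub>R \<theta> \<in> B}"

lemma borel_measurable_reach [measurable]:
  assumes [measurable]: "E \<in> sets borel" shows "reach E \<theta> \<in> borel_measurable borel"
proof -
  have "countable {q \<in> \<rat>. (0::real) < q}" by (rule countable_subset[OF _ countable_rat]) auto
  then show ?thesis
    unfolding reach_def[abs_def] const_ahead_def by (intro borel_measurable_SUP) measurable
qed

lemma borel_arrives [measurable]:
  assumes [measurable]: "E \<in> sets borel" "B \<in> sets borel" shows "arrives E \<theta> B \<in> sets borel"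
  unfolding arrives_def by measurable

lemma const_ahead_iff:
  fixes E :: "'a::euclidean_space set"
  assumes E: "E \<in> sets borel" and q: "q > 0"
  shows "const_ahead E \<theta> q (x + u *\<^sub>R \<theta>) \<longleftrightarrow> essential_boundary (slice E \<theta> x) \<inter> {u<..<u + q} = {}"
proof -
  define A where "A = slice E \<theta> x"
  have A [measurable]: "A \<in> sets borel" unfolding A_def by (rule borel_slice[OF E])
  have int: "(\<integral>\<^sup>+\<rho>. indicator E' (x + u *\<^sub>R \<theta> + \<rho> *\<^sub>R \<theta>) * indicator {0<..<q} \<rho> \<partial>lborel) = (0::ennreal)
      \<longleftrightarrow> (AE v in lborel. u < v \<and> v < u + q \<longrightarrow> v \<notin> A')"
    if A': "A' = slice E' \<theta> x" and [measurable]: "A' \<in> sets borel" for E' A'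
  proof -
    have "(\<integral>\<^sup>+\<rho>. indicator E' (x + u *\<^sub>R \<theta> + \<rho> *\<^sub>R \<theta>) * indicator {0<..<q} \<rho> \<partial>lborel)
        = (\<integral>\<^sup>+\<rho>. indicator A' (\<rho> + u) * indicator {u<..<u + q} (\<rho> + u) \<partial>lborel)"
      by (rule nn_integral_cong) (auto simp: A' indicator_def slice_def algebra_simps)
    also have "\<dots> = (\<integral>\<^sup>+v. indicator A' v * indicator {u<..<u + q} v \<partial>lborel)"
      by (rule nn_integral_lborel_translate) measurable
    also have "\<dots> = 0 \<longleftrightarrow> (AE v in lborel. indicator A' v * indicator {u<..<u + q} v = (0::ennreal))"
      by (rule nn_integral_0_iff_AE) measurable
    also have "\<dots> \<longleftrightarrow> (AE v in lborel. u < v \<and> v < u + q \<longrightarrow> v \<notin> A')"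
      by (rule AE_cong) (auto simp: indicator_def)
    finally show ?thesis .
  qed
  have "slice (- E) \<theta> x = - A" by (auto simp: A_def slice_def)
  then have iff: "const_ahead E \<theta> q (x + u *\<^sub>R \<theta>) \<longleftrightarrow>
      (AE v in lborel. u < v \<and> v < u + q \<longrightarrow> v \<notin> A) \<or> (AE v in lborel. u < v \<and> v < u + q \<longrightarrow> v \<notin> - A)"
    unfolding const_ahead_def using int[of A E] int[of "- A" "- E"] by (simp add: A_def[symmetric])
  show ?thesis
    unfolding iff A_def[symmetric]
  proof
    assume "essential_boundary A \<inter> {u<..<u + q} = {}"
    from AE_const_between_essential_boundary[OF A this]
    show "(AE v in lborel. u < v \<and> v < u + q \<longrightarrow> v \<notin> A) \<or> (AE v in lborel. u < v \<and> v < u + q \<longrightarrow> v \<notin> - A)" by auto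
  next
    assume c: "(AE v in lborel. u < v \<and> v < u + q \<longrightarrow> v \<notin> A) \<or> (AE v in lborel. u < v \<and> v < u + q \<longrightarrow> v \<notin> - A)"
    have "s \<notin> essential_boundary A" if s: "s \<in> {u<..<u + q}" for s
    proof -
      have "open {u<..<u + q}" by simp
      then obtain r where r: "r > 0" "ball s r \<subseteq> {u<..<u + q}" using s openE by blast
      have c': "(AE v in lborel. u < v \<and> v < u + q \<longrightarrow> v \<in> A) \<or> (AE v in lborel. u < v \<and> v < u + q \<longrightarrow> \<not> v \<in> A)"
        using c by auto
      have "(AE v in lborel. v \<in> ball s r \<longrightarrow> v \<in> A) \<or> (AE v in lborel. v \<in> ball s r \<longrightarrow> \<not> v \<in> A)"
        by (rule AE_disj_mono[OF c']) (use r(2) in auto)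
      then show ?thesis using not_essential_boundary_iff[OF A] r(1) by blast
    qed
    then show "essential_boundary A \<inter> {u<..<u + q} = {}" by auto
  qed
qed

lemma reach_eq_distance:
  fixes E :: "'a::euclidean_space set"
  assumes E: "E \<in> sets borel" and s: "s \<in> essential_boundary (slice E \<theta> x)" "u < s"
    and gap: "essential_boundary (slice E \<theta> x) \<inter> {u<..<s} = {}"
  shows "reach E \<theta> (x + u *\<^sub>R \<theta>) = ennreal (s - u)"
proof (rule antisym)
  show "reach E \<theta> (x + u *\<^sub>R \<theta>) \<le> ennreal (s - u)"
    unfolding reach_def
  proof (rule SUP_least)
    fix q :: real assume "q \<in> {q \<in> \<rat>. 0 < q}"
    then have q: "q > 0" by auto
    have "q \<le> s - u" if "const_ahead E \<theta> q (x + u *\<^sub>R \<theta>)"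
    proof (rule ccontr)
      assume "\<not> q \<le> s - u"
      then have "s \<in> essential_boundary (slice E \<theta> x) \<inter> {u<..<u + q}" using s by auto
      then show False using that const_ahead_iff[OF E q] by auto
    qed
    then show "(if const_ahead E \<theta> q (x + u *\<^sub>R \<theta>) then ennreal q else 0) \<le> ennreal (s - u)" by (auto intro: ennreal_leI)
  qed
  show "ennreal (s - u) \<le> reach E \<theta> (x + u *\<^sub>R \<theta>)"
  proof (rule ccontr)
    assume "\<not> ?thesis"
    then have lt: "reach E \<theta> (x + u *\<^sub>R \<theta>) < ennreal (s - u)" by simp
    then obtain r where r: "reach E \<theta> (x + u *\<^sub>R \<theta>) = ennreal r" "r \<ge> 0" "r < s - u"
      by (cases "reach E \<theta> (x + u *\<^sub>R \<theta>)") (auto simp: ennreal_less_iff)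
    then obtain q where q: "q \<in> \<rat>" "r < q" "q < s - u" using Rats_dense_in_real by blast
    have "const_ahead E \<theta> q (x + u *\<^sub>R \<theta>)"
      using const_ahead_iff[OF E, of q \<theta> x u] gap q r(2) by (auto simp: disjoint_iff)
    then have "ennreal q \<le> reach E \<theta> (x + u *\<^sub>R \<theta>)"
      unfolding reach_def using q r(2) by (intro SUP_upper2[of q]) auto
    then show False using r q by (simp add: ennreal_le_iff)
  qed
qed

lemma reach_eq_infinity:
  fixes E :: "'a::euclidean_space set"
  assumes E: "E \<in> sets borel" and gap: "essential_boundary (slice E \<theta> x) \<inter> {u<..} = {}"
  shows "reach E \<theta> (x + u *\<^sub>R \<theta>) = \<infinity>"
proof (rule ccontr)
  assume "reach E \<theta> (x + u *\<^sub>R \<theta>) \<noteq> \<infinity>"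
  then obtain r where r: "reach E \<theta> (x + u *\<^sub>R \<theta>) = ennreal r" "r \<ge> 0" by (cases "reach E \<theta> (x + u *\<^sub>R \<theta>)") auto
  obtain q where q: "q \<in> \<rat>" "r < q" using Rats_dense_in_real[of r "r + 1"] by auto
  have "const_ahead E \<theta> q (x + u *\<^sub>R \<theta>)"
    using const_ahead_iff[OF E, of q \<theta> x u] gap q r(2) by (auto simp: disjoint_iff)
  then have "ennreal q \<le> reach E \<theta> (x + u *\<^sub>R \<theta>)"
    unfolding reach_def using q r(2) by (intro SUP_upper2[of q]) auto
  then show False using r q by (simp add: ennreal_le_iff)
qed

lemma discrete_next_right:
  assumes disc: "discrete_essential_boundary A" and ne: "essential_boundary A \<inter> {u<..} \<noteq> {}"
  obtains s where "s \<in> essential_boundary A" "u < s" "essential_boundary A \<inter> {u<..<s} = {}"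
proof -
  obtain t where t: "t \<in> essential_boundary A" "u < t" using ne by auto
  define F where "F = essential_boundary A \<inter> {u<..<t + 1}"
  have F: "finite F" "t \<in> F" using disc t by (auto simp: F_def discrete_essential_boundary_def)
  then have m: "Min F \<in> F" "\<And>s. s \<in> F \<Longrightarrow> Min F \<le> s" by (auto intro: Min_in)
  show ?thesis
  proof (rule that[of "Min F"])
    show "essential_boundary A \<inter> {u<..<Min F} = {}"
    proof (rule ccontr)
      assume "essential_boundary A \<inter> {u<..<Min F} \<noteq> {}"
      then obtain s where s: "s \<in> essential_boundary A" "u < s" "s < Min F" by auto
      then have "s \<in> F" using m(2)[OF F(2)] by (auto simp: F_def)
      then show False using m(2)[of s] s by auto
    qed
  qed (use m(1) in \<open>auto simp: F_def\<close>)
qed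

text \<open>Off the essential boundary, a point lies in the left gap of the next boundary point and in no other.\<close>

lemma sum_left_gap_eq_arrives:
  fixes E :: "'a::euclidean_space set"
  assumes E: "E \<in> sets borel" and disc: "discrete_essential_boundary (slice E \<theta> x)"
    and fin: "finite (essential_boundary (slice E \<theta> x) \<inter> slice B \<theta> x)" and u: "u \<notin> essential_boundary (slice E \<theta> x)"
  shows "(\<Sum>s\<in>essential_boundary (slice E \<theta> x) \<inter> slice B \<theta> x. indicator (left_gap (slice E \<theta> x) s) u :: ennreal)
    = indicator (arrives E \<theta> B) (x + u *\<^sub>R \<theta>)"
proof -
  define D where "D = essential_boundary (slice E \<theta> x)"
  show ?thesis
  proof (cases "D \<inter> {u<..} = {}")
    case True
    then have "u \<notin> left_gap (slice E \<theta> x) s" if "s \<in> D" for s using that by (auto simp: left_gap_def)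
    moreover have "x + u *\<^sub>R \<theta> \<notin> arrives E \<theta> B"
      using reach_eq_infinity[OF E True[unfolded D_def]] by (simp add: arrives_def)
    ultimately show ?thesis by (auto simp: D_def intro!: sum.neutral)
  next
    case False
    obtain s where s: "s \<in> D" "u < s" "D \<inter> {u<..<s} = {}"
      using discrete_next_right[OF disc False[unfolded D_def]] by (metis D_def)
    have gap: "u \<in> left_gap (slice E \<theta> x) t \<longleftrightarrow> t = s" if "t \<in> D" for t
    proof
      assume g: "u \<in> left_gap (slice E \<theta> x) t"
      show "t = s"
      proof (rule ccontr)
        assume "t \<noteq> s"
        then consider "t < s" | "s < t" by linarith
        then show False using g s that by cases (auto simp: left_gap_def D_def disjoint_iff)
      qed
    next
      assume "t = s"
      have "D \<inter> {u..<s} = {}" using s(3) u by (auto simp: D_def disjoint_iff order_le_less)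
      then show "u \<in> left_gap (slice E \<theta> x) t" using s(2) \<open>t = s\<close> by (simp add: left_gap_def D_def)
    qed
    have "reach E \<theta> (x + u *\<^sub>R \<theta>) = ennreal (s - u)"
      by (rule reach_eq_distance[OF E]) (use s in \<open>auto simp: D_def\<close>)
    then have arr: "x + u *\<^sub>R \<theta> \<in> arrives E \<theta> B \<longleftrightarrow> s \<in> slice B \<theta> x"
      using s(2) by (simp add: arrives_def slice_def algebra_simps)
    have "(\<Sum>t\<in>D \<inter> slice B \<theta> x. indicator (left_gap (slice E \<theta> x) t) u :: ennreal) = (\<Sum>t\<in>D \<inter> slice B \<theta> x. if t = s then 1 else 0)"
      by (rule sum.cong) (auto simp: gap indicator_def)
    also have "\<dots> = (if s \<in> slice B \<theta> x then 1 else 0)"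
      using fin s(1) by (simp add: D_def sum.delta)
    finally show ?thesis by (simp add: D_def arr indicator_def)
  qed
qed

abbreviation lattice_point :: "real \<Rightarrow> int ^ 'n \<Rightarrow> real ^ 'n" where
  "lattice_point L k \<equiv> L *\<^sub>R (\<chi> i. of_int (k $ i))"

text \<open>
  The translates of the half-open cube by the lattice tile the space; \<open>e = -1\<close> runs through the
  lattice in the opposite order.
\<close>

lemma cube_tiling:
  fixes z :: "real ^ 'n"
  assumes L: "L > 0" and e: "e = 1 \<or> e = -1"
  shows "(\<integral>\<^sup>+k. indicator (cube L) (z + e *\<^sub>R lattice_point L k) \<partial>count_space (UNIV :: (int ^ 'n) set)) = (1::ennreal)"
proof -
  define k0 :: "int ^ 'n" where "k0 = (\<chi> i. - (if e = 1 then 1 else -1) * \<lfloor>z $ i / L\<rfloor>)"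
  have iff: "z + e *\<^sub>R lattice_point L k \<in> cube L \<longleftrightarrow> k = k0" for k :: "int ^ 'n"
  proof -
    have "0 \<le> z $ i + e * (L * of_int (k $ i)) \<and> z $ i + e * (L * of_int (k $ i)) < L \<longleftrightarrow> k $ i = k0 $ i" for i
    proof -
      have "0 \<le> z $ i + e * (L * of_int (k $ i)) \<and> z $ i + e * (L * of_int (k $ i)) < L
          \<longleftrightarrow> of_int (- (if e = 1 then 1 else -1) * k $ i) \<le> z $ i / L \<and> z $ i / L < of_int (- (if e = 1 then 1 else -1) * k $ i) + 1"
        using e L by (auto simp: field_simps)
      also have "\<dots> \<longleftrightarrow> \<lfloor>z $ i / L\<rfloor> = - (if e = 1 then 1 else -1) * k $ i" by (metis floor_eq_iff)
      also have "\<dots> \<longleftrightarrow> k $ i = k0 $ i" using e by (auto simp: k0_def)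
      finally show ?thesis .
    qed
    then show ?thesis by (simp add: cube_def vec_eq_iff mult.assoc)
  qed
  have "(\<integral>\<^sup>+k. indicator (cube L) (z + e *\<^sub>R lattice_point L k) \<partial>count_space (UNIV :: (int ^ 'n) set))
      = (\<integral>\<^sup>+k. indicator {k0} k \<partial>count_space (UNIV :: (int ^ 'n) set))"
    by (rule nn_integral_cong) (simp only: indicator_def iff singleton_iff)
  then show ?thesis by (simp add: emeasure_count_space_finite)
qed

lemma periodic_indicator:
  assumes "cube_periodic L E"
  shows "indicator E (y + lattice_point L k) = indicator E y"
    "indicator (- E) (y + lattice_point L k) = indicator (- E) y"
  using assms by (auto simp: cube_periodic_def indicator_def)

lemma periodic_flux:
  assumes "cube_periodic L E"
  shows "flux \<kappa> E \<theta> (y + lattice_point L k) = flux \<kappa> E \<theta> y"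
proof -
  have "y + lattice_point L k + \<rho> *\<^sub>R \<theta> = y + \<rho> *\<^sub>R \<theta> + lattice_point L k" for \<rho> by simp
  then show ?thesis by (simp only: flux_def periodic_indicator[OF assms])
qed

lemma periodic_reach:
  assumes "cube_periodic L E"
  shows "reach E \<theta> (y + lattice_point L k) = reach E \<theta> y"
proof -
  have "y + lattice_point L k + \<rho> *\<^sub>R \<theta> = y + \<rho> *\<^sub>R \<theta> + lattice_point L k" for \<rho> by simp
  then have "const_ahead E \<theta> q (y + lattice_point L k) = const_ahead E \<theta> q y" for q
    by (simp only: const_ahead_def periodic_indicator[OF assms])
  then show ?thesis by (simp add: reach_def)
qed

text \<open>
  Mass transport: moving the mass \<open>F(y)\<close> at \<open>y\<close> to the next boundary point in direction \<open>\<theta>\<close> commutes with the lattice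
  translations, so the mass arriving in the cube is the mass of those points of the cube that have a next boundary point.
\<close>

lemma mass_transport:
  fixes E :: "(real ^ 'n) set"
  assumes E [measurable]: "E \<in> sets borel" and per: "cube_periodic L E" and L: "L > 0"
    and \<kappa> [measurable]: "\<kappa> \<in> borel_measurable borel"
  shows "(\<integral>\<^sup>+y. flux \<kappa> E \<theta> y * indicator (arrives E \<theta> (cube L)) y \<partial>lborel)
    = (\<integral>\<^sup>+y. flux \<kappa> E \<theta> y * indicator {y. reach E \<theta> y < \<infinity>} y * indicator (cube L) y \<partial>lborel)"
proof -
  let ?K = "count_space (UNIV :: (int ^ 'n) set)"
  let ?F = "flux \<kappa> E \<theta>" and ?A = "arrives E \<theta> (cube L)"
  interpret K: sigma_finite_measure ?K by (rule sigma_finite_measure_count_space)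
  interpret pair_sigma_finite ?K lborel by standard
  have pm: "(\<lambda>(k, y). h k y) \<in> borel_measurable (?K \<Otimes>\<^sub>M lborel)" if "\<And>k. h k \<in> borel_measurable borel"
    for h :: "int ^ 'n \<Rightarrow> real ^ 'n \<Rightarrow> ennreal"
    by (rule measurable_pair_measure_countable1) (use that in auto)
  have m1: "(\<lambda>y. ?F y * indicator ?A y * indicator (cube L) (y + 1 *\<^sub>R lattice_point L k)) \<in> borel_measurable borel" for k by measurable
  have m2: "(\<lambda>y. ?F y * indicator ?A (y + -1 *\<^sub>R lattice_point L k) * indicator (cube L) y) \<in> borel_measurable borel" for k by measurable
  (* insert the tiling at the starting point, translate by the lattice vector, remove the tiling at the arrival point *)
  have "(\<integral>\<^sup>+y. ?F y * indicator ?A y \<partial>lborel)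
      = (\<integral>\<^sup>+y. (\<integral>\<^sup>+k. ?F y * indicator ?A y * indicator (cube L) (y + 1 *\<^sub>R lattice_point L k) \<partial>?K) \<partial>lborel)"
    by (rule nn_integral_cong, subst nn_integral_cmult) (simp_all only: cube_tiling[OF L disjI1[OF refl]] borel_measurable_count_space mult_1_right)
  also have "\<dots> = (\<integral>\<^sup>+k. (\<integral>\<^sup>+y. ?F y * indicator ?A y * indicator (cube L) (y + 1 *\<^sub>R lattice_point L k) \<partial>lborel) \<partial>?K)"
    by (rule Fubini'[OF pm[OF m1]])
  also have "\<dots> = (\<integral>\<^sup>+k. (\<integral>\<^sup>+y. ?F y * indicator ?A (y + -1 *\<^sub>R lattice_point L k) * indicator (cube L) y \<partial>lborel) \<partial>?K)"
  proof (rule nn_integral_cong)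
    fix k :: "int ^ 'n"
    have F: "?F (y + -1 *\<^sub>R lattice_point L k) = ?F y" for y
      using periodic_flux[OF per, of \<kappa> \<theta> "y + -1 *\<^sub>R lattice_point L k" k] by simp
    have "(\<integral>\<^sup>+y. ?F y * indicator ?A y * indicator (cube L) (y + 1 *\<^sub>R lattice_point L k) \<partial>lborel)
        = (\<integral>\<^sup>+y. ?F (y + -1 *\<^sub>R lattice_point L k) * indicator ?A (y + -1 *\<^sub>R lattice_point L k)
            * indicator (cube L) (y + -1 *\<^sub>R lattice_point L k + 1 *\<^sub>R lattice_point L k) \<partial>lborel)"
      by (rule nn_integral_lborel_translate[OF m1, symmetric])
    also have "\<dots> = (\<integral>\<^sup>+y. ?F y * indicator ?A (y + -1 *\<^sub>R lattice_point L k) * indicator (cube L) y \<partial>lborel)"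
      unfolding F by simp
    finally show "(\<integral>\<^sup>+y. ?F y * indicator ?A y * indicator (cube L) (y + 1 *\<^sub>R lattice_point L k) \<partial>lborel)
        = (\<integral>\<^sup>+y. ?F y * indicator ?A (y + -1 *\<^sub>R lattice_point L k) * indicator (cube L) y \<partial>lborel)" .
  qed
  also have "\<dots> = (\<integral>\<^sup>+y. (\<integral>\<^sup>+k. ?F y * indicator ?A (y + -1 *\<^sub>R lattice_point L k) * indicator (cube L) y \<partial>?K) \<partial>lborel)"
    by (rule Fubini'[OF pm[OF m2], symmetric])
  also have "\<dots> = (\<integral>\<^sup>+y. ?F y * indicator {y. reach E \<theta> y < \<infinity>} y * indicator (cube L) y \<partial>lborel)"
  proof (rule nn_integral_cong)
    fix y
    define z where "z = y + enn2real (reach E \<theta> y) *\<^sub>R \<theta>"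
    have R: "reach E \<theta> (y + -1 *\<^sub>R lattice_point L k) = reach E \<theta> y" for k
      using periodic_reach[OF per, of \<theta> "y + -1 *\<^sub>R lattice_point L k" k] by simp
    have ind: "(indicator ?A (y + -1 *\<^sub>R lattice_point L k) :: ennreal)
        = indicator {y. reach E \<theta> y < \<infinity>} y * indicator (cube L) (z + -1 *\<^sub>R lattice_point L k)" for k
    proof -
      have z: "y + -1 *\<^sub>R lattice_point L k + enn2real (reach E \<theta> y) *\<^sub>R \<theta> = z + -1 *\<^sub>R lattice_point L k" by (simp add: z_def)
      show ?thesis by (simp only: arrives_def indicator_def mem_Collect_eq R z) simp
    qed
    have "(\<integral>\<^sup>+k. ?F y * indicator ?A (y + -1 *\<^sub>R lattice_point L k) * indicator (cube L) y \<partial>?K)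
        = (\<integral>\<^sup>+k. (?F y * indicator {y. reach E \<theta> y < \<infinity>} y * indicator (cube L) y) * indicator (cube L) (z + -1 *\<^sub>R lattice_point L k) \<partial>?K)"
      unfolding ind by (rule nn_integral_cong) (simp only: mult_ac)
    also have "\<dots> = ?F y * indicator {y. reach E \<theta> y < \<infinity>} y * indicator (cube L) y"
      by (subst nn_integral_cmult) (simp_all only: cube_tiling[OF L disjI2[OF refl]] borel_measurable_count_space mult_1_right)
    finally show "(\<integral>\<^sup>+k. ?F y * indicator ?A (y + -1 *\<^sub>R lattice_point L k) * indicator (cube L) y \<partial>?K)
        = ?F y * indicator {y. reach E \<theta> y < \<infinity>} y * indicator (cube L) y" .
  qed
  finally show ?thesis .
qed

text \<open>A point without a next boundary point carries no mass, because its slice is constant ahead of it.\<close>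

lemma AE_flux_zero_at_infinite_reach:
  fixes E :: "'a::euclidean_space set"
  assumes E [measurable]: "E \<in> sets borel" and lfp: "locally_finite_perimeter E" and \<theta>: "norm \<theta> = 1"
    and \<kappa> [measurable]: "\<kappa> \<in> borel_measurable borel"
  shows "AE y in lborel. reach E \<theta> y = \<infinity> \<longrightarrow> flux \<kappa> E \<theta> y = 0"
proof -
  define N where "N = {y. reach E \<theta> y = \<infinity> \<and> flux \<kappa> E \<theta> y \<noteq> 0}"
  have [measurable]: "N \<in> sets borel" unfolding N_def by measurable
  have "emeasure lborel N = (\<integral>\<^sup>+x. (\<integral>\<^sup>+s. indicator N (x + s *\<^sub>R \<theta>) \<partial>lborel) \<partial>subspace_lborel (perp \<theta>))"
    by (subst nn_integral_lborel_lines[OF \<theta>, symmetric]) auto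
  also have "\<dots> = 0"
  proof (subst nn_integral_0_iff_AE)
    show "AE x in subspace_lborel (perp \<theta>). (\<integral>\<^sup>+s. indicator N (x + s *\<^sub>R \<theta>) \<partial>lborel) = (0::ennreal)"
      using AE_discrete_slices[OF E lfp \<theta>]
    proof eventually_elim
      case (elim x)
      show ?case
      proof (subst nn_integral_0_iff_AE)
        show "AE s in lborel. indicator N (x + s *\<^sub>R \<theta>) = (0::ennreal)"
          using AE_const_to_right[OF borel_slice[OF E] elim]
        proof eventually_elim
          case c: (elim u)
          have "flux \<kappa> E \<theta> (x + u *\<^sub>R \<theta>) = 0" if inf: "reach E \<theta> (x + u *\<^sub>R \<theta>) = \<infinity>"
          proof -
            have gap: "essential_boundary (slice E \<theta> x) \<inter> {u<..} = {}"
            proof (rule ccontr)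
              assume "essential_boundary (slice E \<theta> x) \<inter> {u<..} \<noteq> {}"
              then obtain s where "s \<in> essential_boundary (slice E \<theta> x)" "u < s" "essential_boundary (slice E \<theta> x) \<inter> {u<..<s} = {}"
                by (rule discrete_next_right[OF elim])
              then show False using reach_eq_distance[OF E] inf by fastforce
            qed
            have "AE \<rho> in lborel. \<forall>n::nat. 0 < \<rho> \<and> \<rho> < real n + 1 \<longrightarrow> (u + \<rho> \<in> slice E \<theta> x \<longleftrightarrow> u \<in> slice E \<theta> x)"
            proof (subst AE_all_countable, rule allI)
              fix n :: nat
              have "essential_boundary (slice E \<theta> x) \<inter> {u<..<u + (real n + 1)} = {}" using gap by auto
              moreover have "real n + 1 > 0" by simp
              ultimately show "AE \<rho> in lborel. 0 < \<rho> \<and> \<rho> < real n + 1 \<longrightarrow> (u + \<rho> \<in> slice E \<theta> x \<longleftrightarrow> u \<in> slice E \<theta> x)"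
                using c by blast
            qed
            then have "AE \<rho> in lborel. 0 < \<rho> \<longrightarrow> (u + \<rho> \<in> slice E \<theta> x \<longleftrightarrow> u \<in> slice E \<theta> x)"
            proof eventually_elim
              case (elim \<rho>)
              obtain n where "\<rho> < real n" using reals_Archimedean2 by blast
              then show ?case using elim by (metis less_add_one less_trans)
            qed
            then have "AE \<rho> in lborel. ennreal (\<bar>indicat_real (slice E \<theta> x) u - indicat_real (slice E \<theta> x) (u + \<rho> *\<^sub>R 1)\<bar> * \<kappa> \<rho>) * indicator {0<..} \<rho> = 0"
              by eventually_elim (auto simp: indicator_def)
            then have "flux \<kappa> (slice E \<theta> x) 1 u = 0"
              unfolding flux_def using borel_slice[OF E] by (subst nn_integral_0_iff_AE) auto
            then show ?thesis by (simp add: flux_slice)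
          qed
          then show ?case by (auto simp: N_def indicator_def)
        qed
      qed measurable
    qed
  qed (intro measurable_subspace_lborel, measurable)
  finally have "AE y in lborel. y \<notin> N"
    by (intro AE_not_in) (auto simp: null_sets_def)
  then show ?thesis by eventually_elim (auto simp: N_def)
qed

text \<open>
  The flux collected in the left gaps of the boundary points in the cube is the flux arriving in the cube, and by
  mass transport it equals the flux starting there.
\<close>

theorem sum_left_gaps:
  fixes E :: "(real ^ 'n) set"
  assumes E [measurable]: "E \<in> sets borel" and lfp: "locally_finite_perimeter E" and per: "cube_periodic L E" and L: "L > 0"
    and \<kappa> [measurable]: "\<kappa> \<in> borel_measurable borel" and \<theta>: "norm \<theta> = 1"
  obtains \<alpha> where "\<alpha> \<in> borel_measurable borel"
    "AE x in subspace_lborel (perp \<theta>). (\<Sum>s\<in>essential_boundary (slice E \<theta> x) \<inter> slice (cube L) \<theta> x.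
        \<integral>\<^sup>+u. flux \<kappa> (slice E \<theta> x) 1 u * indicator (left_gap (slice E \<theta> x) s) u \<partial>lborel) = \<alpha> x"
    "(\<integral>\<^sup>+x. \<alpha> x \<partial>subspace_lborel (perp \<theta>)) = (\<integral>\<^sup>+y. flux \<kappa> E \<theta> y * indicator (cube L) y \<partial>lborel)"
proof -
  let ?A = "arrives E \<theta> (cube L)"
  define \<alpha> where "\<alpha> x = (\<integral>\<^sup>+u. flux \<kappa> E \<theta> (x + u *\<^sub>R \<theta>) * indicator ?A (x + u *\<^sub>R \<theta>) \<partial>lborel)" for x
  have bd: "bounded (cube L :: (real^'n) set)" by (rule bounded_subset[OF bounded_outer_cube cube_subset_outer_cube[of L 0]])
  show ?thesis
  proof
    show "\<alpha> \<in> borel_measurable borel" unfolding \<alpha>_def[abs_def] by measurable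
    show "AE x in subspace_lborel (perp \<theta>). (\<Sum>s\<in>essential_boundary (slice E \<theta> x) \<inter> slice (cube L) \<theta> x.
        \<integral>\<^sup>+u. flux \<kappa> (slice E \<theta> x) 1 u * indicator (left_gap (slice E \<theta> x) s) u \<partial>lborel) = \<alpha> x"
      using AE_discrete_slices[OF E lfp \<theta>]
    proof eventually_elim
      case disc: (elim x)
      let ?S = "slice E \<theta> x"
      have S [measurable]: "?S \<in> sets borel" by (rule borel_slice[OF E])
      obtain R where R: "\<And>s. s \<in> slice (cube L) \<theta> x \<Longrightarrow> \<bar>s\<bar> < R"
        using bounded_slice[OF bd \<theta>, of x] bounded_pos_less by (metis real_norm_def)
      have "essential_boundary ?S \<inter> slice (cube L) \<theta> x \<subseteq> essential_boundary ?S \<inter> {-R<..<R}" using R by force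
      then have fin: "finite (essential_boundary ?S \<inter> slice (cube L) \<theta> x)"
        by (rule finite_subset) (use disc in \<open>auto simp: discrete_essential_boundary_def\<close>)
      have "(\<Sum>s\<in>essential_boundary ?S \<inter> slice (cube L) \<theta> x. \<integral>\<^sup>+u. flux \<kappa> ?S 1 u * indicator (left_gap ?S s) u \<partial>lborel)
          = (\<integral>\<^sup>+u. (\<Sum>s\<in>essential_boundary ?S \<inter> slice (cube L) \<theta> x. flux \<kappa> ?S 1 u * indicator (left_gap ?S s) u) \<partial>lborel)"
        by (rule nn_integral_sum[symmetric]) (use borel_left_gap[OF S] in measurable)
      also have "\<dots> = \<alpha> x"
        unfolding \<alpha>_def
      proof (rule nn_integral_cong_AE)
        have "AE u in lborel. u \<notin> essential_boundary ?S"
          using countable_discrete_essential_boundary[OF disc] by (intro AE_not_in countable_imp_null_set_lborel)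
        then show "AE u in lborel. (\<Sum>s\<in>essential_boundary ?S \<inter> slice (cube L) \<theta> x. flux \<kappa> ?S 1 u * indicator (left_gap ?S s) u)
            = flux \<kappa> E \<theta> (x + u *\<^sub>R \<theta>) * indicator ?A (x + u *\<^sub>R \<theta>)"
        proof eventually_elim
          case (elim u)
          show ?case
            unfolding sum_distrib_left[symmetric] sum_left_gap_eq_arrives[OF E disc fin elim] flux_slice ..
        qed
      qed
      finally show ?case .
    qed
    have "(\<integral>\<^sup>+x. \<alpha> x \<partial>subspace_lborel (perp \<theta>)) = (\<integral>\<^sup>+y. flux \<kappa> E \<theta> y * indicator ?A y \<partial>lborel)"
      unfolding \<alpha>_def by (rule nn_integral_lborel_lines[OF \<theta>, symmetric]) measurable
    also have "\<dots> = (\<integral>\<^sup>+y. flux \<kappa> E \<theta> y * indicator {y. reach E \<theta> y < \<infinity>} y * indicator (cube L) y \<partial>lborel)"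
      by (rule mass_transport[OF E per L \<kappa>])
    also have "\<dots> = (\<integral>\<^sup>+y. flux \<kappa> E \<theta> y * indicator (cube L) y \<partial>lborel)"
      using AE_flux_zero_at_infinite_reach[OF E lfp \<theta> \<kappa>]
      by (intro nn_integral_cong_AE, eventually_elim) (auto simp: indicator_def less_top)
    finally show "(\<integral>\<^sup>+x. \<alpha> x \<partial>subspace_lborel (perp \<theta>)) = (\<integral>\<^sup>+y. flux \<kappa> E \<theta> y * indicator (cube L) y \<partial>lborel)" .
  qed
qed

text \<open>Reversing the direction exchanges left and right.\<close>

lemma mem_uminus_image: "x \<in> uminus ` X \<longleftrightarrow> - x \<in> X" for x :: real
  by (force simp: image_iff intro: bexI[of _ "- x"])

lemma essential_boundary_uminus:
  assumes [measurable]: "A \<in> sets borel"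
  shows "essential_boundary (uminus ` A) = uminus ` essential_boundary A"
proof -
  have em: "emeasure lborel (uminus ` X) = emeasure lborel X" if [measurable]: "X \<in> sets borel" for X :: "real set"
  proof -
    have "uminus ` X = uminus -` X" by (auto simp: mem_uminus_image)
    then have "emeasure lborel (uminus ` X) = emeasure (distr lborel borel uminus) X" by (simp add: emeasure_distr)
    then show ?thesis by (simp add: lborel_distr_uminus)
  qed
  have i1: "uminus ` A \<inter> ball s r = uminus ` (A \<inter> ball (- s) r)" for s r
    by (rule set_eqI) (simp add: mem_uminus_image dist_real_def abs_minus_commute)
  have i2: "ball s r - uminus ` A = uminus ` (ball (- s) r - A)" for s r
    by (rule set_eqI) (simp add: mem_uminus_image dist_real_def abs_minus_commute)
  have "s \<in> essential_boundary (uminus ` A) \<longleftrightarrow> - s \<in> essential_boundary A" for s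
    unfolding essential_boundary_def i1 i2 mem_Collect_eq by (simp add: em)
  then show ?thesis by (simp add: set_eq_iff mem_uminus_image)
qed

lemma slice_uminus: "slice E (- \<theta>) x = uminus ` slice E \<theta> x"
  by (simp add: set_eq_iff slice_def mem_uminus_image)

lemma left_gap_uminus:
  assumes "A \<in> sets borel" shows "left_gap (uminus ` A) (- s) = uminus ` right_gap A s"
proof -
  have "uminus ` D \<inter> {u..<- s} = uminus ` (D \<inter> {s<..- u})" for D u
    by (rule set_eqI) (auto simp: mem_uminus_image)
  then have "u \<in> left_gap (uminus ` A) (- s) \<longleftrightarrow> - u \<in> right_gap A s" for u
    unfolding left_gap_def right_gap_def essential_boundary_uminus[OF assms] by auto
  then show ?thesis by (simp add: set_eq_iff mem_uminus_image)
qed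

theorem sum_right_gaps:
  fixes E :: "(real ^ 'n) set"
  assumes E [measurable]: "E \<in> sets borel" and lfp: "locally_finite_perimeter E" and per: "cube_periodic L E" and L: "L > 0"
    and \<kappa> [measurable]: "\<kappa> \<in> borel_measurable borel" and \<theta>: "norm \<theta> = 1"
  obtains \<alpha> where "\<alpha> \<in> borel_measurable borel"
    "AE x in subspace_lborel (perp \<theta>). (\<Sum>s\<in>essential_boundary (slice E \<theta> x) \<inter> slice (cube L) \<theta> x.
        \<integral>\<^sup>+u. flux \<kappa> (slice E \<theta> x) (-1) u * indicator (right_gap (slice E \<theta> x) s) u \<partial>lborel) = \<alpha> x"
    "(\<integral>\<^sup>+x. \<alpha> x \<partial>subspace_lborel (perp \<theta>)) = (\<integral>\<^sup>+y. flux \<kappa> E (- \<theta>) y * indicator (cube L) y \<partial>lborel)"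
proof -
  have n: "norm (- \<theta>) = 1" using \<theta> by simp
  have pp: "perp (- \<theta>) = perp \<theta>" by auto
  obtain \<alpha> where \<alpha>: "\<alpha> \<in> borel_measurable borel"
    "AE x in subspace_lborel (perp (- \<theta>)). (\<Sum>s\<in>essential_boundary (slice E (- \<theta>) x) \<inter> slice (cube L) (- \<theta>) x.
        \<integral>\<^sup>+u. flux \<kappa> (slice E (- \<theta>) x) 1 u * indicator (left_gap (slice E (- \<theta>) x) s) u \<partial>lborel) = \<alpha> x"
    "(\<integral>\<^sup>+x. \<alpha> x \<partial>subspace_lborel (perp (- \<theta>))) = (\<integral>\<^sup>+y. flux \<kappa> E (- \<theta>) y * indicator (cube L) y \<partial>lborel)"
    by (rule sum_left_gaps[OF E lfp per L \<kappa> n])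
  have eq: "(\<Sum>s\<in>essential_boundary (slice E (- \<theta>) x) \<inter> slice (cube L) (- \<theta>) x.
        \<integral>\<^sup>+u. flux \<kappa> (slice E (- \<theta>) x) 1 u * indicator (left_gap (slice E (- \<theta>) x) s) u \<partial>lborel)
      = (\<Sum>s\<in>essential_boundary (slice E \<theta> x) \<inter> slice (cube L) \<theta> x.
        \<integral>\<^sup>+u. flux \<kappa> (slice E \<theta> x) (-1) u * indicator (right_gap (slice E \<theta> x) s) u \<partial>lborel)" for x
  proof -
    let ?S = "slice E \<theta> x"
    have S [measurable]: "?S \<in> sets borel" by (rule borel_slice[OF E])
    have S' [measurable]: "uminus ` ?S \<in> sets borel" using borel_slice[OF E, of "- \<theta>" x] by (simp add: slice_uminus)
    have dom: "essential_boundary (slice E (- \<theta>) x) \<inter> slice (cube L) (- \<theta>) x = uminus ` (essential_boundary ?S \<inter> slice (cube L) \<theta> x)"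
      unfolding slice_uminus essential_boundary_uminus[OF S] by (auto simp: image_iff) 
    have imem: "(indicator (uminus ` X) (- u) :: 'b::zero_neq_one) = indicator X u" for X and u :: real
      by (auto simp: indicator_def image_iff) 
    have fl: "flux \<kappa> (uminus ` ?S) 1 (0 - u) = flux \<kappa> ?S (-1) u" for u
    proof -
      have "indicat_real (uminus ` ?S) (0 - u + \<rho> *\<^sub>R 1) = indicat_real ?S (u + \<rho> *\<^sub>R (-1))" for \<rho>
        using imem[of ?S "u - \<rho>"] by simp
      moreover have "indicat_real (uminus ` ?S) (0 - u) = indicat_real ?S u" using imem[of ?S u] by simp
      ultimately show ?thesis by (simp add: flux_def)
    qed
    have one: "(\<integral>\<^sup>+u. flux \<kappa> (uminus ` ?S) 1 u * indicator (left_gap (uminus ` ?S) (- s)) u \<partial>lborel)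
        = (\<integral>\<^sup>+u. flux \<kappa> ?S (-1) u * indicator (right_gap ?S s) u \<partial>lborel)" for s
    proof -
      have "(\<integral>\<^sup>+u. flux \<kappa> (uminus ` ?S) 1 u * indicator (left_gap (uminus ` ?S) (- s)) u \<partial>lborel)
          = (\<integral>\<^sup>+u. flux \<kappa> (uminus ` ?S) 1 (0 - u) * indicator (left_gap (uminus ` ?S) (- s)) (0 - u) \<partial>lborel)"
        by (rule nn_integral_lborel_reflect[symmetric]) (use borel_left_gap[OF S'] in measurable)
      then show ?thesis unfolding fl left_gap_uminus[OF S] by (simp add: imem)
    qed
    show ?thesis
      unfolding dom unfolding slice_uminus by (subst sum.reindex) (auto simp: one inj_on_def)
  qed
  show ?thesis
    using that[OF \<alpha>(1)] \<alpha>(2,3) unfolding pp eq by blast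
qed

section \<open>Radial kernels\<close>

text \<open>In polar coordinates, a null set of radii contributes nothing.\<close>

lemma AE_norm:
  fixes P :: "real \<Rightarrow> bool"
  assumes "AE r in lborel. 0 < r \<longrightarrow> P r"
  shows "AE \<zeta> in lborel. P (norm (\<zeta> :: 'a::euclidean_space))"
proof -
  obtain N where N: "\<And>r. r \<in> space lborel - N \<Longrightarrow> 0 < r \<longrightarrow> P r" "N \<in> null_sets lborel"
    by (rule AE_E3[OF assms]) (rule that)
  have [measurable]: "N \<in> sets borel" using N(2) by (auto simp: null_sets_def)
  have rN: "AE r in lborel. r \<notin> N" using N(2) by (rule AE_not_in)
  have [measurable]: "{\<zeta>::'a. norm \<zeta> \<in> N} \<in> sets borel" by measurable
  have "emeasure lborel {\<zeta>::'a. norm \<zeta> \<in> N} = (\<integral>\<^sup>+\<zeta>. indicator {\<zeta>. norm \<zeta> \<in> N} (\<zeta>::'a) \<partial>lborel)"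
    by (rule nn_integral_indicator[symmetric]) measurable
  also have "\<dots> = (\<integral>\<^sup>+\<zeta>. indicator N (norm (\<zeta>::'a)) \<partial>lborel)"
    by (rule nn_integral_cong) (simp add: indicator_def)
  also have "\<dots> = (\<integral>\<^sup>+\<theta>. (\<integral>\<^sup>+r. indicator N (norm (r *\<^sub>R (\<theta>::'a))) * ennreal (r ^ (DIM('a) - 1)) * indicator {0<..} r \<partial>lborel) \<partial>sphere_lborel)"
    by (rule nn_integral_polar) measurable
  also have "\<dots> = (\<integral>\<^sup>+\<theta>. 0 \<partial>(sphere_lborel :: 'a measure))"
  proof (rule nn_integral_cong)
    fix \<theta> :: 'a assume "\<theta> \<in> space sphere_lborel"
    then have \<theta>: "norm \<theta> = 1" by (simp add: space_sphere_lborel)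
    have "(\<integral>\<^sup>+r. indicator N (norm (r *\<^sub>R \<theta>)) * ennreal (r ^ (DIM('a) - 1)) * indicator {0<..} r \<partial>lborel) = (\<integral>\<^sup>+r. 0 \<partial>(lborel :: real measure))"
      using rN by (intro nn_integral_cong_AE, eventually_elim) (auto simp: indicator_def \<theta>)
    then show "(\<integral>\<^sup>+r. indicator N (norm (r *\<^sub>R \<theta>)) * ennreal (r ^ (DIM('a) - 1)) * indicator {0<..} r \<partial>lborel) = 0" by simp
  qed
  finally have "AE \<zeta>::'a in lborel. \<zeta> \<notin> {\<zeta>. norm \<zeta> \<in> N}"
    by (intro AE_not_in) (auto simp: null_sets_def)
  moreover have "AE \<zeta>::'a in lborel. \<zeta> \<noteq> 0" by (rule AE_lborel_singleton)
  ultimately show ?thesis by eventually_elim (use N(1) in auto)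
qed

text \<open>
  A Borel representative of the kernel need not be radial. Along almost every ray it agrees almost everywhere with
  the kernel, so its values on one such ray give a Borel profile.
\<close>

lemma radial_profile:
  fixes \<kappa> :: "real ^ 'n \<Rightarrow> real"
  assumes \<kappa>: "\<kappa> \<in> borel_measurable lebesgue" and nn: "\<And>\<zeta>. 0 \<le> \<kappa> \<zeta>"
    and rad: "\<And>z w. norm z = norm w \<Longrightarrow> \<kappa> z = \<kappa> w"
  obtains k where "k \<in> borel_measurable borel" "\<And>r. 0 \<le> k r" "AE r in lborel. 0 < r \<longrightarrow> (\<forall>z. norm z = r \<longrightarrow> \<kappa> z = k r)"
proof -
  obtain \<kappa>' where \<kappa>' [measurable]: "\<kappa>' \<in> borel_measurable borel" and eq: "AE \<zeta> in lborel. \<kappa> \<zeta> = \<kappa>' \<zeta>"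
    using completion_ex_borel_measurable_real[OF \<kappa>] by auto
  obtain N where N: "\<And>\<zeta>. \<zeta> \<in> space lborel - N \<Longrightarrow> \<kappa> \<zeta> = \<kappa>' \<zeta>" "N \<in> null_sets lborel"
    by (rule AE_E3[OF eq]) (rule that)
  have [measurable]: "N \<in> sets borel" using N(2) by (auto simp: null_sets_def)
  define Q where "Q \<theta> = (\<integral>\<^sup>+r. indicator N (r *\<^sub>R \<theta>) * ennreal (r ^ (DIM(real ^ 'n) - 1)) * indicator {0<..} r \<partial>lborel)" for \<theta> :: "real ^ 'n"
  have [measurable]: "Q \<in> borel_measurable borel" unfolding Q_def[abs_def] by measurable
  have "(\<integral>\<^sup>+\<zeta>. indicator N \<zeta> \<partial>lborel) = (\<integral>\<^sup>+\<theta>. Q \<theta> \<partial>sphere_lborel)"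
    unfolding Q_def by (rule nn_integral_polar) measurable
  then have "(\<integral>\<^sup>+\<theta>. Q \<theta> \<partial>sphere_lborel) = 0" using N(2) by (simp add: null_sets_def)
  then have Q0: "AE \<theta> in sphere_lborel. Q \<theta> = 0" by (subst (asm) nn_integral_0_iff_AE) (auto intro!: measurable_sphere_lborel)
  have "\<exists>\<theta>. norm \<theta> = 1 \<and> Q \<theta> = 0"
  proof (rule ccontr)
    assume "\<not> ?thesis"
    then have "AE \<theta> in sphere_lborel. \<not> Q \<theta> = 0" by (intro AE_sphere_I) auto
    with Q0 have "AE \<theta> in (sphere_lborel :: (real ^ 'n) measure). \<bar>\<theta> \<bullet> axis undefined 1\<bar> = 0" by eventually_elim simp
    then have "sphere_const TYPE(real ^ 'n) = 0" unfolding mean_width_def by (rule integral_eq_zero_AE)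
    then show False using sphere_const_pos[where 'n='n] by simp
  qed
  then obtain \<theta> where \<theta>: "norm \<theta> = 1" "Q \<theta> = 0" by auto
  have ray: "AE r in lborel. indicator N (r *\<^sub>R \<theta>) * ennreal (r ^ (DIM(real ^ 'n) - 1)) * indicator {0<..} r = 0"
    using \<theta>(2) unfolding Q_def by (subst (asm) nn_integral_0_iff_AE) auto
  show ?thesis
  (* the representative \<kappa>' may be negative on a null set *)
  proof (rule that[of "\<lambda>r. max 0 (\<kappa>' (r *\<^sub>R \<theta>))"])
    show "AE r in lborel. 0 < r \<longrightarrow> (\<forall>z. norm z = r \<longrightarrow> \<kappa> z = max 0 (\<kappa>' (r *\<^sub>R \<theta>)))"
      using ray
    proof eventually_elim
      case (elim r)
      show ?case
      proof (intro impI allI)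
        fix z :: "real ^ 'n" assume r: "0 < r" and z: "norm z = r"
        then have "r *\<^sub>R \<theta> \<notin> N" using elim by (auto simp: indicator_def)
        moreover have "\<kappa> z = \<kappa> (r *\<^sub>R \<theta>)" using r z \<theta>(1) by (intro rad) simp
        ultimately show "\<kappa> z = max 0 (\<kappa>' (r *\<^sub>R \<theta>))" using N(1) nn[of z] by simp
      qed
    qed
  qed auto
qed

lemma nn_integral_inverse_square:
  assumes t: "t > 0"
  shows "(\<integral>\<^sup>+\<rho>. ennreal (1 / (\<bar>\<rho>\<bar> + t)^2) \<partial>lborel) < \<infinity>"
proof -
  define h where "h \<rho> = ennreal (1 / (\<bar>\<rho>\<bar> + t)^2) * indicator {0<..} \<rho>" for \<rho> :: real
  have [measurable]: "h \<in> borel_measurable borel" unfolding h_def by measurable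
  have "(\<integral>\<^sup>+\<rho>. h \<rho> \<partial>lborel) = (\<integral>\<^sup>+\<rho>. ennreal (real 1 / (\<rho> + t) ^ (1 + 1)) * indicator {t<..} (\<rho> + t) \<partial>lborel)"
    by (rule nn_integral_cong) (auto simp: h_def indicator_def power2_eq_square)
  also have "\<dots> = (\<integral>\<^sup>+u. ennreal (real 1 / u ^ (1 + 1)) * indicator {t<..} u \<partial>lborel)"
    by (rule nn_integral_lborel_translate) measurable
  also have "\<dots> = ennreal (1 / t ^ 1)" by (rule nn_integral_power_tail) (use t in auto)
  finally have I: "(\<integral>\<^sup>+\<rho>. h \<rho> \<partial>lborel) = ennreal (1 / t)" by simp
  have "(\<integral>\<^sup>+\<rho>. ennreal (1 / (\<bar>\<rho>\<bar> + t)^2) \<partial>lborel) = (\<integral>\<^sup>+\<rho>. h \<rho> + h (0 - \<rho>) \<partial>lborel)"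
    using AE_lborel_singleton[of "0::real"] by (intro nn_integral_cong_AE, eventually_elim) (auto simp: h_def indicator_def)
  also have "\<dots> = (\<integral>\<^sup>+\<rho>. h \<rho> \<partial>lborel) + (\<integral>\<^sup>+\<rho>. h (0 - \<rho>) \<partial>lborel)" by (rule nn_integral_add) measurable
  also have "(\<integral>\<^sup>+\<rho>. h (0 - \<rho>) \<partial>lborel) = (\<integral>\<^sup>+\<rho>. h \<rho> \<partial>lborel)" by (rule nn_integral_lborel_reflect) measurable
  finally show ?thesis by (simp add: I)
qed

text \<open>
  \<open>r\<^sup>d\<^sup>-\<^sup>1 (r + t)\<^sup>-\<^sup>p \<le> t\<^sup>d\<^sup>+\<^sup>1\<^sup>-\<^sup>p (r +
  t)\<^sup>-\<^sup>2\<close>, and the right-hand side is integrable.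
\<close>

lemma kernel_mass_finite:
  fixes k :: "real \<Rightarrow> real"
  assumes t: "t > 0" and p: "p \<ge> real d + 1" and C: "C \<ge> 0" and d: "d \<ge> 1"
    and bound: "AE r in lborel. 0 < r \<longrightarrow> k r \<le> C / (r + t) powr p"
  shows "(\<integral>\<^sup>+\<rho>. ennreal (\<bar>\<rho>\<bar> ^ (d - 1) * k \<bar>\<rho>\<bar>) \<partial>lborel) < \<infinity>"
proof -
  define B where "B = C * t powr (real d + 1 - p)"
  have "AE \<rho> in lborel. k (norm (\<rho>::real)) \<le> C / (norm \<rho> + t) powr p" by (rule AE_norm[OF bound])
  then have "(\<integral>\<^sup>+\<rho>. ennreal (\<bar>\<rho>\<bar> ^ (d - 1) * k \<bar>\<rho>\<bar>) \<partial>lborel) \<le> (\<integral>\<^sup>+\<rho>. ennreal B * ennreal (1 / (\<bar>\<rho>\<bar> + t)^2) \<partial>lborel)"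
  proof (intro nn_integral_mono_AE, eventually_elim)
    case (elim \<rho>)
    define a where "a = \<bar>\<rho>\<bar> + t"
    have a: "a > 0" "t \<le> a" "\<bar>\<rho>\<bar> \<le> a" using t by (auto simp: a_def)
    have "\<bar>\<rho>\<bar> ^ (d - 1) * k \<bar>\<rho>\<bar> \<le> \<bar>\<rho>\<bar> ^ (d - 1) * (C / a powr p)"
      using elim by (intro mult_left_mono) (auto simp: a_def)
    also have "\<dots> \<le> a ^ (d - 1) * (C / a powr p)" using a C by (intro mult_right_mono power_mono) auto
    also have "a ^ (d - 1) = a powr (real d - 1)" using a(1) d by (simp add: powr_realpow[symmetric] of_nat_diff)
    also have "a powr (real d - 1) * (C / a powr p) = C * (a powr (real d + 1 - p) * a powr (-2))"
    proof -
      have "a powr (real d - 1) = a powr (real d + 1 - p) * a powr (-2) * a powr p"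
        unfolding powr_add[symmetric] by simp
      then show ?thesis using a(1) by simp
    qed
    also have "\<dots> \<le> C * (t powr (real d + 1 - p) * a powr (-2))"
      using a t p C by (intro mult_left_mono mult_right_mono powr_mono2') auto
    also have "\<dots> = B * (1 / a\<^sup>2)"
      using a(1) by (simp add: B_def powr_minus powr_numeral divide_inverse)
    finally have "\<bar>\<rho>\<bar> ^ (d - 1) * k \<bar>\<rho>\<bar> \<le> B * (1 / (\<bar>\<rho>\<bar> + t)\<^sup>2)" by (simp add: a_def)
    moreover have "B \<ge> 0" using C by (simp add: B_def)
    ultimately show ?case by (simp add: ennreal_mult[symmetric] ennreal_leI)
  qed
  also have "\<dots> = ennreal B * (\<integral>\<^sup>+\<rho>. ennreal (1 / (\<bar>\<rho>\<bar> + t)^2) \<partial>lborel)" by (rule nn_integral_cmult) measurable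
  also have "\<dots> < \<infinity>" using nn_integral_inverse_square[OF t] by (simp add: ennreal_mult_less_top)
  finally show ?thesis .
qed

lemma kernel_bar_eq:
  fixes \<kappa> :: "real ^ 'n \<Rightarrow> real"
  assumes "AE r in lborel. 0 < r \<longrightarrow> (\<forall>z. norm z = r \<longrightarrow> \<kappa> z = k r)"
  shows "AE \<rho> in lborel. kernel_bar \<kappa> \<rho> = \<bar>\<rho>\<bar> ^ (CARD('n) - 1) * k \<bar>\<rho>\<bar>"
  using AE_norm[where 'a=real, OF assms]
proof eventually_elim
  case (elim \<rho>)
  have "\<exists>z :: real ^ 'n. norm z = \<bar>\<rho>\<bar>" using vector_choose_size[of "\<bar>\<rho>\<bar>"] by (metis abs_ge_zero)
  then have "norm (SOME z :: real ^ 'n. norm z = \<bar>\<rho>\<bar>) = \<bar>\<rho>\<bar>" by (rule someI_ex)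
  then show ?case using elim by (simp add: kernel_bar_def)
qed

lemma radial_moment:
  fixes k :: "real \<Rightarrow> real" and n :: nat
  assumes [measurable]: "k \<in> borel_measurable borel"
  shows "(\<integral>\<^sup>+\<rho>. ennreal (\<bar>\<rho>\<bar> * (\<bar>\<rho>\<bar> ^ n * k \<bar>\<rho>\<bar>)) * indicator {-1..1} \<rho> \<partial>lborel)
    = 2 * (\<integral>\<^sup>+r. ennreal (r ^ Suc n * k r) * indicator {0<..1} r \<partial>lborel)"
proof -
  define h where "h r = ennreal (r ^ Suc n * k r) * indicator {0<..1} r" for r :: real
  have [measurable]: "h \<in> borel_measurable borel" unfolding h_def by measurable
  have "(\<integral>\<^sup>+\<rho>. ennreal (\<bar>\<rho>\<bar> * (\<bar>\<rho>\<bar> ^ n * k \<bar>\<rho>\<bar>)) * indicator {-1..1} \<rho> \<partial>lborel) = (\<integral>\<^sup>+\<rho>. h \<rho> + h (0 - \<rho>) \<partial>lborel)"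
  proof (rule nn_integral_cong)
    fix \<rho> :: real
    consider "\<rho> > 0" | "\<rho> = 0" | "\<rho> < 0" by linarith
    then show "ennreal (\<bar>\<rho>\<bar> * (\<bar>\<rho>\<bar> ^ n * k \<bar>\<rho>\<bar>)) * indicator {-1..1} \<rho> = h \<rho> + h (0 - \<rho>)"
      by cases (auto simp: h_def indicator_def mult.assoc)
  qed
  also have "\<dots> = (\<integral>\<^sup>+\<rho>. h \<rho> \<partial>lborel) + (\<integral>\<^sup>+\<rho>. h (0 - \<rho>) \<partial>lborel)" by (rule nn_integral_add) measurable
  also have "(\<integral>\<^sup>+\<rho>. h (0 - \<rho>) \<partial>lborel) = (\<integral>\<^sup>+\<rho>. h \<rho> \<partial>lborel)" by (rule nn_integral_lborel_reflect) measurable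
  finally show ?thesis by (simp add: h_def mult_2)
qed

text \<open>
  Polar coordinates split the integral into the mean of \<open>|\<langle>\<theta>, e\<rangle>|\<close> over the
  sphere and a radial moment.
\<close>

lemma J_const_eq:
  fixes \<kappa> :: "real ^ 'n \<Rightarrow> real"
  assumes k [measurable]: "k \<in> borel_measurable borel" and nn: "\<And>r. 0 \<le> k r"
    and rad: "AE r in lborel. 0 < r \<longrightarrow> (\<forall>z. norm z = r \<longrightarrow> \<kappa> z = k r)"
  shows "J_const \<kappa> = sphere_const TYPE(real ^ 'n) * enn2real (\<integral>\<^sup>+r. ennreal (r ^ CARD('n) * k r) * indicator {0<..1} r \<partial>lborel)"
proof -
  define e where "e = (SOME \<theta> :: real ^ 'n. norm \<theta> = 1)"
  have "\<exists>\<theta> :: real ^ 'n. norm \<theta> = 1" using norm_axis_1 by blast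
  then have e: "norm e = 1" unfolding e_def by (rule someI_ex)
  have AEk: "AE \<zeta> :: real ^ 'n in lborel. \<kappa> \<zeta> = k (norm \<zeta>)"
    using AE_norm[where 'a="real ^ 'n", OF rad] by eventually_elim simp
  have [measurable]: "cball (0 :: real ^ 'n) 1 \<in> sets borel" by simp
  have "J_const \<kappa> = (\<integral>\<zeta>. (\<bar>\<zeta> \<bullet> e\<bar> * k (norm \<zeta>)) * indicat_real (cball 0 1) \<zeta> \<partial>lborel)"
    unfolding J_const_def e_def[symmetric] set_lebesgue_integral_def
    by (rule integral_completion_AE_cong, measurable) (use AEk in \<open>eventually_elim, simp\<close>)
  also have "\<dots> = enn2real (\<integral>\<^sup>+\<zeta>. ennreal (\<bar>\<zeta> \<bullet> e\<bar> * k (norm \<zeta>)) * indicator (cball 0 1) \<zeta> \<partial>lborel)"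
    by (subst integral_eq_nn_integral) (auto intro!: arg_cong[where f=enn2real] nn_integral_cong simp: nn indicator_def)
  also have "(\<integral>\<^sup>+\<zeta>. ennreal (\<bar>\<zeta> \<bullet> e\<bar> * k (norm \<zeta>)) * indicator (cball 0 1) \<zeta> \<partial>lborel)
      = (\<integral>\<^sup>+\<theta>. (\<integral>\<^sup>+r. ennreal (\<bar>(r *\<^sub>R \<theta>) \<bullet> e\<bar> * k (norm (r *\<^sub>R \<theta>))) * indicator (cball 0 1) (r *\<^sub>R \<theta>)
          * ennreal (r ^ (DIM(real ^ 'n) - 1)) * indicator {0<..} r \<partial>lborel) \<partial>sphere_lborel)"
    by (rule nn_integral_polar) measurable
  also have "\<dots> = (\<integral>\<^sup>+\<theta>. ennreal \<bar>\<theta> \<bullet> e\<bar> * (\<integral>\<^sup>+r. ennreal (r ^ CARD('n) * k r) * indicator {0<..1} r \<partial>lborel) \<partial>sphere_lborel)"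
  proof (rule nn_integral_cong)
    fix \<theta> :: "real ^ 'n" assume "\<theta> \<in> space sphere_lborel"
    then have \<theta>: "norm \<theta> = 1" by (simp add: space_sphere_lborel)
    have "(\<integral>\<^sup>+r. ennreal (\<bar>(r *\<^sub>R \<theta>) \<bullet> e\<bar> * k (norm (r *\<^sub>R \<theta>))) * indicator (cball 0 1) (r *\<^sub>R \<theta>)
          * ennreal (r ^ (DIM(real ^ 'n) - 1)) * indicator {0<..} r \<partial>lborel)
        = (\<integral>\<^sup>+r. ennreal \<bar>\<theta> \<bullet> e\<bar> * (ennreal (r ^ CARD('n) * k r) * indicator {0<..1} r) \<partial>lborel)"
    proof (rule nn_integral_cong)
      fix r :: real
      show "ennreal (\<bar>(r *\<^sub>R \<theta>) \<bullet> e\<bar> * k (norm (r *\<^sub>R \<theta>))) * indicator (cball 0 1) (r *\<^sub>R \<theta>)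
          * ennreal (r ^ (DIM(real ^ 'n) - 1)) * indicator {0<..} r
          = ennreal \<bar>\<theta> \<bullet> e\<bar> * (ennreal (r ^ CARD('n) * k r) * indicator {0<..1} r)"
      proof (cases "0 < r \<and> r \<le> 1")
        case True
        have "r * r ^ (CARD('n) - 1) = r ^ CARD('n)" by (metis power_Suc Suc_pred' zero_less_card_finite)
        then have "\<bar>r * (\<theta> \<bullet> e)\<bar> * k r * r ^ (CARD('n) - 1) = \<bar>\<theta> \<bullet> e\<bar> * (r ^ CARD('n) * k r)"
          using True by (simp add: abs_mult mult.assoc mult.left_commute) 
        then show ?thesis using True \<theta> nn by (simp add: indicator_def ennreal_mult[symmetric])
      qed (use \<theta> in \<open>auto simp: indicator_def\<close>)
    qed
    also have "\<dots> = ennreal \<bar>\<theta> \<bullet> e\<bar> * (\<integral>\<^sup>+r. ennreal (r ^ CARD('n) * k r) * indicator {0<..1} r \<partial>lborel)"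
      by (rule nn_integral_cmult) measurable
    finally show "(\<integral>\<^sup>+r. ennreal (\<bar>(r *\<^sub>R \<theta>) \<bullet> e\<bar> * k (norm (r *\<^sub>R \<theta>))) * indicator (cball 0 1) (r *\<^sub>R \<theta>)
          * ennreal (r ^ (DIM(real ^ 'n) - 1)) * indicator {0<..} r \<partial>lborel)
        = ennreal \<bar>\<theta> \<bullet> e\<bar> * (\<integral>\<^sup>+r. ennreal (r ^ CARD('n) * k r) * indicator {0<..1} r \<partial>lborel)" .
  qed
  also have "\<dots> = (\<integral>\<^sup>+\<theta>. ennreal \<bar>\<theta> \<bullet> e\<bar> \<partial>sphere_lborel) * (\<integral>\<^sup>+r. ennreal (r ^ CARD('n) * k r) * indicator {0<..1} r \<partial>lborel)"
    by (rule nn_integral_multc) (auto intro!: measurable_sphere_lborel)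
  also have "(\<integral>\<^sup>+\<theta>. ennreal \<bar>\<theta> \<bullet> e\<bar> \<partial>sphere_lborel) = ennreal (sphere_const TYPE(real ^ 'n))"
  proof -
    have "integrable sphere_lborel (\<lambda>\<theta>. \<bar>\<theta> \<bullet> e\<bar>)"
      by (rule integrable_sphere_bounded[where B=1]) (use e inner_sphere_bound[of _ e] in auto)
    then have "(\<integral>\<^sup>+\<theta>. ennreal \<bar>\<theta> \<bullet> e\<bar> \<partial>sphere_lborel) = ennreal (mean_width TYPE(real ^ 'n) e)"
      unfolding mean_width_def by (rule nn_integral_eq_integral) auto
    then show ?thesis using mean_width_unit[OF e] by simp
  qed
  finally show ?thesis using sphere_const_pos[where 'n='n] by (simp add: enn2real_mult)
qed

section \<open>The nonlocal term in polar coordinates\<close>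

definition cube_flux :: "(real \<Rightarrow> real) \<Rightarrow> (real ^ 'n) set \<Rightarrow> real \<Rightarrow> real ^ 'n \<Rightarrow> ennreal" where
  "cube_flux \<kappa> E L \<theta> = (\<integral>\<^sup>+y. flux \<kappa> E \<theta> y * indicator (cube L) y \<partial>lborel)"

lemma measurable_flux2:
  fixes E :: "'a::euclidean_space set"
  assumes [measurable]: "E \<in> sets borel" "\<kappa> \<in> borel_measurable borel"
  shows "(\<lambda>(\<theta>, y). flux \<kappa> E \<theta> y) \<in> borel_measurable (borel \<Otimes>\<^sub>M borel)"
  unfolding flux_def by measurable

lemma borel_measurable_cube_flux:
  fixes E :: "(real ^ 'n) set"
  assumes [measurable]: "E \<in> sets borel" "\<kappa> \<in> borel_measurable borel"
  shows "cube_flux \<kappa> E L \<in> borel_measurable borel"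
proof -
  note [measurable] = measurable_flux2[OF assms]
  show ?thesis unfolding cube_flux_def[abs_def] by measurable
qed

lemma cube_finite: "emeasure lborel (cube L :: (real ^ 'n) set) < \<infinity>"
  using emeasure_bounded_finite[OF bounded_subset[OF bounded_outer_cube cube_subset_outer_cube[of L 0]]] by simp

lemma cube_flux_le:
  fixes E :: "(real ^ 'n) set"
  assumes "\<And>\<rho>. 0 \<le> \<kappa> \<rho>"
  shows "cube_flux \<kappa> E L \<theta> \<le> (\<integral>\<^sup>+\<rho>. ennreal (\<kappa> \<rho>) \<partial>lborel) * emeasure lborel (cube L :: (real ^ 'n) set)"
proof -
  have "cube_flux \<kappa> E L \<theta> \<le> (\<integral>\<^sup>+y. (\<integral>\<^sup>+\<rho>. ennreal (\<kappa> \<rho>) \<partial>lborel) * indicator (cube L) (y :: real ^ 'n) \<partial>lborel)"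
    unfolding cube_flux_def by (intro nn_integral_mono mult_right_mono flux_le assms) auto
  then show ?thesis by (simp add: nn_integral_cmult)
qed

text \<open>
  Polar coordinates in \<open>\<zeta>\<close> turn the inner integral into the average of the fluxes in all
  directions.
\<close>

lemma nonlocal_polar:
  fixes E E' :: "(real ^ 'n) set" and \<kappa> :: "real ^ 'n \<Rightarrow> real"
  assumes E' [measurable]: "E' \<in> sets borel" and EE: "AE x in lborel. x \<in> E \<longleftrightarrow> x \<in> E'"
    and k [measurable]: "k \<in> borel_measurable borel" and nn: "\<And>r. 0 \<le> k r"
    and rad: "AE r in lborel. 0 < r \<longrightarrow> (\<forall>z. norm z = r \<longrightarrow> \<kappa> z = k r)"
    and \<kappa>': "\<kappa>' = (\<lambda>\<rho>. \<bar>\<rho>\<bar> ^ (CARD('n) - 1) * k \<bar>\<rho>\<bar>)"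
    and fin: "(\<integral>\<^sup>+\<rho>. ennreal (\<kappa>' \<rho>) \<partial>lborel) < \<infinity>"
  shows "(LINT x:cube L|lebesgue. (LINT \<zeta>|lebesgue. \<bar>indicat_real E (x + \<zeta>) - indicat_real E x\<bar> * \<kappa> \<zeta>))
    = enn2real (\<integral>\<^sup>+\<theta>. cube_flux \<kappa>' E' L \<theta> \<partial>sphere_lborel)"
proof -
  have \<kappa>'m [measurable]: "\<kappa>' \<in> borel_measurable borel" unfolding \<kappa>' by measurable
  have \<kappa>'nn: "0 \<le> \<kappa>' \<rho>" for \<rho> by (simp add: \<kappa>' nn)
  note [measurable] = measurable_flux2[OF E' \<kappa>'m]
  have AEk: "AE \<zeta> :: real ^ 'n in lborel. \<kappa> \<zeta> = k (norm \<zeta>)"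
    using AE_norm[where 'a="real ^ 'n", OF rad] by eventually_elim simp
  have shift: "AE \<zeta> in lborel. x + \<zeta> \<in> E \<longleftrightarrow> x + \<zeta> \<in> E'" for x
  proof -
    have "AE \<zeta> in distr lborel borel ((+) x). \<zeta> \<in> E \<longleftrightarrow> \<zeta> \<in> E'" using EE unfolding lborel_distr_plus .
    then show ?thesis by (rule AE_distrD[rotated]) simp
  qed
  define G where "G x = (\<integral>\<^sup>+\<theta>. flux \<kappa>' E' \<theta> x \<partial>sphere_lborel)" for x
  interpret S: finite_measure "sphere_lborel :: (real ^ 'n) measure" by (rule finite_sphere_lborel)
  interpret PS: pair_sigma_finite "sphere_lborel :: (real ^ 'n) measure" "lborel :: (real ^ 'n) measure" by standard
  have m2: "(\<lambda>(\<theta>, x). flux \<kappa>' E' \<theta> x * indicator (cube L) x) \<in> borel_measurable (sphere_lborel \<Otimes>\<^sub>M lborel)"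
  proof -
    have m: "(\<lambda>z. (fst z, snd z)) \<in> sphere_lborel \<Otimes>\<^sub>M lborel \<rightarrow>\<^sub>M (borel :: (real ^ 'n) measure) \<Otimes>\<^sub>M (borel :: (real ^ 'n) measure)"
      by (intro measurable_Pair measurable_compose[OF measurable_fst measurable_sphere_lborel] measurable_compose[OF measurable_snd]) auto
    have "(\<lambda>(\<theta>, x). flux \<kappa>' E' \<theta> x * indicator (cube L) x) \<in> borel_measurable ((borel :: (real ^ 'n) measure) \<Otimes>\<^sub>M (borel :: (real ^ 'n) measure))"
      by measurable
    from measurable_compose[OF m this] show ?thesis by (simp add: case_prod_beta')
  qed
  have m1: "(\<lambda>(\<theta>, x). flux \<kappa>' E' \<theta> x) \<in> borel_measurable (sphere_lborel \<Otimes>\<^sub>M lborel)"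
  proof -
    have m: "(\<lambda>z. (fst z, snd z)) \<in> sphere_lborel \<Otimes>\<^sub>M lborel \<rightarrow>\<^sub>M (borel :: (real ^ 'n) measure) \<Otimes>\<^sub>M (borel :: (real ^ 'n) measure)"
      by (intro measurable_Pair measurable_compose[OF measurable_fst measurable_sphere_lborel] measurable_compose[OF measurable_snd]) auto
    from measurable_compose[OF m measurable_flux2[OF E' \<kappa>'m]] show ?thesis by (simp add: case_prod_beta')
  qed
  have Gm [measurable]: "G \<in> borel_measurable borel"
  proof -
    have "(\<lambda>x. \<integral>\<^sup>+\<theta>. flux \<kappa>' E' \<theta> x \<partial>sphere_lborel) \<in> borel_measurable (lborel :: (real ^ 'n) measure)"
      using S.borel_measurable_nn_integral_fst[OF measurable_pair_swap[OF m1]] by (simp add: case_prod_beta')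
    then show ?thesis by (simp add: G_def[abs_def])
  qed
  have Gfin: "G x \<noteq> \<infinity>" for x
  proof -
    have "G x \<le> (\<integral>\<^sup>+\<theta>. (\<integral>\<^sup>+\<rho>. ennreal (\<kappa>' \<rho>) \<partial>lborel) \<partial>(sphere_lborel :: (real ^ 'n) measure))"
      unfolding G_def by (intro nn_integral_mono flux_le \<kappa>'nn)
    also have "\<dots> < \<infinity>" using fin by (simp add: ennreal_mult_eq_top_iff less_top[symmetric])
    finally show ?thesis by simp
  qed
  have inner: "(LINT \<zeta>|lebesgue. \<bar>indicat_real E (x + \<zeta>) - indicat_real E x\<bar> * \<kappa> \<zeta>) = enn2real (G x)"
    if x: "x \<in> E \<longleftrightarrow> x \<in> E'" for x
  proof -
    have "(LINT \<zeta>|lebesgue. \<bar>indicat_real E (x + \<zeta>) - indicat_real E x\<bar> * \<kappa> \<zeta>)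
        = (\<integral>\<zeta>. \<bar>indicat_real E' x - indicat_real E' (x + \<zeta>)\<bar> * k (norm \<zeta>) \<partial>lborel)"
    proof (rule integral_completion_AE_cong)
      show "AE \<zeta> in lborel. \<bar>indicat_real E (x + \<zeta>) - indicat_real E x\<bar> * \<kappa> \<zeta>
          = \<bar>indicat_real E' x - indicat_real E' (x + \<zeta>)\<bar> * k (norm \<zeta>)"
        using shift[of x] AEk by eventually_elim (use x in \<open>auto simp: indicator_def\<close>)
    qed measurable
    also have "\<dots> = enn2real (\<integral>\<^sup>+\<zeta>. ennreal (\<bar>indicat_real E' x - indicat_real E' (x + \<zeta>)\<bar> * k (norm \<zeta>)) \<partial>lborel)"
      by (rule integral_eq_nn_integral) (auto simp: nn)
    also have "(\<integral>\<^sup>+\<zeta>. ennreal (\<bar>indicat_real E' x - indicat_real E' (x + \<zeta>)\<bar> * k (norm \<zeta>)) \<partial>lborel)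
        = (\<integral>\<^sup>+\<theta>. (\<integral>\<^sup>+r. ennreal (\<bar>indicat_real E' x - indicat_real E' (x + r *\<^sub>R \<theta>)\<bar> * k (norm (r *\<^sub>R \<theta>)))
            * ennreal (r ^ (DIM(real ^ 'n) - 1)) * indicator {0<..} r \<partial>lborel) \<partial>sphere_lborel)"
      by (rule nn_integral_polar) measurable
    also have "\<dots> = G x"
      unfolding G_def flux_def
    proof (intro nn_integral_cong)
      fix \<theta> :: "real ^ 'n" and r :: real assume "\<theta> \<in> space sphere_lborel"
      then have \<theta>: "norm \<theta> = 1" by (simp add: space_sphere_lborel)
      show "ennreal (\<bar>indicat_real E' x - indicat_real E' (x + r *\<^sub>R \<theta>)\<bar> * k (norm (r *\<^sub>R \<theta>)))
            * ennreal (r ^ (DIM(real ^ 'n) - 1)) * indicator {0<..} r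
          = ennreal (\<bar>indicat_real E' x - indicat_real E' (x + r *\<^sub>R \<theta>)\<bar> * \<kappa>' r) * indicator {0<..} r"
        using \<theta> nn by (cases "r > 0") (auto simp: \<kappa>' ennreal_mult[symmetric] mult_ac)
    qed
    finally show ?thesis .
  qed
  have "(LINT x:cube L|lebesgue. (LINT \<zeta>|lebesgue. \<bar>indicat_real E (x + \<zeta>) - indicat_real E x\<bar> * \<kappa> \<zeta>))
      = (\<integral>x. enn2real (G x * indicator (cube L) x) \<partial>lborel)"
    unfolding set_lebesgue_integral_def
  proof (rule integral_completion_AE_cong)
    show "AE x in lborel. indicat_real (cube L) x *\<^sub>R (LINT \<zeta>|lebesgue. \<bar>indicat_real E (x + \<zeta>) - indicat_real E x\<bar> * \<kappa> \<zeta>)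
        = enn2real (G x * indicator (cube L) x)"
      using EE by eventually_elim (subst inner, assumption, simp add: indicator_def)
  qed measurable
  also have "\<dots> = enn2real (\<integral>\<^sup>+x. G x * indicator (cube L) x \<partial>lborel)"
    by (rule integral_enn2real) (use Gfin in \<open>auto simp: indicator_def\<close>)
  also have "(\<integral>\<^sup>+x. G x * indicator (cube L) x \<partial>lborel) = (\<integral>\<^sup>+x. (\<integral>\<^sup>+\<theta>. flux \<kappa>' E' \<theta> x * indicator (cube L) x \<partial>sphere_lborel) \<partial>lborel)"
    unfolding G_def
  proof (rule nn_integral_cong, rule nn_integral_multc[symmetric])
    fix x :: "real ^ 'n"
    have "(\<lambda>\<theta>. flux \<kappa>' E' \<theta> x) \<in> borel_measurable borel" by measurable
    then show "(\<lambda>\<theta>. flux \<kappa>' E' \<theta> x) \<in> borel_measurable sphere_lborel" by (rule measurable_sphere_lborel)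
  qed
  also have "\<dots> = (\<integral>\<^sup>+\<theta>. cube_flux \<kappa>' E' L \<theta> \<partial>sphere_lborel)"
    unfolding cube_flux_def by (rule PS.Fubini'[OF m2])
  finally show ?thesis .
qed

section \<open>Assembling the formula\<close>

text \<open>
  The union of all lattice translates of a Borel subset of full measure is a Borel set, and by periodicity it
  stays inside \<open>E\<close>.
\<close>

lemma periodic_borel_representative:
  fixes E :: "(real ^ 'n) set"
  assumes E: "E \<in> sets lebesgue" and per: "cube_periodic L E"
  obtains E' where "E' \<in> sets borel" "cube_periodic L E'" "AE x in lborel. x \<in> E \<longleftrightarrow> x \<in> E'"
proof -
  obtain B where B [measurable]: "B \<in> sets borel" and BE: "B \<subseteq> E" and AE: "AE x in lborel. x \<in> E \<longleftrightarrow> x \<in> B"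
    by (rule lebesgue_AE_borel[OF E])
  define E' where "E' = (\<Union>k. {x. x + lattice_point L k \<in> B})"
  have shift: "x + lattice_point L j + lattice_point L k = x + lattice_point L (j + k)" for x :: "real ^ 'n" and j k
    by (simp add: vec_eq_iff algebra_simps)
  have EE: "B \<subseteq> E'" "E' \<subseteq> E"
  proof -
    have "x + lattice_point L 0 = x" for x :: "real ^ 'n" by (simp add: vec_eq_iff)
    then have "x \<in> {x. x + lattice_point L 0 \<in> B}" if "x \<in> B" for x using that by (simp only: mem_Collect_eq)
    then show "B \<subseteq> E'" unfolding E'_def by blast
    show "E' \<subseteq> E" using BE per by (auto simp: E'_def cube_periodic_def)
  qed
  show ?thesis
  proof
    show "E' \<in> sets borel" unfolding E'_def by (intro sets.countable_UN') (auto intro!: countableI_type)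
    have fw: "x \<in> E'" if x: "x + lattice_point L j \<in> E'" for x j
    proof -
      obtain k where "x + lattice_point L j + lattice_point L k \<in> B" using x unfolding E'_def by blast
      then have "x + lattice_point L (j + k) \<in> B" by (simp only: shift)
      then show ?thesis unfolding E'_def by blast
    qed
    have "x + lattice_point L j \<in> E'" if "x \<in> E'" for x j
    proof (rule fw[of _ "- j"])
      have "x + lattice_point L j + lattice_point L (- j) = x" by (simp add: vec_eq_iff)
      then show "x + lattice_point L j + lattice_point L (- j) \<in> E'" using that by (simp only:)
    qed
    then show "cube_periodic L E'" using fw unfolding cube_periodic_def by blast
    show "AE x in lborel. x \<in> E \<longleftrightarrow> x \<in> E'" using AE by eventually_elim (use EE in auto)
  qed
qed

lemma integrable_enn2real:
  assumes f: "f \<in> borel_measurable M" and fin: "(\<integral>\<^sup>+x. f x \<partial>M) < \<infinity>"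
  shows "integrable M (\<lambda>x. enn2real (f x))"
proof (rule integrableI_nonneg)
  have "(\<integral>\<^sup>+x. ennreal (enn2real (f x)) \<partial>M) \<le> (\<integral>\<^sup>+x. f x \<partial>M)"
    by (intro nn_integral_mono) (metis enn2real_nonneg ennreal_enn2real_if ennreal_zero_less_top order_le_less zero_le)
  then show "(\<integral>\<^sup>+x. ennreal (enn2real (f x)) \<partial>M) < \<infinity>" using fin by (rule le_less_trans)
qed (use f in auto)

text \<open>
  For a fixed direction, the first term of \<^const>\<open>r_fun\<close> counts the boundary points in the cube,
  and the other two amount to the fluxes from the cube in the directions \<open>\<theta>\<close> and
  \<open>-\<theta>\<close>. Both fluxes are finite for almost every line, so the terms may be summed and
  integrated separately.
\<close>

lemma integral_slices_r_fun:
  fixes E E' :: "(real ^ 'n) set" and \<kappa> \<kappa>' :: "real \<Rightarrow> real"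
  assumes E' [measurable]: "E' \<in> sets borel" and EE: "AE x in lborel. x \<in> E \<longleftrightarrow> x \<in> E'"
    and lfp: "locally_finite_perimeter E'" and per: "cube_periodic L E'" and L: "L > 0"
    and \<kappa>' [measurable]: "\<kappa>' \<in> borel_measurable borel" and nn: "\<And>\<rho>. 0 \<le> \<kappa>' \<rho>" and eq: "AE \<rho> in lborel. \<kappa> \<rho> = \<kappa>' \<rho>"
    and even: "\<And>\<rho>. \<kappa>' (- \<rho>) = \<kappa>' \<rho>" and fin: "(\<integral>\<^sup>+\<rho>. ennreal (\<kappa>' \<rho>) \<partial>lborel) < \<infinity>"
    and \<theta>: "norm \<theta> = 1"
  shows "(LINT x|subspace_lebesgue (perp \<theta>). (\<Sum>s\<in>reduced_boundary (slice E \<theta> x) \<inter> slice (cube L) \<theta> x. r_fun \<kappa> (slice E \<theta> x) s))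
    = enn2real (\<integral>\<^sup>+\<rho>. ennreal (\<bar>\<rho>\<bar> * \<kappa>' \<rho>) * indicator {-1..1} \<rho> \<partial>lborel) * enn2real (cube_dir_variation E' L \<theta>)
      - enn2real (cube_flux \<kappa>' E' L \<theta>) - enn2real (cube_flux \<kappa>' E' L (- \<theta>))"
proof -
  let ?M = "subspace_lborel (perp \<theta>)"
  define W where "W = enn2real (\<integral>\<^sup>+\<rho>. ennreal (\<bar>\<rho>\<bar> * \<kappa>' \<rho>) * indicator {-1..1} \<rho> \<partial>lborel)"
  obtain g where g: "g \<in> borel_measurable borel" "AE x in ?M. boundary_count E' \<theta> (cube L) x = g x"
    "(\<integral>\<^sup>+x. g x \<partial>?M) = cube_dir_variation E' L \<theta>"
    by (rule cube_count_slices[OF E' lfp \<theta>])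
  obtain \<alpha> where \<alpha>: "\<alpha> \<in> borel_measurable borel"
    "AE x in ?M. (\<Sum>s\<in>essential_boundary (slice E' \<theta> x) \<inter> slice (cube L) \<theta> x.
        \<integral>\<^sup>+u. flux \<kappa>' (slice E' \<theta> x) 1 u * indicator (left_gap (slice E' \<theta> x) s) u \<partial>lborel) = \<alpha> x"
    "(\<integral>\<^sup>+x. \<alpha> x \<partial>?M) = (\<integral>\<^sup>+y. flux \<kappa>' E' \<theta> y * indicator (cube L) y \<partial>lborel)"
    by (rule sum_left_gaps[OF E' lfp per L \<kappa>' \<theta>])
  obtain \<beta> where \<beta>: "\<beta> \<in> borel_measurable borel"
    "AE x in ?M. (\<Sum>s\<in>essential_boundary (slice E' \<theta> x) \<inter> slice (cube L) \<theta> x.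
        \<integral>\<^sup>+u. flux \<kappa>' (slice E' \<theta> x) (-1) u * indicator (right_gap (slice E' \<theta> x) s) u \<partial>lborel) = \<beta> x"
    "(\<integral>\<^sup>+x. \<beta> x \<partial>?M) = (\<integral>\<^sup>+y. flux \<kappa>' E' (- \<theta>) y * indicator (cube L) y \<partial>lborel)"
    by (rule sum_right_gaps[OF E' lfp per L \<kappa>' \<theta>])
  note \<alpha>I = \<alpha>(3)[folded cube_flux_def] and \<beta>I = \<beta>(3)[folded cube_flux_def]
  have gM: "g \<in> borel_measurable ?M" and \<alpha>M: "\<alpha> \<in> borel_measurable ?M" and \<beta>M: "\<beta> \<in> borel_measurable ?M"
    using g(1) \<alpha>(1) \<beta>(1) by (auto intro: measurable_subspace_lborel)
  have Nfin: "cube_flux \<kappa>' E' L v < \<infinity>" for v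
    using le_less_trans[OF cube_flux_le[of \<kappa>' E' L v, OF nn]] fin cube_finite[where L=L and 'n='n]
    by (simp add: ennreal_mult_less_top)
  have gfin: "(\<integral>\<^sup>+x. g x \<partial>?M) < \<infinity>"
  proof -
    have "cube_dir_variation E' L \<theta> \<le> dir_variation E' \<theta> (outer_cube L 0)" unfolding cube_dir_variation_def by (rule INF_lower) simp
    then show ?thesis unfolding g(3) using dir_variation_finite[OF E' lfp open_outer_cube bounded_outer_cube \<theta>] by (rule le_less_trans)
  qed
  have \<alpha>fin: "(\<integral>\<^sup>+x. \<alpha> x \<partial>?M) < \<infinity>" and \<beta>fin: "(\<integral>\<^sup>+x. \<beta> x \<partial>?M) < \<infinity>" unfolding \<alpha>I \<beta>I by (rule Nfin)+
  have ne: "AE x in ?M. g x \<noteq> \<infinity>" "AE x in ?M. \<alpha> x \<noteq> \<infinity>" "AE x in ?M. \<beta> x \<noteq> \<infinity>"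
    using gfin \<alpha>fin \<beta>fin nn_integral_noteq_infinite[OF gM] nn_integral_noteq_infinite[OF \<alpha>M] nn_integral_noteq_infinite[OF \<beta>M] by auto
  have bd: "bounded (cube L :: (real^'n) set)" by (rule bounded_subset[OF bounded_outer_cube cube_subset_outer_cube[of L 0]])
  have "(LINT x|subspace_lebesgue (perp \<theta>). (\<Sum>s\<in>reduced_boundary (slice E \<theta> x) \<inter> slice (cube L) \<theta> x. r_fun \<kappa> (slice E \<theta> x) s))
      = (\<integral>x. W * enn2real (g x) - enn2real (\<alpha> x) - enn2real (\<beta> x) \<partial>?M)"
    unfolding subspace_lebesgue_eq
  proof (rule integral_completion_AE_cong)
    show "(\<lambda>x. W * enn2real (g x) - enn2real (\<alpha> x) - enn2real (\<beta> x)) \<in> borel_measurable ?M"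
      using gM \<alpha>M \<beta>M by measurable
    show "AE x in ?M. (\<Sum>s\<in>reduced_boundary (slice E \<theta> x) \<inter> slice (cube L) \<theta> x. r_fun \<kappa> (slice E \<theta> x) s)
        = W * enn2real (g x) - enn2real (\<alpha> x) - enn2real (\<beta> x)"
      using AE_discrete_slices[OF E' lfp \<theta>] AE_slice_cong[OF \<theta> EE] g(2) \<alpha>(2) \<beta>(2) ne(2,3)
    proof eventually_elim
      case (elim x)
      let ?S = "slice E' \<theta> x"
      let ?D = "essential_boundary ?S \<inter> slice (cube L) \<theta> x"
      define a where "a s = (\<integral>\<^sup>+u. flux \<kappa>' ?S 1 u * indicator (left_gap ?S s) u \<partial>lborel)" for s
      define b where "b s = (\<integral>\<^sup>+u. flux \<kappa>' ?S (-1) u * indicator (right_gap ?S s) u \<partial>lborel)" for s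
      have S: "?S \<in> sets borel" by (rule borel_slice[OF E'])
      have rb: "reduced_boundary (slice E \<theta> x) = essential_boundary ?S"
        using reduced_boundary_cong[OF lebesgue_sets_AE_cong[OF S elim(2)] S elim(2)] reduced_boundary_real[OF S elim(1)] by simp
      obtain R where R: "\<And>s. s \<in> slice (cube L) \<theta> x \<Longrightarrow> \<bar>s\<bar> < R"
        using bounded_slice[OF bd \<theta>, of x] bounded_pos_less by (metis real_norm_def)
      have "?D \<subseteq> essential_boundary ?S \<inter> {-R<..<R}" using R by force
      then have finD: "finite ?D"
        by (rule finite_subset) (use elim(1) in \<open>auto simp: discrete_essential_boundary_def\<close>)
      have A: "(\<Sum>s\<in>?D. a s) = \<alpha> x" and B: "(\<Sum>s\<in>?D. b s) = \<beta> x" using elim by (simp_all add: a_def b_def)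
      have af: "a s < top" if "s \<in> ?D" for s
        using member_le_sum[OF that, of a] finD elim(6) unfolding A by (auto simp: less_top[symmetric] top_unique)
      have bf: "b s < top" if "s \<in> ?D" for s
        using member_le_sum[OF that, of b] finD elim(7) unfolding B by (auto simp: less_top[symmetric] top_unique)
      have "g x = of_nat (card ?D)" using elim(3) finD by (simp add: emeasure_count_space_finite)
      then have gx: "enn2real (g x) = real (card ?D)" by (simp add: ennreal_of_nat_eq_real_of_nat)
      have "(\<Sum>s\<in>?D. r_fun \<kappa> (slice E \<theta> x) s) = (\<Sum>s\<in>?D. W - enn2real (a s) - enn2real (b s))"
        by (rule sum.cong[OF refl]) (simp add: r_fun_eq[OF S elim(1,2) \<kappa>' nn eq even fin] W_def a_def b_def)
      also have "\<dots> = W * enn2real (g x) - enn2real (\<Sum>s\<in>?D. a s) - enn2real (\<Sum>s\<in>?D. b s)"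
        using enn2real_sum[of ?D a] enn2real_sum[of ?D b] af bf by (simp add: sum_subtractf gx o_def)
      finally show ?case unfolding rb A B .
    qed
  qed
  also have "\<dots> = W * (\<integral>x. enn2real (g x) \<partial>?M) - (\<integral>x. enn2real (\<alpha> x) \<partial>?M) - (\<integral>x. enn2real (\<beta> x) \<partial>?M)"
    using integrable_enn2real[OF gM gfin] integrable_enn2real[OF \<alpha>M \<alpha>fin] integrable_enn2real[OF \<beta>M \<beta>fin] by simp
  also have "\<dots> = W * enn2real (cube_dir_variation E' L \<theta>) - enn2real (cube_flux \<kappa>' E' L \<theta>) - enn2real (cube_flux \<kappa>' E' L (- \<theta>))"
    unfolding integral_enn2real[OF gM ne(1)] integral_enn2real[OF \<alpha>M ne(2)] integral_enn2real[OF \<beta>M ne(3)] g(3) \<alpha>I \<beta>I ..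
  finally show ?thesis by (simp add: W_def)
qed

text \<open>
  Integrating the previous identity over the sphere, the boundary count yields \<open>C\<^sub>1\<^sub>,\<^sub>d
  Per\<close>, and the two fluxes have the same average because \<open>\<theta> \<mapsto> -\<theta>\<close>
  preserves the surface measure. With \<open>m\<close> the radial moment, \<open>J = C\<^sub>1\<^sub>,\<^sub>d
  m\<close> while the first term of \<^const>\<open>r_fun\<close> is \<open>2 m\<close>.
\<close>

theorem functional_eq_integral_slices:
  fixes E :: "(real ^ 'n) set" and \<kappa> :: "real ^ 'n \<Rightarrow> real"
  assumes \<kappa>: "\<kappa> \<in> borel_measurable lebesgue" and nn: "\<And>\<zeta>. 0 \<le> \<kappa> \<zeta>"
    and rot: "\<And>z w. norm z = norm w \<Longrightarrow> \<kappa> z = \<kappa> w"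
    and bound: "\<And>\<zeta>. \<kappa> \<zeta> \<le> C / (norm \<zeta> + t) powr p" and C: "C \<ge> 0" and t: "t > 0" and p: "p \<ge> real CARD('n) + 1"
    and L: "L > 0" and per: "cube_periodic L E" and lfp: "locally_finite_perimeter E"
  shows "functional \<kappa> E L = 1 / (2 * L ^ CARD('n)) *
    (LINT \<theta>|sphere_measure. (LINT x|subspace_lebesgue (perp \<theta>).
       (\<Sum>s\<in>reduced_boundary (slice E \<theta> x) \<inter> slice (cube L) \<theta> x. r_fun (kernel_bar \<kappa>) (slice E \<theta> x) s)))"
proof -
  obtain k where k [measurable]: "k \<in> borel_measurable borel" and knn: "\<And>r. 0 \<le> k r"
    and rad: "AE r in lborel. 0 < r \<longrightarrow> (\<forall>z. norm z = r \<longrightarrow> \<kappa> z = k r)"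
    by (rule radial_profile[OF \<kappa> nn]) (rule rot, assumption, rule that)
  define \<kappa>' where "\<kappa>' = (\<lambda>\<rho>. \<bar>\<rho>\<bar> ^ (CARD('n) - 1) * k \<bar>\<rho>\<bar>)"
  have \<kappa>'m [measurable]: "\<kappa>' \<in> borel_measurable borel" unfolding \<kappa>'_def by measurable
  have \<kappa>'nn: "0 \<le> \<kappa>' \<rho>" and even: "\<kappa>' (- \<rho>) = \<kappa>' \<rho>" for \<rho> by (simp_all add: \<kappa>'_def knn)
  have \<kappa>'eq: "AE \<rho> in lborel. kernel_bar \<kappa> \<rho> = \<kappa>' \<rho>" unfolding \<kappa>'_def by (rule kernel_bar_eq[OF rad])
  have "AE r in lborel. 0 < r \<longrightarrow> k r \<le> C / (r + t) powr p"
    using rad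
  proof eventually_elim
    case (elim r)
    show ?case
    proof
      assume r: "0 < r"
      obtain z :: "real ^ 'n" where z: "norm z = r" using vector_choose_size[of r] r by (metis less_imp_le)
      then show "k r \<le> C / (r + t) powr p" using elim r bound[of z] by simp
    qed
  qed
  then have fin: "(\<integral>\<^sup>+\<rho>. ennreal (\<kappa>' \<rho>) \<partial>lborel) < \<infinity>"
    unfolding \<kappa>'_def using kernel_mass_finite[OF t p C] by simp
  have EL: "E \<in> sets lebesgue" using lfp by (simp add: locally_finite_perimeter_def)
  obtain E' where E' [measurable]: "E' \<in> sets borel" and per': "cube_periodic L E'" and EE: "AE x in lborel. x \<in> E \<longleftrightarrow> x \<in> E'"
    by (rule periodic_borel_representative[OF EL per])
  have lfp': "locally_finite_perimeter E'" using lfp locally_finite_perimeter_cong[OF EL E' EE] by simp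
  define m where "m = (\<integral>\<^sup>+r. ennreal (r ^ CARD('n) * k r) * indicator {0<..1} r \<partial>lborel)"
  define c where "c = sphere_const TYPE(real ^ 'n)"
  define P where "P = enn2real (perimeter E (cube L))"
  define N where "N = (\<integral>\<^sup>+\<theta>. cube_flux \<kappa>' E' L \<theta> \<partial>sphere_lborel)"
  have cpos: "c > 0" unfolding c_def by (rule sphere_const_pos)
  have J: "J_const \<kappa> = c * enn2real m" unfolding c_def m_def by (rule J_const_eq[OF k knn rad])
  have W: "enn2real (\<integral>\<^sup>+\<rho>. ennreal (\<bar>\<rho>\<bar> * \<kappa>' \<rho>) * indicator {-1..1} \<rho> \<partial>lborel) = 2 * enn2real m"
    using radial_moment[OF k, of "CARD('n) - 1"] by (simp add: \<kappa>'_def m_def enn2real_mult)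
  have Nm: "cube_flux \<kappa>' E' L \<in> borel_measurable borel" by (rule borel_measurable_cube_flux[OF E' \<kappa>'m])
  have Vm: "cube_dir_variation E' L \<in> borel_measurable borel" by (rule borel_measurable_cube_dir_variation[OF E'])
  define I where "I = (\<integral>\<^sup>+\<rho>. ennreal (\<kappa>' \<rho>) \<partial>lborel) * emeasure lborel (cube L :: (real ^ 'n) set)"
  have I: "I < \<infinity>" using fin cube_finite[where L=L and 'n='n] by (simp add: I_def ennreal_mult_less_top)
  have Nle: "cube_flux \<kappa>' E' L v \<le> I" for v unfolding I_def by (rule cube_flux_le[OF \<kappa>'nn])
  have Nne: "cube_flux \<kappa>' E' L v \<noteq> \<infinity>" for v using Nle[of v] I by auto
  interpret S: finite_measure "sphere_lborel :: (real ^ 'n) measure" by (rule finite_sphere_lborel)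
  have Nfin: "N < \<infinity>"
  proof -
    have "N \<le> (\<integral>\<^sup>+\<theta>. I \<partial>(sphere_lborel :: (real ^ 'n) measure))" unfolding N_def by (intro nn_integral_mono Nle)
    also have "\<dots> < \<infinity>" using I by (simp add: ennreal_mult_eq_top_iff less_top[symmetric])
    finally show ?thesis .
  qed
  have Pfin: "perimeter E (cube L) < \<infinity>"
  proof -
    have "perimeter E (cube L) \<le> variation_in_open E (outer_cube L 0)"
      unfolding perimeter_def by (intro INF_lower) (simp add: open_outer_cube cube_subset_outer_cube)
    also have "\<dots> = perimeter E (outer_cube L 0)" by (rule perimeter_open[OF open_outer_cube, symmetric])
    also have "\<dots> < \<infinity>" using lfp unfolding locally_finite_perimeter_def by (blast intro: open_outer_cube bounded_outer_cube)
    finally show ?thesis .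
  qed
  have V: "(\<integral>\<^sup>+\<theta>. cube_dir_variation E' L \<theta> \<partial>sphere_lborel) = ennreal c * perimeter E (cube L)"
    unfolding c_def perimeter_cong[OF EL E' EE] by (rule perimeter_cube[OF E' lfp'])
  have Vfin: "(\<integral>\<^sup>+\<theta>. cube_dir_variation E' L \<theta> \<partial>sphere_lborel) < \<infinity>"
    unfolding V using Pfin by (simp add: ennreal_mult_less_top)
  have N': "(\<integral>\<^sup>+\<theta>. cube_flux \<kappa>' E' L (- \<theta>) \<partial>sphere_lborel) = N"
    unfolding N_def by (rule nn_integral_sphere_orthogonal[OF _ Nm]) (simp add: orthogonal_transformation_neg orthogonal_transformation_id)
  have N'm: "(\<lambda>\<theta>. cube_flux \<kappa>' E' L (- \<theta>)) \<in> borel_measurable borel" using Nm by measurable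
  note sm = measurable_sphere_lborel[OF Vm] measurable_sphere_lborel[OF Nm] measurable_sphere_lborel[OF N'm]
  have "(LINT \<theta>|sphere_measure. (LINT x|subspace_lebesgue (perp \<theta>).
       (\<Sum>s\<in>reduced_boundary (slice E \<theta> x) \<inter> slice (cube L) \<theta> x. r_fun (kernel_bar \<kappa>) (slice E \<theta> x) s)))
    = (\<integral>\<theta>. 2 * enn2real m * enn2real (cube_dir_variation E' L \<theta>) - enn2real (cube_flux \<kappa>' E' L \<theta>) - enn2real (cube_flux \<kappa>' E' L (- \<theta>)) \<partial>sphere_lborel)"
    unfolding sphere_measure_eq
  proof (rule integral_completion_AE_cong)
    show "AE \<theta> in sphere_lborel. (LINT x|subspace_lebesgue (perp \<theta>).
         (\<Sum>s\<in>reduced_boundary (slice E \<theta> x) \<inter> slice (cube L) \<theta> x. r_fun (kernel_bar \<kappa>) (slice E \<theta> x) s))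
       = 2 * enn2real m * enn2real (cube_dir_variation E' L \<theta>) - enn2real (cube_flux \<kappa>' E' L \<theta>) - enn2real (cube_flux \<kappa>' E' L (- \<theta>))"
      by (rule AE_sphere_I)
        (simp only: integral_slices_r_fun[OF E' EE lfp' per' L \<kappa>'m \<kappa>'nn \<kappa>'eq even fin] W)
  qed (use sm in measurable)
  also have "\<dots> = 2 * enn2real m * (\<integral>\<theta>. enn2real (cube_dir_variation E' L \<theta>) \<partial>sphere_lborel)
      - (\<integral>\<theta>. enn2real (cube_flux \<kappa>' E' L \<theta>) \<partial>sphere_lborel) - (\<integral>\<theta>. enn2real (cube_flux \<kappa>' E' L (- \<theta>)) \<partial>sphere_lborel)"
    using integrable_enn2real[OF sm(1) Vfin] integrable_enn2real[OF sm(2) Nfin[unfolded N_def]]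
      integrable_enn2real[OF sm(3)] N' Nfin by simp
  also have "(\<integral>\<theta>. enn2real (cube_dir_variation E' L \<theta>) \<partial>sphere_lborel) = c * P"
  proof -
    have "AE \<theta> in sphere_lborel. cube_dir_variation E' L \<theta> \<noteq> \<infinity>"
      by (rule nn_integral_noteq_infinite[OF sm(1)]) (use Vfin in auto)
    from integral_enn2real[OF sm(1) this] show ?thesis using cpos by (simp add: V P_def enn2real_mult)
  qed
  also have "(\<integral>\<theta>. enn2real (cube_flux \<kappa>' E' L \<theta>) \<partial>sphere_lborel) = enn2real N"
    unfolding N_def by (rule integral_enn2real[OF sm(2)]) (rule AE_I2, rule Nne)
  also have "(\<integral>\<theta>. enn2real (cube_flux \<kappa>' E' L (- \<theta>)) \<partial>sphere_lborel) = enn2real N"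
    unfolding N'[symmetric] by (rule integral_enn2real[OF sm(3)]) (rule AE_I2, rule Nne)
  finally have rhs: "(LINT \<theta>|sphere_measure. (LINT x|subspace_lebesgue (perp \<theta>).
       (\<Sum>s\<in>reduced_boundary (slice E \<theta> x) \<inter> slice (cube L) \<theta> x. r_fun (kernel_bar \<kappa>) (slice E \<theta> x) s)))
    = 2 * (c * enn2real m * P - enn2real N)" by simp
  have f: "functional \<kappa> E L = 1 / L ^ CARD('n) * (c * enn2real m * P - enn2real N)"
    unfolding functional_def J P_def[symmetric] N_def nonlocal_polar[OF E' EE k knn rad \<kappa>'_def fin] ..
  have half: "1 / (2 * L ^ CARD('n)) * (2 * X) = 1 / L ^ CARD('n) * X" for X by simp
  show ?thesis unfolding rhs half by (rule f)
qed

theorem proposition3p1: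
  fixes K :: "real \<Rightarrow> real ^ 'n \<Rightarrow> real" and p \<tau> :: real and k :: 'n
  assumes "p \<ge> real CARD('n) + 3" and "\<tau> > 0" and "admissible_kernel p K"
  shows
    "(\<forall>(L::real) (E :: (real ^ 'n) set).
        L > 0 \<and> cube_periodic L E \<and> locally_finite_perimeter E \<longrightarrow>
        functional (K \<tau>) E L =
          1 / (2 * L ^ CARD('n)) *
          (LINT \<theta>|sphere_measure. (LINT x|subspace_lebesgue (perp \<theta>).
             (\<Sum>s\<in>reduced_boundary (slice E \<theta> x) \<inter> slice (cube L) \<theta> x.
                r_fun (kernel_bar (K \<tau>)) (slice E \<theta> x) s)))) \<and>
     (\<forall>(E :: (real ^ 'n) set) \<Omega>.
        locally_finite_perimeter E \<and> open \<Omega> \<and> bounded \<Omega> \<longrightarrow>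
        perimeter E \<Omega> =
          (\<integral>\<^sup>+ \<theta>. (\<integral>\<^sup>+ x. perimeter (slice E \<theta> x) (slice \<Omega> \<theta> x) \<partial>subspace_lebesgue (perp \<theta>))
             \<partial>sphere_measure) / ennreal (C1d k))"
proof -
  define t where "t = \<tau> powr (1 / (p - real CARD('n) - 1))"
  have t: "t > 0" using assms(2) by (simp add: t_def)
  have K: "K \<tau> \<in> borel_measurable lebesgue" and rot: "\<forall>R \<zeta>. orthogonal_transformation R \<longrightarrow> K \<tau> (R \<zeta>) = K \<tau> \<zeta>"
    using assms(2,3) unfolding admissible_kernel_def by blast+
  have rad: "K \<tau> z = K \<tau> w" if nz: "norm z = norm w" for z w
  proof -
    obtain R where "orthogonal_transformation R" "R w = z"
      using orthogonal_transformation_exists[of w z] nz by metis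
    then show ?thesis using rot by metis
  qed
  have "\<exists>C>0. \<forall>\<zeta>. 1 / (C * (norm \<zeta> + t) powr p) \<le> K \<tau> \<zeta> \<and> K \<tau> \<zeta> \<le> C / (norm \<zeta> + t) powr p"
    using assms(2,3) unfolding admissible_kernel_def t_def by meson
  then obtain C where C: "C > 0" and lo: "\<And>\<zeta>. 1 / (C * (norm \<zeta> + t) powr p) \<le> K \<tau> \<zeta>"
    and up: "\<And>\<zeta>. K \<tau> \<zeta> \<le> C / (norm \<zeta> + t) powr p"
    by auto
  have nn: "0 \<le> K \<tau> \<zeta>" for \<zeta>
  proof -
    have "0 \<le> 1 / (C * (norm \<zeta> + t) powr p)" using C by simp
    then show ?thesis using lo[of \<zeta>] by linarith
  qed
  have p: "p \<ge> real CARD('n) + 1" using assms(1) by simp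
  note functional = functional_eq_integral_slices[where \<kappa>="K \<tau>", OF K nn rad up less_imp_le[OF C] t p]
  show ?thesis by (intro conjI allI impI functional perimeter_open_eq_integral_slices) auto
qed

end
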